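(* Let $(\mathcal{L},[.,.],\alpha)$ be a multiplicative Hom-Leibniz algebra over $\mathbb{K}$ with $\mathbb{H}=H^2(\mathcal{L},\mathcal{L})$ finite-dimensional. Let $C_0=\mathbb{K}$, $C_1=\mathbb{K}\oplus\mathbb{H}'$, let $\eta_1$ be the universal infinitesimal deformation with base $C_1$, and suppose that for some $k\ge1$ a finite-dimensional local algebra $C_k$ and a deformation $\eta_k$ of $\mathcal{L}$ with base $C_k$ have been constructed by the inductive procedure described in the context, starting from $(C_1,\eta_1)$. Let $$0\to(\ker w_k)'\xrightarrow{i_{k+1}}C_{k+1}\xrightarrow{p_{k+1}}C_k\to0\qquad(\ast)$$ be the extension described in the context. Then the deformation $\eta_k$ with base $C_k$ admits an extension to a deformation $\eta_{k+1}$ with base $C_{k+1}$ (that is, $(p_{k+1})_\ast\eta_{k+1}=\eta_k$), which is unique up to an isomorphism and an automorphism of the extension $(\ast)$. By induction, this process yields a sequence of finite-dimensional local algebras $C_k$ and deformations $\eta_k$ of $\mathcal{L}$ with base $C_k$, $$\mathbb{K}\xleftarrow{p_1}C_1\xleftarrow{p_2}\cdots\xleftarrow{p_k}C_k\xleftarrow{p_{k+1}}C_{k+1}\cdots,$$ such that $(p_{k+1})_\ast\eta_{k+1}=\eta_k$. Thus, by taking the projective limit, one obtains a formal deformation $\eta$ of $\mathcal{L}$ with base $C=\varprojlim C_k$.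
   Context: $\mathbb{K}$ is an algebraically closed field of characteristic $0$; a prime $'$ denotes the dual vector space or dual map. A (multiplicative) Hom-Leibniz algebra $(\mathcal{L},[.,.],\alpha)$ is a $\mathbb{K}$-vector space with a bilinear bracket and a linear map $\alpha:\mathcal{L}\to\mathcal{L}$ such that $[\alpha(x),[y,z]]=[[x,y],\alpha(z)]-[[x,z],\alpha(y)]$ and $\alpha([x,y])=[\alpha(x),\alpha(y)]$. $\mathcal{C}^n(\mathcal{L},\mathcal{L})$ is the space of $n$-linear maps $\varphi:\mathcal{L}^n\to\mathcal{L}$ with $\alpha\circ\varphi=\varphi\circ(\alpha,\dots,\alpha)$, with coboundary $$\delta^n\varphi(x_1,\dots,x_{n+1})=[\alpha^{n-1}(x_1),\varphi(x_2,\dots,x_{n+1})]+\sum_{i=2}^{n+1}(-1)^i[\varphi(x_1,\dots,\widehat{x_i},\dots,x_{n+1}),\alpha^{n-1}(x_i)]$$ $$+\sum_{1\le i<j\le n+1}(-1)^{j+1}\varphi(\alpha(x_1),\dots,\alpha(x_{i-1}),[x_i,x_j],\alpha(x_{i+1}),\dots,\widehat{x_j},\dots,\alpha(x_{n+1})),$$ and $H^n(\mathcal{L},\mathcal{L})$ ($n\ge2$) is its cohomology. Deformations. A deformation $\lambda$ of $\mathcal{L}$ with base a commutative unital $\mathbb{K}$-algebra $A$ with augmentation $\varepsilon:A\to\mathbb{K}$ is an $A$-bilinear bracket $[.,.]_\lambda$ on $A\otimes\mathcal{L}$ making $(A\otimes\mathcal{L},[.,.]_\lambda,\mathrm{id}\otimes\alpha)$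 a (multiplicative) Hom-Leibniz algebra with $(\varepsilon\otimes\mathrm{id})[1\otimes l_1,1\otimes l_2]_\lambda=[l_1,l_2]$. Isomorphism (equivalence) of two deformations with base $A$ is an $A$-linear bijection preserving brackets, commuting with $\mathrm{id}\otimes\alpha$ and compatible with $\varepsilon\otimes\mathrm{id}$. For a unital homomorphism $\phi:A\to A'$ compatible with augmentations, the push-out $\phi_\ast\lambda$ is the deformation with base $A'$ with $[1\otimes l_1,1\otimes l_2]_{\phi_\ast\lambda}=(\phi\otimes\mathrm{id})[1\otimes l_1,1\otimes l_2]_\lambda$. For a complete local algebra $A$ with maximal ideal $\mathfrak m$ (so $A=\varprojlim A/\mathfrak m^n$), a formal deformation with base $A$ is a Hom-Leibniz $A$-algebra structure on $A\widehat\otimes\mathcal{L}=\varprojlim(A/\mathfrak m^n\otimes\mathcal{L})$ which is a projective limit of deformations with base $A/\mathfrak m^n$ and such that $\varepsilon\widehat\otimes\mathrm{id}:A\widehat\otimes\mathcal{L}\to\mathcal{L}$ is a Hom-Leibniz homomorphism. Universal infinitesimal deformation. $C_1=\mathbb{K}\oplus\mathbb{H}'$ with $(k_1,h_1)(k_2,h_2)=(k_1k_2,k_1h_2+k_2h_1)$ and augmentation $p_1:C_1\to\mathbb{K}$ the projection. With a basis $\{h_i\}$ of $\mathbb{H}$, dual basis $\{g_i\}$, and cocycles $\mu_i$ representing $h_i$, $[1\otimes l_1,1\otimes l_2]_{\eta_1}=1\otimes[l_1,l_2]+\sum_i g_i\otimes\mu_i(l_1,l_2)$. Extensions. For a local commutative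 algebra $A$ with maximal ideal $\mathfrak m=\ker\varepsilon$ and a finite-dimensional $A$-module $M$ with $\mathfrak mM=0$, an extension of $A$ by $M$ is a commutative algebra $B$ with an exact sequence $0\to M\xrightarrow{i}B\xrightarrow{p}A\to0$, $p$ an algebra homomorphism, $i(m)b=i(m\,p(b))$, $i(M)^2=0$. Isomorphism classes correspond to $H^2_{Harr}(A,M)$ (symmetric Hochschild $2$-cocycles $f:A\times A\to M$ modulo coboundaries of linear maps), $f$ corresponding to $A\oplus M$ with $(a_1,m_1)(a_2,m_2)=(a_1a_2,a_1m_2+a_2m_1+f(a_1,a_2))$. An automorphism of the extension is an algebra automorphism $u$ of $B$ with $u\circ i=i$ and $p\circ u=p$. "Unique up to an isomorphism and an automorphism of the extension" means: if $\mu,\mu'$ are deformations with base $B$ with the same push-out $p_\ast\mu=p_\ast\mu'=\lambda$, then there is an automorphism $u$ of the extension with $u_\ast\mu$ isomorphic to $\mu'$. Obstruction. Given a deformation $\lambda$ with finite-dimensional local base $A$ and an extension of $A$ by $M$ of class $[f]$, choose a $B$-bilinear operation $\{.,.\}$ on $B\otimes\mathcal{L}$ commuting with $\mathrm{id}\otimes\alpha$ and lifting $[.,.]_\lambda$ through $p\otimes\mathrm{id}$; the expression $\{1\otimes\alpha(l_1),\{1\otimes l_2,1\otimes l_3\}\}-\{\{1\otimes l_1,1\otimes l_2\},1\otimes\alpha(l_3)\}+\{\{1\otimes l_1,1\otimes l_3\},1\otimes\alpha(l_2)\}$ lies in $i(M)\otimes\mathcal{L}$ and defines a cocycle in $M\otimes\mathcal{C}^3(\mathcal{L},\mathcal{L})$,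 whose class $\theta_\lambda([f])\in M\otimes H^3(\mathcal{L},\mathcal{L})$ is independent of the lift. Inductive step. Given $(C_k,\eta_k)$, let $Ch_2(C_k)=S^2C_k$, so that Harrison $2$-cochains with values in $\mathbb{K}$ are elements of $(Ch_2(C_k))'$. Choose a linear map $H^2_{Harr}(C_k,\mathbb{K})\to(Ch_2(C_k))'$ sending each class to a representing cocycle, and let $f_{C_k}:Ch_2(C_k)\to H^2_{Harr}(C_k,\mathbb{K})'$ be its dual. It is a cocycle and defines the extension $0\to H^2_{Harr}(C_k,\mathbb{K})'\xrightarrow{\bar i_{k+1}}\bar C_{k+1}\xrightarrow{\bar p_{k+1}}C_k\to0$. The obstruction $\theta_{\eta_k}([f_{C_k}])\in H^2_{Harr}(C_k,\mathbb{K})'\otimes H^3(\mathcal{L},\mathcal{L})$ gives a linear map $w_k:H^2_{Harr}(C_k,\mathbb{K})\to H^3(\mathcal{L},\mathcal{L})$ with dual $w_k':H^3(\mathcal{L},\mathcal{L})'\to H^2_{Harr}(C_k,\mathbb{K})'$. Put $C_{k+1}=\bar C_{k+1}/\bar i_{k+1}(w_k'(H^3(\mathcal{L},\mathcal{L})'))$, and let $i_{k+1},p_{k+1}$ be induced by $\bar i_{k+1},\bar p_{k+1}$; since $\mathrm{coker}(w_k')\cong(\ker w_k)'$ this gives the extension $(\ast)$. Then $\eta_{k+1}$ is chosen as a deformation with base $C_{k+1}$ extending $\eta_k$. *)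

theory Defs
  imports
    "HOL-Library.Function_Algebras"
    "HOL-Computational_Algebra.Polynomial"
begin

section \<open>Linear algebra on subspaces of function spaces\<close>

text \<open>Function types carry their pointwise group structure (from \<^theory>\<open>HOL-Library.Function_Algebras\<close>);
  \<open>pw s\<close> is the corresponding pointwise scalar multiplication, so that \<open>pw (*)\<close> is the
  scalar multiplication of the vector space \<open>K\<^sup>I\<close> on the type \<open>'i \<Rightarrow> 'k\<close>.\<close>

definition pw :: "('k \<Rightarrow> 'v \<Rightarrow> 'v) \<Rightarrow> 'k \<Rightarrow> ('i \<Rightarrow> 'v) \<Rightarrow> 'i \<Rightarrow> 'v" where
  "pw s c f = (\<lambda>x. s c (f x))"

definition linear_on ::
  "('k \<Rightarrow> 'v::ab_group_add \<Rightarrow> 'v) \<Rightarrow> ('k \<Rightarrow> 'w::ab_group_add \<Rightarrow> 'w) \<Rightarrow> 'v set \<Rightarrow> ('v \<Rightarrow> 'w) \<Rightarrow> bool" where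
  "linear_on s1 s2 V f \<longleftrightarrow>
     (\<forall>x\<in>V. \<forall>y\<in>V. f (x + y) = f x + f y) \<and> (\<forall>c. \<forall>x\<in>V. f (s1 c x) = s2 c (f x))"

definition finite_dim :: "('k::field \<Rightarrow> 'v::ab_group_add \<Rightarrow> 'v) \<Rightarrow> 'v set \<Rightarrow> bool" where
  "finite_dim s V \<longleftrightarrow> (\<exists>F. finite F \<and> F \<subseteq> V \<and> V \<subseteq> module.span s F)"

text \<open>The quotient \<open>Z/B\<close> of two subspaces \<open>B \<subseteq> Z\<close> is the set of cosets; its zero is the coset \<open>B\<close>.
  Linearity of a map on \<open>Z/B\<close> is expressed through representatives.  A functional on \<open>Z/B\<close> is
  a \<open>K\<close>-valued function on cosets, normalised to be \<open>0\<close> outside \<open>Z/B\<close>; hence \<open>(Z/B)'\<close> is a subspace of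
  a function space \<open>K\<^sup>I\<close>.\<close>

definition coset :: "'v::ab_group_add set \<Rightarrow> 'v \<Rightarrow> 'v set" where
  "coset B z = (\<lambda>b. z + b) ` B"

definition quot :: "'v::ab_group_add set \<Rightarrow> 'v set \<Rightarrow> 'v set set" where
  "quot Z B = coset B ` Z"

definition linear_on_quot ::
  "('k \<Rightarrow> 'v::ab_group_add \<Rightarrow> 'v) \<Rightarrow> ('k \<Rightarrow> 'w::ab_group_add \<Rightarrow> 'w) \<Rightarrow> 'v set \<Rightarrow> 'v set \<Rightarrow> ('v set \<Rightarrow> 'w) \<Rightarrow> bool" where
  "linear_on_quot s1 s2 Z B f \<longleftrightarrow>
     (\<forall>x\<in>Z. \<forall>y\<in>Z. f (coset B (x + y)) = f (coset B x) + f (coset B y)) \<and>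
     (\<forall>c. \<forall>x\<in>Z. f (coset B (s1 c x)) = s2 c (f (coset B x)))"

definition dual_quot ::
  "('k::field \<Rightarrow> 'v::ab_group_add \<Rightarrow> 'v) \<Rightarrow> 'v set \<Rightarrow> 'v set \<Rightarrow> ('v set \<Rightarrow> 'k) set" where
  "dual_quot s Z B = {g. linear_on_quot s (*) Z B g \<and> (\<forall>X. X \<notin> quot Z B \<longrightarrow> g X = 0)}"

definition finite_dim_quot :: "('k::field \<Rightarrow> 'v::ab_group_add \<Rightarrow> 'v) \<Rightarrow> 'v set \<Rightarrow> 'v set \<Rightarrow> bool" where
  "finite_dim_quot s Z B \<longleftrightarrow> (\<exists>F. finite F \<and> F \<subseteq> Z \<and> Z \<subseteq> module.span s (F \<union> B))"

text \<open>The cosets of \<open>\<mu> 0, \<dots>, \<mu> (n - 1)\<close> form a basis of \<open>Z/B\<close>.\<close>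

definition basis_quot :: "('k::field \<Rightarrow> 'v::ab_group_add \<Rightarrow> 'v) \<Rightarrow> 'v set \<Rightarrow> 'v set \<Rightarrow> nat \<Rightarrow> (nat \<Rightarrow> 'v) \<Rightarrow> bool" where
  "basis_quot s Z B n \<mu> \<longleftrightarrow>
     (\<forall>i<n. \<mu> i \<in> Z) \<and>
     (\<forall>z\<in>Z. \<exists>c. z - (\<Sum>i<n. s (c i) (\<mu> i)) \<in> B) \<and>
     (\<forall>c. (\<Sum>i<n. s (c i) (\<mu> i)) \<in> B \<longrightarrow> (\<forall>i<n. c i = 0))"


section \<open>Hom-Leibniz algebras and their cohomology\<close>

text \<open>The defining closure conditions and identities, on a subset \<open>S\<close> (no linearity).\<close>

definition hom_leibniz_on :: "'v::ab_group_add set \<Rightarrow> ('v \<Rightarrow> 'v \<Rightarrow> 'v) \<Rightarrow> ('v \<Rightarrow> 'v) \<Rightarrow> bool" where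
  "hom_leibniz_on S br al \<longleftrightarrow>
     (\<forall>x\<in>S. \<forall>y\<in>S. br x y \<in> S) \<and> (\<forall>x\<in>S. al x \<in> S) \<and>
     (\<forall>x\<in>S. \<forall>y\<in>S. \<forall>z\<in>S. br (al x) (br y z) = br (br x y) (al z) - br (br x z) (al y)) \<and>
     (\<forall>x\<in>S. \<forall>y\<in>S. al (br x y) = br (al x) (al y))"

record ('k, 'l) hom_leib =
  scl :: "'k \<Rightarrow> 'l \<Rightarrow> 'l"
  brk :: "'l \<Rightarrow> 'l \<Rightarrow> 'l"
  twist :: "'l \<Rightarrow> 'l"

definition hom_leibniz_algebra :: "('k::field, 'l::ab_group_add) hom_leib \<Rightarrow> bool" where
  "hom_leibniz_algebra L \<longleftrightarrow>
     vector_space (scl L) \<and>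
     (\<forall>x. Vector_Spaces.linear (scl L) (scl L) (\<lambda>y. brk L x y)) \<and>
     (\<forall>y. Vector_Spaces.linear (scl L) (scl L) (\<lambda>x. brk L x y)) \<and>
     Vector_Spaces.linear (scl L) (scl L) (twist L) \<and>
     hom_leibniz_on UNIV (brk L) (twist L)"

text \<open>An \<open>n\<close>-ary map is a function on lists, normalised to be \<open>0\<close> on lists of length other than \<open>n\<close>.\<close>

definition cochains :: "('k::field, 'l::ab_group_add) hom_leib \<Rightarrow> nat \<Rightarrow> ('l list \<Rightarrow> 'l) set" where
  "cochains L n = {\<phi>.
     (\<forall>xs. length xs \<noteq> n \<longrightarrow> \<phi> xs = 0) \<and>
     (\<forall>xs i. length xs = n \<and> i < n \<longrightarrow> Vector_Spaces.linear (scl L) (scl L) (\<lambda>x. \<phi> (xs[i := x]))) \<and>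
     (\<forall>xs. length xs = n \<longrightarrow> twist L (\<phi> xs) = \<phi> (map (twist L) xs))}"

definition omit :: "nat \<Rightarrow> 'l list \<Rightarrow> 'l list" where
  "omit i xs = take i xs @ drop (Suc i) xs"

text \<open>List positions start at \<open>0\<close>: position \<open>i\<close> holds the argument \<open>x\<^bsub>i+1\<^esub>\<close>, whence the signs.\<close>

definition coboundary :: "('k::field, 'l::ab_group_add) hom_leib \<Rightarrow> nat \<Rightarrow> ('l list \<Rightarrow> 'l) \<Rightarrow> 'l list \<Rightarrow> 'l" where
  "coboundary L n \<phi> xs = (if length xs = n + 1 then
       brk L ((twist L ^^ (n - 1)) (xs ! 0)) (\<phi> (omit 0 xs))
     + (\<Sum>i\<in>{1..n}. scl L ((-1) ^ (i + 1)) (brk L (\<phi> (omit i xs)) ((twist L ^^ (n - 1)) (xs ! i))))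
     + (\<Sum>j\<in>{1..n}. \<Sum>i<j. scl L ((-1) ^ j)
          (\<phi> (omit j ((map (twist L) xs)[i := brk L (xs ! i) (xs ! j)]))))
     else 0)"

definition cocycles :: "('k::field, 'l::ab_group_add) hom_leib \<Rightarrow> nat \<Rightarrow> ('l list \<Rightarrow> 'l) set" where
  "cocycles L n = {\<phi> \<in> cochains L n. \<forall>xs. coboundary L n \<phi> xs = 0}"

definition coboundaries :: "('k::field, 'l::ab_group_add) hom_leib \<Rightarrow> nat \<Rightarrow> ('l list \<Rightarrow> 'l) set" where
  "coboundaries L n = coboundary L (n - 1) ` cochains L (n - 1)"

text \<open>\<open>H\<^sup>n(L,L)\<close> for \<open>n \<ge> 2\<close> and its dual.\<close>

definition HL :: "('k::field, 'l::ab_group_add) hom_leib \<Rightarrow> nat \<Rightarrow> ('l list \<Rightarrow> 'l) set set" where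
  "HL L n = quot (cocycles L n) (coboundaries L n)"

definition HL_dual :: "('k::field, 'l::ab_group_add) hom_leib \<Rightarrow> nat \<Rightarrow> (('l list \<Rightarrow> 'l) set \<Rightarrow> 'k) set" where
  "HL_dual L n = dual_quot (pw (scl L)) (cocycles L n) (coboundaries L n)"


section \<open>Augmented commutative algebras\<close>

text \<open>The underlying vector space of an algebra is a subspace of \<open>K\<^sup>I\<close> with pointwise vector space
  operations; the multiplication is arbitrary.  Up to isomorphism every algebra is of this form,
  and \<open>I\<close> can be taken to be \<open>nat\<close> when the algebra is finite-dimensional.  The operations only matter on the carrier.\<close>

record ('k, 'i) aug_alg =
  acar :: "('i \<Rightarrow> 'k) set"
  amul :: "('i \<Rightarrow> 'k) \<Rightarrow> ('i \<Rightarrow> 'k) \<Rightarrow> 'i \<Rightarrow> 'k"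
  aone :: "'i \<Rightarrow> 'k"
  aeps :: "('i \<Rightarrow> 'k) \<Rightarrow> 'k"

definition aug_algebra :: "('k::field, 'i) aug_alg \<Rightarrow> bool" where
  "aug_algebra A \<longleftrightarrow>
     module.subspace (pw (*)) (acar A) \<and> aone A \<in> acar A \<and>
     (\<forall>x\<in>acar A. \<forall>y\<in>acar A. amul A x y \<in> acar A) \<and>
     (\<forall>x\<in>acar A. linear_on (pw (*)) (pw (*)) (acar A) (amul A x)) \<and>
     (\<forall>x\<in>acar A. \<forall>y\<in>acar A. amul A x y = amul A y x) \<and>
     (\<forall>x\<in>acar A. \<forall>y\<in>acar A. \<forall>z\<in>acar A. amul A (amul A x y) z = amul A x (amul A y z)) \<and>
     (\<forall>x\<in>acar A. amul A (aone A) x = x) \<and>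
     linear_on (pw (*)) (*) (acar A) (aeps A) \<and>
     (\<forall>x\<in>acar A. \<forall>y\<in>acar A. aeps A (amul A x y) = aeps A x * aeps A y) \<and>
     aeps A (aone A) = 1"

definition aug_hom :: "('k::field, 'i) aug_alg \<Rightarrow> ('k, 'j) aug_alg \<Rightarrow> (('i \<Rightarrow> 'k) \<Rightarrow> 'j \<Rightarrow> 'k) \<Rightarrow> bool" where
  "aug_hom A B \<phi> \<longleftrightarrow>
     (\<forall>x\<in>acar A. \<phi> x \<in> acar B) \<and> linear_on (pw (*)) (pw (*)) (acar A) \<phi> \<and>
     (\<forall>x\<in>acar A. \<forall>y\<in>acar A. \<phi> (amul A x y) = amul B (\<phi> x) (\<phi> y)) \<and>
     \<phi> (aone A) = aone B \<and> (\<forall>x\<in>acar A. aeps B (\<phi> x) = aeps A x)"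

definition aug_iso :: "('k::field, 'i) aug_alg \<Rightarrow> ('k, 'j) aug_alg \<Rightarrow> (('i \<Rightarrow> 'k) \<Rightarrow> 'j \<Rightarrow> 'k) \<Rightarrow> bool" where
  "aug_iso A B \<phi> \<longleftrightarrow> aug_hom A B \<phi> \<and> bij_betw \<phi> (acar A) (acar B)"

definition aug_ideal :: "('k::field, 'i) aug_alg \<Rightarrow> ('i \<Rightarrow> 'k) set" where
  "aug_ideal A = {x \<in> acar A. aeps A x = 0}"

definition alg_ideal :: "('k::field, 'i) aug_alg \<Rightarrow> ('i \<Rightarrow> 'k) set \<Rightarrow> bool" where
  "alg_ideal A J \<longleftrightarrow> module.subspace (pw (*)) J \<and> J \<subseteq> acar A \<and> (\<forall>a\<in>acar A. \<forall>x\<in>J. amul A a x \<in> J)"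

definition maximal_ideal :: "('k::field, 'i) aug_alg \<Rightarrow> ('i \<Rightarrow> 'k) set \<Rightarrow> bool" where
  "maximal_ideal A J \<longleftrightarrow> alg_ideal A J \<and> J \<noteq> acar A \<and>
     (\<forall>J'. alg_ideal A J' \<and> J \<subseteq> J' \<longrightarrow> J' = J \<or> J' = acar A)"

definition local_algebra :: "('k::field, 'i) aug_alg \<Rightarrow> bool" where
  "local_algebra A \<longleftrightarrow> aug_algebra A \<and> (\<forall>J. maximal_ideal A J \<longleftrightarrow> J = aug_ideal A)"

definition fd_local_algebra :: "('k::field, 'i) aug_alg \<Rightarrow> bool" where
  "fd_local_algebra A \<longleftrightarrow> local_algebra A \<and> finite_dim (pw (*)) (acar A)"

primrec max_pow :: "('k::field, 'i) aug_alg \<Rightarrow> nat \<Rightarrow> ('i \<Rightarrow> 'k) set" where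
  "max_pow A 0 = acar A"
| "max_pow A (Suc n) = module.span (pw (*)) {amul A x y |x y. x \<in> aug_ideal A \<and> y \<in> max_pow A n}"

text \<open>The second conjunct says that the canonical map from \<open>A\<close> to the projective limit of the \<open>A/m\<^sup>n\<close> is bijective.\<close>

definition complete_local_algebra :: "('k::field, 'i) aug_alg \<Rightarrow> bool" where
  "complete_local_algebra A \<longleftrightarrow> local_algebra A \<and>
     (\<forall>x. (\<forall>n. x n \<in> acar A \<and> x (Suc n) - x n \<in> max_pow A n) \<longrightarrow>
       (\<exists>!a. a \<in> acar A \<and> (\<forall>n. a - x n \<in> max_pow A n)))"

definition base_field :: "('k::field, unit) aug_alg" where
  "base_field = \<lparr>acar = UNIV, amul = (\<lambda>x y u. x u * y u), aone = (\<lambda>_. 1), aeps = (\<lambda>x. x ())\<rparr>"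


section \<open>Tensor products\<close>

text \<open>For a subspace \<open>A\<close> of \<open>K\<^sup>I\<close> and a vector space \<open>L\<close>, the map \<open>A \<otimes> L \<rightarrow> L\<^sup>I\<close> sending \<open>a \<otimes> l\<close> to
  \<open>(a\<^sub>i l)\<^sub>i\<close> is injective; \<open>A \<otimes> L\<close> is identified with its image.  \<open>tensor_lift L A \<beta>\<close> is the linear map
  on \<open>A \<otimes> L\<close> induced by a bilinear map \<open>\<beta>\<close> on \<open>A \<times> L\<close>.\<close>

definition tens :: "('k, 'l) hom_leib \<Rightarrow> ('i \<Rightarrow> 'k) \<Rightarrow> 'l \<Rightarrow> 'i \<Rightarrow> 'l" where
  "tens L a l = (\<lambda>i. scl L (a i) l)"

definition tensor_space :: "('k::field, 'l::ab_group_add) hom_leib \<Rightarrow> ('k, 'i) aug_alg \<Rightarrow> ('i \<Rightarrow> 'l) set" where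
  "tensor_space L A = module.span (pw (scl L)) {tens L a l |a l. a \<in> acar A}"

definition tensor_lift ::
  "('k::field, 'l::ab_group_add) hom_leib \<Rightarrow> ('k, 'i) aug_alg \<Rightarrow> (('i \<Rightarrow> 'k) \<Rightarrow> 'l \<Rightarrow> 'w::ab_group_add) \<Rightarrow> ('i \<Rightarrow> 'l) \<Rightarrow> 'w" where
  "tensor_lift L A \<beta> t = (THE u. \<exists>ps. set ps \<subseteq> acar A \<times> UNIV \<and>
     t = sum_list (map (\<lambda>(a, l). tens L a l) ps) \<and> u = sum_list (map (\<lambda>(a, l). \<beta> a l) ps))"

text \<open>\<open>g \<otimes> id\<close> for linear \<open>g : A \<rightarrow> B\<close>, then \<open>\<epsilon> \<otimes> id\<close> (with values in \<open>K \<otimes> L = L\<close>), \<open>id \<otimes> \<alpha>\<close>, and the \<open>A\<close>-module structure.\<close>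

definition tmap ::
  "('k::field, 'l::ab_group_add) hom_leib \<Rightarrow> ('k, 'i) aug_alg \<Rightarrow> (('i \<Rightarrow> 'k) \<Rightarrow> 'j \<Rightarrow> 'k) \<Rightarrow> ('i \<Rightarrow> 'l) \<Rightarrow> 'j \<Rightarrow> 'l" where
  "tmap L A g = tensor_lift L A (\<lambda>a l. tens L (g a) l)"

definition teps :: "('k::field, 'l::ab_group_add) hom_leib \<Rightarrow> ('k, 'i) aug_alg \<Rightarrow> ('i \<Rightarrow> 'l) \<Rightarrow> 'l" where
  "teps L A = tensor_lift L A (\<lambda>a l. scl L (aeps A a) l)"

definition ttwist :: "('k::field, 'l::ab_group_add) hom_leib \<Rightarrow> ('k, 'i) aug_alg \<Rightarrow> ('i \<Rightarrow> 'l) \<Rightarrow> 'i \<Rightarrow> 'l" where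
  "ttwist L A = tensor_lift L A (\<lambda>a l. tens L a (twist L l))"

definition act :: "('k::field, 'l::ab_group_add) hom_leib \<Rightarrow> ('k, 'i) aug_alg \<Rightarrow> ('i \<Rightarrow> 'k) \<Rightarrow> ('i \<Rightarrow> 'l) \<Rightarrow> 'i \<Rightarrow> 'l" where
  "act L A a = tensor_lift L A (\<lambda>a' l. tens L (amul A a a') l)"

abbreviation unit_tens :: "('k, 'l) hom_leib \<Rightarrow> ('k, 'i) aug_alg \<Rightarrow> 'l \<Rightarrow> 'i \<Rightarrow> 'l" where
  "unit_tens L A l \<equiv> tens L (aone A) l"


section \<open>Deformations\<close>

text \<open>Additivity and homogeneity in each argument, on a set \<open>T\<close> on which \<open>R\<close> acts by \<open>sm\<close>.\<close>

definition bilinear_on :: "'r set \<Rightarrow> ('r \<Rightarrow> 'v::ab_group_add \<Rightarrow> 'v) \<Rightarrow> 'v set \<Rightarrow> ('v \<Rightarrow> 'v \<Rightarrow> 'v) \<Rightarrow> bool" where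
  "bilinear_on R sm T b \<longleftrightarrow>
     (\<forall>x\<in>T. \<forall>y\<in>T. \<forall>z\<in>T. b (x + y) z = b x z + b y z \<and> b x (y + z) = b x y + b x z) \<and>
     (\<forall>r\<in>R. \<forall>x\<in>T. \<forall>y\<in>T. b (sm r x) y = sm r (b x y) \<and> b x (sm r y) = sm r (b x y))"

definition deformation ::
  "('k::field, 'l::ab_group_add) hom_leib \<Rightarrow> ('k, 'i) aug_alg \<Rightarrow> (('i \<Rightarrow> 'l) \<Rightarrow> ('i \<Rightarrow> 'l) \<Rightarrow> 'i \<Rightarrow> 'l) \<Rightarrow> bool" where
  "deformation L A lam \<longleftrightarrow> aug_algebra A \<and>
     bilinear_on (acar A) (act L A) (tensor_space L A) lam \<and>
     hom_leibniz_on (tensor_space L A) lam (ttwist L A) \<and>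
     (\<forall>l1 l2. teps L A (lam (unit_tens L A l1) (unit_tens L A l2)) = brk L l1 l2)"

definition equivalent_deformations ::
  "('k::field, 'l::ab_group_add) hom_leib \<Rightarrow> ('k, 'i) aug_alg \<Rightarrow>
    (('i \<Rightarrow> 'l) \<Rightarrow> ('i \<Rightarrow> 'l) \<Rightarrow> 'i \<Rightarrow> 'l) \<Rightarrow> (('i \<Rightarrow> 'l) \<Rightarrow> ('i \<Rightarrow> 'l) \<Rightarrow> 'i \<Rightarrow> 'l) \<Rightarrow> bool" where
  "equivalent_deformations L A lam lam' \<longleftrightarrow> (\<exists>\<rho>.
     let T = tensor_space L A in
     bij_betw \<rho> T T \<and>
     (\<forall>s\<in>T. \<forall>t\<in>T. \<rho> (s + t) = \<rho> s + \<rho> t) \<and>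
     (\<forall>a\<in>acar A. \<forall>t\<in>T. \<rho> (act L A a t) = act L A a (\<rho> t)) \<and>
     (\<forall>s\<in>T. \<forall>t\<in>T. \<rho> (lam s t) = lam' (\<rho> s) (\<rho> t)) \<and>
     (\<forall>t\<in>T. \<rho> (ttwist L A t) = ttwist L A (\<rho> t)) \<and>
     (\<forall>t\<in>T. teps L A (\<rho> t) = teps L A t))"

text \<open>\<open>lam'\<close> is the push-out \<open>\<phi>\<^sub>* lam\<close>; by bilinearity it is determined on \<open>A' \<otimes> L\<close> by the last clause.\<close>

definition is_pushout ::
  "('k::field, 'l::ab_group_add) hom_leib \<Rightarrow> ('k, 'i) aug_alg \<Rightarrow> ('k, 'j) aug_alg \<Rightarrow> (('i \<Rightarrow> 'k) \<Rightarrow> 'j \<Rightarrow> 'k) \<Rightarrow>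
    (('i \<Rightarrow> 'l) \<Rightarrow> ('i \<Rightarrow> 'l) \<Rightarrow> 'i \<Rightarrow> 'l) \<Rightarrow> (('j \<Rightarrow> 'l) \<Rightarrow> ('j \<Rightarrow> 'l) \<Rightarrow> 'j \<Rightarrow> 'l) \<Rightarrow> bool" where
  "is_pushout L A A' \<phi> lam lam' \<longleftrightarrow>
     aug_hom A A' \<phi> \<and> deformation L A lam \<and> deformation L A' lam' \<and>
     (\<forall>l1 l2. lam' (unit_tens L A' l1) (unit_tens L A' l2) = tmap L A \<phi> (lam (unit_tens L A l1) (unit_tens L A l2)))"


section \<open>Extensions, Harrison cohomology, obstructions\<close>

text \<open>An extension of the local algebra \<open>A\<close> by a finite-dimensional space \<open>M\<close> annihilated by the maximal
  ideal; thus \<open>A\<close> acts on \<open>M\<close> through the augmentation.\<close>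

definition algebra_extension ::
  "('k::field, 'i) aug_alg \<Rightarrow> ('m \<Rightarrow> 'k) set \<Rightarrow> ('k, 'j) aug_alg \<Rightarrow> (('m \<Rightarrow> 'k) \<Rightarrow> 'j \<Rightarrow> 'k) \<Rightarrow> (('j \<Rightarrow> 'k) \<Rightarrow> 'i \<Rightarrow> 'k) \<Rightarrow> bool" where
  "algebra_extension A M B i p \<longleftrightarrow>
     local_algebra A \<and> aug_algebra B \<and> module.subspace (pw (*)) M \<and> finite_dim (pw (*)) M \<and>
     linear_on (pw (*)) (pw (*)) M i \<and> inj_on i M \<and> i ` M = {b \<in> acar B. p b = 0} \<and>
     aug_hom B A p \<and> p ` acar B = acar A \<and>
     (\<forall>m\<in>M. \<forall>b\<in>acar B. amul B (i m) b = i (pw (*) (aeps A (p b)) m)) \<and>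
     (\<forall>m\<in>M. \<forall>m'\<in>M. amul B (i m) (i m') = 0)"

definition extension_automorphism ::
  "('m \<Rightarrow> 'k::field) set \<Rightarrow> ('k, 'j) aug_alg \<Rightarrow> (('m \<Rightarrow> 'k) \<Rightarrow> 'j \<Rightarrow> 'k) \<Rightarrow> (('j \<Rightarrow> 'k) \<Rightarrow> 'i \<Rightarrow> 'k) \<Rightarrow> (('j \<Rightarrow> 'k) \<Rightarrow> 'j \<Rightarrow> 'k) \<Rightarrow> bool" where
  "extension_automorphism M B i p u \<longleftrightarrow>
     aug_iso B B u \<and> (\<forall>m\<in>M. u (i m) = i m) \<and> (\<forall>b\<in>acar B. p (u b) = p b)"

text \<open>The algebra \<open>A \<oplus> M\<close> defined by a symmetric \<open>2\<close>-cocycle \<open>f : A \<times> A \<rightarrow> M\<close>; the pair \<open>(a, m)\<close> is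
  \<open>case_sum a m\<close>.  As \<open>f\<close> need not vanish on \<open>1\<close>, the unit is \<open>(1, -f(1,1))\<close>.\<close>

definition ext_alg ::
  "('k::field, 'i) aug_alg \<Rightarrow> ('m \<Rightarrow> 'k) set \<Rightarrow> (('i \<Rightarrow> 'k) \<Rightarrow> ('i \<Rightarrow> 'k) \<Rightarrow> 'm \<Rightarrow> 'k) \<Rightarrow> ('k, 'i + 'm) aug_alg" where
  "ext_alg A M f = \<lparr>
     acar = {case_sum a m |a m. a \<in> acar A \<and> m \<in> M},
     amul = (\<lambda>x y. case_sum (amul A (x \<circ> Inl) (y \<circ> Inl))
        (pw (*) (aeps A (x \<circ> Inl)) (y \<circ> Inr) + pw (*) (aeps A (y \<circ> Inl)) (x \<circ> Inr) + f (x \<circ> Inl) (y \<circ> Inl))),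
     aone = case_sum (aone A) (- f (aone A) (aone A)),
     aeps = (\<lambda>x. aeps A (x \<circ> Inl))\<rparr>"

text \<open>\<open>2\<close>-cocycles and \<open>2\<close>-coboundaries of \<open>A\<close> with values in \<open>K\<close>, normalised to be \<open>0\<close> outside \<open>A \<times> A\<close>.\<close>

definition harr_cocycles :: "('k::field, 'i) aug_alg \<Rightarrow> (('i \<Rightarrow> 'k) \<Rightarrow> ('i \<Rightarrow> 'k) \<Rightarrow> 'k) set" where
  "harr_cocycles A = {f.
     (\<forall>a b. a \<notin> acar A \<or> b \<notin> acar A \<longrightarrow> f a b = 0) \<and>
     (\<forall>a b. f a b = f b a) \<and> (\<forall>a\<in>acar A. linear_on (pw (*)) (*) (acar A) (f a)) \<and>
     (\<forall>a\<in>acar A. \<forall>b\<in>acar A. \<forall>c\<in>acar A.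
        aeps A a * f b c - f (amul A a b) c + f a (amul A b c) - aeps A c * f a b = 0)}"

definition harr_coboundaries :: "('k::field, 'i) aug_alg \<Rightarrow> (('i \<Rightarrow> 'k) \<Rightarrow> ('i \<Rightarrow> 'k) \<Rightarrow> 'k) set" where
  "harr_coboundaries A = {\<lambda>a b. if a \<in> acar A \<and> b \<in> acar A
      then aeps A a * g b - g (amul A a b) + aeps A b * g a else 0 |g. linear_on (pw (*)) (*) (acar A) g}"

text \<open>\<open>H\<^sup>2\<^sub>H\<^sub>a\<^sub>r\<^sub>r(A,K)\<close> and its dual.\<close>

definition Harr :: "('k::field, 'i) aug_alg \<Rightarrow> (('i \<Rightarrow> 'k) \<Rightarrow> ('i \<Rightarrow> 'k) \<Rightarrow> 'k) set set" where
  "Harr A = quot (harr_cocycles A) (harr_coboundaries A)"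

definition Harr_dual :: "('k::field, 'i) aug_alg \<Rightarrow> ((('i \<Rightarrow> 'k) \<Rightarrow> ('i \<Rightarrow> 'k) \<Rightarrow> 'k) set \<Rightarrow> 'k) set" where
  "Harr_dual A = dual_quot (pw (pw (*))) (harr_cocycles A) (harr_coboundaries A)"

text \<open>A linear choice of representing cocycles (recall that a class is a set of cocycles), its dual
  \<open>f\<^sub>A : A \<times> A \<rightarrow> H\<^sup>2\<^sub>H\<^sub>a\<^sub>r\<^sub>r(A,K)'\<close>, and the algebra of the corresponding extension of \<open>A\<close>, whose
  structure maps are \<open>case_sum 0\<close> and \<open>\<lambda>x. x \<circ> Inl\<close>.\<close>

definition harr_section ::
  "('k::field, 'i) aug_alg \<Rightarrow> ((('i \<Rightarrow> 'k) \<Rightarrow> ('i \<Rightarrow> 'k) \<Rightarrow> 'k) set \<Rightarrow> ('i \<Rightarrow> 'k) \<Rightarrow> ('i \<Rightarrow> 'k) \<Rightarrow> 'k) \<Rightarrow> bool" where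
  "harr_section A \<sigma> \<longleftrightarrow>
     linear_on_quot (pw (pw (*))) (pw (pw (*))) (harr_cocycles A) (harr_coboundaries A) \<sigma> \<and>
     (\<forall>c\<in>Harr A. \<sigma> c \<in> c)"

definition harr_univ_cocycle ::
  "('k::field, 'i) aug_alg \<Rightarrow> ((('i \<Rightarrow> 'k) \<Rightarrow> ('i \<Rightarrow> 'k) \<Rightarrow> 'k) set \<Rightarrow> ('i \<Rightarrow> 'k) \<Rightarrow> ('i \<Rightarrow> 'k) \<Rightarrow> 'k) \<Rightarrow>
    ('i \<Rightarrow> 'k) \<Rightarrow> ('i \<Rightarrow> 'k) \<Rightarrow> (('i \<Rightarrow> 'k) \<Rightarrow> ('i \<Rightarrow> 'k) \<Rightarrow> 'k) set \<Rightarrow> 'k" where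
  "harr_univ_cocycle A \<sigma> a b = (\<lambda>c. if c \<in> Harr A then \<sigma> c a b else 0)"

abbreviation harr_univ_ext ::
  "('k::field, 'i) aug_alg \<Rightarrow> ((('i \<Rightarrow> 'k) \<Rightarrow> ('i \<Rightarrow> 'k) \<Rightarrow> 'k) set \<Rightarrow> ('i \<Rightarrow> 'k) \<Rightarrow> ('i \<Rightarrow> 'k) \<Rightarrow> 'k) \<Rightarrow>
    ('k, 'i + (('i \<Rightarrow> 'k) \<Rightarrow> ('i \<Rightarrow> 'k) \<Rightarrow> 'k) set) aug_alg" where
  "harr_univ_ext A \<sigma> \<equiv> ext_alg A (Harr_dual A) (harr_univ_cocycle A \<sigma>)"

definition is_bracket_lift ::
  "('k::field, 'l::ab_group_add) hom_leib \<Rightarrow> ('k, 'i) aug_alg \<Rightarrow> ('k, 'j) aug_alg \<Rightarrow> (('j \<Rightarrow> 'k) \<Rightarrow> 'i \<Rightarrow> 'k) \<Rightarrow>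
    (('i \<Rightarrow> 'l) \<Rightarrow> ('i \<Rightarrow> 'l) \<Rightarrow> 'i \<Rightarrow> 'l) \<Rightarrow> (('j \<Rightarrow> 'l) \<Rightarrow> ('j \<Rightarrow> 'l) \<Rightarrow> 'j \<Rightarrow> 'l) \<Rightarrow> bool" where
  "is_bracket_lift L A B p lam br \<longleftrightarrow>
     (let T = tensor_space L B in
     (\<forall>s\<in>T. \<forall>t\<in>T. br s t \<in> T) \<and> bilinear_on (acar B) (act L B) T br \<and>
     (\<forall>s\<in>T. \<forall>t\<in>T. ttwist L B (br s t) = br (ttwist L B s) (ttwist L B t)) \<and>
     (\<forall>s\<in>T. \<forall>t\<in>T. tmap L B p (br s t) = lam (tmap L B p s) (tmap L B p t)))"

definition obstruction_cochain ::
  "('k::field, 'l::ab_group_add) hom_leib \<Rightarrow> ('k, 'j) aug_alg \<Rightarrow> (('j \<Rightarrow> 'l) \<Rightarrow> ('j \<Rightarrow> 'l) \<Rightarrow> 'j \<Rightarrow> 'l) \<Rightarrow>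
    'l \<Rightarrow> 'l \<Rightarrow> 'l \<Rightarrow> 'j \<Rightarrow> 'l" where
  "obstruction_cochain L B br l1 l2 l3 = (let e = unit_tens L B; al = twist L in
     br (e (al l1)) (br (e l2) (e l3)) - br (br (e l1) (e l2)) (e (al l3)) + br (br (e l1) (e l3)) (e (al l2)))"

text \<open>The map \<open>w : H\<^sup>2\<^sub>H\<^sub>a\<^sub>r\<^sub>r(A,K) \<rightarrow> H\<^sup>3(L,L)\<close> given by the obstruction class: the obstruction
  cochain has values in \<open>H\<^sup>2\<^sub>H\<^sub>a\<^sub>r\<^sub>r(A,K)' \<otimes> L\<close>, whose elements are \<open>L\<close>-valued functions of \<open>c \<in> H\<^sup>2\<^sub>H\<^sub>a\<^sub>r\<^sub>r(A,K)\<close>, and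
  evaluation of such a function at \<open>c\<close> is \<open>ev\<^sub>c \<otimes> id\<close>.\<close>

definition is_obstruction_map ::
  "('k::field, 'l::ab_group_add) hom_leib \<Rightarrow> ('k, 'i) aug_alg \<Rightarrow> (('i \<Rightarrow> 'l) \<Rightarrow> ('i \<Rightarrow> 'l) \<Rightarrow> 'i \<Rightarrow> 'l) \<Rightarrow>
    ((('i \<Rightarrow> 'k) \<Rightarrow> ('i \<Rightarrow> 'k) \<Rightarrow> 'k) set \<Rightarrow> ('i \<Rightarrow> 'k) \<Rightarrow> ('i \<Rightarrow> 'k) \<Rightarrow> 'k) \<Rightarrow>
    ((('i \<Rightarrow> 'k) \<Rightarrow> ('i \<Rightarrow> 'k) \<Rightarrow> 'k) set \<Rightarrow> ('l list \<Rightarrow> 'l) set) \<Rightarrow> bool" where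
  "is_obstruction_map L A lam \<sigma> w \<longleftrightarrow> (\<exists>br.
     is_bracket_lift L A (harr_univ_ext A \<sigma>) (\<lambda>x. x \<circ> Inl) lam br \<and>
     (\<forall>c\<in>Harr A. w c = coset (coboundaries L 3)
        (\<lambda>xs. if length xs = 3
              then obstruction_cochain L (harr_univ_ext A \<sigma>) br (xs ! 0) (xs ! 1) (xs ! 2) (Inr c) else 0)))"

definition obstruction_dual ::
  "('k::field, 'i) aug_alg \<Rightarrow> ((('i \<Rightarrow> 'k) \<Rightarrow> ('i \<Rightarrow> 'k) \<Rightarrow> 'k) set \<Rightarrow> ('l list \<Rightarrow> 'l) set) \<Rightarrow>
    (('l list \<Rightarrow> 'l) set \<Rightarrow> 'k) \<Rightarrow> (('i \<Rightarrow> 'k) \<Rightarrow> ('i \<Rightarrow> 'k) \<Rightarrow> 'k) set \<Rightarrow> 'k" where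
  "obstruction_dual A w g = (\<lambda>c. if c \<in> Harr A then g (w c) else 0)"

text \<open>\<open>ker w\<close> is the quotient of the space of those cocycles whose class is killed by \<open>w\<close>.\<close>

definition ker_cocycles ::
  "('k::field, 'l::ab_group_add) hom_leib \<Rightarrow> ('k, 'i) aug_alg \<Rightarrow>
    ((('i \<Rightarrow> 'k) \<Rightarrow> ('i \<Rightarrow> 'k) \<Rightarrow> 'k) set \<Rightarrow> ('l list \<Rightarrow> 'l) set) \<Rightarrow> (('i \<Rightarrow> 'k) \<Rightarrow> ('i \<Rightarrow> 'k) \<Rightarrow> 'k) set" where
  "ker_cocycles L A w = {z \<in> harr_cocycles A. w (coset (harr_coboundaries A) z) = coboundaries L 3}"

definition ker_obstruction ::
  "('k::field, 'l::ab_group_add) hom_leib \<Rightarrow> ('k, 'i) aug_alg \<Rightarrow>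
    ((('i \<Rightarrow> 'k) \<Rightarrow> ('i \<Rightarrow> 'k) \<Rightarrow> 'k) set \<Rightarrow> ('l list \<Rightarrow> 'l) set) \<Rightarrow> (('i \<Rightarrow> 'k) \<Rightarrow> ('i \<Rightarrow> 'k) \<Rightarrow> 'k) set set" where
  "ker_obstruction L A w = quot (ker_cocycles L A w) (harr_coboundaries A)"

definition ker_obstruction_dual ::
  "('k::field, 'l::ab_group_add) hom_leib \<Rightarrow> ('k, 'i) aug_alg \<Rightarrow>
    ((('i \<Rightarrow> 'k) \<Rightarrow> ('i \<Rightarrow> 'k) \<Rightarrow> 'k) set \<Rightarrow> ('l list \<Rightarrow> 'l) set) \<Rightarrow> ((('i \<Rightarrow> 'k) \<Rightarrow> ('i \<Rightarrow> 'k) \<Rightarrow> 'k) set \<Rightarrow> 'k) set" where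
  "ker_obstruction_dual L A w = dual_quot (pw (pw (*))) (ker_cocycles L A w) (harr_coboundaries A)"


section \<open>The inductive construction\<close>

definition inf_base :: "('k::field, 'l::ab_group_add) hom_leib \<Rightarrow> ('k, unit + ('l list \<Rightarrow> 'l) set) aug_alg" where
  "inf_base L = ext_alg base_field (HL_dual L 2) (\<lambda>_ _. 0)"

definition universal_infinitesimal ::
  "('k::field, 'l::ab_group_add) hom_leib \<Rightarrow>
    ((unit + ('l list \<Rightarrow> 'l) set \<Rightarrow> 'l) \<Rightarrow> (unit + ('l list \<Rightarrow> 'l) set \<Rightarrow> 'l) \<Rightarrow> unit + ('l list \<Rightarrow> 'l) set \<Rightarrow> 'l) \<Rightarrow> bool" where
  "universal_infinitesimal L lam \<longleftrightarrow> deformation L (inf_base L) lam \<and>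
     (\<exists>n \<mu> g. basis_quot (pw (scl L)) (cocycles L 2) (coboundaries L 2) n \<mu> \<and>
        (\<forall>i<n. g i \<in> HL_dual L 2 \<and>
           (\<forall>j<n. g i (coset (coboundaries L 2) (\<mu> j)) = (if i = j then 1 else 0))) \<and>
        (\<forall>l1 l2. lam (unit_tens L (inf_base L) l1) (unit_tens L (inf_base L) l2) =
           unit_tens L (inf_base L) (brk L l1 l2) + (\<Sum>i<n. tens L (case_sum 0 (g i)) (\<mu> i [l1, l2]))))"

text \<open>\<open>C'\<close> is (a copy in \<open>K\<^sup>I\<close> of) the quotient of the universal extension of \<open>A\<close> by the image of
  \<open>w'\<close>, given by the surjection \<open>\<rho>\<close>, and \<open>i\<close>, \<open>p\<close> are the induced maps; \<open>i\<close> is defined on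
  \<open>(ker w)'\<close> because restriction to \<open>ker w\<close> induces \<open>coker w' \<cong> (ker w)'\<close>.\<close>

definition inductive_step ::
  "('k::field, 'l::ab_group_add) hom_leib \<Rightarrow> ('k, 'i) aug_alg \<Rightarrow> (('i \<Rightarrow> 'l) \<Rightarrow> ('i \<Rightarrow> 'l) \<Rightarrow> 'i \<Rightarrow> 'l) \<Rightarrow>
    ((('i \<Rightarrow> 'k) \<Rightarrow> ('i \<Rightarrow> 'k) \<Rightarrow> 'k) set \<Rightarrow> ('l list \<Rightarrow> 'l) set) \<Rightarrow> ('k, 'i) aug_alg \<Rightarrow>
    (((('i \<Rightarrow> 'k) \<Rightarrow> ('i \<Rightarrow> 'k) \<Rightarrow> 'k) set \<Rightarrow> 'k) \<Rightarrow> 'i \<Rightarrow> 'k) \<Rightarrow> (('i \<Rightarrow> 'k) \<Rightarrow> 'i \<Rightarrow> 'k) \<Rightarrow> bool" where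
  "inductive_step L A lam w C' i p \<longleftrightarrow> aug_algebra C' \<and>
     (\<exists>\<sigma> \<rho>. harr_section A \<sigma> \<and> is_obstruction_map L A lam \<sigma> w \<and>
       aug_hom (harr_univ_ext A \<sigma>) C' \<rho> \<and>
       \<rho> ` acar (harr_univ_ext A \<sigma>) = acar C' \<and>
       {x \<in> acar (harr_univ_ext A \<sigma>). \<rho> x = 0} = case_sum 0 ` obstruction_dual A w ` HL_dual L 3 \<and>
       (\<forall>g\<in>Harr_dual A. i (\<lambda>c. if c \<in> ker_obstruction L A w then g c else 0) = \<rho> (case_sum 0 g)) \<and>
       (\<forall>x\<in>acar (harr_univ_ext A \<sigma>). p (\<rho> x) = x \<circ> Inl))"

text \<open>The objects with index at most \<open>k\<close> (for \<open>k \<ge> 1\<close>) have been constructed by the inductive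
  procedure.  The maps \<open>p j : C (Suc j) \<rightarrow> C j\<close> and \<open>i j : (ker (w j))' \<rightarrow> C (Suc j)\<close> are the ones usually
  given the index \<open>j + 1\<close>; \<open>w 0\<close> and \<open>i 0\<close> play no role.\<close>

definition constructed ::
  "('k::field, 'l::ab_group_add) hom_leib \<Rightarrow> nat \<Rightarrow> (nat \<Rightarrow> ('k, nat) aug_alg) \<Rightarrow>
    (nat \<Rightarrow> (nat \<Rightarrow> 'l) \<Rightarrow> (nat \<Rightarrow> 'l) \<Rightarrow> nat \<Rightarrow> 'l) \<Rightarrow>
    (nat \<Rightarrow> ((nat \<Rightarrow> 'k) \<Rightarrow> (nat \<Rightarrow> 'k) \<Rightarrow> 'k) set \<Rightarrow> ('l list \<Rightarrow> 'l) set) \<Rightarrow>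
    (nat \<Rightarrow> (((nat \<Rightarrow> 'k) \<Rightarrow> (nat \<Rightarrow> 'k) \<Rightarrow> 'k) set \<Rightarrow> 'k) \<Rightarrow> nat \<Rightarrow> 'k) \<Rightarrow>
    (nat \<Rightarrow> (nat \<Rightarrow> 'k) \<Rightarrow> nat \<Rightarrow> 'k) \<Rightarrow> bool" where
  "constructed L k C \<eta> w i p \<longleftrightarrow>
     (\<forall>j\<le>k. fd_local_algebra (C j) \<and> deformation L (C j) (\<eta> j)) \<and>
     bij_betw (aeps (C 0)) (acar (C 0)) UNIV \<and>
     (\<exists>lam \<psi>. universal_infinitesimal L lam \<and> aug_iso (inf_base L) (C 1) \<psi> \<and>
        is_pushout L (inf_base L) (C 1) \<psi> lam (\<eta> 1)) \<and>
     (\<forall>j<k. is_pushout L (C (Suc j)) (C j) (p j) (\<eta> (Suc j)) (\<eta> j)) \<and>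
     (\<forall>j. 1 \<le> j \<and> j < k \<longrightarrow> inductive_step L (C j) (\<eta> j) (w j) (C (Suc j)) (i j) (p j))"


section \<open>Projective limits and formal deformations\<close>

definition component :: "nat \<Rightarrow> (nat \<times> 'i \<Rightarrow> 'k) \<Rightarrow> 'i \<Rightarrow> 'k" where
  "component n x = (\<lambda>j. x (n, j))"

definition lim_alg ::
  "(nat \<Rightarrow> ('k::field, 'i) aug_alg) \<Rightarrow> (nat \<Rightarrow> ('i \<Rightarrow> 'k) \<Rightarrow> 'i \<Rightarrow> 'k) \<Rightarrow> ('k, nat \<times> 'i) aug_alg" where
  "lim_alg C p = \<lparr>
     acar = {x. \<forall>n. component n x \<in> acar (C n) \<and> p n (component (Suc n) x) = component n x},
     amul = (\<lambda>x y (n, j). amul (C n) (component n x) (component n y) j),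
     aone = (\<lambda>(n, j). aone (C n) j),
     aeps = (\<lambda>x. aeps (C 0) (component 0 x))\<rparr>"

text \<open>\<open>Q n\<close>, with the projection \<open>\<pi> n\<close>, is a realisation of \<open>A/m\<^bsup>n+1\<^esup>\<close>, and \<open>q n\<close> is the canonical map
  from \<open>A/m\<^bsup>n+2\<^esup>\<close> to \<open>A/m\<^bsup>n+1\<^esup>\<close>.\<close>

definition quotient_system ::
  "('k::field, 'i) aug_alg \<Rightarrow> (nat \<Rightarrow> ('k, 'j) aug_alg) \<Rightarrow> (nat \<Rightarrow> ('i \<Rightarrow> 'k) \<Rightarrow> 'j \<Rightarrow> 'k) \<Rightarrow>
    (nat \<Rightarrow> ('j \<Rightarrow> 'k) \<Rightarrow> 'j \<Rightarrow> 'k) \<Rightarrow> bool" where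
  "quotient_system A Q \<pi> q \<longleftrightarrow> (\<forall>n.
     aug_algebra (Q n) \<and> aug_hom A (Q n) (\<pi> n) \<and> \<pi> n ` acar A = acar (Q n) \<and>
     {x \<in> acar A. \<pi> n x = 0} = max_pow A (Suc n) \<and>
     (\<forall>x\<in>acar A. q n (\<pi> (Suc n) x) = \<pi> n x))"

text \<open>The completed tensor product of \<open>A\<close> and \<open>L\<close>, the projective limit of the \<open>A/m\<^sup>n \<otimes> L\<close>.\<close>

definition ctensor_space ::
  "('k::field, 'l::ab_group_add) hom_leib \<Rightarrow> (nat \<Rightarrow> ('k, 'j) aug_alg) \<Rightarrow> (nat \<Rightarrow> ('j \<Rightarrow> 'k) \<Rightarrow> 'j \<Rightarrow> 'k) \<Rightarrow>
    (nat \<Rightarrow> 'j \<Rightarrow> 'l) set" where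
  "ctensor_space L Q q = {t. \<forall>n. t n \<in> tensor_space L (Q n) \<and> tmap L (Q (Suc n)) (q n) (t (Suc n)) = t n}"

definition formal_deformation ::
  "('k::field, 'l::ab_group_add) hom_leib \<Rightarrow> ('k, 'i) aug_alg \<Rightarrow>
    (nat \<Rightarrow> ('k, 'j) aug_alg) \<Rightarrow> (nat \<Rightarrow> ('i \<Rightarrow> 'k) \<Rightarrow> 'j \<Rightarrow> 'k) \<Rightarrow> (nat \<Rightarrow> ('j \<Rightarrow> 'k) \<Rightarrow> 'j \<Rightarrow> 'k) \<Rightarrow>
    ((nat \<Rightarrow> 'j \<Rightarrow> 'l) \<Rightarrow> (nat \<Rightarrow> 'j \<Rightarrow> 'l) \<Rightarrow> nat \<Rightarrow> 'j \<Rightarrow> 'l) \<Rightarrow> bool" where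
  "formal_deformation L A Q \<pi> q br \<longleftrightarrow>
     complete_local_algebra A \<and> quotient_system A Q \<pi> q \<and>
     (let T = ctensor_space L Q q; al = (\<lambda>t n. ttwist L (Q n) (t n)) in
     bilinear_on (acar A) (\<lambda>a t n. act L (Q n) (\<pi> n a) (t n)) T br \<and>
     hom_leibniz_on T br al \<and>
     (\<exists>lam. (\<forall>n. deformation L (Q n) (lam n) \<and>
               is_pushout L (Q (Suc n)) (Q n) (q n) (lam (Suc n)) (lam n)) \<and>
            (\<forall>s\<in>T. \<forall>t\<in>T. br s t = (\<lambda>n. lam n (s n) (t n)))) \<and>
     (\<forall>s\<in>T. \<forall>t\<in>T. teps L (Q 0) (br s t 0) = brk L (teps L (Q 0) (s 0)) (teps L (Q 0) (t 0))) \<and>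
     (\<forall>t\<in>T. teps L (Q 0) (al t 0) = twist L (teps L (Q 0) (t 0))))"

text \<open>The push-out of a formal deformation along a homomorphism \<open>\<phi> : A \<rightarrow> B\<close> which factors through
  some \<open>A/m\<^bsup>n+1\<^esup>\<close> is the deformation \<open>lam\<close>.\<close>

definition is_formal_pushout ::
  "('k::field, 'l::ab_group_add) hom_leib \<Rightarrow> ('k, 'i) aug_alg \<Rightarrow>
    (nat \<Rightarrow> ('k, 'j) aug_alg) \<Rightarrow> (nat \<Rightarrow> ('i \<Rightarrow> 'k) \<Rightarrow> 'j \<Rightarrow> 'k) \<Rightarrow>
    ((nat \<Rightarrow> 'j \<Rightarrow> 'l) \<Rightarrow> (nat \<Rightarrow> 'j \<Rightarrow> 'l) \<Rightarrow> nat \<Rightarrow> 'j \<Rightarrow> 'l) \<Rightarrow>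
    ('k, 'm) aug_alg \<Rightarrow> (('i \<Rightarrow> 'k) \<Rightarrow> 'm \<Rightarrow> 'k) \<Rightarrow> (('m \<Rightarrow> 'l) \<Rightarrow> ('m \<Rightarrow> 'l) \<Rightarrow> 'm \<Rightarrow> 'l) \<Rightarrow> bool" where
  "is_formal_pushout L A Q \<pi> br B \<phi> lam \<longleftrightarrow>
     aug_hom A B \<phi> \<and> deformation L B lam \<and>
     (\<exists>n \<phi>'. aug_hom (Q n) B \<phi>' \<and> (\<forall>x\<in>acar A. \<phi>' (\<pi> n x) = \<phi> x) \<and>
        (\<forall>l1 l2. lam (unit_tens L B l1) (unit_tens L B l2) =
           tmap L (Q n) \<phi>' (br (\<lambda>j. unit_tens L (Q j) l1) (\<lambda>j. unit_tens L (Q j) l2) n)))"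

end

theory Submission
  imports Defs
begin

text \<open>The proof replaces tensor manipulations by functionals.  An algebra is a subspace of a function space, hence an element of \<open>A \<otimes> L\<close> is determined
  by the values in \<open>L\<close> which functionals on \<open>A\<close> assign to it.  The functionals that matter for an extension \<open>P : D \<rightarrow> A\<close> with small kernel are the
  derivations of \<open>D\<close> twisted by a Harrison cocycle \<open>f\<close> of \<open>A\<close>: functionals \<open>\<xi>\<close> with
  \<open>\<xi>(d e) = \<epsilon>(d) \<xi>(e) + \<epsilon>(e) \<xi>(d) + f(P d, P e)\<close>.  Every functional on the kernel extends to one of these, the
  class of \<open>f\<close> being that of the extension pushed out along the functional (\<open>extend_to_twisted_derivation\<close>).  The
  central observation is \<open>tev_obstruction\<close>: the value of \<open>\<xi>\<close> on the obstruction of a lifted bracket is the coboundary of the value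
  of \<open>\<xi>\<close> on the bracket plus a term which depends only on the deformation over \<open>A\<close> and on \<open>f\<close>, but neither on \<open>D\<close> nor
  on the lift.

  This gives the single step.  The universal extension of \<open>C\<^sub>k\<close> carries evaluation at every Harrison class as a twisted
  derivation.  In the quotient by the image of \<open>w'\<close> only evaluations at classes of \<open>ker w\<close> survive (\<open>functional_on_kernel\<close>);
  at these the obstruction is a coboundary, and subtracting the corresponding cochains from the bracket yields an extension
  of the deformation (\<open>deformation_extends\<close>).  Two extensions differ by \<open>2\<close>-cocycles with coefficients in the kernel, since the comparison
  terms agree.  Their classes are values of derivations of \<open>C\<^sub>k\<close> on \<open>\<eta>\<^sub>k\<close>, because this is true for the universal infinitesimal
  deformation; such derivations define an automorphism of the extension, after which the difference is a coboundary and is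
  removed by an equivalence (\<open>extension_unique\<close>).  A finite-dimensional quotient algebra can be realised in a space of
  sequences, and dependent choice iterates the step (\<open>constructed_continue\<close>).

  For the limit, the quotients of \<open>lim C\<^sub>k\<close> by powers of its maximal ideal have to be identified.  They are the algebras \<open>C\<^sub>k\<close> themselves.
  The construction never adds new generators: for \<open>k \<ge> 1\<close> the kernel of \<open>C\<^bsub>k+1\<^esub> \<rightarrow> C\<^sub>k\<close> lies in the square of the maximal ideal
  (\<open>kernel_in_square\<close>), since a functional which annihilates this square is a derivation up to the augmentation, and comparing it with the evaluation to which it
  restricts on the kernel trivialises the class of this evaluation.
  More precisely this kernel is the power of exponent \<open>k + 1\<close> (\<open>kernel_step\<close>): a functional on \<open>C\<^bsub>k+2\<^esub>\<close> which annihilates the power of exponent \<open>k + 2\<close> agrees on the kernel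
  of \<open>C\<^bsub>k+2\<^esub> \<rightarrow> C\<^sub>k\<close> with a derivation over \<open>C\<^sub>k\<close> with an unobstructed twist, and \<open>C\<^bsub>k+1\<^esub>\<close> was built so as to contain all of these already.
  In such a tower choose elements of the limit lifting a basis of the maximal ideal of \<open>C\<^sub>1\<close>.  By successive approximation, the elements of the limit which
  vanish in \<open>C\<^bsub>k+1\<^esub>\<close> are combinations of them with coefficients vanishing in \<open>C\<^sub>k\<close> (\<open>kernel_combination\<close>); hence the kernels of the projections to \<open>C\<^sub>k\<close> are the powers of the maximal ideal (\<open>max_pow_limit\<close>), the limit is
  complete, and the brackets \<open>\<eta>\<^sub>k\<close> define a formal deformation componentwise.\<close>

section \<open>Linear algebra on subspaces and their quotients\<close>

lemma vector_space_times: "vector_space ((*) :: 'k::field \<Rightarrow> 'k \<Rightarrow> 'k)"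
  by unfold_locales (auto simp: algebra_simps)

lemma vector_space_pw: "vector_space s \<Longrightarrow> vector_space (pw s)"
  unfolding vector_space_def by (auto simp: pw_def fun_eq_iff)

lemmas vector_space_pw_times = vector_space_pw[OF vector_space_times]

lemma sum_apply: "sum f I x = (\<Sum>i\<in>I. f i x)" for f :: "'i \<Rightarrow> 'a \<Rightarrow> 'b::comm_monoid_add"
  by (induction I rule: infinite_finite_induct) auto

lemma linear_onD:
  assumes "linear_on s1 s2 V f"
  shows "x \<in> V \<Longrightarrow> y \<in> V \<Longrightarrow> f (x + y) = f x + f y" "x \<in> V \<Longrightarrow> f (s1 c x) = s2 c (f x)"
  using assms by (auto simp: linear_on_def)

lemma linear_onI:
  assumes "\<And>x y. x \<in> V \<Longrightarrow> y \<in> V \<Longrightarrow> f (x + y) = f x + f y"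
    and "\<And>c x. x \<in> V \<Longrightarrow> f (s1 c x) = s2 c (f x)"
  shows "linear_on s1 s2 V f"
  using assms by (auto simp: linear_on_def)

lemma linear_imp_linear_on: "Vector_Spaces.linear s1 s2 f \<Longrightarrow> linear_on s1 s2 V f"
  by (auto simp: linear_on_def Vector_Spaces.linear_iff)

lemma linear_on_subset: "linear_on s1 s2 V f \<Longrightarrow> W \<subseteq> V \<Longrightarrow> linear_on s1 s2 W f"
  by (auto simp: linear_on_def subset_iff)

lemma linear_on_comp:
  "linear_on s1 s2 V f \<Longrightarrow> linear_on s2 s3 W g \<Longrightarrow> f ` V \<subseteq> W \<Longrightarrow> linear_on s1 s3 V (\<lambda>x. g (f x))"
  by (auto simp: linear_on_def image_subset_iff)

lemma linear_on_cong: "(\<And>x. x \<in> V \<Longrightarrow> f x = g x) \<Longrightarrow> module.subspace s1 V \<Longrightarrow> vector_space s1 \<Longrightarrow>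
   linear_on s1 s2 V f \<longleftrightarrow> linear_on s1 s2 V g"
  unfolding linear_on_def
  by (metis (no_types, opaque_lifting) module.subspace_add module.subspace_scale module_iff_vector_space)

lemma additive_zero:
  fixes f :: "'v::ab_group_add \<Rightarrow> 'w::ab_group_add"
  assumes "f (0 + 0) = f 0 + f 0" shows "f 0 = 0"
  using assms by simp

lemma additive_diff:
  fixes f :: "'v::ab_group_add \<Rightarrow> 'w::ab_group_add"
  assumes "f ((x - y) + y) = f (x - y) + f y" shows "f (x - y) = f x - f y"
  using assms by (simp add: algebra_simps)

context vector_space_pair
begin

lemma linear_on_zero: "linear_on s1 s2 V f \<Longrightarrow> vs1.subspace V \<Longrightarrow> f 0 = 0"
  by (rule additive_zero, rule linear_onD(1)) (auto simp: vs1.subspace_0)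

lemma linear_on_diff:
  "linear_on s1 s2 V f \<Longrightarrow> vs1.subspace V \<Longrightarrow> x \<in> V \<Longrightarrow> y \<in> V \<Longrightarrow> f (x - y) = f x - f y"
  by (rule additive_diff, rule linear_onD(1)) (auto simp: vs1.subspace_diff)

lemma linear_on_sum:
  assumes "linear_on s1 s2 V f" "vs1.subspace V" "\<And>i. i \<in> I \<Longrightarrow> g i \<in> V"
  shows "f (sum g I) = (\<Sum>i\<in>I. f (g i))"
  using assms(3)
proof (induction I rule: infinite_finite_induct)
  case (insert i I)
  then have "sum g I \<in> V" by (intro vs1.subspace_sum assms(2)) auto
  with insert assms show ?case by (auto simp: linear_onD(1))
qed (use linear_on_zero assms in auto)

lemma subspace_linear_image: "linear_on s1 s2 V f \<Longrightarrow> vs1.subspace V \<Longrightarrow> vs2.subspace (f ` V)"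
  unfolding vs2.subspace_def
  using linear_on_zero[of V f] vs1.subspace_0[of V]
  by (auto simp: image_iff) (metis linear_onD vs1.subspace_add vs1.subspace_scale)+

lemma linear_on_extend:
  assumes V: "vs1.subspace V" and f: "linear_on s1 s2 V f"
  obtains F where "Vector_Spaces.linear s1 s2 F" "\<And>x. x \<in> V \<Longrightarrow> F x = f x"
proof -
  obtain B where B: "B \<subseteq> V" "vs1.independent B" "V \<subseteq> vs1.span B"
    using vs1.maximal_independent_subset by blast
  obtain F where F: "Vector_Spaces.linear s1 s2 F" "\<forall>x\<in>B. F x = f x"
    using linear_independent_extend[OF B(2)] by blast
  have "x \<in> V \<and> F x = f x" if "x \<in> vs1.span B" for x
    using that
  proof (induction rule: vs1.span_induct_alt)
    case base
    show ?case using linear_on_zero[OF f V] linear_0[OF F(1)] V by (simp add: vs1.subspace_0)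
  next
    case (step c x y)
    then have "x \<in> V" "s1 c x \<in> V" using B V by (auto simp: vs1.subspace_scale)
    then show ?case using step B V F linear_onD[OF f]
      by (auto simp: vs1.subspace_add linear_add[OF F(1)] linear_scale[OF F(1)])
  qed
  with F(1) B(3) that show thesis by blast
qed

lemma linear_section:
  assumes V: "vs1.subspace V" and f: "linear_on s1 s2 V f"
  obtains g where "Vector_Spaces.linear s2 s1 g" "\<And>y. y \<in> f ` V \<Longrightarrow> g y \<in> V" "\<And>y. y \<in> f ` V \<Longrightarrow> f (g y) = y"
proof -
  obtain F where F: "Vector_Spaces.linear s1 s2 F" "\<And>x. x \<in> V \<Longrightarrow> F x = f x"
    using linear_on_extend[OF V f] by blast
  obtain g where g: "g ` UNIV \<subseteq> V" "Vector_Spaces.linear s2 s1 g" "\<forall>v\<in>F ` V. F (g v) = v"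
    using linear_exists_right_inverse_on[OF F(1) V] by blast
  show thesis
  proof
    fix y assume "y \<in> f ` V"
    then have "y \<in> F ` V" using F(2) by auto
    then have "g y \<in> V" "F (g y) = y" using g by auto
    then show "g y \<in> V" "f (g y) = y" using F(2)[of "g y"] by auto
  qed (use g in auto)
qed

end

lemma vector_space_pair_times: "vector_space s \<Longrightarrow> vector_space_pair s ((*) :: 'k::field \<Rightarrow> 'k \<Rightarrow> 'k)"
  by (simp add: vector_space_pair_def vector_space_times)

interpretation K: vector_space "pw ((*) :: 'k::field \<Rightarrow> 'k \<Rightarrow> 'k) :: 'k \<Rightarrow> ('i \<Rightarrow> 'k) \<Rightarrow> 'i \<Rightarrow> 'k"
  by (rule vector_space_pw_times)

interpretation KK: vector_space_pair "pw ((*) :: 'k::field \<Rightarrow> 'k \<Rightarrow> 'k) :: 'k \<Rightarrow> ('i \<Rightarrow> 'k) \<Rightarrow> 'i \<Rightarrow> 'k"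
  "pw ((*) :: 'k::field \<Rightarrow> 'k \<Rightarrow> 'k) :: 'k \<Rightarrow> ('j \<Rightarrow> 'k) \<Rightarrow> 'j \<Rightarrow> 'k"
  unfolding vector_space_pair_def by (simp add: vector_space_pw_times)

text \<open>A basis of \<open>Z/B\<close> with its coordinates.  The coordinate functionals are defined on the whole space, so that they
  do not depend on a choice of representatives.\<close>

definition frame_mod ::
  "('k::field \<Rightarrow> 'v::ab_group_add \<Rightarrow> 'v) \<Rightarrow> 'v set \<Rightarrow> 'v set \<Rightarrow> nat \<Rightarrow> (nat \<Rightarrow> 'v) \<Rightarrow> (nat \<Rightarrow> 'v \<Rightarrow> 'k) \<Rightarrow> bool" where
  "frame_mod s Z B n z \<xi> \<longleftrightarrow>
     (\<forall>i<n. z i \<in> Z \<and> Vector_Spaces.linear s (*) (\<xi> i) \<and> (\<forall>b\<in>B. \<xi> i b = 0)) \<and>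
     (\<forall>i<n. \<forall>j<n. \<xi> i (z j) = (if i = j then 1 else 0)) \<and>
     (\<forall>x\<in>Z. x - (\<Sum>i<n. s (\<xi> i x) (z i)) \<in> B)"

definition quot_functional :: "'v::ab_group_add set \<Rightarrow> 'v set \<Rightarrow> ('v \<Rightarrow> 'k::zero) \<Rightarrow> 'v set \<Rightarrow> 'k" where
  "quot_functional Z B \<phi> X = (if X \<in> quot Z B then \<phi> (SOME x. x \<in> Z \<and> coset B x = X) else 0)"

context vector_space
begin

lemma separating_functional:
  assumes W: "subspace W" and x: "x \<notin> W"
  obtains \<phi> where "Vector_Spaces.linear scale (*) \<phi>" "\<And>w. w \<in> W \<Longrightarrow> \<phi> w = 0" "\<phi> x = 1"
proof -
  interpret P: vector_space_pair scale "(*)"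
    by (rule vector_space_pair_times) unfold_locales
  obtain B where B: "B \<subseteq> W" "independent B" "W \<subseteq> span B"
    using maximal_independent_subset by blast
  have "span B = W" using B W by (meson span_minimal subset_antisym)
  then have ind: "independent (insert x B)" using x B(2) by (simp add: independent_insertI)
  obtain \<phi> where \<phi>: "Vector_Spaces.linear scale (*) \<phi>" "\<forall>b\<in>insert x B. \<phi> b = (if b = x then 1 else 0)"
    using P.linear_independent_extend[OF ind, of "\<lambda>b. if b = x then 1 else 0"] by blast
  have "\<phi> w = 0" if "w \<in> W" for w
  proof (rule P.linear_eq_0_on_span[OF \<phi>(1)])
    show "w \<in> span B" using that B by auto
    show "\<phi> b = 0" if "b \<in> B" for b using that x B(1) \<phi>(2) by auto
  qed
  then show thesis using \<phi> that by auto
qed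

lemma finite_dim_subspace:
  assumes "subspace V" "V \<subseteq> span F" "finite F"
  shows "finite_dim scale V"
proof -
  obtain B where B: "B \<subseteq> V" "independent B" "V \<subseteq> span B"
    using maximal_independent_subset by blast
  have "finite B" using independent_span_bound[OF assms(3) B(2)] B assms(2) by blast
  then show ?thesis using B by (auto simp: finite_dim_def)
qed

lemma finite_dim_mono: "subspace V \<Longrightarrow> V \<subseteq> W \<Longrightarrow> finite_dim scale W \<Longrightarrow> finite_dim scale V"
  unfolding finite_dim_def[of scale W] by (meson finite_dim_subspace order_trans)

lemma frame_mod_exists:
  assumes B: "subspace B" and fin: "finite_dim_quot scale Z B"
  obtains n z \<xi> where "frame_mod scale Z B n z \<xi>"
proof -
  interpret P: vector_space_pair scale "(*)"
    by (rule vector_space_pair_times) unfold_locales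
  obtain F where F: "finite F" "F \<subseteq> Z" "Z \<subseteq> span (F \<union> B)"
    using fin by (auto simp: finite_dim_quot_def)
  obtain BB where BB: "BB \<subseteq> B" "independent BB" "B \<subseteq> span BB"
    using maximal_independent_subset by blast
  obtain C where C: "BB \<subseteq> C" "C \<subseteq> F \<union> BB" "independent C" "F \<union> BB \<subseteq> span C"
    using maximal_independent_subset_extend[of BB "F \<union> BB"] BB(2) by auto
  define G where "G = C - BB"
  have "finite G" using C(2) F(1) by (auto simp: G_def intro: finite_subset)
  then obtain n and z :: "nat \<Rightarrow> 'b" where z: "G = z ` {..<n}" "inj_on z {..<n}"
    using finite_imp_nat_seg_image_inj_on[of G] unfolding lessThan_def by blast
  have "\<exists>\<xi>. Vector_Spaces.linear scale (*) \<xi> \<and> (\<forall>c\<in>C. \<xi> c = (if c = z i then 1 else 0))" for i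
    using P.linear_independent_extend[OF C(3), of "\<lambda>c. if c = z i then 1 else 0"] by blast
  then obtain \<xi> where \<xi>: "\<And>i. Vector_Spaces.linear scale (*) (\<xi> i)"
    "\<And>i c. c \<in> C \<Longrightarrow> \<xi> i c = (if c = z i then 1 else 0)"
    by metis
  have zG: "z i \<in> G" if "i < n" for i using z that by auto
  have \<xi>B: "\<xi> i b = 0" if "i < n" "b \<in> B" for i b
  proof (rule P.linear_eq_0_on_span[OF \<xi>(1)])
    show "b \<in> span BB" using that BB by auto
    show "\<xi> i c = 0" if "c \<in> BB" for c
      using that \<xi>(2)[of c i] C(1) zG[OF \<open>i < n\<close>] by (auto simp: G_def)
  qed
  have Zspan: "Z \<subseteq> span C"
  proof -
    have "B \<subseteq> span C" using BB(3) C(1) span_mono by blast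
    then have "F \<union> B \<subseteq> span C" using C(4) by auto
    then have "span (F \<union> B) \<subseteq> span C" by (rule span_minimal) auto
    then show ?thesis using F(3) by auto
  qed
  have rem: "x - (\<Sum>i<n. \<xi> i x *s z i) \<in> B" if "x \<in> span C" for x
    using that
  proof (induction rule: span_induct_alt)
    case base
    have "\<xi> i 0 = 0" for i using P.linear_0[OF \<xi>(1)] .
    then show ?case using subspace_0[OF B] by simp
  next
    case (step c x y)
    have x: "x - (\<Sum>i<n. \<xi> i x *s z i) \<in> B"
    proof (cases "x \<in> BB")
      case True
      then have "(\<Sum>i<n. \<xi> i x *s z i) = 0" using \<xi>B BB(1) by (auto intro!: sum.neutral)
      then show ?thesis using True BB by auto
    next
      case False
      then obtain j where j: "j < n" "x = z j" using step z by (auto simp: G_def)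
      have "\<xi> i x *s z i = (if i = j then x else 0)" if "i < n" for i
        using \<xi>(2)[OF step(1), of i] j that z(2) by (auto simp: inj_on_def)
      then have "(\<Sum>i<n. \<xi> i x *s z i) = (\<Sum>i<n. (if i = j then x else 0))" by (intro sum.cong) auto
      also have "\<dots> = x" using j by simp
      finally show ?thesis using subspace_0[OF B] by simp
    qed
    have "(c *s x + y) - (\<Sum>i<n. \<xi> i (c *s x + y) *s z i)
        = c *s (x - (\<Sum>i<n. \<xi> i x *s z i)) + (y - (\<Sum>i<n. \<xi> i y *s z i))"
      by (simp add: P.linear_add[OF \<xi>(1)] P.linear_scale[OF \<xi>(1)] scale_left_distrib sum.distrib
          scale_right_diff_distrib scale_sum_right algebra_simps)
    moreover have "c *s (x - (\<Sum>i<n. \<xi> i x *s z i)) + (y - (\<Sum>i<n. \<xi> i y *s z i)) \<in> B"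
      using x step.IH by (intro subspace_add[OF B] subspace_scale[OF B])
    ultimately show ?case by (simp only:)
  qed
  have delta: "\<xi> i (z j) = (if i = j then 1 else 0)" if "i < n" "j < n" for i j
    using \<xi>(2)[of "z j" i] zG[OF that(2)] z(2) that by (auto simp: G_def inj_on_def)
  have "z i \<in> Z" if "i < n" for i using zG[OF that] C(2) F(2) by (auto simp: G_def)
  then have "frame_mod scale Z B n z \<xi>"
    unfolding frame_mod_def using \<xi>(1) \<xi>B delta rem Zspan by auto
  then show thesis by (rule that)
qed

lemma finite_dim_imp_finite_dim_quot: "finite_dim scale Z \<Longrightarrow> finite_dim_quot scale Z B"
  unfolding finite_dim_def finite_dim_quot_def
  by (meson Un_upper1 order_trans span_mono)

lemma frame_exists:
  assumes "finite_dim scale Z"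
  obtains n :: nat and z \<xi> where "\<And>i. i < n \<Longrightarrow> z i \<in> Z" "\<And>i. i < n \<Longrightarrow> Vector_Spaces.linear scale (*) (\<xi> i)"
    "\<And>i j. i < n \<Longrightarrow> j < n \<Longrightarrow> \<xi> i (z j) = (if i = j then 1 else 0)"
    "\<And>x. x \<in> Z \<Longrightarrow> x = (\<Sum>i<n. \<xi> i x *s z i)"
proof -
  obtain n z \<xi> where "frame_mod scale Z {0} n z \<xi>"
    using frame_mod_exists[OF subspace_single_0 finite_dim_imp_finite_dim_quot[OF assms]] by metis
  then show thesis by (intro that[where n = n and z = z and \<xi> = \<xi>]) (auto simp: frame_mod_def)
qed

lemma coset_eq_iff: "subspace B \<Longrightarrow> coset B x = coset B y \<longleftrightarrow> x - y \<in> B"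
proof
  assume B: "subspace B" and "coset B x = coset B y"
  then have "x + 0 \<in> coset B y" unfolding coset_def using subspace_0 by blast
  then obtain b where "b \<in> B" "x = y + b" by (auto simp: coset_def)
  then show "x - y \<in> B" by simp
next
  assume B: "subspace B" and d: "x - y \<in> B"
  have "x + b \<in> coset B y" if "b \<in> B" for b
    unfolding coset_def using subspace_add[OF B d that] by (auto intro!: image_eqI[of _ _ "x - y + b"])
  moreover have "y + b \<in> coset B x" if "b \<in> B" for b
    unfolding coset_def using subspace_diff[OF B that d] by (auto intro!: image_eqI[of _ _ "b - (x - y)"])
  ultimately show "coset B x = coset B y" by (auto simp: coset_def)
qed

lemma coset_zero: "coset B 0 = B" by (auto simp: coset_def)

lemma coset_eq_self_iff: "subspace B \<Longrightarrow> coset B x = B \<longleftrightarrow> x \<in> B"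
  using coset_eq_iff[of B x 0] by (simp add: coset_zero)

lemma mem_coset_iff: "y \<in> coset B x \<longleftrightarrow> y - x \<in> B"
  unfolding coset_def by (metis (no_types, lifting) add_diff_cancel_left' diff_add_cancel image_iff add.commute)

lemma quot_functional:
  assumes Z: "subspace Z" and B: "subspace B" and \<phi>: "linear_on scale (*) Z \<phi>"
    and zero: "\<And>b. b \<in> Z \<Longrightarrow> b \<in> B \<Longrightarrow> \<phi> b = 0"
  shows "z \<in> Z \<Longrightarrow> quot_functional Z B \<phi> (coset B z) = \<phi> z"
    and "quot_functional Z B \<phi> \<in> dual_quot scale Z B"
proof -
  interpret P: vector_space_pair scale "(*)"
    by (rule vector_space_pair_times) unfold_locales
  have *: "quot_functional Z B \<phi> (coset B z) = \<phi> z" if z: "z \<in> Z" for z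
  proof -
    define x where "x = (SOME x. x \<in> Z \<and> coset B x = coset B z)"
    have x: "x \<in> Z" "coset B x = coset B z" unfolding x_def by (rule someI2[of _ z]; use z in simp)+
    then have "x - z \<in> B" "x - z \<in> Z" using coset_eq_iff[OF B] z Z by (auto simp: subspace_diff)
    then have "\<phi> (x - z) = 0" by (intro zero)
    then have "\<phi> x = \<phi> z" using P.linear_on_diff[OF \<phi> Z x(1) z] by simp
    then show ?thesis using z by (auto simp: quot_functional_def quot_def x_def)
  qed
  then show "z \<in> Z \<Longrightarrow> quot_functional Z B \<phi> (coset B z) = \<phi> z" .
  show "quot_functional Z B \<phi> \<in> dual_quot scale Z B"
    unfolding dual_quot_def linear_on_quot_def
    using Z by (auto simp: * subspace_add subspace_scale linear_onD[OF \<phi>])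
      (simp add: quot_functional_def)
qed

lemma dual_quotD:
  assumes "g \<in> dual_quot scale Z B"
  shows "x \<in> Z \<Longrightarrow> y \<in> Z \<Longrightarrow> g (coset B (x + y)) = g (coset B x) + g (coset B y)"
    and "x \<in> Z \<Longrightarrow> g (coset B (c *s x)) = c * g (coset B x)"
    and "X \<notin> quot Z B \<Longrightarrow> g X = 0"
  using assms by (auto simp: dual_quot_def linear_on_quot_def)

lemma dual_quot_linear_on: "g \<in> dual_quot scale Z B \<Longrightarrow> linear_on scale (*) Z (\<lambda>z. g (coset B z))"
  by (auto simp: linear_on_def dual_quotD)

lemma dual_quot_zero:
  assumes "g \<in> dual_quot scale Z B" "subspace Z" "subspace B" "b \<in> Z" "b \<in> B"
  shows "g (coset B b) = 0"
proof -
  interpret P: vector_space_pair scale "(*)"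
    by (rule vector_space_pair_times) unfold_locales
  have "coset B b = coset B 0" using coset_eq_iff[OF assms(3)] assms(5) by simp
  then show ?thesis using P.linear_on_zero[OF dual_quot_linear_on[OF assms(1)] assms(2)] by simp
qed

lemma subspace_dual_quot: "module.subspace (pw (*)) (dual_quot scale Z B)"
  by (rule K.subspaceI) (auto simp: dual_quot_def linear_on_quot_def pw_def algebra_simps)

lemma dual_quot_separates:
  assumes Z: "subspace Z" and B: "subspace B" and z: "z \<in> Z"
    and zero: "\<And>g. g \<in> dual_quot scale Z B \<Longrightarrow> g (coset B z) = 0"
  shows "z \<in> B"
proof (rule ccontr)
  assume "z \<notin> B"
  then obtain \<phi> where \<phi>: "Vector_Spaces.linear scale (*) \<phi>" "\<And>w. w \<in> B \<Longrightarrow> \<phi> w = 0" "\<phi> z = 1"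
    using separating_functional[OF B] by metis
  have "quot_functional Z B \<phi> \<in> dual_quot scale Z B" "quot_functional Z B \<phi> (coset B z) = 1"
    using quot_functional[OF Z B linear_imp_linear_on[OF \<phi>(1)]] \<phi> z by auto
  then show False using zero[of "quot_functional Z B \<phi>"] by simp
qed

text \<open>A functional on \<open>Z/B\<close> is determined by its values on the frame.  This makes \<open>Z/B\<close> reflexive: a functional on \<open>(Z/B)'\<close> is
  evaluation at a class, which identifies functionals on the kernel of an extension with Harrison classes.\<close>

lemma frame_dual:
  assumes Z: "subspace Z" and B: "subspace B" and f: "frame_mod scale Z B n z \<xi>"
  shows "i < n \<Longrightarrow> quot_functional Z B (\<xi> i) \<in> dual_quot scale Z B"
    and "i < n \<Longrightarrow> x \<in> Z \<Longrightarrow> quot_functional Z B (\<xi> i) (coset B x) = \<xi> i x"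
    and "g \<in> dual_quot scale Z B \<Longrightarrow> g = (\<Sum>i<n. pw (*) (g (coset B (z i))) (quot_functional Z B (\<xi> i)))"
proof -
  interpret P: vector_space_pair scale "(*)"
    by (rule vector_space_pair_times) unfold_locales
  have \<xi>: "linear_on scale (*) Z (\<xi> i)" "b \<in> B \<Longrightarrow> \<xi> i b = 0" if "i < n" for i b
    using f that by (auto simp: frame_mod_def linear_imp_linear_on)
  show 1: "quot_functional Z B (\<xi> i) \<in> dual_quot scale Z B" if "i < n" for i
    using quot_functional(2)[OF Z B \<xi>(1)[OF that]] \<xi>(2)[OF that] by simp
  show 2: "quot_functional Z B (\<xi> i) (coset B x) = \<xi> i x" if "i < n" "x \<in> Z" for i x
    using quot_functional(1)[OF Z B \<xi>(1)[OF that(1)] _ that(2)] \<xi>(2)[OF that(1)] by simp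
  show "g = (\<Sum>i<n. pw (*) (g (coset B (z i))) (quot_functional Z B (\<xi> i)))"
    if g: "g \<in> dual_quot scale Z B"
  proof
    fix X
    show "g X = (\<Sum>i<n. pw (*) (g (coset B (z i))) (quot_functional Z B (\<xi> i))) X"
    proof (cases "X \<in> quot Z B")
      case False
      then show ?thesis using dual_quotD(3)[OF g] by (simp add: pw_def quot_functional_def sum_apply)
    next
      case True
      then obtain x where x: "x \<in> Z" "X = coset B x" by (auto simp: quot_def)
      let ?y = "\<Sum>i<n. \<xi> i x *s z i"
      have zZ: "\<xi> i x *s z i \<in> Z" if "i < n" for i using f that Z by (auto simp: frame_mod_def subspace_scale)
      have "X = coset B ?y" using x f coset_eq_iff[OF B] by (auto simp: frame_mod_def)
      then have "g X = (\<Sum>i<n. g (coset B (\<xi> i x *s z i)))"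
        using P.linear_on_sum[OF dual_quot_linear_on[OF g] Z, of "{..<n}" "\<lambda>i. \<xi> i x *s z i"] zZ by simp
      also have "\<dots> = (\<Sum>i<n. \<xi> i x * g (coset B (z i)))"
        using f by (intro sum.cong refl dual_quotD(2)[OF g]) (auto simp: frame_mod_def)
      finally show ?thesis using x 2 by (simp add: pw_def sum_apply mult.commute)
    qed
  qed
qed

lemma finite_dim_dual_quot:
  assumes Z: "subspace Z" and B: "subspace B" and fin: "finite_dim_quot scale Z B"
  shows "finite_dim (pw (*)) (dual_quot scale Z B)"
proof -
  obtain n z \<xi> where f: "frame_mod scale Z B n z \<xi>" using frame_mod_exists[OF B fin] by metis
  let ?F = "(\<lambda>i. quot_functional Z B (\<xi> i)) ` {..<n}"
  have "g \<in> K.span ?F" if "g \<in> dual_quot scale Z B" for g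
    by (subst frame_dual(3)[OF Z B f that]) (intro K.span_sum K.span_scale K.span_base imageI)
  then show ?thesis unfolding finite_dim_def using frame_dual(1)[OF Z B f]
    by (intro exI[of _ ?F]) auto
qed

lemma quot_reflexive:
  assumes Z: "subspace Z" and B: "subspace B" and fin: "finite_dim_quot scale Z B"
    and \<Phi>: "linear_on (pw (*)) (*) (dual_quot scale Z B) \<Phi>"
  obtains x where "x \<in> Z" "\<And>g. g \<in> dual_quot scale Z B \<Longrightarrow> \<Phi> g = g (coset B x)"
proof -
  interpret P: vector_space_pair scale "(*)"
    by (rule vector_space_pair_times) unfold_locales
  interpret KF: vector_space_pair "pw ((*) :: 'a \<Rightarrow> _)" "(*)"
    by (rule vector_space_pair_times[OF vector_space_pw_times])
  obtain n z \<xi> where f: "frame_mod scale Z B n z \<xi>" using frame_mod_exists[OF B fin] by metis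
  let ?g = "\<lambda>i. quot_functional Z B (\<xi> i)"
  have z: "z i \<in> Z" if "i < n" for i using f that by (auto simp: frame_mod_def)
  define x where "x = (\<Sum>i<n. \<Phi> (?g i) *s z i)"
  have "x \<in> Z" unfolding x_def using z Z by (auto intro!: subspace_sum subspace_scale)
  moreover have "\<Phi> g = g (coset B x)" if g: "g \<in> dual_quot scale Z B" for g
  proof -
    have "\<Phi> g = \<Phi> (\<Sum>i<n. pw (*) (g (coset B (z i))) (?g i))"
      using arg_cong[OF frame_dual(3)[OF Z B f g], of \<Phi>] .
    also have "\<dots> = (\<Sum>i<n. \<Phi> (pw (*) (g (coset B (z i))) (?g i)))"
      using frame_dual(1)[OF Z B f] subspace_dual_quot[of Z B]
      by (intro KF.linear_on_sum[OF \<Phi>]) (auto intro: K.subspace_scale)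
    also have "\<dots> = (\<Sum>i<n. \<Phi> (?g i) * g (coset B (z i)))"
      using frame_dual(1)[OF Z B f] by (intro sum.cong) (auto simp: linear_onD[OF \<Phi>])
    also have "\<dots> = (\<Sum>i<n. g (coset B (\<Phi> (?g i) *s z i)))"
      by (rule sum.cong) (use z in \<open>auto simp: dual_quotD(2)[OF g]\<close>)
    also have "\<dots> = g (coset B x)" unfolding x_def
      by (rule P.linear_on_sum[OF dual_quot_linear_on[OF g] Z, symmetric])
        (use z Z in \<open>auto simp: subspace_scale\<close>)
    finally show ?thesis .
  qed
  ultimately show thesis by (rule that)
qed

end

section \<open>Augmented algebras\<close>

text \<open>Unification produces \<open>\<eta>\<close>-expanded functions, which the pointwise rules would unfold; they are
  therefore applied only on request.\<close>

lemmas pointwise = plus_fun_apply zero_fun_apply minus_apply uminus_apply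

declare pointwise [simp del]

lemma aug_algebraD:
  assumes "aug_algebra A"
  shows "module.subspace (pw (*)) (acar A)" "aone A \<in> acar A"
    "x \<in> acar A \<Longrightarrow> y \<in> acar A \<Longrightarrow> amul A x y \<in> acar A"
    "x \<in> acar A \<Longrightarrow> linear_on (pw (*)) (pw (*)) (acar A) (amul A x)"
    "x \<in> acar A \<Longrightarrow> y \<in> acar A \<Longrightarrow> amul A x y = amul A y x"
    "x \<in> acar A \<Longrightarrow> y \<in> acar A \<Longrightarrow> z \<in> acar A \<Longrightarrow> amul A (amul A x y) z = amul A x (amul A y z)"
    "x \<in> acar A \<Longrightarrow> amul A (aone A) x = x"
    "x \<in> acar A \<Longrightarrow> amul A x (aone A) = x"
    "linear_on (pw (*)) (*) (acar A) (aeps A)"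
    "x \<in> acar A \<Longrightarrow> y \<in> acar A \<Longrightarrow> aeps A (amul A x y) = aeps A x * aeps A y"
    "aeps A (aone A) = 1"
  using assms unfolding aug_algebra_def by (blast, blast, blast, blast, blast, blast, blast, metis, blast, blast, blast)

lemma aug_algebra_mul_add:
  assumes "aug_algebra A" "x \<in> acar A" "y \<in> acar A" "z \<in> acar A"
  shows "amul A x (y + z) = amul A x y + amul A x z" "amul A (y + z) x = amul A y x + amul A z x"
    "amul A x (pw (*) c y) = pw (*) c (amul A x y)" "amul A (pw (*) c y) x = pw (*) c (amul A y x)"
proof -
  have s: "y + z \<in> acar A" "pw (*) c y \<in> acar A"
    using assms aug_algebraD(1)[OF assms(1)] by (auto simp: K.subspace_add K.subspace_scale)
  show 1: "amul A x (y + z) = amul A x y + amul A x z"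
    using linear_onD(1)[OF aug_algebraD(4)[OF assms(1,2)]] assms by auto
  show 2: "amul A x (pw (*) c y) = pw (*) c (amul A x y)"
    using linear_onD(2)[OF aug_algebraD(4)[OF assms(1,2)]] assms by auto
  show "amul A (y + z) x = amul A y x + amul A z x" "amul A (pw (*) c y) x = pw (*) c (amul A y x)"
    using 1 2 aug_algebraD(5)[OF assms(1)] s assms by simp_all
qed

lemma aug_homD:
  assumes "aug_hom A B \<phi>"
  shows "x \<in> acar A \<Longrightarrow> \<phi> x \<in> acar B" "linear_on (pw (*)) (pw (*)) (acar A) \<phi>"
    "x \<in> acar A \<Longrightarrow> y \<in> acar A \<Longrightarrow> \<phi> (amul A x y) = amul B (\<phi> x) (\<phi> y)"
    "\<phi> (aone A) = aone B" "x \<in> acar A \<Longrightarrow> aeps B (\<phi> x) = aeps A x"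
  using assms by (auto simp: aug_hom_def)

lemma aug_hom_comp: "aug_hom A B f \<Longrightarrow> aug_hom B C g \<Longrightarrow> aug_hom A C (\<lambda>x. g (f x))"
  unfolding aug_hom_def using linear_on_comp[of "pw (*)" "pw (*)" "acar A" f "pw (*)" "acar B" g]
  by (simp add: image_subset_iff)

section \<open>Tensor products as spaces of vector-valued functions\<close>

definition additive_on :: "'v::ab_group_add set \<Rightarrow> ('v \<Rightarrow> 'w::ab_group_add) \<Rightarrow> bool" where
  "additive_on T F \<longleftrightarrow> (\<forall>s\<in>T. \<forall>t\<in>T. F (s + t) = F s + F t)"

lemma additive_onD: "additive_on T F \<Longrightarrow> s \<in> T \<Longrightarrow> t \<in> T \<Longrightarrow> F (s + t) = F s + F t"
  by (simp add: additive_on_def)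

lemma additive_on_zero: "additive_on T F \<Longrightarrow> 0 \<in> T \<Longrightarrow> F 0 = 0"
  by (intro additive_zero additive_onD)

locale hom_leibniz =
  fixes L :: "('k::field, 'l::ab_group_add) hom_leib"
  assumes hl: "hom_leibniz_algebra L"
begin

lemma vector_space_scl: "vector_space (scl L)"
  using hl by (simp add: hom_leibniz_algebra_def)

sublocale LV: vector_space "scl L" by (rule vector_space_scl)

lemma vector_space_pw_scl: "vector_space (pw (scl L))"
  by (rule vector_space_pw[OF vector_space_scl])

lemma brk_add: "brk L (x + y) z = brk L x z + brk L y z" "brk L x (y + z) = brk L x y + brk L x z"
  and brk_scl: "brk L (scl L c x) y = scl L c (brk L x y)" "brk L x (scl L c y) = scl L c (brk L x y)"
  and twist_add: "twist L (x + y) = twist L x + twist L y"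
  and twist_scl: "twist L (scl L c x) = scl L c (twist L x)"
  using hl by (simp_all add: hom_leibniz_algebra_def Vector_Spaces.linear_iff)

lemma brk_leibniz:
    "brk L (twist L x) (brk L y z) = brk L (brk L x y) (twist L z) - brk L (brk L x z) (twist L y)"
  and twist_brk: "twist L (brk L x y) = brk L (twist L x) (twist L y)"
  using hl by (simp_all add: hom_leibniz_algebra_def hom_leibniz_on_def)

lemma brk_zero: "brk L 0 x = 0" "brk L x 0 = 0" and twist_zero: "twist L 0 = 0"
  using brk_scl[of 0 0 x] brk_scl(2)[of x 0 0] twist_scl[of 0 0] by auto

lemma brk_neg: "brk L (- x) y = - brk L x y" "brk L x (- y) = - brk L x y"
  using brk_scl(1)[of "-1" x y] brk_scl(2)[of x "-1" y] by simp_all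

lemma twist_neg: "twist L (- x) = - twist L x"
  using twist_scl[of "-1" x] by simp

lemma tens_add: "tens L (a + b) l = tens L a l + tens L b l" "tens L a (l + m) = tens L a l + tens L a m"
  and tens_scale: "tens L (pw (*) c a) l = tens L a (scl L c l)"
  and tens_scale': "pw (scl L) c (tens L a l) = tens L a (scl L c l)"
  and tens_zero: "tens L 0 l = 0" "tens L a 0 = 0"
  and tens_neg: "tens L a (- l) = - tens L a l"
  and tens_diff: "tens L (a - b) l = tens L a l - tens L b l" "tens L a (l - m) = tens L a l - tens L a m"
  by (auto simp: pointwise tens_def pw_def fun_eq_iff LV.scale_left_distrib LV.scale_right_distrib
      LV.scale_left_diff_distrib LV.scale_right_diff_distrib mult.commute)

lemma tens_sum: "tens L a (sum f I) = (\<Sum>i\<in>I. tens L a (f i))"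
   "tens L (sum g I) l = (\<Sum>i\<in>I. tens L (g i) l)"
  by (induction I rule: infinite_finite_induct) (auto simp: tens_zero tens_add)

abbreviation T :: "('k, 'i) aug_alg \<Rightarrow> ('i \<Rightarrow> 'l) set" where "T \<equiv> tensor_space L"

lemma
  shows T_zero: "0 \<in> T A" and T_add: "s \<in> T A \<Longrightarrow> t \<in> T A \<Longrightarrow> s + t \<in> T A"
    and T_diff: "s \<in> T A \<Longrightarrow> t \<in> T A \<Longrightarrow> s - t \<in> T A"
    and T_scale: "s \<in> T A \<Longrightarrow> pw (scl L) c s \<in> T A"
    and T_sum: "(\<And>i. i \<in> I \<Longrightarrow> f i \<in> T A) \<Longrightarrow> sum f I \<in> T A"
    and T_pure: "a \<in> acar A \<Longrightarrow> tens L a l \<in> T A"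
proof -
  interpret V: vector_space "pw (scl L)" by (rule vector_space_pw_scl)
  show "0 \<in> T A" "s \<in> T A \<Longrightarrow> t \<in> T A \<Longrightarrow> s + t \<in> T A"
   "s \<in> T A \<Longrightarrow> t \<in> T A \<Longrightarrow> s - t \<in> T A"
   "s \<in> T A \<Longrightarrow> pw (scl L) c s \<in> T A" "(\<And>i. i \<in> I \<Longrightarrow> f i \<in> T A) \<Longrightarrow> sum f I \<in> T A"
   "a \<in> acar A \<Longrightarrow> tens L a l \<in> T A"
    unfolding tensor_space_def
    by (auto simp: V.span_zero V.span_add V.span_diff V.span_scale V.span_sum intro: V.span_base)
qed

lemma T_induct [consumes 1, case_names zero pure]:
  assumes "t \<in> T A" "P 0" "\<And>a l t. a \<in> acar A \<Longrightarrow> t \<in> T A \<Longrightarrow> P t \<Longrightarrow> P (tens L a l + t)"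
  shows "P t"
proof -
  interpret V: vector_space "pw (scl L)" by (rule vector_space_pw_scl)
  have "t \<in> T A \<and> P t"
    using assms(1) unfolding tensor_space_def
  proof (induction rule: V.span_induct_alt)
    case (step c x y)
    then obtain a l where a: "a \<in> acar A" "x = tens L a l" by blast
    have y: "y \<in> T A" "P y" using step.IH by (simp_all add: tensor_space_def)
    have "pw (scl L) c x = tens L a (scl L c l)" by (simp only: a tens_scale')
    with assms(3)[OF a(1) y] T_add[OF T_pure[OF a(1)] y(1)] show ?case
      by (simp only: tensor_space_def simp_thms)
  next
    case base
    show ?case using assms(2) V.span_zero by (intro conjI)
  qed
  then show ?thesis by simp
qed

lemma T_ext:
  assumes "additive_on (T A) F" "additive_on (T A) G"
    and "\<And>a l. a \<in> acar A \<Longrightarrow> F (tens L a l) = G (tens L a l)" and t: "t \<in> T A"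
  shows "F t = G t"
  using t
proof (induction rule: T_induct)
  case zero
  have "F 0 = G 0" by (simp only: additive_on_zero[OF assms(1) T_zero] additive_on_zero[OF assms(2) T_zero])
  then show ?case .
next
  case (pure a l t)
  have "F (tens L a l + t) = G (tens L a l + t)"
    by (simp only: additive_onD[OF assms(1) T_pure[OF pure(1)] pure(2)]
        additive_onD[OF assms(2) T_pure[OF pure(1)] pure(2)] assms(3)[OF pure(1)] pure(3))
  then show ?case .
qed

text \<open>The condition under which a function of a pair factors through the tensor product.\<close>

definition balanced :: "('k, 'i) aug_alg \<Rightarrow> (('i \<Rightarrow> 'k) \<Rightarrow> 'l \<Rightarrow> 'w::ab_group_add) \<Rightarrow> bool" where
  "balanced A \<beta> \<longleftrightarrow>
     (\<forall>a\<in>acar A. \<forall>b\<in>acar A. \<forall>l. \<beta> (a + b) l = \<beta> a l + \<beta> b l) \<and>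
     (\<forall>a\<in>acar A. \<forall>l m. \<beta> a (l + m) = \<beta> a l + \<beta> a m) \<and>
     (\<forall>a\<in>acar A. \<forall>c l. \<beta> (pw (*) c a) l = \<beta> a (scl L c l))"

abbreviation tsum :: "(('i \<Rightarrow> 'k) \<times> 'l) list \<Rightarrow> 'i \<Rightarrow> 'l" where
  "tsum ps \<equiv> sum_list (map (\<lambda>(a, l). tens L a l) ps)"

text \<open>Expanding the second factors in a Hamel basis of \<open>L\<close> turns a vanishing sum of pure tensors into
  vanishing sums of first factors.\<close>

lemma balanced_vanishes:
  fixes A :: "('k, 'i) aug_alg" and \<beta> :: "('i \<Rightarrow> 'k) \<Rightarrow> 'l \<Rightarrow> 'w::ab_group_add"
  assumes A: "module.subspace (pw (*)) (acar A)" and \<beta>: "balanced A \<beta>"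
    and ps: "set ps \<subseteq> acar A \<times> UNIV" and zero: "tsum ps = 0"
  shows "sum_list (map (\<lambda>(a, l). \<beta> a l) ps) = 0"
proof -
  obtain B where B: "LV.independent B" "UNIV \<subseteq> LV.span B"
    using LV.maximal_independent_subset by blast
  let ?r = "LV.representation B"
  define S where "S = (\<Union>p\<in>set ps. {b. ?r (snd p) b \<noteq> 0})"
  have S: "finite S" "S \<subseteq> B"
    using LV.finite_representation LV.representation_ne_zero by (auto simp: S_def)
  have \<beta>0: "\<beta> 0 l = 0" "a \<in> acar A \<Longrightarrow> \<beta> a 0 = 0" for a l
  proof -
    show "\<beta> 0 l = 0"
      using \<beta> K.subspace_0[OF A] unfolding balanced_def by (intro additive_zero[of "\<lambda>a. \<beta> a l"]) blast
    show "\<beta> a 0 = 0" if "a \<in> acar A"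
      using \<beta> that unfolding balanced_def by (intro additive_zero[of "\<beta> a"]) blast
  qed
  have \<beta>sum: "\<beta> a (\<Sum>b\<in>S'. f b) = (\<Sum>b\<in>S'. \<beta> a (f b))" if "a \<in> acar A" for a f and S' :: "'l set"
    using \<beta> that \<beta>0 by (induction S' rule: infinite_finite_induct) (auto simp: balanced_def)
  define k where "k qs b = sum_list (map (\<lambda>(a, l). pw (*) (?r l b) a) qs)"
    for qs :: "(('i \<Rightarrow> 'k) \<times> 'l) list" and b
  have k: "k qs b \<in> acar A" if "set qs \<subseteq> acar A \<times> UNIV" for qs b
    using that by (induction qs) (auto simp: k_def K.subspace_0[OF A] K.subspace_add[OF A] K.subspace_scale[OF A])
  have expand: "l = (\<Sum>b\<in>S. scl L (?r l b) b)" if "(a, l) \<in> set ps" for a l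
  proof -
    have "(\<Sum>b\<in>S. scl L (?r l b) b) = (\<Sum>b | ?r l b \<noteq> 0. scl L (?r l b) b)"
      using S(1) that by (intro sum.mono_neutral_right) (auto simp: S_def intro!: bexI[of _ "(a, l)"])
    also have "\<dots> = l" using LV.sum_nonzero_representation_eq[OF B(1)] B(2) by blast
    finally show ?thesis by simp
  qed
  have sums: "sum_list (map (\<lambda>(a, l). \<beta>' a l) qs) = (\<Sum>b\<in>S. \<beta>' (k qs b) b)"
    if \<beta>': "balanced A \<beta>'" "\<And>l. \<beta>' 0 l = 0"
      "\<And>a f. a \<in> acar A \<Longrightarrow> \<beta>' a (\<Sum>b\<in>S. f b) = (\<Sum>b\<in>S. \<beta>' a (f b))"
      and qs: "set qs \<subseteq> set ps" for qs and \<beta>' :: "('i \<Rightarrow> 'k) \<Rightarrow> 'l \<Rightarrow> 'x::ab_group_add"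
    using qs
  proof (induction qs)
    case Nil
    then show ?case using \<beta>' by (simp add: k_def)
  next
    case (Cons q qs)
    obtain a l where q: "q = (a, l)" by force
    have a: "a \<in> acar A" "(a, l) \<in> set ps" using q Cons ps by auto
    have "\<beta>' a l = \<beta>' a (\<Sum>b\<in>S. scl L (?r l b) b)" using expand[OF a(2)] by simp
    also have "\<dots> = (\<Sum>b\<in>S. \<beta>' (pw (*) (?r l b) a) b)"
      using \<beta>'(1) a by (simp add: \<beta>'(3) balanced_def)
    finally have "\<beta>' a l = (\<Sum>b\<in>S. \<beta>' (pw (*) (?r l b) a) b)" .
    moreover have "k (q # qs) b = pw (*) (?r l b) a + k qs b" for b by (simp add: k_def q)
    moreover have "\<beta>' (pw (*) (?r l b) a + k qs b) b = \<beta>' (pw (*) (?r l b) a) b + \<beta>' (k qs b) b" for b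
      using \<beta>'(1) a k[of qs b] Cons ps K.subspace_scale[OF A] by (auto simp: balanced_def)
    ultimately show ?case using Cons by (simp add: q sum.distrib)
  qed
  have tens_bal: "balanced A (tens L)"
    by (auto simp: balanced_def tens_add tens_scale)
  have *: "(\<Sum>b\<in>S. tens L (k ps b) b) = 0"
    using sums[OF tens_bal _ _ order_refl] zero by (simp add: tens_zero tens_sum)
  have "k ps b = 0" if b: "b \<in> S" for b
  proof
    fix x
    have "(\<Sum>b\<in>S. scl L (k ps b x) b) = 0"
      using fun_cong[OF *, of x] by (simp add: tens_def sum_apply pointwise)
    then show "k ps b x = 0 x" using LV.independentD[OF B(1) S, of "\<lambda>b. k ps b x"] b by (simp add: pointwise)
  qed
  then show ?thesis using sums[OF \<beta> \<beta>0(1) \<beta>sum order_refl] by (simp add: \<beta>0)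
qed

lemma T_tsum:
  assumes "t \<in> T A"
  obtains ps where "set ps \<subseteq> acar A \<times> UNIV" "t = tsum ps"
proof -
  have "\<exists>ps. set ps \<subseteq> acar A \<times> UNIV \<and> t = tsum ps"
    using assms
  proof (induction rule: T_induct)
    case zero
    then show ?case by (intro exI[of _ "[]"]) auto
  next
    case (pure a l t)
    then obtain ps where "set ps \<subseteq> acar A \<times> UNIV" "t = tsum ps" by auto
    then show ?case using pure by (intro exI[of _ "(a, l) # ps"]) auto
  qed
  then show thesis using that by blast
qed

lemma tensor_lift_tsum:
  assumes A: "module.subspace (pw (*)) (acar A)" and \<beta>: "balanced A \<beta>"
    and ps: "set ps \<subseteq> acar A \<times> UNIV"
  shows "tensor_lift L A \<beta> (tsum ps) = sum_list (map (\<lambda>(a, l). \<beta> a l) ps)"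
proof -
  have \<beta>n: "\<beta> a (- l) = - \<beta> a l" if "a \<in> acar A" for a l
  proof -
    have add: "\<beta> a (l + m) = \<beta> a l + \<beta> a m" for l m using \<beta> that unfolding balanced_def by blast
    have "\<beta> a 0 = 0" by (rule additive_zero) (rule add)
    then show ?thesis using add[of "- l" l] by (simp add: eq_neg_iff_add_eq_0)
  qed
  have "u = sum_list (map (\<lambda>(a, l). \<beta> a l) ps)"
    if qs: "set qs \<subseteq> acar A \<times> UNIV" "tsum ps = tsum qs" "u = sum_list (map (\<lambda>(a, l). \<beta> a l) qs)" for u qs
  proof -
    let ?n = "map (\<lambda>(a, l). (a, - l))"
    have n: "tsum (?n qs) = - tsum qs" "sum_list (map (\<lambda>(a, l). \<beta> a l) (?n qs)) = - u"
      unfolding qs(3) using qs(1) by (induction qs) (auto simp: tens_neg \<beta>n)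
    have "sum_list (map (\<lambda>(a, l). \<beta> a l) (ps @ ?n qs)) = 0"
      using ps qs n by (intro balanced_vanishes[OF A \<beta>]) auto
    then have "sum_list (map (\<lambda>(a, l). \<beta> a l) ps) + - u = 0" using n(2) by (simp only: map_append sum_list_append)
    then show ?thesis by simp
  qed
  then show ?thesis unfolding tensor_lift_def using ps by (intro the_equality) blast+
qed

lemma tensor_lift_pure:
  assumes "module.subspace (pw (*)) (acar A)" "balanced A \<beta>" "a \<in> acar A"
  shows "tensor_lift L A \<beta> (tens L a l) = \<beta> a l"
  using tensor_lift_tsum[OF assms(1,2), of "[(a, l)]"] assms(3) by simp

lemma tensor_lift_additive:
  assumes "module.subspace (pw (*)) (acar A)" "balanced A \<beta>"
  shows "additive_on (T A) (tensor_lift L A \<beta>)"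
  unfolding additive_on_def
proof (intro ballI)
  fix s t assume "s \<in> T A" "t \<in> T A"
  then obtain ps qs where *: "set ps \<subseteq> acar A \<times> UNIV" "s = tsum ps" "set qs \<subseteq> acar A \<times> UNIV" "t = tsum qs"
    by (metis T_tsum)
  then have "s + t = tsum (ps @ qs)" by simp
  then show "tensor_lift L A \<beta> (s + t) = tensor_lift L A \<beta> s + tensor_lift L A \<beta> t"
    using * tensor_lift_tsum[OF assms, of "ps @ qs"]
    by (simp add: tensor_lift_tsum[OF assms])
qed

end

context hom_leibniz
begin

abbreviation sub :: "('k, 'i) aug_alg \<Rightarrow> bool" where
  "sub A \<equiv> module.subspace (pw (*)) (acar A)"

abbreviation lin :: "('k, 'i) aug_alg \<Rightarrow> (('i \<Rightarrow> 'k) \<Rightarrow> 'j \<Rightarrow> 'k) \<Rightarrow> bool" where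
  "lin A \<equiv> linear_on (pw (*)) (pw (*)) (acar A)"

abbreviation lfun :: "('k, 'i) aug_alg \<Rightarrow> (('i \<Rightarrow> 'k) \<Rightarrow> 'k) \<Rightarrow> bool" where
  "lfun A \<equiv> linear_on (pw (*)) (*) (acar A)"

lemma additive_on_T:
  assumes "additive_on (T A) F"
  shows "F 0 = 0" "s \<in> T A \<Longrightarrow> t \<in> T A \<Longrightarrow> F (s + t) = F s + F t"
    "s \<in> T A \<Longrightarrow> t \<in> T A \<Longrightarrow> F (s - t) = F s - F t" "s \<in> T A \<Longrightarrow> F (- s) = - F s"
    "(\<And>i. i \<in> I \<Longrightarrow> f i \<in> T A) \<Longrightarrow> F (sum f I) = (\<Sum>i\<in>I. F (f i))"
proof -
  show 0: "F 0 = 0" by (rule additive_on_zero[OF assms T_zero])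
  show 1: "F (s + t) = F s + F t" if "s \<in> T A" "t \<in> T A" for s t
    by (rule additive_onD[OF assms that])
  show 2: "F (s - t) = F s - F t" if "s \<in> T A" "t \<in> T A" for s t
    using 1[OF T_diff[OF that] that(2)] by (simp only: diff_add_cancel eq_diff_eq)
  show "F (- s) = - F s" if "s \<in> T A"
    using 2[OF T_zero that] 0 by simp
  show "F (sum f I) = (\<Sum>i\<in>I. F (f i))" if "\<And>i. i \<in> I \<Longrightarrow> f i \<in> T A"
    using that
  proof (induction I rule: infinite_finite_induct)
    case (insert i I)
    then have "sum f I \<in> T A" by (intro T_sum) auto
    with insert show ?case by (simp add: 1)
  qed (simp_all add: 0)
qed

lemma additive_on_intros:
  shows "additive_on S F \<Longrightarrow> additive_on S G \<Longrightarrow> additive_on S (\<lambda>t. F t + G t)"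
    and "additive_on S F \<Longrightarrow> additive_on S G \<Longrightarrow> additive_on S (\<lambda>t. F t - G t)"
    and "(\<And>i. i \<in> I \<Longrightarrow> additive_on S (H i)) \<Longrightarrow> additive_on S (\<lambda>t. \<Sum>i\<in>I. H i t)"
    and "additive_on S (\<lambda>t. t)" and "additive_on S (\<lambda>t. 0)"
    and "additive_on S E \<Longrightarrow> additive_on S (\<lambda>t. brk L (E t) z)"
    and "additive_on S E \<Longrightarrow> additive_on S (\<lambda>t. brk L z (E t))"
    and "additive_on S E \<Longrightarrow> additive_on S (\<lambda>t. scl L c (E t))"
    and "additive_on S E \<Longrightarrow> additive_on S (\<lambda>t. twist L (E t))"
    and "additive_on S E \<Longrightarrow> additive_on S (\<lambda>t. tens L a (E t))"
    and "additive_on S E' \<Longrightarrow> additive_on S (\<lambda>t. pw (scl L) c (E' t))"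
  by (simp_all add: additive_on_def algebra_simps brk_add twist_add LV.scale_right_distrib tens_add sum.distrib)
    (simp_all add: pw_def fun_eq_iff pointwise LV.scale_right_distrib)

lemma additive_on_comp:
  "additive_on S' F \<Longrightarrow> additive_on S G \<Longrightarrow> (\<And>t. t \<in> S \<Longrightarrow> G t \<in> S') \<Longrightarrow> additive_on S (\<lambda>t. F (G t))"
  by (simp add: additive_on_def)

definition tev :: "('k, 'i) aug_alg \<Rightarrow> (('i \<Rightarrow> 'k) \<Rightarrow> 'k) \<Rightarrow> ('i \<Rightarrow> 'l) \<Rightarrow> 'l" where
  "tev A \<xi> = tensor_lift L A (\<lambda>a l. scl L (\<xi> a) l)"

lemma teps_tev: "teps L A = tev A (aeps A)"
  by (simp add: teps_def tev_def)

context
  fixes A :: "('k, 'i) aug_alg"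
  assumes A: "sub A"
begin

lemma balanced_tev: "lfun A \<xi> \<Longrightarrow> balanced A (\<lambda>a l. scl L (\<xi> a) l)"
  by (auto simp: balanced_def linear_onD LV.scale_left_distrib LV.scale_right_distrib mult.commute)

lemma tev_pure: "lfun A \<xi> \<Longrightarrow> a \<in> acar A \<Longrightarrow> tev A \<xi> (tens L a l) = scl L (\<xi> a) l"
  unfolding tev_def by (rule tensor_lift_pure[OF A balanced_tev])

lemma tev_additive: "lfun A \<xi> \<Longrightarrow> additive_on (T A) (tev A \<xi>)"
  unfolding tev_def by (rule tensor_lift_additive[OF A balanced_tev])

lemma balanced_tmap: "lin A g \<Longrightarrow> balanced A (\<lambda>a l. tens L (g a) l)"
  by (auto simp: balanced_def linear_onD tens_add tens_scale)

lemma tmap_pure: "lin A g \<Longrightarrow> a \<in> acar A \<Longrightarrow> tmap L A g (tens L a l) = tens L (g a) l"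
  unfolding tmap_def by (rule tensor_lift_pure[OF A balanced_tmap])

lemma tmap_additive: "lin A g \<Longrightarrow> additive_on (T A) (tmap L A g)"
  unfolding tmap_def by (rule tensor_lift_additive[OF A balanced_tmap])

lemma balanced_ttwist: "balanced A (\<lambda>a l. tens L a (twist L l))"
  by (auto simp: balanced_def tens_add tens_scale twist_add twist_scl)

lemma ttwist_pure: "a \<in> acar A \<Longrightarrow> ttwist L A (tens L a l) = tens L a (twist L l)"
  unfolding ttwist_def by (rule tensor_lift_pure[OF A balanced_ttwist])

lemma ttwist_additive: "additive_on (T A) (ttwist L A)"
  unfolding ttwist_def by (rule tensor_lift_additive[OF A balanced_ttwist])

lemma ttwist_in: "t \<in> T A \<Longrightarrow> ttwist L A t \<in> T A"
proof (induction rule: T_induct)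
  case zero
  then show ?case using T_zero additive_on_T(1)[OF ttwist_additive] by metis
next
  case (pure a l t)
  have "ttwist L A (tens L a l + t) \<in> T A"
    using pure additive_on_T(2)[OF ttwist_additive T_pure[OF pure(1)] pure(2)]
    by (simp only: ttwist_pure T_add T_pure)
  then show ?case .
qed

lemma tmap_in:
  assumes g: "lin A g" "\<And>a. a \<in> acar A \<Longrightarrow> g a \<in> acar B" and t: "t \<in> T A"
  shows "tmap L A g t \<in> T B"
  using t
proof (induction rule: T_induct)
  case zero
  then show ?case using T_zero additive_on_T(1)[OF tmap_additive[OF g(1)]] by metis
next
  case (pure a l t)
  have "tmap L A g (tens L a l + t) \<in> T B"
    using pure g additive_on_T(2)[OF tmap_additive[OF g(1)] T_pure[OF pure(1)] pure(2)]
    by (simp only: tmap_pure T_add T_pure)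
  then show ?case .
qed

lemma tev_ttwist: "lfun A \<xi> \<Longrightarrow> t \<in> T A \<Longrightarrow> tev A \<xi> (ttwist L A t) = twist L (tev A \<xi> t)"
  by (rule T_ext[where F = "\<lambda>t. tev A \<xi> (ttwist L A t)"])
    (auto intro!: additive_on_intros additive_on_comp[OF tev_additive ttwist_additive] ttwist_in tev_additive
      simp: ttwist_pure tev_pure twist_scl)

lemma tmap_ttwist:
  assumes "sub B" "lin A g" "\<And>a. a \<in> acar A \<Longrightarrow> g a \<in> acar B" "t \<in> T A"
  shows "tmap L A g (ttwist L A t) = ttwist L B (tmap L A g t)"
  by (rule T_ext[OF _ _ _ assms(4), where F = "\<lambda>t. tmap L A g (ttwist L A t)"])
    (use assms in \<open>auto intro!: additive_on_comp[OF tmap_additive ttwist_additive] ttwist_in tmap_in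
      additive_on_comp[OF hom_leibniz.ttwist_additive[OF hom_leibniz_axioms] tmap_additive]
      simp: ttwist_pure tmap_pure hom_leibniz.ttwist_pure[OF hom_leibniz_axioms]\<close>)

lemma tev_tmap:
  assumes "sub B" "lin A g" "\<And>a. a \<in> acar A \<Longrightarrow> g a \<in> acar B" "lfun B \<xi>" "t \<in> T A"
  shows "tev B \<xi> (tmap L A g t) = tev A (\<lambda>a. \<xi> (g a)) t"
proof -
  have 1: "lfun A (\<lambda>a. \<xi> (g a))" by (rule linear_on_comp[OF assms(2,4)]) (use assms in auto)
  show ?thesis
    by (rule T_ext[OF _ _ _ assms(5), where F = "\<lambda>t. tev B \<xi> (tmap L A g t)"])
      (use assms 1 in \<open>auto intro!: additive_on_comp[OF hom_leibniz.tev_additive[OF hom_leibniz_axioms] tmap_additive] tmap_in tev_additive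
        simp: tmap_pure tev_pure hom_leibniz.tev_pure[OF hom_leibniz_axioms]\<close>)
qed

lemma tmap_tmap:
  assumes "sub B" "lin A g" "\<And>a. a \<in> acar A \<Longrightarrow> g a \<in> acar B" "lin B h" "t \<in> T A"
  shows "tmap L B h (tmap L A g t) = tmap L A (\<lambda>a. h (g a)) t"
proof -
  have 1: "lin A (\<lambda>a. h (g a))" by (rule linear_on_comp[OF assms(2,4)]) (use assms in auto)
  show ?thesis
    by (rule T_ext[OF _ _ _ assms(5), where F = "\<lambda>t. tmap L B h (tmap L A g t)"])
      (use assms 1 in \<open>auto intro!: additive_on_comp[OF hom_leibniz.tmap_additive[OF hom_leibniz_axioms] tmap_additive] tmap_in tmap_additive
        simp: tmap_pure hom_leibniz.tmap_pure[OF hom_leibniz_axioms]\<close>)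
qed

lemma tmap_id:
  assumes "\<And>a. a \<in> acar A \<Longrightarrow> g a = a" "t \<in> T A"
  shows "tmap L A g t = t"
proof -
  have 1: "lin A g" by (rule linear_onI) (use assms A in \<open>auto simp: K.subspace_add K.subspace_scale\<close>)
  show ?thesis
    by (rule T_ext[OF _ _ _ assms(2), where F = "tmap L A g" and G = "\<lambda>t. t"])
      (use assms 1 in \<open>auto intro!: tmap_additive additive_on_intros simp: tmap_pure\<close>)
qed

lemma tev_cong:
  assumes "lfun A \<xi>" "\<And>a. a \<in> acar A \<Longrightarrow> \<xi> a = \<zeta> a" "t \<in> T A"
  shows "tev A \<xi> t = tev A \<zeta> t"
proof -
  have 1: "lfun A \<zeta>" using linear_on_cong[of "acar A" \<xi> \<zeta> "pw (*)" "(*)"] assms(1,2) A vector_space_pw_times by simp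
  show ?thesis
    by (rule T_ext[OF _ _ _ assms(3), where F = "tev A \<xi>"]) (use assms 1 in \<open>auto intro!: tev_additive simp: tev_pure\<close>)
qed

lemma tev_add:
  assumes "lfun A \<xi>" "lfun A \<zeta>" "t \<in> T A"
  shows "tev A (\<lambda>a. \<xi> a + \<zeta> a) t = tev A \<xi> t + tev A \<zeta> t"
proof -
  have 1: "lfun A (\<lambda>a. \<xi> a + \<zeta> a)" using assms by (auto simp: linear_on_def algebra_simps)
  show ?thesis
    by (rule T_ext[OF _ _ _ assms(3), where F = "tev A (\<lambda>a. \<xi> a + \<zeta> a)"])
      (use assms 1 in \<open>auto intro!: tev_additive additive_on_intros simp: tev_pure LV.scale_left_distrib\<close>)
qed

lemma tev_scale:
  assumes "lfun A \<xi>" "t \<in> T A"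
  shows "tev A (\<lambda>a. c * \<xi> a) t = scl L c (tev A \<xi> t)"
proof -
  have 1: "lfun A (\<lambda>a. c * \<xi> a)" using assms by (auto simp: linear_on_def algebra_simps)
  show ?thesis
    by (rule T_ext[OF _ _ _ assms(2), where F = "tev A (\<lambda>a. c * \<xi> a)"])
      (use assms 1 in \<open>auto intro!: tev_additive additive_on_intros simp: tev_pure\<close>)
qed

text \<open>Components of elements of \<open>A \<otimes> L\<close> are thus values of functionals; in particular, the obstruction at a Harrison class is the value
  of a twisted derivation.\<close>

lemma tev_coordinate:
  assumes "t \<in> T A"
  shows "tev A (\<lambda>a. a j) t = t j"
proof -
  have 1: "lfun A (\<lambda>a. a j)" by (auto simp: linear_on_def pw_def pointwise)
  show ?thesis
    by (rule T_ext[OF _ _ _ assms, where F = "tev A (\<lambda>a. a j)" and G = "\<lambda>t. t j"])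
      (simp_all add: tev_additive tev_pure 1, simp_all add: additive_on_def pointwise tens_def)
qed

end

context
  fixes A :: "('k, 'i) aug_alg"
  assumes A: "aug_algebra A"
begin

lemma sub_alg: "sub A" using A by (rule aug_algebraD(1))

lemma balanced_act: "a \<in> acar A \<Longrightarrow> balanced A (\<lambda>b l. tens L (amul A a b) l)"
  using aug_algebra_mul_add[OF A] by (auto simp: balanced_def tens_add tens_scale)

lemma act_pure: "a \<in> acar A \<Longrightarrow> b \<in> acar A \<Longrightarrow> act L A a (tens L b l) = tens L (amul A a b) l"
  unfolding act_def by (rule tensor_lift_pure[OF sub_alg balanced_act])

lemma act_additive: "a \<in> acar A \<Longrightarrow> additive_on (T A) (act L A a)"
  unfolding act_def by (rule tensor_lift_additive[OF sub_alg balanced_act])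

lemma act_tmap: "a \<in> acar A \<Longrightarrow> act L A a = tmap L A (amul A a)"
  by (simp add: act_def tmap_def)

lemma act_in: "a \<in> acar A \<Longrightarrow> t \<in> T A \<Longrightarrow> act L A a t \<in> T A"
  unfolding act_tmap by (rule tmap_in[OF sub_alg]) (use aug_algebraD[OF A] in auto)

lemma act_unit: "a \<in> acar A \<Longrightarrow> act L A a (unit_tens L A l) = tens L a l"
  using aug_algebraD[OF A] by (simp add: act_pure)

lemma act_one: "t \<in> T A \<Longrightarrow> act L A (aone A) t = t"
  using aug_algebraD[OF A] by (simp add: act_tmap tmap_id[OF sub_alg])

lemma act_act: "a \<in> acar A \<Longrightarrow> b \<in> acar A \<Longrightarrow> t \<in> T A \<Longrightarrow> act L A a (act L A b t) = act L A (amul A a b) t"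
  by (rule T_ext[where F = "\<lambda>t. act L A a (act L A b t)"])
    (use aug_algebraD[OF A] in \<open>auto intro!: act_additive additive_on_comp[OF act_additive act_additive] act_in simp: act_pure\<close>)

lemma act_add: "a \<in> acar A \<Longrightarrow> b \<in> acar A \<Longrightarrow> t \<in> T A \<Longrightarrow> act L A (a + b) t = act L A a t + act L A b t"
proof -
  assume *: "a \<in> acar A" "b \<in> acar A" "t \<in> T A"
  then have "a + b \<in> acar A" using sub_alg by (simp add: K.subspace_add)
  then show ?thesis
    by (intro T_ext[OF _ _ _ *(3), where F = "\<lambda>t. act L A (a + b) t"])
      (use * in \<open>auto intro!: act_additive additive_on_intros simp: act_pure tens_add aug_algebra_mul_add[OF A]\<close>)
qed

lemma act_scale: "a \<in> acar A \<Longrightarrow> t \<in> T A \<Longrightarrow> act L A (pw (*) c a) t = pw (scl L) c (act L A a t)"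
proof -
  assume *: "a \<in> acar A" "t \<in> T A"
  then have "pw (*) c a \<in> acar A" using sub_alg by (simp add: K.subspace_scale)
  then show ?thesis
    by (intro T_ext[OF _ _ _ *(2), where F = "\<lambda>t. act L A (pw (*) c a) t"])
      (use * in \<open>auto intro!: act_additive additive_on_intros simp: act_pure tens_scale tens_scale' aug_algebra_mul_add[OF A]\<close>)
qed

lemma ttwist_act: "a \<in> acar A \<Longrightarrow> t \<in> T A \<Longrightarrow> ttwist L A (act L A a t) = act L A a (ttwist L A t)"
  by (rule T_ext[where F = "\<lambda>t. ttwist L A (act L A a t)"])
    (use aug_algebraD[OF A] in \<open>auto intro!: additive_on_comp[OF act_additive ttwist_additive[OF sub_alg]]
      additive_on_comp[OF ttwist_additive[OF sub_alg] act_additive] ttwist_in[OF sub_alg] act_in simp: act_pure ttwist_pure[OF sub_alg]\<close>)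

lemma teps_pure: "a \<in> acar A \<Longrightarrow> teps L A (tens L a l) = scl L (aeps A a) l"
  unfolding teps_tev by (rule tev_pure[OF sub_alg aug_algebraD(9)[OF A]])

lemma teps_unit: "teps L A (unit_tens L A l) = l"
  using aug_algebraD[OF A] by (simp add: teps_pure)

lemma teps_additive: "additive_on (T A) (teps L A)"
  unfolding teps_tev by (rule tev_additive[OF sub_alg aug_algebraD(9)[OF A]])

lemma teps_act: "a \<in> acar A \<Longrightarrow> t \<in> T A \<Longrightarrow> teps L A (act L A a t) = scl L (aeps A a) (teps L A t)"
  by (rule T_ext[where F = "\<lambda>t. teps L A (act L A a t)"])
    (use aug_algebraD[OF A] in \<open>auto intro!: additive_on_comp[OF teps_additive act_additive]
      additive_on_intros teps_additive act_in simp: act_pure teps_pure\<close>)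

lemma teps_ttwist: "t \<in> T A \<Longrightarrow> teps L A (ttwist L A t) = twist L (teps L A t)"
  unfolding teps_tev by (rule tev_ttwist[OF sub_alg aug_algebraD(9)[OF A]])

lemma unit_in: "unit_tens L A l \<in> T A"
  using aug_algebraD[OF A] by (simp add: T_pure)

lemma ttwist_unit: "ttwist L A (unit_tens L A l) = unit_tens L A (twist L l)"
  using aug_algebraD[OF A] by (simp add: ttwist_pure[OF sub_alg])

end

lemma tmap_act:
  assumes A: "aug_algebra A" and B: "aug_algebra B" and g: "aug_hom A B g" and a: "a \<in> acar A" and t: "t \<in> T A"
  shows "tmap L A g (act L A a t) = act L B (g a) (tmap L A g t)"
  by (rule T_ext[OF _ _ _ t, where F = "\<lambda>t. tmap L A g (act L A a t)"])
    (use aug_algebraD(3)[OF A] aug_homD(1-3)[OF g] A B a sub_alg[OF A] sub_alg[OF B] in \<open>auto intro!: additive_on_comp[OF tmap_additive act_additive]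
      additive_on_comp[OF act_additive tmap_additive] act_in tmap_in simp: act_pure tmap_pure\<close>)

lemma teps_tmap:
  assumes A: "aug_algebra A" and B: "aug_algebra B" and g: "aug_hom A B g" and t: "t \<in> T A"
  shows "teps L B (tmap L A g t) = teps L A t"
proof -
  have "teps L B (tmap L A g t) = tev A (\<lambda>a. aeps B (g a)) t"
    unfolding teps_tev using aug_homD[OF g] aug_algebraD[OF B] sub_alg[OF A] sub_alg[OF B] t by (intro tev_tmap) auto
  also have "\<dots> = teps L A t"
    unfolding teps_tev using aug_homD[OF g] aug_algebraD[OF A] sub_alg[OF A] t by (intro tev_cong[symmetric]) auto
  finally show ?thesis .
qed

lemma tmap_unit: "aug_algebra A \<Longrightarrow> aug_hom A B g \<Longrightarrow> tmap L A g (unit_tens L A l) = unit_tens L B l"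
  using aug_homD(2,4)[of A B g] aug_algebraD(1,2)[of A] by (simp add: tmap_pure)

end

section \<open>Brackets over an algebra\<close>

context hom_leibniz
begin

text \<open>The part of the structure of a deformation that does not involve the Leibniz identity.\<close>

definition tbracket :: "('k, 'i) aug_alg \<Rightarrow> (('i \<Rightarrow> 'l) \<Rightarrow> ('i \<Rightarrow> 'l) \<Rightarrow> 'i \<Rightarrow> 'l) \<Rightarrow> bool" where
  "tbracket A br \<longleftrightarrow>
     (\<forall>s\<in>T A. \<forall>t\<in>T A. br s t \<in> T A) \<and> bilinear_on (acar A) (act L A) (T A) br \<and>
     (\<forall>s\<in>T A. \<forall>t\<in>T A. ttwist L A (br s t) = br (ttwist L A s) (ttwist L A t))"

definition bilinear_cochain :: "('k \<Rightarrow> 'v \<Rightarrow> 'v) \<Rightarrow> ('l \<Rightarrow> 'l \<Rightarrow> 'v::ab_group_add) \<Rightarrow> bool" where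
  "bilinear_cochain s \<psi> \<longleftrightarrow>
     (\<forall>x y z. \<psi> (x + y) z = \<psi> x z + \<psi> y z \<and> \<psi> z (x + y) = \<psi> z x + \<psi> z y) \<and>
     (\<forall>c x y. \<psi> (scl L c x) y = s c (\<psi> x y) \<and> \<psi> x (scl L c y) = s c (\<psi> x y))"

lemma is_bracket_lift_iff:
  "is_bracket_lift L A B p lam br \<longleftrightarrow>
     tbracket B br \<and> (\<forall>s\<in>T B. \<forall>t\<in>T B. tmap L B p (br s t) = lam (tmap L B p s) (tmap L B p t))"
  by (auto simp: is_bracket_lift_def tbracket_def Let_def)

lemma tbracket_in: "tbracket A br \<Longrightarrow> s \<in> T A \<Longrightarrow> t \<in> T A \<Longrightarrow> br s t \<in> T A"
  by (simp add: tbracket_def)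

lemma tbracket_ttwist: "tbracket A br \<Longrightarrow> s \<in> T A \<Longrightarrow> t \<in> T A \<Longrightarrow>
    ttwist L A (br s t) = br (ttwist L A s) (ttwist L A t)"
  by (simp add: tbracket_def)

lemma tbracket_additive:
  "tbracket A br \<Longrightarrow> t \<in> T A \<Longrightarrow> additive_on (T A) (\<lambda>s. br s t)"
  "tbracket A br \<Longrightarrow> t \<in> T A \<Longrightarrow> additive_on (T A) (br t)"
  by (simp_all add: tbracket_def additive_on_def bilinear_on_def)

lemma tbracket_act:
  "tbracket A br \<Longrightarrow> a \<in> acar A \<Longrightarrow> s \<in> T A \<Longrightarrow> t \<in> T A \<Longrightarrow> br (act L A a s) t = act L A a (br s t)"
  "tbracket A br \<Longrightarrow> a \<in> acar A \<Longrightarrow> s \<in> T A \<Longrightarrow> t \<in> T A \<Longrightarrow> br s (act L A a t) = act L A a (br s t)"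
  by (simp_all add: tbracket_def bilinear_on_def)

lemma act_commute: "aug_algebra A \<Longrightarrow> a \<in> acar A \<Longrightarrow> b \<in> acar A \<Longrightarrow> t \<in> T A \<Longrightarrow>
    act L A a (act L A b t) = act L A b (act L A a t)"
  by (simp add: act_act aug_algebraD(5)[of A a b])

lemma scale_act:
  assumes A: "aug_algebra A" and t: "t \<in> T A"
  shows "pw (scl L) c t = act L A (pw (*) c (aone A)) t"
  using act_scale[OF A aug_algebraD(2)[OF A] t, of c] act_one[OF A t] by simp

lemma unit_scale: "unit_tens L A (scl L c x) = pw (scl L) c (unit_tens L A x)"
  by (simp add: tens_scale')

lemma tbracket_pure:
  assumes A: "aug_algebra A" and br: "tbracket A br" and "a \<in> acar A" "b \<in> acar A"
  shows "br (tens L a l) (tens L b m) = act L A (amul A a b) (br (unit_tens L A l) (unit_tens L A m))"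
proof -
  have "br (tens L a l) (tens L b m) = br (act L A a (unit_tens L A l)) (act L A b (unit_tens L A m))"
    using assms by (simp add: act_unit)
  also have "\<dots> = act L A (amul A a b) (br (unit_tens L A l) (unit_tens L A m))"
    using assms by (simp add: tbracket_act[OF br] unit_in act_in tbracket_in[OF br] act_act aug_algebraD(5)[OF A, of b a])
  finally show ?thesis .
qed

lemma tbracket_cochain:
  assumes A: "aug_algebra A" and br: "tbracket A br"
  shows "bilinear_cochain (pw (scl L)) (\<lambda>x y. br (unit_tens L A x) (unit_tens L A y))"
proof -
  have c: "pw (*) c (aone A) \<in> acar A" for c
    using aug_algebraD(1,2)[OF A] by (rule K.subspace_scale)
  show ?thesis unfolding bilinear_cochain_def
    by (simp add: tens_add additive_on_T(2)[OF tbracket_additive(1)[OF br]] additive_on_T(2)[OF tbracket_additive(2)[OF br]]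
        unit_in[OF A] unit_scale scale_act[OF A] c tbracket_act[OF br] tbracket_in[OF br])
qed

lemma tbracket_extend:
  assumes A: "aug_algebra A" and \<psi>: "bilinear_cochain (pw (scl L)) \<psi>"
    and \<psi>T: "\<And>x y. \<psi> x y \<in> T A" and tw: "\<And>x y. ttwist L A (\<psi> x y) = \<psi> (twist L x) (twist L y)"
  obtains br where "tbracket A br" "\<And>x y. br (unit_tens L A x) (unit_tens L A y) = \<psi> x y"
proof -
  note S = sub_alg[OF A]
  have mul: "amul A a b \<in> acar A" if "a \<in> acar A" "b \<in> acar A" for a b
    using aug_algebraD(3)[OF A] that by simp
  have plus: "a + b \<in> acar A" and sc: "pw (*) c a \<in> acar A" if "a \<in> acar A" "b \<in> acar A" for a b c
    using K.subspace_add[OF S] K.subspace_scale[OF S] that by auto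
  define G where "G a l = tensor_lift L A (\<lambda>b m. act L A (amul A a b) (\<psi> l m))" for a l
  have bal1: "balanced A (\<lambda>b m. act L A (amul A a b) (\<psi> l m))" if a: "a \<in> acar A" for a l
    using a \<psi> unfolding balanced_def bilinear_cochain_def
    by (simp add: aug_algebra_mul_add[OF A] act_add[OF A] mul act_scale[OF A] \<psi>T additive_on_T(2)[OF act_additive[OF A]])
      (simp add: scale_act[OF A] \<psi>T act_in[OF A] act_commute[OF A] mul sc aug_algebraD(2)[OF A])
  have Gp: "G a l (tens L b m) = act L A (amul A a b) (\<psi> l m)" if "a \<in> acar A" "b \<in> acar A" for a b l m
    unfolding G_def by (rule tensor_lift_pure[OF S bal1]) (use that in auto)
  have Ga: "additive_on (T A) (G a l)" if "a \<in> acar A" for a l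
    unfolding G_def by (rule tensor_lift_additive[OF S bal1]) (use that in auto)
  have GT: "G a l t \<in> T A" if "a \<in> acar A" "t \<in> T A" for a l t
    using that(2)
  proof (induction rule: T_induct)
    case zero
    show ?case using additive_on_T(1)[OF Ga[OF that(1)]] T_zero by metis
  next
    case (pure b m t)
    have "G a l (tens L b m + t) \<in> T A"
      using pure that mul additive_on_T(2)[OF Ga[OF that(1)] T_pure[OF pure(1)] pure(2)]
      by (simp only: Gp T_add act_in[OF A] \<psi>T)
    then show ?case .
  qed
  have bal2: "balanced A (\<lambda>a l. G a l t)" if t: "t \<in> T A" for t
    unfolding balanced_def
  proof (intro conjI ballI allI)
    show "G (a + b) l t = G a l t + G b l t" if "a \<in> acar A" "b \<in> acar A" for a b l
      by (rule T_ext[OF _ _ _ t, where F = "G (a + b) l"])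
        (use that in \<open>simp_all add: Ga plus additive_on_intros Gp aug_algebra_mul_add[OF A] act_add[OF A] mul \<psi>T\<close>)
    show "G a (l + m) t = G a l t + G a m t" if "a \<in> acar A" for a l m
      by (rule T_ext[OF _ _ _ t, where F = "G a (l + m)"])
        (use that \<psi> in \<open>simp_all add: Ga additive_on_intros Gp mul \<psi>T bilinear_cochain_def additive_on_T(2)[OF act_additive[OF A]]\<close>)
    show "G (pw (*) c a) l t = G a (scl L c l) t" if "a \<in> acar A" for a c l
      by (rule T_ext[OF _ _ _ t, where F = "G (pw (*) c a) l"])
        (use that \<psi> in \<open>simp_all add: Ga sc Gp mul \<psi>T bilinear_cochain_def aug_algebra_mul_add[OF A] act_scale[OF A],
          simp_all add: scale_act[OF A] \<psi>T act_in[OF A] act_commute[OF A] mul sc aug_algebraD(2)[OF A]\<close>)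
  qed
  define br where "br s t = tensor_lift L A (\<lambda>a l. G a l t) s" for s t
  have brp: "br (tens L a l) t = G a l t" if "a \<in> acar A" "t \<in> T A" for a l t
    unfolding br_def by (rule tensor_lift_pure[OF S bal2]) (use that in auto)
  have bra: "additive_on (T A) (\<lambda>s. br s t)" if "t \<in> T A" for t
    unfolding br_def by (rule tensor_lift_additive[OF S bal2]) (use that in auto)
  have brT: "br s t \<in> T A" if "t \<in> T A" "s \<in> T A" for s t
    using that(2)
  proof (induction rule: T_induct)
    case zero
    show ?case using additive_on_T(1)[OF bra[OF that(1)]] T_zero by metis
  next
    case (pure b m s)
    have "br (tens L b m + s) t \<in> T A"
      using pure that additive_on_T(2)[OF bra[OF that(1)] T_pure[OF pure(1)] pure(2)]
      by (simp only: brp T_add GT)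
    then show ?case .
  qed
  have bra2: "additive_on (T A) (br s)" if s: "s \<in> T A" for s
    unfolding additive_on_def
  proof (intro ballI)
    fix t u assume tu: "t \<in> T A" "u \<in> T A"
    show "br s (t + u) = br s t + br s u"
      by (rule T_ext[OF _ _ _ s, where F = "\<lambda>s. br s (t + u)"])
        (use tu in \<open>simp_all add: bra T_add additive_on_intros brp additive_on_T(2)[OF Ga]\<close>)
  qed
  have unit: "br (unit_tens L A x) (unit_tens L A y) = \<psi> x y" for x y
    using aug_algebraD(2,7)[OF A] by (simp add: brp unit_in[OF A] Gp act_one[OF A] \<psi>T)
  have Gact2: "G a l (act L A c t) = act L A c (G a l t)" if "a \<in> acar A" "c \<in> acar A" "t \<in> T A" for a l c t
  proof (rule T_ext[OF _ _ _ that(3), where F = "\<lambda>t. G a l (act L A c t)"])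
    show "additive_on (T A) (\<lambda>t. G a l (act L A c t))" "additive_on (T A) (\<lambda>t. act L A c (G a l t))"
      using that by (simp_all add: additive_on_comp[OF Ga act_additive[OF A]] additive_on_comp[OF act_additive[OF A] Ga]
          act_in[OF A] GT)
    fix b m assume b: "b \<in> acar A"
    have "amul A a (amul A c b) = amul A (amul A c a) b"
      using that b by (simp add: aug_algebraD(6)[OF A, symmetric] aug_algebraD(5)[OF A, of a c])
    also have "\<dots> = amul A c (amul A a b)" using that b by (simp add: aug_algebraD(6)[OF A])
    finally show "G a l (act L A c (tens L b m)) = act L A c (G a l (tens L b m))"
      using that b by (simp add: act_pure[OF A] Gp mul act_act[OF A] \<psi>T)
  qed
  have act1: "br (act L A c s) t = act L A c (br s t)" if "c \<in> acar A" "s \<in> T A" "t \<in> T A" for c s t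
  proof (rule T_ext[OF _ _ _ that(2), where F = "\<lambda>s. br (act L A c s) t"])
    show "additive_on (T A) (\<lambda>s. br (act L A c s) t)" "additive_on (T A) (\<lambda>s. act L A c (br s t))"
      using that by (simp_all add: additive_on_comp[OF bra act_additive[OF A]] additive_on_comp[OF act_additive[OF A] bra]
          act_in[OF A] brT)
    fix a l assume a: "a \<in> acar A"
    have "G (amul A c a) l t = act L A c (G a l t)"
      by (rule T_ext[OF _ _ _ that(3), where F = "G (amul A c a) l"])
        (use that a in \<open>simp_all add: Ga mul additive_on_comp[OF act_additive[OF A] Ga] GT Gp act_act[OF A] \<psi>T aug_algebraD(6)[OF A]\<close>)
    then show "br (act L A c (tens L a l)) t = act L A c (br (tens L a l) t)"
      using that a by (simp add: act_pure[OF A] brp mul)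
  qed
  have act2: "br s (act L A c t) = act L A c (br s t)" if "c \<in> acar A" "s \<in> T A" "t \<in> T A" for c s t
    by (rule T_ext[OF _ _ _ that(2), where F = "\<lambda>s. br s (act L A c t)"])
      (use that in \<open>simp_all add: additive_on_comp[OF act_additive[OF A] bra] bra act_in[OF A] brT brp Gact2\<close>)
  have Gtw: "ttwist L A (G a l t) = G a (twist L l) (ttwist L A t)" if "a \<in> acar A" "t \<in> T A" for a l t
    by (rule T_ext[OF _ _ _ that(2), where F = "\<lambda>t. ttwist L A (G a l t)"])
      (use that in \<open>simp_all add: additive_on_comp[OF Ga ttwist_additive[OF S]] additive_on_comp[OF ttwist_additive[OF S] Ga]
        ttwist_in[OF S] GT ttwist_pure[OF S] Gp mul ttwist_act[OF A] \<psi>T tw\<close>)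
  have twb: "ttwist L A (br s t) = br (ttwist L A s) (ttwist L A t)" if "s \<in> T A" "t \<in> T A" for s t
    by (rule T_ext[OF _ _ _ that(1), where F = "\<lambda>s. ttwist L A (br s t)"])
      (use that in \<open>simp_all add: additive_on_comp[OF bra ttwist_additive[OF S]] additive_on_comp[OF ttwist_additive[OF S] bra]
        ttwist_in[OF S] brT ttwist_pure[OF S] brp Gtw\<close>)
  have "tbracket A br"
    unfolding tbracket_def bilinear_on_def
    by (simp add: brT act1 act2 twb additive_on_T(2)[OF bra] additive_on_T(2)[OF bra2])
  then show thesis using unit that by blast
qed

text \<open>The Leibniz identity is trilinear over the algebra, so it suffices to check it on \<open>1 \<otimes> L\<close>.\<close>

lemma leibniz_from_units:
  assumes A: "aug_algebra A" and br: "tbracket A br"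
    and zero: "\<And>x y z. obstruction_cochain L A br x y z = 0"
    and stu: "s \<in> T A" "t \<in> T A" "u \<in> T A"
  shows "br (ttwist L A s) (br t u) = br (br s t) (ttwist L A u) - br (br s u) (ttwist L A t)"
proof -
  note S = sub_alg[OF A]
  note add = tbracket_additive[OF br]
  note [simp] = tbracket_in[OF br] ttwist_in[OF S] unit_in[OF A] act_in[OF A] T_pure
  define K where "K s t u = br (ttwist L A s) (br t u) - br (br s t) (ttwist L A u) + br (br s u) (ttwist L A t)" for s t u
  have K1: "additive_on (T A) (\<lambda>s. K s t u)" if "t \<in> T A" "u \<in> T A" for t u
    unfolding K_def using that
    by (auto intro!: additive_on_intros additive_on_comp[OF add(1) ttwist_additive[OF S]] additive_on_comp[OF add(1) add(1)])
  have K2: "additive_on (T A) (\<lambda>t. K s t u)" if "s \<in> T A" "u \<in> T A" for s u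
    unfolding K_def using that
    by (auto intro!: additive_on_intros additive_on_comp[OF add(2) ttwist_additive[OF S]]
        additive_on_comp[OF add(2) add(1)] additive_on_comp[OF add(1) add(2)])
  have K3: "additive_on (T A) (K s t)" if "s \<in> T A" "t \<in> T A" for s t
    unfolding K_def using that
    by (auto intro!: additive_on_intros additive_on_comp[OF add(2) ttwist_additive[OF S]]
        additive_on_comp[OF add(2) add(2)] additive_on_comp[OF add(1) add(2)])
  have zero': "br (unit_tens L A (twist L x)) (br (unit_tens L A y) (unit_tens L A z)) =
     br (br (unit_tens L A x) (unit_tens L A y)) (unit_tens L A (twist L z))
     - br (br (unit_tens L A x) (unit_tens L A z)) (unit_tens L A (twist L y))" for x y z
    using zero[of x y z] unfolding obstruction_cochain_def Let_def by (simp add: algebra_simps)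
  have pure: "K (tens L a x) (tens L b y) (tens L c z) = 0"
    if abc: "a \<in> acar A" "b \<in> acar A" "c \<in> acar A" for a b c x y z
  proof -
    let ?X = "act L A a (unit_tens L A x)" and ?Y = "act L A b (unit_tens L A y)" and ?Z = "act L A c (unit_tens L A z)"
    let ?m = "\<lambda>t. act L A a (act L A b (act L A c t))"
    have 1: "br (ttwist L A ?X) (br ?Y ?Z) = ?m (br (unit_tens L A (twist L x)) (br (unit_tens L A y) (unit_tens L A z)))"
      using abc by (simp add: tbracket_act[OF br] ttwist_act[OF A] ttwist_unit[OF A] act_commute[OF A])
    have 2: "br (br ?X ?Y) (ttwist L A ?Z) = ?m (br (br (unit_tens L A x) (unit_tens L A y)) (unit_tens L A (twist L z)))"
      using abc by (simp add: tbracket_act[OF br] ttwist_act[OF A] ttwist_unit[OF A] act_commute[OF A])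
    have 3: "br (br ?X ?Z) (ttwist L A ?Y) = ?m (br (br (unit_tens L A x) (unit_tens L A z)) (unit_tens L A (twist L y)))"
      using abc by (simp add: tbracket_act[OF br] ttwist_act[OF A] ttwist_unit[OF A] act_commute[OF A])
    have "K ?X ?Y ?Z = 0"
      unfolding K_def 1 2 3 zero' using abc by (simp add: additive_on_T(3)[OF act_additive[OF A]])
    then show ?thesis using abc by (simp add: act_unit[OF A])
  qed
  have "K s t u = 0"
    by (rule T_ext[OF K1[OF stu(2,3)] additive_on_intros(5) _ stu(1)],
        rule T_ext[OF K2[OF _ stu(3)] additive_on_intros(5) _ stu(2)], simp,
        rule T_ext[OF K3 additive_on_intros(5) _ stu(3)]) (simp_all add: pure)
  then show ?thesis by (simp add: K_def algebra_simps)
qed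

lemma deformationI:
  assumes "aug_algebra A" "tbracket A br" "\<And>x y z. obstruction_cochain L A br x y z = 0"
    "\<And>x y. teps L A (br (unit_tens L A x) (unit_tens L A y)) = brk L x y"
  shows "deformation L A br"
  using assms leibniz_from_units[OF assms(1-3)] ttwist_in[OF sub_alg[OF assms(1)]]
  unfolding deformation_def hom_leibniz_on_def tbracket_def by blast

lemma deformationD:
  assumes "deformation L A br"
  shows "aug_algebra A" "tbracket A br" "obstruction_cochain L A br x y z = 0"
    "teps L A (br (unit_tens L A x) (unit_tens L A y)) = brk L x y"
proof -
  show A: "aug_algebra A" and "tbracket A br" "teps L A (br (unit_tens L A x) (unit_tens L A y)) = brk L x y"
    using assms unfolding deformation_def hom_leibniz_on_def tbracket_def by blast+
  have "br (ttwist L A (unit_tens L A x)) (br (unit_tens L A y) (unit_tens L A z)) =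
      br (br (unit_tens L A x) (unit_tens L A y)) (ttwist L A (unit_tens L A z))
    - br (br (unit_tens L A x) (unit_tens L A z)) (ttwist L A (unit_tens L A y))"
    using assms unit_in[OF A] unfolding deformation_def hom_leibniz_on_def by blast
  then show "obstruction_cochain L A br x y z = 0"
    by (simp add: obstruction_cochain_def Let_def ttwist_unit[OF A])
qed

lemma teps_bracket:
  assumes A: "aug_algebra A" and br: "tbracket A br"
    and unit: "\<And>x y. teps L A (br (unit_tens L A x) (unit_tens L A y)) = brk L x y"
    and st: "s \<in> T A" "t \<in> T A"
  shows "teps L A (br s t) = brk L (teps L A s) (teps L A t)"
proof -
  note add = tbracket_additive[OF br]
  have pure: "teps L A (br (tens L a x) (tens L b y)) = brk L (teps L A (tens L a x)) (teps L A (tens L b y))"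
    if "a \<in> acar A" "b \<in> acar A" for a b x y
    using that by (simp add: tbracket_pure[OF A br] teps_act[OF A] aug_algebraD(3,10)[OF A] tbracket_in[OF br] unit_in[OF A]
        unit teps_pure[OF A] brk_scl)
  have *: "teps L A (br (tens L a x) t) = brk L (teps L A (tens L a x)) (teps L A t)" if a: "a \<in> acar A" for a x
  proof (rule T_ext[OF _ _ _ st(2), where F = "\<lambda>t. teps L A (br (tens L a x) t)"])
    show "additive_on (T A) (\<lambda>t. teps L A (br (tens L a x) t))"
      using a by (intro additive_on_comp[OF teps_additive[OF A] add(2)]) (auto intro: tbracket_in[OF br] T_pure)
    show "additive_on (T A) (\<lambda>t. brk L (teps L A (tens L a x)) (teps L A t))"
      by (intro additive_on_intros teps_additive[OF A])
  qed (use a pure in blast)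
  show ?thesis
  proof (rule T_ext[OF _ _ _ st(1), where F = "\<lambda>s. teps L A (br s t)"])
    show "additive_on (T A) (\<lambda>s. teps L A (br s t))"
      using st by (intro additive_on_comp[OF teps_additive[OF A] add(1)]) (auto intro: tbracket_in[OF br] T_pure)
    show "additive_on (T A) (\<lambda>s. brk L (teps L A s) (teps L A t))"
      by (intro additive_on_intros teps_additive[OF A])
  qed (use * in blast)
qed

context
  fixes A :: "('k, 'i) aug_alg" and B :: "('k, 'j) aug_alg" and \<phi>
  assumes A: "aug_algebra A" and B: "aug_algebra B" and \<phi>: "aug_hom A B \<phi>"
begin

lemma tmap_hom_in: "t \<in> T A \<Longrightarrow> tmap L A \<phi> t \<in> T B"
  by (rule tmap_in[OF sub_alg[OF A] aug_homD(2,1)[OF \<phi>]])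

lemma tmap_hom_additive: "additive_on (T A) (tmap L A \<phi>)"
  by (rule tmap_additive[OF sub_alg[OF A] aug_homD(2)[OF \<phi>]])

lemma tmap_hom_ttwist: "t \<in> T A \<Longrightarrow> tmap L A \<phi> (ttwist L A t) = ttwist L B (tmap L A \<phi> t)"
  by (rule tmap_ttwist[OF sub_alg[OF A] sub_alg[OF B] aug_homD(2,1)[OF \<phi>]])

lemma tbracket_pushout:
  assumes br: "tbracket A br"
  obtains br' where "tbracket B br'"
    "\<And>x y. br' (unit_tens L B x) (unit_tens L B y) = tmap L A \<phi> (br (unit_tens L A x) (unit_tens L A y))"
proof -
  have c: "pw (*) c (aone A) \<in> acar A" for c
    using aug_algebraD(1,2)[OF A] by (rule K.subspace_scale)
  have sc: "tmap L A \<phi> (pw (scl L) c t) = pw (scl L) c (tmap L A \<phi> t)" if "t \<in> T A" for c t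
    using that c linear_onD(2)[OF aug_homD(2)[OF \<phi>] aug_algebraD(2)[OF A]] aug_homD(4)[OF \<phi>]
    by (simp add: scale_act[OF A] scale_act[OF B] tmap_hom_in tmap_act[OF A B \<phi>])
  show thesis
  proof (rule tbracket_extend[OF B, of "\<lambda>x y. tmap L A \<phi> (br (unit_tens L A x) (unit_tens L A y))"])
    show "bilinear_cochain (pw (scl L)) (\<lambda>x y. tmap L A \<phi> (br (unit_tens L A x) (unit_tens L A y)))"
      using tbracket_cochain[OF A br] unfolding bilinear_cochain_def
      by (simp add: sc tbracket_in[OF br] unit_in[OF A] additive_on_T(2)[OF tmap_hom_additive])
    show "tmap L A \<phi> (br (unit_tens L A x) (unit_tens L A y)) \<in> T B" for x y
      by (simp add: tmap_hom_in tbracket_in[OF br] unit_in[OF A])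
    show "ttwist L B (tmap L A \<phi> (br (unit_tens L A x) (unit_tens L A y)))
        = tmap L A \<phi> (br (unit_tens L A (twist L x)) (unit_tens L A (twist L y)))" for x y
      by (simp add: tmap_hom_ttwist[symmetric] tbracket_in[OF br] unit_in[OF A] tbracket_ttwist[OF br] ttwist_unit[OF A])
  qed (use that in blast)
qed

lemma tbracket_tmap:
  assumes br: "tbracket A br" and br': "tbracket B br'"
    and unit: "\<And>x y. br' (unit_tens L B x) (unit_tens L B y) = tmap L A \<phi> (br (unit_tens L A x) (unit_tens L A y))"
    and st: "s \<in> T A" "t \<in> T A"
  shows "tmap L A \<phi> (br s t) = br' (tmap L A \<phi> s) (tmap L A \<phi> t)"
proof -
  note [simp] = tbracket_in[OF br] tbracket_in[OF br'] tmap_hom_in T_pure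
  have pure: "tmap L A \<phi> (br (tens L a x) (tens L b y)) = br' (tmap L A \<phi> (tens L a x)) (tmap L A \<phi> (tens L b y))"
    if "a \<in> acar A" "b \<in> acar A" for a b x y
    using that by (simp add: tbracket_pure[OF A br] tbracket_pure[OF B br'] tmap_pure[OF sub_alg[OF A] aug_homD(2)[OF \<phi>]]
        tmap_act[OF A B \<phi>] unit aug_homD(1,3)[OF \<phi>] aug_algebraD(3)[OF A] unit_in[OF A])
  have *: "tmap L A \<phi> (br (tens L a x) t) = br' (tmap L A \<phi> (tens L a x)) (tmap L A \<phi> t)" if a: "a \<in> acar A" for a x
    by (rule T_ext[OF _ _ _ st(2), where F = "\<lambda>t. tmap L A \<phi> (br (tens L a x) t)"])
      (use a in \<open>simp_all add: pure additive_on_comp[OF tmap_hom_additive tbracket_additive(2)[OF br]]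
          additive_on_comp[OF tbracket_additive(2)[OF br'] tmap_hom_additive]\<close>)
  show ?thesis
    by (rule T_ext[OF _ _ _ st(1), where F = "\<lambda>s. tmap L A \<phi> (br s t)"])
      (use st in \<open>simp_all add: * additive_on_comp[OF tmap_hom_additive tbracket_additive(1)[OF br]]
          additive_on_comp[OF tbracket_additive(1)[OF br'] tmap_hom_additive]\<close>)
qed

lemma obstruction_tmap:
  assumes br: "tbracket A br"
    and hom: "\<And>s t. s \<in> T A \<Longrightarrow> t \<in> T A \<Longrightarrow> tmap L A \<phi> (br s t) = br' (tmap L A \<phi> s) (tmap L A \<phi> t)"
  shows "tmap L A \<phi> (obstruction_cochain L A br x y z) = obstruction_cochain L B br' x y z"
  unfolding obstruction_cochain_def Let_def
  by (simp add: hom additive_on_T(2,3)[OF tmap_hom_additive] T_diff tbracket_in[OF br] unit_in[OF A] tmap_unit[OF A \<phi>])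

lemma obstruction_in: "tbracket A br \<Longrightarrow> obstruction_cochain L A br x y z \<in> T A"
  unfolding obstruction_cochain_def Let_def by (simp add: T_diff T_add tbracket_in unit_in[OF A])

lemma pushout_deformation:
  assumes lam: "deformation L A lam"
  obtains lam' where "is_pushout L A B \<phi> lam lam'"
proof -
  note br = deformationD(2)[OF lam]
  obtain lam' where lam': "tbracket B lam'"
    "\<And>x y. lam' (unit_tens L B x) (unit_tens L B y) = tmap L A \<phi> (lam (unit_tens L A x) (unit_tens L A y))"
    using tbracket_pushout[OF br] by blast
  have "deformation L B lam'"
  proof (rule deformationI[OF B lam'(1)])
    show "obstruction_cochain L B lam' x y z = 0" for x y z
    proof -
      have "obstruction_cochain L B lam' x y z = tmap L A \<phi> (obstruction_cochain L A lam x y z)"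
        by (rule obstruction_tmap[OF br tbracket_tmap[OF br lam'], symmetric])
      also have "\<dots> = 0" unfolding deformationD(3)[OF lam] by (rule additive_on_T(1)[OF tmap_hom_additive])
      finally show ?thesis .
    qed
    show "teps L B (lam' (unit_tens L B x) (unit_tens L B y)) = brk L x y" for x y
      using lam'(2) teps_tmap[OF A B \<phi>] deformationD(4)[OF lam] tbracket_in[OF br] unit_in[OF A] by simp
  qed
  then have "is_pushout L A B \<phi> lam lam'" using lam \<phi> lam'(2) by (simp add: is_pushout_def)
  then show thesis by (rule that)
qed

end

lemma is_pushout_tmap:
  assumes "is_pushout L A B \<phi> lam lam'" "s \<in> T A" "t \<in> T A"
  shows "tmap L A \<phi> (lam s t) = lam' (tmap L A \<phi> s) (tmap L A \<phi> t)"
proof -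
  have *: "aug_hom A B \<phi>" "deformation L A lam" "deformation L B lam'"
    "\<And>x y. lam' (unit_tens L B x) (unit_tens L B y) = tmap L A \<phi> (lam (unit_tens L A x) (unit_tens L A y))"
    using assms(1) by (simp_all add: is_pushout_def)
  show ?thesis
    by (rule tbracket_tmap[OF deformationD(1)[OF *(2)] deformationD(1)[OF *(3)] *(1)
          deformationD(2)[OF *(2)] deformationD(2)[OF *(3)] *(4) assms(2,3)])
qed

end

section \<open>Low-degree cochains\<close>

context hom_leibniz
begin

text \<open>The coboundary operators in degrees \<open>1\<close> and \<open>2\<close>, on cochains with separate arguments instead of lists.\<close>

definition d1 :: "('l \<Rightarrow> 'l) \<Rightarrow> 'l \<Rightarrow> 'l \<Rightarrow> 'l" where
  "d1 \<gamma> x y = brk L x (\<gamma> y) + brk L (\<gamma> x) y - \<gamma> (brk L x y)"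

definition d2 :: "('l \<Rightarrow> 'l \<Rightarrow> 'l) \<Rightarrow> 'l \<Rightarrow> 'l \<Rightarrow> 'l \<Rightarrow> 'l" where
  "d2 \<beta> x y z = brk L (twist L x) (\<beta> y z) + brk L (\<beta> x z) (twist L y) - brk L (\<beta> x y) (twist L z)
     - \<beta> (brk L x y) (twist L z) + \<beta> (brk L x z) (twist L y) + \<beta> (twist L x) (brk L y z)"

definition cochain2 :: "('l \<Rightarrow> 'l \<Rightarrow> 'l) \<Rightarrow> bool" where
  "cochain2 \<beta> \<longleftrightarrow> bilinear_cochain (scl L) \<beta> \<and> (\<forall>x y. twist L (\<beta> x y) = \<beta> (twist L x) (twist L y))"

definition cochain1 :: "('l \<Rightarrow> 'l) \<Rightarrow> bool" where
  "cochain1 \<gamma> \<longleftrightarrow> Vector_Spaces.linear (scl L) (scl L) \<gamma> \<and> (\<forall>x. twist L (\<gamma> x) = \<gamma> (twist L x))"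

abbreviation list2 :: "('l \<Rightarrow> 'l \<Rightarrow> 'l) \<Rightarrow> 'l list \<Rightarrow> 'l" where
  "list2 \<beta> \<equiv> \<lambda>xs. if length xs = 2 then \<beta> (xs ! 0) (xs ! 1) else 0"

abbreviation list3 :: "('l \<Rightarrow> 'l \<Rightarrow> 'l \<Rightarrow> 'l) \<Rightarrow> 'l list \<Rightarrow> 'l" where
  "list3 \<beta> \<equiv> \<lambda>xs. if length xs = 3 then \<beta> (xs ! 0) (xs ! 1) (xs ! 2) else 0"

lemma linear_scl_iff: "Vector_Spaces.linear (scl L) (scl L) f \<longleftrightarrow>
    (\<forall>x y. f (x + y) = f x + f y) \<and> (\<forall>c x. f (scl L c x) = scl L c (f x))"
  by (simp add: Vector_Spaces.linear_iff vector_space_scl)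

lemma length_2_conv: "length xs = 2 \<longleftrightarrow> (\<exists>x y. xs = [x, y])"
  by (auto simp: numeral_2_eq_2 length_Suc_conv)

lemma length_3_conv: "length xs = 3 \<longleftrightarrow> (\<exists>x y z. xs = [x, y, z])"
  by (auto simp: numeral_3_eq_3 length_Suc_conv)

lemma coboundary_1: "coboundary L 1 \<phi> [x, y] = d1 (\<lambda>x. \<phi> [x]) x y"
  by (simp add: coboundary_def omit_def d1_def)

lemma interval_1_2: "{Suc 0..2} = {Suc 0, 2}" and lessThan_2: "{..<2::nat} = {0, Suc 0}"
  and lessThan_1: "{..<Suc 0} = {0}" and interval_1_3: "{Suc 0..3} = {Suc 0, 2, 3}"
  and lessThan_3: "{..<3::nat} = {0, Suc 0, 2}"
  by auto

lemma coboundary_2: "coboundary L 2 \<phi> [x, y, z] = d2 (\<lambda>x y. \<phi> [x, y]) x y z"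
  by (simp add: coboundary_def omit_def d2_def interval_1_2 lessThan_2 lessThan_1 algebra_simps numeral_2_eq_2)

lemma coboundary_3: "coboundary L 3 \<phi> [x, y, z, w] =
    brk L (twist L (twist L x)) (\<phi> [y, z, w]) + brk L (\<phi> [x, z, w]) (twist L (twist L y))
    - brk L (\<phi> [x, y, w]) (twist L (twist L z)) + brk L (\<phi> [x, y, z]) (twist L (twist L w))
    - \<phi> [brk L x y, twist L z, twist L w] + \<phi> [brk L x z, twist L y, twist L w]
    + \<phi> [twist L x, brk L y z, twist L w] - \<phi> [brk L x w, twist L y, twist L z]
    - \<phi> [twist L x, brk L y w, twist L z] - \<phi> [twist L x, twist L y, brk L z w]"
  by (simp add: coboundary_def omit_def interval_1_3 lessThan_3 lessThan_2 lessThan_1 algebra_simps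
      numeral_2_eq_2 numeral_3_eq_3)

lemma coboundary_add: "coboundary L n (\<phi> + \<chi>) = coboundary L n \<phi> + coboundary L n \<chi>"
  by (rule ext) (simp add: coboundary_def pointwise brk_add LV.scale_right_distrib sum.distrib sum_subtractf sum_negf)

lemma coboundary_scale: "coboundary L n (pw (scl L) c \<phi>) = pw (scl L) c (coboundary L n \<phi>)"
  by (rule ext) (simp add: coboundary_def pw_def brk_scl LV.scale_right_distrib LV.scale_sum_right
      sum_negf mult.commute LV.scale_right_diff_distrib)

lemma coboundary_zero: "coboundary L n 0 = 0"
  using coboundary_add[of n 0 0] by simp

lemma subspace_cochains: "module.subspace (pw (scl L)) (cochains L n)"
proof -
  interpret V: vector_space "pw (scl L)" by (rule vector_space_pw_scl)
  show ?thesis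
    by (rule V.subspaceI)
      (auto simp: cochains_def pointwise pw_def linear_scl_iff twist_zero twist_add twist_scl
        LV.scale_right_distrib algebra_simps)
qed

lemma subspace_cocycles: "module.subspace (pw (scl L)) (cocycles L n)"
proof -
  interpret V: vector_space "pw (scl L)" by (rule vector_space_pw_scl)
  note S = subspace_cochains[of n]
  show ?thesis
    by (rule V.subspaceI)
      (auto simp: cocycles_def coboundary_add coboundary_scale coboundary_zero V.subspace_0[OF S]
        V.subspace_add[OF S] V.subspace_scale[OF S] pointwise, simp add: pw_def)
qed

lemma subspace_coboundaries: "module.subspace (pw (scl L)) (coboundaries L n)"
proof -
  interpret V: vector_space "pw (scl L)" by (rule vector_space_pw_scl)
  interpret VV: vector_space_pair "pw (scl L)" "pw (scl L)" by unfold_locales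
  show ?thesis unfolding coboundaries_def
    by (rule VV.subspace_linear_image[OF _ subspace_cochains])
      (simp add: linear_on_def coboundary_add coboundary_scale)
qed

lemma cochain1_iff:
  assumes "\<phi> \<in> cochains L 1" shows "cochain1 (\<lambda>x. \<phi> [x])"
proof -
  have lin: "Vector_Spaces.linear (scl L) (scl L) (\<lambda>x. \<phi> (xs[i := x]))" if "length xs = 1" "i < 1" for xs i
    using assms that by (auto simp: cochains_def)
  have tw: "twist L (\<phi> xs) = \<phi> (map (twist L) xs)" if "length xs = 1" for xs
    using assms that by (auto simp: cochains_def)
  show ?thesis using lin[of "[undefined]" 0] tw[of "[x]" for x] by (simp add: cochain1_def)
qed

lemma cochain2_of_cochains:
  assumes "\<phi> \<in> cochains L 2" shows "cochain2 (\<lambda>x y. \<phi> [x, y])"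
proof -
  have lin: "Vector_Spaces.linear (scl L) (scl L) (\<lambda>x. \<phi> (xs[i := x]))" if "length xs = 2" "i < 2" for xs i
    using assms that by (auto simp: cochains_def)
  have tw: "twist L (\<phi> xs) = \<phi> (map (twist L) xs)" if "length xs = 2" for xs
    using assms that by (auto simp: cochains_def)
  have 1: "Vector_Spaces.linear (scl L) (scl L) (\<lambda>x. \<phi> [x, y])" "Vector_Spaces.linear (scl L) (scl L) (\<lambda>x. \<phi> [y, x])" for y
    using lin[of "[y, y]" 0] lin[of "[y, y]" 1] by simp_all
  then show ?thesis using tw[of "[x, y]" for x y]
    by (simp add: cochain2_def bilinear_cochain_def linear_scl_iff)
qed

lemma cochain2_list: "cochain2 \<beta> \<Longrightarrow> list2 \<beta> \<in> cochains L 2"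
  unfolding cochains_def cochain2_def bilinear_cochain_def
  by (auto simp: length_2_conv linear_scl_iff less_2_cases_iff)

lemma twist_diff: "twist L (x - y) = twist L x - twist L y"
  using twist_add[of "x - y" y] by simp

lemma brk_diff: "brk L (x - y) z = brk L x z - brk L y z" "brk L z (x - y) = brk L z x - brk L z y"
  using brk_add(1)[of "x - y" y z] brk_add(2)[of z "x - y" y] by simp_all

lemma cochain2_combination:
  "cochain2 \<beta> \<Longrightarrow> cochain2 \<gamma> \<Longrightarrow> cochain2 (\<lambda>x y. \<beta> x y - \<gamma> x y)"
  "cochain2 \<beta> \<Longrightarrow> cochain2 \<gamma> \<Longrightarrow> cochain2 (\<lambda>x y. \<beta> x y + \<gamma> x y)"
  unfolding cochain2_def bilinear_cochain_def
  by (simp_all add: twist_add twist_diff LV.scale_right_distrib LV.scale_right_diff_distrib)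

lemma d2_diff: "d2 (\<lambda>x y. \<beta> x y - \<gamma> x y) x y z = d2 \<beta> x y z - d2 \<gamma> x y z"
  unfolding d2_def brk_diff by simp

lemma cocycles2_list:
  assumes "cochain2 \<beta>" "\<And>x y z. d2 \<beta> x y z = 0"
  shows "list2 \<beta> \<in> cocycles L 2"
proof -
  have "coboundary L 2 (list2 \<beta>) xs = 0" for xs
  proof (cases "length xs = 3")
    case True
    then obtain x y z where "xs = [x, y, z]" by (auto simp: length_3_conv)
    then show ?thesis using assms(2) by (simp add: coboundary_2 d2_def)
  qed (simp add: coboundary_def)
  then show ?thesis using cochain2_list[OF assms(1)] by (simp add: cocycles_def)
qed

lemma cocycles2D:
  assumes "\<phi> \<in> cocycles L 2"
  shows "cochain2 (\<lambda>x y. \<phi> [x, y])" "d2 (\<lambda>x y. \<phi> [x, y]) x y z = 0"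
  using assms coboundary_2[of \<phi>] cochain2_of_cochains[of \<phi>] by (auto simp: cocycles_def)

lemma coboundaries3_list:
  assumes "cochain2 \<beta>"
  shows "list3 (d2 \<beta>) \<in> coboundaries L 3"
proof -
  have "list3 (d2 \<beta>) = coboundary L 2 (list2 \<beta>)"
  proof
    fix xs
    show "list3 (d2 \<beta>) xs = coboundary L 2 (list2 \<beta>) xs"
    proof (cases "length xs = 3")
      case True
      then obtain x y z where "xs = [x, y, z]" by (auto simp: length_3_conv)
      then show ?thesis by (simp add: coboundary_2 d2_def)
    qed (simp add: coboundary_def)
  qed
  then show ?thesis using cochain2_list[OF assms] by (simp add: coboundaries_def)
qed

lemma coboundaries3D:
  assumes "\<phi> \<in> coboundaries L 3"
  obtains \<beta> where "cochain2 \<beta>" "\<And>x y z. \<phi> [x, y, z] = d2 \<beta> x y z"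
proof -
  obtain \<chi> where "\<chi> \<in> cochains L 2" "\<phi> = coboundary L 2 \<chi>" using assms by (auto simp: coboundaries_def)
  then show thesis using that cochain2_of_cochains coboundary_2 by metis
qed

lemma coboundaries2D:
  assumes "\<phi> \<in> coboundaries L 2"
  obtains \<gamma> where "cochain1 \<gamma>" "\<And>x y. \<phi> [x, y] = d1 \<gamma> x y"
proof -
  obtain \<chi> where "\<chi> \<in> cochains L 1" "\<phi> = coboundary L 1 \<chi>" using assms by (auto simp: coboundaries_def)
  then show thesis using that cochain1_iff coboundary_1 by metis
qed

lemma cocycles3_list:
  assumes lin: "\<And>x x' y z c. \<gamma> (x + x') y z = \<gamma> x y z + \<gamma> x' y z \<and> \<gamma> (scl L c x) y z = scl L c (\<gamma> x y z)"
      "\<And>x y y' z c. \<gamma> x (y + y') z = \<gamma> x y z + \<gamma> x y' z \<and> \<gamma> x (scl L c y) z = scl L c (\<gamma> x y z)"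
      "\<And>x y z z' c. \<gamma> x y (z + z') = \<gamma> x y z + \<gamma> x y z' \<and> \<gamma> x y (scl L c z) = scl L c (\<gamma> x y z)"
    and tw: "\<And>x y z. twist L (\<gamma> x y z) = \<gamma> (twist L x) (twist L y) (twist L z)"
    and cocycle: "\<And>x y z w. brk L (twist L (twist L x)) (\<gamma> y z w) + brk L (\<gamma> x z w) (twist L (twist L y))
    - brk L (\<gamma> x y w) (twist L (twist L z)) + brk L (\<gamma> x y z) (twist L (twist L w))
    - \<gamma> (brk L x y) (twist L z) (twist L w) + \<gamma> (brk L x z) (twist L y) (twist L w)
    + \<gamma> (twist L x) (brk L y z) (twist L w) - \<gamma> (brk L x w) (twist L y) (twist L z)
    - \<gamma> (twist L x) (brk L y w) (twist L z) - \<gamma> (twist L x) (twist L y) (brk L z w) = 0"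
  shows "list3 \<gamma> \<in> cocycles L 3"
proof -
  have "list3 \<gamma> \<in> cochains L 3"
    unfolding cochains_def using lin tw
    by (auto simp: length_3_conv linear_scl_iff less_Suc_eq numeral_3_eq_3 numeral_2_eq_2)
  moreover have "coboundary L 3 (list3 \<gamma>) xs = 0" for xs
  proof (cases "length xs = 4")
    case True
    then obtain x y z w where "xs = [x, y, z, w]"
      by (auto simp: length_Suc_conv eval_nat_numeral)
    then show ?thesis using cocycle[of x y z w] by (simp add: coboundary_3)
  qed (simp add: coboundary_def)
  ultimately show ?thesis by (simp add: cocycles_def)
qed

end

section \<open>Surjections with small kernel, and twisted derivations\<close>

text \<open>Equivalently, the augmentation ideal of \<open>D\<close> annihilates the kernel of \<open>P\<close>.\<close>

definition small_kernel :: "('k::field, 'j) aug_alg \<Rightarrow> (('j \<Rightarrow> 'k) \<Rightarrow> 'i \<Rightarrow> 'k) \<Rightarrow> bool" where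
  "small_kernel D P \<longleftrightarrow> (\<forall>d\<in>acar D. \<forall>n\<in>acar D. P n = 0 \<longrightarrow> amul D d n = pw (*) (aeps D d) n)"

text \<open>A linear functional on \<open>D\<close> that is a derivation up to a \<open>2\<close>-cochain \<open>f\<close> of \<open>A\<close>; equivalently, a map
  from \<open>D\<close> to the extension of \<open>A\<close> by \<open>K\<close> with cocycle \<open>f\<close>, lifting \<open>P\<close>.\<close>

definition twisted_derivation ::
  "('k::field, 'j) aug_alg \<Rightarrow> (('j \<Rightarrow> 'k) \<Rightarrow> 'i \<Rightarrow> 'k) \<Rightarrow> (('i \<Rightarrow> 'k) \<Rightarrow> ('i \<Rightarrow> 'k) \<Rightarrow> 'k) \<Rightarrow> (('j \<Rightarrow> 'k) \<Rightarrow> 'k) \<Rightarrow> bool" where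
  "twisted_derivation D P f \<xi> \<longleftrightarrow> linear_on (pw (*)) (*) (acar D) \<xi> \<and>
     (\<forall>d\<in>acar D. \<forall>e\<in>acar D. \<xi> (amul D d e) = aeps D d * \<xi> e + aeps D e * \<xi> d + f (P d) (P e))"

lemma aeps_zero: "aug_algebra A \<Longrightarrow> aeps A 0 = 0"
proof -
  assume A: "aug_algebra A"
  interpret KF: vector_space_pair "pw ((*) :: 'a \<Rightarrow> _)" "(*)"
    by (rule vector_space_pair_times[OF vector_space_pw_times])
  show ?thesis using KF.linear_on_zero aug_algebraD(1,9)[OF A] by blast
qed

lemma aug_hom_zero: "aug_algebra A \<Longrightarrow> aug_hom A B \<phi> \<Longrightarrow> \<phi> 0 = 0"
proof -
  assume A: "aug_algebra A" and \<phi>: "aug_hom A B \<phi>"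
  show ?thesis using KK.linear_on_zero aug_algebraD(1)[OF A] aug_homD(2)[OF \<phi>] by blast
qed

lemma aug_hom_diff: "aug_algebra A \<Longrightarrow> aug_hom A B \<phi> \<Longrightarrow> x \<in> acar A \<Longrightarrow> y \<in> acar A \<Longrightarrow> \<phi> (x - y) = \<phi> x - \<phi> y"
proof -
  assume A: "aug_algebra A" and \<phi>: "aug_hom A B \<phi>" and xy: "x \<in> acar A" "y \<in> acar A"
  show ?thesis using KK.linear_on_diff aug_algebraD(1)[OF A] aug_homD(2)[OF \<phi>] xy by blast
qed

lemma aug_hom_section:
  assumes D: "aug_algebra D" and P: "aug_hom D A P" and surj: "P ` acar D = acar A"
  obtains s where "Vector_Spaces.linear (pw (*)) (pw (*)) s" "\<And>a. a \<in> acar A \<Longrightarrow> s a \<in> acar D"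
    "\<And>a. a \<in> acar A \<Longrightarrow> P (s a) = a"
proof -
  show thesis using KK.linear_section[OF aug_algebraD(1)[OF D] aug_homD(2)[OF P]] that unfolding surj by metis
qed

lemma subspace_kernel_on:
  assumes D: "aug_algebra D" and P: "aug_hom D A P"
  shows "module.subspace (pw (*)) {d \<in> acar D. P d = 0}"
proof -
  have "pw (*) c 0 = 0" for c :: 'a by (simp add: pw_def fun_eq_iff pointwise)
  then show ?thesis
    using aug_algebraD(1)[OF D] aug_hom_zero[OF D P] linear_onD[OF aug_homD(2)[OF P]]
    by (intro K.subspaceI) (auto simp: K.subspace_0 K.subspace_add K.subspace_scale)
qed

text \<open>A functional on the kernel which respects the module structure over the augmentation is extended by \<open>0\<close> along a linear
  section of \<open>P\<close>.  Its failure to be a derivation is then concentrated on products of elements of the section and is a Harrison cocycle \<open>f\<close>, the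
  cocycle of the extension pushed out along the functional.  Another representative of the class of \<open>f\<close> is reached by subtracting
  a functional pulled back from \<open>A\<close>, which does not affect the kernel.\<close>

lemma extend_to_twisted_derivation:
  assumes D: "aug_algebra D" and A: "aug_algebra A" and P: "aug_hom D A P" and surj: "P ` acar D = acar A"
    and \<xi>: "linear_on (pw (*)) (*) (acar D) \<xi>"
    and \<xi>N: "\<And>d n. d \<in> acar D \<Longrightarrow> n \<in> acar D \<Longrightarrow> P n = 0 \<Longrightarrow> \<xi> (amul D d n) = aeps D d * \<xi> n"
  obtains f where "f \<in> harr_cocycles A"
    "\<And>f'. f' - f \<in> harr_coboundaries A \<Longrightarrow>
      \<exists>\<xi>'. twisted_derivation D P f' \<xi>' \<and> (\<forall>n\<in>acar D. P n = 0 \<longrightarrow> \<xi>' n = \<xi> n)"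
proof -
  interpret KF: vector_space_pair "pw ((*) :: 'a \<Rightarrow> 'a \<Rightarrow> 'a)" "(*)"
    by (rule vector_space_pair_times[OF vector_space_pw_times])
  note subD = aug_algebraD(1)[OF D] and subA = aug_algebraD(1)[OF A]
  note Dmul = aug_algebraD(3)[OF D] and Amul = aug_algebraD(3)[OF A]
  note PA = aug_homD(1)[OF P] and Pmul = aug_homD(3)[OF P] and Peps = aug_homD(5)[OF P]
  obtain s where s: "Vector_Spaces.linear (pw (*)) (pw (*)) s" "\<And>a. a \<in> acar A \<Longrightarrow> s a \<in> acar D"
    "\<And>a. a \<in> acar A \<Longrightarrow> P (s a) = a"
    using aug_hom_section[OF D P surj] by metis
  have slin: "s (a + b) = s a + s b" "s (pw (*) c a) = pw (*) c (s a)" for a b c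
    using s(1) by (simp_all add: Vector_Spaces.linear_iff)
  have epss: "aeps D (s a) = aeps A a" if "a \<in> acar A" for a using Peps[OF s(2)[OF that]] s(3)[OF that] by simp
  \<comment> \<open>the projection to the kernel along the section\<close>
  define \<kappa> where "\<kappa> d = d - s (P d)" for d
  have \<kappa>: "\<kappa> d \<in> acar D" "P (\<kappa> d) = 0" if "d \<in> acar D" for d
    using that s(2,3)[OF PA[OF that]] by (simp_all add: \<kappa>_def K.subspace_diff[OF subD] aug_hom_diff[OF D P])
  have \<kappa>lin: "\<kappa> (d + e) = \<kappa> d + \<kappa> e" "\<kappa> (pw (*) c d) = pw (*) c (\<kappa> d)" if "d \<in> acar D" "e \<in> acar D" for d e c
    using that linear_onD[OF aug_homD(2)[OF P]] by (simp_all add: \<kappa>_def slin K.scale_right_diff_distrib)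
  define \<xi>0 where "\<xi>0 d = \<xi> (\<kappa> d)" for d
  have \<xi>0lin: "linear_on (pw (*)) (*) (acar D) \<xi>0"
    using \<kappa> \<kappa>lin linear_onD[OF \<xi>] by (intro linear_onI) (simp_all add: \<xi>0_def)
  have s0: "s 0 = 0" using slin(1)[of 0 0] by simp
  have \<xi>0N: "\<xi>0 n = \<xi> n" if "n \<in> acar D" "P n = 0" for n
    using that by (simp add: \<xi>0_def \<kappa>_def s0)
  have \<xi>0s: "\<xi>0 (s a) = 0" if "a \<in> acar A" for a
    using that s(3) KF.linear_on_zero[OF \<xi> subD] by (simp add: \<xi>0_def \<kappa>_def)
  define f where "f a b = (if a \<in> acar A \<and> b \<in> acar A then \<xi>0 (amul D (s a) (s b)) else 0)" for a b
  have tw: "\<xi>0 (amul D d e) = aeps D d * \<xi>0 e + aeps D e * \<xi>0 d + f (P d) (P e)"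
    if de: "d \<in> acar D" "e \<in> acar D" for d e
  proof -
    let ?a = "s (P d)" and ?b = "s (P e)"
    have in': "?a \<in> acar D" "?b \<in> acar D" using de PA s(2) by auto
    have d: "d = ?a + \<kappa> d" "e = ?b + \<kappa> e" by (simp_all add: \<kappa>_def)
    have "amul D d e = amul D ?a ?b + (amul D (\<kappa> d) ?b + amul D (\<kappa> e) d)"
    proof -
      have "amul D d e = amul D d ?b + amul D d (\<kappa> e)"
        by (subst d(2)) (rule aug_algebra_mul_add(1)[OF D de(1) in'(2) \<kappa>(1)[OF de(2)]])
      also have "amul D d ?b = amul D ?a ?b + amul D (\<kappa> d) ?b"
        by (subst d(1)) (rule aug_algebra_mul_add(2)[OF D in'(2) in'(1) \<kappa>(1)[OF de(1)]])
      also have "amul D d (\<kappa> e) = amul D (\<kappa> e) d" using aug_algebraD(5)[OF D] de \<kappa>(1) by blast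
      finally show ?thesis by (simp add: algebra_simps)
    qed
    moreover have "\<xi>0 (amul D (\<kappa> d) ?b) = aeps D e * \<xi>0 d"
    proof -
      have c: "amul D (\<kappa> d) ?b = amul D ?b (\<kappa> d)" using aug_algebraD(5)[OF D] in' \<kappa>(1) de by blast
      have "P (amul D ?b (\<kappa> d)) = 0"
        using Pmul[OF in'(2) \<kappa>(1)[OF de(1)]] \<kappa>(2)[OF de(1)] aug_algebra_mul_add(3)[OF A _ _ K.subspace_0[OF subA], of "P ?b" _ 0] PA[OF in'(2)]
          K.subspace_0[OF subA] by simp
      then have "\<xi>0 (amul D ?b (\<kappa> d)) = \<xi> (amul D ?b (\<kappa> d))" using in' \<kappa> de Dmul by (intro \<xi>0N) auto
      also have "\<dots> = aeps D ?b * \<xi> (\<kappa> d)" using in' \<kappa> de by (intro \<xi>N) auto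
      finally show ?thesis unfolding c using epss[OF PA[OF de(2)]] Peps[OF de(2)] by (simp add: \<xi>0_def)
    qed
    moreover have "\<xi>0 (amul D (\<kappa> e) d) = aeps D d * \<xi>0 e"
    proof -
      have c: "amul D (\<kappa> e) d = amul D d (\<kappa> e)" using aug_algebraD(5)[OF D] \<kappa>(1) de by blast
      have "P (amul D d (\<kappa> e)) = 0"
        using Pmul[OF de(1) \<kappa>(1)[OF de(2)]] \<kappa>(2)[OF de(2)] aug_algebra_mul_add(3)[OF A _ _ K.subspace_0[OF subA], of "P d" _ 0] PA[OF de(1)]
          K.subspace_0[OF subA] by simp
      then have "\<xi>0 (amul D d (\<kappa> e)) = \<xi> (amul D d (\<kappa> e))" using \<kappa> de Dmul by (intro \<xi>0N) auto
      also have "\<dots> = aeps D d * \<xi> (\<kappa> e)" using \<kappa> de by (intro \<xi>N) auto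
      finally show ?thesis unfolding c by (simp add: \<xi>0_def)
    qed
    moreover have "\<xi>0 (amul D ?a ?b) = f (P d) (P e)" using de PA by (simp add: f_def)
    ultimately show ?thesis
      using linear_onD(1)[OF \<xi>0lin] in' \<kappa>(1) de Dmul K.subspace_add[OF subD] by simp
  qed
  have f: "f a b = \<xi>0 (amul D (s a) (s b))" if "a \<in> acar A" "b \<in> acar A" for a b
    using that by (simp add: f_def)
  have fc: "f \<in> harr_cocycles A"
    unfolding harr_cocycles_def
  proof (intro CollectI conjI allI impI ballI)
    show "f a b = 0" if "a \<notin> acar A \<or> b \<notin> acar A" for a b using that by (auto simp: f_def)
    show "f a b = f b a" for a b using aug_algebraD(5)[OF D] s(2) by (auto simp: f_def)
    show "linear_on (pw (*)) (*) (acar A) (f a)" if a: "a \<in> acar A" for a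
      using a linear_onD[OF \<xi>0lin] Dmul s(2) aug_algebra_mul_add(1)[OF D] aug_algebra_mul_add(3)[OF D _ _ aug_algebraD(2)[OF D]] K.subspace_add[OF subA] K.subspace_scale[OF subA]
      by (intro linear_onI) (simp_all add: f slin)
    fix a b c assume abc: "a \<in> acar A" "b \<in> acar A" "c \<in> acar A"
    have P': "P (amul D (s a) (s b)) = amul A a b" "P (amul D (s b) (s c)) = amul A b c"
      using abc Pmul s by simp_all
    have "\<xi>0 (amul D (amul D (s a) (s b)) (s c)) = aeps A c * f a b + f (amul A a b) c"
      using tw[of "amul D (s a) (s b)" "s c"] abc s P' Dmul \<xi>0s epss by (simp add: f)
    moreover have "\<xi>0 (amul D (s a) (amul D (s b) (s c))) = aeps A a * f b c + f a (amul A b c)"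
      using tw[of "s a" "amul D (s b) (s c)"] abc s P' Dmul \<xi>0s epss by (simp add: f)
    ultimately show "aeps A a * f b c - f (amul A a b) c + f a (amul A b c) - aeps A c * f a b = 0"
      using aug_algebraD(6)[OF D] abc s(2) by (simp add: algebra_simps)
  qed
  show thesis
  proof (rule that[OF fc])
    fix f' assume "f' - f \<in> harr_coboundaries A"
    then obtain g where g: "linear_on (pw (*)) (*) (acar A) g" "f' - f = (\<lambda>a b. if a \<in> acar A \<and> b \<in> acar A
      then aeps A a * g b - g (amul A a b) + aeps A b * g a else 0)"
      by (auto simp: harr_coboundaries_def)
    have f': "f' a b = f a b + aeps A a * g b - g (amul A a b) + aeps A b * g a" if "a \<in> acar A" "b \<in> acar A" for a b
      using fun_cong[OF fun_cong[OF g(2), of a], of b] that by (simp add: pointwise algebra_simps)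
    have g0: "g 0 = 0" by (rule KF.linear_on_zero[OF g(1) subA])
    have "twisted_derivation D P f' (\<lambda>d. \<xi>0 d - g (P d))"
      unfolding twisted_derivation_def
    proof (intro conjI ballI)
      show "linear_on (pw (*)) (*) (acar D) (\<lambda>d. \<xi>0 d - g (P d))"
        using linear_onD[OF \<xi>0lin] linear_onD[OF g(1)] linear_onD[OF aug_homD(2)[OF P]] PA
        by (intro linear_onI) (simp_all add: algebra_simps)
      fix d e assume de: "d \<in> acar D" "e \<in> acar D"
      show "\<xi>0 (amul D d e) - g (P (amul D d e)) = aeps D d * (\<xi>0 e - g (P e)) + aeps D e * (\<xi>0 d - g (P d)) + f' (P d) (P e)"
        using tw[OF de] f'[OF PA PA, OF de] de Pmul[OF de] Peps by (simp add: algebra_simps)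
    qed
    then show "\<exists>\<xi>'. twisted_derivation D P f' \<xi>' \<and> (\<forall>n\<in>acar D. P n = 0 \<longrightarrow> \<xi>' n = \<xi> n)"
      using \<xi>0N g0 by (intro exI[of _ "\<lambda>d. \<xi>0 d - g (P d)"]) auto
  qed
qed

section \<open>The obstruction\<close>

context hom_leibniz
begin

text \<open>The failure of the Leibniz identity over the algebra.  Its values on \<open>1 \<otimes> L\<close> are the obstruction; the cocycle condition involves its values
  at brackets, which are not of this form.\<close>

definition jac :: "('k, 'i) aug_alg \<Rightarrow> (('i \<Rightarrow> 'l) \<Rightarrow> ('i \<Rightarrow> 'l) \<Rightarrow> 'i \<Rightarrow> 'l) \<Rightarrow>
    ('i \<Rightarrow> 'l) \<Rightarrow> ('i \<Rightarrow> 'l) \<Rightarrow> ('i \<Rightarrow> 'l) \<Rightarrow> 'i \<Rightarrow> 'l" where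
  "jac A br s t u = br (ttwist L A s) (br t u) - br (br s t) (ttwist L A u) + br (br s u) (ttwist L A t)"

context
  fixes A :: "('k, 'i) aug_alg" and br
  assumes A: "aug_algebra A" and br: "tbracket A br"
begin

lemma jac_in: "s \<in> T A \<Longrightarrow> t \<in> T A \<Longrightarrow> u \<in> T A \<Longrightarrow> jac A br s t u \<in> T A"
  by (simp add: jac_def T_add T_diff tbracket_in[OF br] ttwist_in[OF sub_alg[OF A]])

lemma jac_unit: "jac A br (unit_tens L A x) (unit_tens L A y) (unit_tens L A z) = obstruction_cochain L A br x y z"
  by (simp add: jac_def obstruction_cochain_def Let_def ttwist_unit[OF A])

lemma jac_additive:
  shows "t \<in> T A \<Longrightarrow> u \<in> T A \<Longrightarrow> additive_on (T A) (\<lambda>s. jac A br s t u)"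
    and "s \<in> T A \<Longrightarrow> u \<in> T A \<Longrightarrow> additive_on (T A) (\<lambda>t. jac A br s t u)"
    and "s \<in> T A \<Longrightarrow> t \<in> T A \<Longrightarrow> additive_on (T A) (jac A br s t)"
proof -
  note S = sub_alg[OF A]
  note add = tbracket_additive[OF br]
  note [simp] = tbracket_in[OF br] ttwist_in[OF S]
  show "t \<in> T A \<Longrightarrow> u \<in> T A \<Longrightarrow> additive_on (T A) (\<lambda>s. jac A br s t u)" unfolding jac_def
    by (auto intro!: additive_on_intros additive_on_comp[OF add(1) ttwist_additive[OF S]] additive_on_comp[OF add(1) add(1)])
  show "s \<in> T A \<Longrightarrow> u \<in> T A \<Longrightarrow> additive_on (T A) (\<lambda>t. jac A br s t u)" unfolding jac_def
    by (auto intro!: additive_on_intros additive_on_comp[OF add(2) ttwist_additive[OF S]]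
        additive_on_comp[OF add(2) add(1)] additive_on_comp[OF add(1) add(2)])
  show "s \<in> T A \<Longrightarrow> t \<in> T A \<Longrightarrow> additive_on (T A) (jac A br s t)" unfolding jac_def
    by (auto intro!: additive_on_intros additive_on_comp[OF add(2) ttwist_additive[OF S]]
        additive_on_comp[OF add(2) add(2)] additive_on_comp[OF add(1) add(2)])
qed

lemma jac_act:
  assumes "a \<in> acar A" "s \<in> T A" "t \<in> T A" "u \<in> T A"
  shows "jac A br (act L A a s) t u = act L A a (jac A br s t u)"
    and "jac A br s (act L A a t) u = act L A a (jac A br s t u)"
    and "jac A br s t (act L A a u) = act L A a (jac A br s t u)"
  using assms unfolding jac_def
  by (simp_all add: tbracket_act[OF br] ttwist_act[OF A] tbracket_in[OF br] ttwist_in[OF sub_alg[OF A]]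
      additive_on_T(2,3)[OF act_additive[OF A]] T_diff)

lemma obstruction_ttwist: "ttwist L A (obstruction_cochain L A br x y z) =
    obstruction_cochain L A br (twist L x) (twist L y) (twist L z)"
proof -
  note S = sub_alg[OF A]
  show ?thesis unfolding obstruction_cochain_def Let_def
    by (simp add: additive_on_T(2,3)[OF ttwist_additive[OF S]] T_diff tbracket_in[OF br] unit_in[OF A]
        tbracket_ttwist[OF br] ttwist_unit[OF A])
qed

text \<open>The reason why obstructions are cocycles: expanding every term by biadditivity and multiplicativity of the bracket, all iterated brackets
  cancel in pairs.\<close>

lemma jac_cocycle:
  assumes "s \<in> T A" "t \<in> T A" "u \<in> T A" "v \<in> T A"
  defines "\<alpha> \<equiv> ttwist L A"
  shows "br (\<alpha> (\<alpha> s)) (jac A br t u v) + br (jac A br s u v) (\<alpha> (\<alpha> t)) - br (jac A br s t v) (\<alpha> (\<alpha> u))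
    + br (jac A br s t u) (\<alpha> (\<alpha> v)) - jac A br (br s t) (\<alpha> u) (\<alpha> v) + jac A br (br s u) (\<alpha> t) (\<alpha> v)
    + jac A br (\<alpha> s) (br t u) (\<alpha> v) - jac A br (br s v) (\<alpha> t) (\<alpha> u)
    - jac A br (\<alpha> s) (br t v) (\<alpha> u) - jac A br (\<alpha> s) (\<alpha> t) (br u v) = 0"
  using assms(1-4) unfolding \<alpha>_def jac_def
  by (simp add: additive_on_T(2,3)[OF tbracket_additive(1)[OF br]] additive_on_T(2,3)[OF tbracket_additive(2)[OF br]]
      tbracket_in[OF br] ttwist_in[OF sub_alg[OF A]] T_diff T_add tbracket_ttwist[OF br])

end

context
  fixes D :: "('k, 'j) aug_alg" and A :: "('k, 'i) aug_alg" and P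
  assumes D: "aug_algebra D" and A: "aug_algebra A" and P: "aug_hom D A P" and surj: "P ` acar D = acar A"
begin

text \<open>A linear section of \<open>P\<close> identifies the kernel of \<open>P \<otimes> id\<close> with \<open>ker P \<otimes> L\<close>, which is spanned by pure tensors.\<close>

lemma T_kernel_ext:
  assumes F: "additive_on (T D) F" and G: "additive_on (T D) G"
    and eq: "\<And>n l. n \<in> acar D \<Longrightarrow> P n = 0 \<Longrightarrow> F (tens L n l) = G (tens L n l)"
    and t: "t \<in> T D" "tmap L D P t = 0"
  shows "F t = G t"
proof -
  note subD = sub_alg[OF D] and subA = sub_alg[OF A]
  obtain s where s: "Vector_Spaces.linear (pw (*)) (pw (*)) s" "\<And>a. a \<in> acar A \<Longrightarrow> s a \<in> acar D"
    "\<And>a. a \<in> acar A \<Longrightarrow> P (s a) = a"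
    using aug_hom_section[OF D P surj] by metis
  have slin: "lin A s" by (rule linear_imp_linear_on[OF s(1)])
  define \<kappa> where "\<kappa> d = d - s (P d)" for d
  have \<kappa>: "\<kappa> d \<in> acar D" "P (\<kappa> d) = 0" if "d \<in> acar D" for d
    using that s(2,3)[OF aug_homD(1)[OF P that]] by (simp_all add: \<kappa>_def K.subspace_diff[OF subD] aug_hom_diff[OF D P])
  have \<kappa>lin: "lin D \<kappa>"
    using linear_onD[OF slin] aug_homD(1)[OF P] linear_onD[OF aug_homD(2)[OF P]]
    by (intro linear_onI) (simp_all add: \<kappa>_def K.scale_right_diff_distrib)
  have split: "tens L (\<kappa> d) l + tens L (s (P d)) l = tens L d l" for d l
    by (simp add: tens_add(1)[symmetric] \<kappa>_def)
  have "t = tmap L D \<kappa> t + tmap L A s (tmap L D P t)"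
    by (rule T_ext[OF _ _ _ t(1), where F = "\<lambda>t. t"])
      (auto intro!: additive_on_intros tmap_additive[OF subD \<kappa>lin] additive_on_comp[OF tmap_additive[OF subA slin] tmap_hom_additive[OF D A P]]
        tmap_hom_in[OF D A P] simp: tmap_pure[OF subD \<kappa>lin] tmap_pure[OF subD aug_homD(2)[OF P]] tmap_pure[OF subA slin]
        aug_homD(1)[OF P] split)
  then have t\<kappa>: "tmap L D \<kappa> t = t" using t(2) additive_on_T(1)[OF tmap_additive[OF subA slin]] by simp
  have \<kappa>T: "tmap L D \<kappa> t \<in> T D" if "t \<in> T D" for t by (rule tmap_in[OF subD \<kappa>lin _ that]) (use \<kappa> in auto)
  have "F (tmap L D \<kappa> t) = G (tmap L D \<kappa> t)"
    by (rule T_ext[OF _ _ _ t(1), where F = "\<lambda>t. F (tmap L D \<kappa> t)"])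
      (use \<kappa> in \<open>auto intro!: additive_on_comp[OF F tmap_additive[OF subD \<kappa>lin]] additive_on_comp[OF G tmap_additive[OF subD \<kappa>lin]]
        \<kappa>T eq simp: tmap_pure[OF subD \<kappa>lin]\<close>)
  then show ?thesis by (simp add: t\<kappa>)
qed

text \<open>The kernel of \<open>P \<otimes> id\<close> is \<open>ker P \<otimes> L\<close>, a sum of copies of \<open>L\<close> indexed by a basis of \<open>ker P\<close>.\<close>

lemma kernel_decomposition:
  assumes n: "\<And>i. i < r \<Longrightarrow> n i \<in> acar D" and \<xi>: "\<And>i. i < r \<Longrightarrow> lfun D (\<xi> i)"
    and basis: "\<And>x. x \<in> acar D \<Longrightarrow> P x = 0 \<Longrightarrow> x = (\<Sum>i<r. pw (*) (\<xi> i x) (n i))"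
    and t: "t \<in> T D" "tmap L D P t = 0"
  shows "t = (\<Sum>i<r. tens L (n i) (tev D (\<xi> i) t))"
proof (rule T_kernel_ext[OF _ _ _ t, where F = "\<lambda>t. t"])
  show "additive_on (T D) (\<lambda>t. \<Sum>i<r. tens L (n i) (tev D (\<xi> i) t))"
    by (intro additive_on_intros tev_additive[OF sub_alg[OF D] \<xi>]) auto
  show "tens L x l = (\<Sum>i<r. tens L (n i) (tev D (\<xi> i) (tens L x l)))" if x: "x \<in> acar D" "P x = 0" for x l
  proof -
    have "tens L x l = (\<Sum>i<r. tens L (pw (*) (\<xi> i x) (n i)) l)"
      by (subst (1) basis[OF x]) (simp add: tens_sum)
    also have "\<dots> = (\<Sum>i<r. tens L (n i) (tev D (\<xi> i) (tens L x l)))"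
      by (rule sum.cong) (use x \<xi> in \<open>simp_all add: tens_scale tev_pure[OF sub_alg[OF D]]\<close>)
    finally show ?thesis .
  qed
qed (rule additive_on_intros)

end

text \<open>What a twist \<open>f\<close> adds when a twisted derivation is applied to a product over the algebra: the functional \<open>f a\<close> is applied to the
  bracket of \<open>lam\<close>, where \<open>a\<close> is the algebra coefficient of one argument.  The defect is the Leibniz expression formed
  with these additional terms.\<close>

definition rmul where
  "rmul A lam f s z = tensor_lift L A (\<lambda>a l. tev A (f a) (lam (unit_tens L A l) (unit_tens L A z))) s"

definition lmul where
  "lmul A lam f z s = tensor_lift L A (\<lambda>a l. tev A (f a) (lam (unit_tens L A z) (unit_tens L A l))) s"

definition defect where
  "defect A lam f x y z =
     lmul A lam f (twist L x) (lam (unit_tens L A y) (unit_tens L A z))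
     - rmul A lam f (lam (unit_tens L A x) (unit_tens L A y)) (twist L z)
     + rmul A lam f (lam (unit_tens L A x) (unit_tens L A z)) (twist L y)"

definition tev2 where
  "tev2 D br \<xi> x y = tev D \<xi> (br (unit_tens L D x) (unit_tens L D y))"

context
  fixes D :: "('k, 'j) aug_alg" and A :: "('k, 'i) aug_alg" and P lam br
  assumes D: "aug_algebra D" and A: "aug_algebra A" and P: "aug_hom D A P"
    and lam: "tbracket A lam"
    and lam_eps: "\<And>x y. teps L A (lam (unit_tens L A x) (unit_tens L A y)) = brk L x y"
    and br: "tbracket D br"
    and lift: "\<And>s t. s \<in> T D \<Longrightarrow> t \<in> T D \<Longrightarrow> tmap L D P (br s t) = lam (tmap L D P s) (tmap L D P t)"
begin

lemma lift_eps: "teps L D (br (unit_tens L D x) (unit_tens L D y)) = brk L x y"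
proof -
  have "teps L D (br (unit_tens L D x) (unit_tens L D y)) = teps L A (tmap L D P (br (unit_tens L D x) (unit_tens L D y)))"
    by (rule teps_tmap[OF D A P tbracket_in[OF br unit_in[OF D] unit_in[OF D]], symmetric])
  then show ?thesis by (simp add: lift unit_in[OF D] tmap_unit[OF D P] lam_eps)
qed

lemma cochain2_tev2: assumes \<xi>: "lfun D \<xi>" shows "cochain2 (tev2 D br \<xi>)"
proof -
  note S = sub_alg[OF D]
  note [simp] = tbracket_in[OF br] unit_in[OF D]
  have sc: "tev D \<xi> (pw (scl L) c t) = scl L c (tev D \<xi> t)" if "t \<in> T D" for c t
    using that
  proof (induction rule: T_induct)
    case zero
    have "pw (scl L) c (0 :: 'j \<Rightarrow> 'l) = 0" by (simp add: pw_def fun_eq_iff pointwise)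
    then have "tev D \<xi> (pw (scl L) c 0) = scl L c (tev D \<xi> 0)"
      by (simp only: additive_on_T(1)[OF tev_additive[OF S \<xi>]] LV.scale_zero_right)
    then show ?case .
  next
    case (pure a l t)
    have "pw (scl L) c (tens L a l + t) = tens L a (scl L c l) + pw (scl L) c t"
      by (simp add: tens_scale'[symmetric]) (simp add: pw_def fun_eq_iff pointwise LV.scale_right_distrib)
    then have "tev D \<xi> (pw (scl L) c (tens L a l + t)) = scl L c (tev D \<xi> (tens L a l + t))"
      using pure by (simp add: additive_on_T(2)[OF tev_additive[OF S \<xi>]] T_pure T_scale tev_pure[OF S \<xi>] LV.scale_right_distrib mult.commute)
    then show ?case .
  qed
  show ?thesis
    using tbracket_cochain[OF D br] unfolding cochain2_def bilinear_cochain_def tev2_def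
    by (simp add: sc additive_on_T(2)[OF tev_additive[OF S \<xi>]] tev_ttwist[OF S \<xi>, symmetric] tbracket_ttwist[OF br] ttwist_unit[OF D])
qed

context
  fixes f \<xi>
  assumes f: "\<And>a. a \<in> acar A \<Longrightarrow> lfun A (f a)" "\<And>a b. f a b = f b a"
    and \<xi>: "twisted_derivation D P f \<xi>"
begin

lemma \<xi>lin: "lfun D \<xi>" and \<xi>mul: "d \<in> acar D \<Longrightarrow> e \<in> acar D \<Longrightarrow>
    \<xi> (amul D d e) = aeps D d * \<xi> e + aeps D e * \<xi> d + f (P d) (P e)"
  using \<xi> by (auto simp: twisted_derivation_def)

lemma tev_act_twisted:
  assumes d: "d \<in> acar D" and t: "t \<in> T D"
  shows "tev D \<xi> (act L D d t) = scl L (aeps D d) (tev D \<xi> t) + scl L (\<xi> d) (teps L D t) + tev A (f (P d)) (tmap L D P t)"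
proof (rule T_ext[OF _ _ _ t, where F = "\<lambda>t. tev D \<xi> (act L D d t)"])
  note S = sub_alg[OF D] and S' = sub_alg[OF A]
  note fP = f(1)[OF aug_homD(1)[OF P d]]
  show "additive_on (T D) (\<lambda>t. tev D \<xi> (act L D d t))"
    by (rule additive_on_comp[OF tev_additive[OF S \<xi>lin] act_additive[OF D d] act_in[OF D d]])
  show "additive_on (T D) (\<lambda>t. scl L (aeps D d) (tev D \<xi> t) + scl L (\<xi> d) (teps L D t) + tev A (f (P d)) (tmap L D P t))"
    by (intro additive_on_intros tev_additive[OF S \<xi>lin] teps_additive[OF D]
        additive_on_comp[OF tev_additive[OF S' fP] tmap_hom_additive[OF D A P] tmap_hom_in[OF D A P]])
  show "tev D \<xi> (act L D d (tens L e l)) = scl L (aeps D d) (tev D \<xi> (tens L e l)) + scl L (\<xi> d) (teps L D (tens L e l))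
      + tev A (f (P d)) (tmap L D P (tens L e l))" if e: "e \<in> acar D" for e l
    using d e by (simp add: act_pure[OF D] tev_pure[OF S \<xi>lin] tev_pure[OF S' fP] teps_pure[OF D] aug_algebraD(3)[OF D]
        tmap_pure[OF S aug_homD(2)[OF P]] aug_homD(1)[OF P] \<xi>mul LV.scale_left_distrib mult.commute)
qed

lemma balanced_mul:
  "balanced A (\<lambda>a l. tev A (f a) (lam (unit_tens L A l) (unit_tens L A z)))"
  "balanced A (\<lambda>a l. tev A (f a) (lam (unit_tens L A z) (unit_tens L A l)))"
proof -
  note S' = sub_alg[OF A]
  note [simp] = tbracket_in[OF lam] unit_in[OF A]
  have fl: "f (a + b) c = f a c + f b c" "f (pw (*) k a) c = k * f a c" if "a \<in> acar A" "b \<in> acar A" "c \<in> acar A" for a b c k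
    using f that linear_onD[OF f(1)[of c]] by metis+
  have add: "tev A (f (a + b)) t = tev A (f a) t + tev A (f b) t" if "a \<in> acar A" "b \<in> acar A" "t \<in> T A" for a b t
  proof -
    have "tev A (f (a + b)) t = tev A (\<lambda>c. f a c + f b c) t"
      by (rule tev_cong[OF S' f(1)]) (use that fl K.subspace_add[OF S'] in auto)
    then show ?thesis using tev_add[OF S' f(1) f(1)] that by simp
  qed
  have scal: "tev A (f (pw (*) k a)) t = scl L k (tev A (f a) t)" if "a \<in> acar A" "t \<in> T A" for a k t
  proof -
    have "tev A (f (pw (*) k a)) t = tev A (\<lambda>c. k * f a c) t"
      by (rule tev_cong[OF S' f(1)]) (use that fl K.subspace_scale[OF S'] in auto)
    then show ?thesis using tev_scale[OF S' f(1)] that by simp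
  qed
  have scal': "tev A (f a) (pw (scl L) k t) = scl L k (tev A (f a) t)" if "a \<in> acar A" "t \<in> T A" for a k t
    by (rule T_ext[OF _ _ _ that(2), where F = "\<lambda>t. tev A (f a) (pw (scl L) k t)"])
      (use that in \<open>auto intro!: additive_on_comp[OF tev_additive[OF S' f(1)] additive_on_intros(11)[OF additive_on_intros(4)]]
        T_scale additive_on_intros tev_additive[OF S' f(1)] simp: tens_scale' tev_pure[OF S' f(1)] mult.commute\<close>)
  note lin = tbracket_cochain[OF A lam, unfolded bilinear_cochain_def]
  show "balanced A (\<lambda>a l. tev A (f a) (lam (unit_tens L A l) (unit_tens L A z)))"
    "balanced A (\<lambda>a l. tev A (f a) (lam (unit_tens L A z) (unit_tens L A l)))"
    unfolding balanced_def using lin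
    by (simp_all add: add scal scal' additive_on_T(2)[OF tev_additive[OF S' f(1)]])
qed

lemma tev_bracket_right:
  assumes s: "s \<in> T D"
  shows "tev D \<xi> (br s (unit_tens L D z)) = tev2 D br \<xi> (teps L D s) z + brk L (tev D \<xi> s) z + rmul A lam f (tmap L D P s) z"
proof (rule T_ext[OF _ _ _ s, where F = "\<lambda>s. tev D \<xi> (br s (unit_tens L D z))"])
  note S = sub_alg[OF D] and S' = sub_alg[OF A]
  note c2 = cochain2_tev2[OF \<xi>lin, unfolded cochain2_def bilinear_cochain_def]
  note [simp] = tbracket_in[OF br] unit_in[OF D] T_pure
  show "additive_on (T D) (\<lambda>s. tev D \<xi> (br s (unit_tens L D z)))"
    by (rule additive_on_comp[OF tev_additive[OF S \<xi>lin] tbracket_additive(1)[OF br]]) auto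
  have "additive_on (T D) (\<lambda>s. tev2 D br \<xi> (teps L D s) z)"
    using c2 by (simp add: additive_on_def additive_on_T(2)[OF teps_additive[OF D]])
  moreover have "additive_on (T D) (\<lambda>s. rmul A lam f (tmap L D P s) z)"
    unfolding rmul_def
    by (rule additive_on_comp[OF tensor_lift_additive[OF S' balanced_mul(1)] tmap_hom_additive[OF D A P] tmap_hom_in[OF D A P]])
  ultimately show "additive_on (T D) (\<lambda>s. tev2 D br \<xi> (teps L D s) z + brk L (tev D \<xi> s) z + rmul A lam f (tmap L D P s) z)"
    by (intro additive_on_intros tev_additive[OF S \<xi>lin])
  show "tev D \<xi> (br (tens L d l) (unit_tens L D z)) = tev2 D br \<xi> (teps L D (tens L d l)) z + brk L (tev D \<xi> (tens L d l)) z
      + rmul A lam f (tmap L D P (tens L d l)) z" if d: "d \<in> acar D" for d l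
  proof -
    have "br (tens L d l) (unit_tens L D z) = act L D d (br (unit_tens L D l) (unit_tens L D z))"
      using tbracket_act(1)[OF br d, of "unit_tens L D l"] d by (simp add: act_unit[OF D])
    moreover have "rmul A lam f (tens L (P d) l) z = tev A (f (P d)) (lam (unit_tens L A l) (unit_tens L A z))"
      unfolding rmul_def by (rule tensor_lift_pure[OF S' balanced_mul(1) aug_homD(1)[OF P d]])
    ultimately show ?thesis
      using d c2 by (simp add: tev_act_twisted lift_eps lift tmap_unit[OF D P] teps_pure[OF D] tev_pure[OF S \<xi>lin]
          tmap_pure[OF S aug_homD(2)[OF P]] brk_scl tev2_def[symmetric])
  qed
qed

lemma tev_bracket_left:
  assumes s: "s \<in> T D"
  shows "tev D \<xi> (br (unit_tens L D z) s) = tev2 D br \<xi> z (teps L D s) + brk L z (tev D \<xi> s) + lmul A lam f z (tmap L D P s)"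
proof (rule T_ext[OF _ _ _ s, where F = "\<lambda>s. tev D \<xi> (br (unit_tens L D z) s)"])
  note S = sub_alg[OF D] and S' = sub_alg[OF A]
  note c2 = cochain2_tev2[OF \<xi>lin, unfolded cochain2_def bilinear_cochain_def]
  note [simp] = tbracket_in[OF br] unit_in[OF D] T_pure
  show "additive_on (T D) (\<lambda>s. tev D \<xi> (br (unit_tens L D z) s))"
    by (rule additive_on_comp[OF tev_additive[OF S \<xi>lin] tbracket_additive(2)[OF br]]) auto
  have "additive_on (T D) (\<lambda>s. tev2 D br \<xi> z (teps L D s))"
    using c2 by (simp add: additive_on_def additive_on_T(2)[OF teps_additive[OF D]])
  moreover have "additive_on (T D) (\<lambda>s. lmul A lam f z (tmap L D P s))"
    unfolding lmul_def
    by (rule additive_on_comp[OF tensor_lift_additive[OF S' balanced_mul(2)] tmap_hom_additive[OF D A P] tmap_hom_in[OF D A P]])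
  ultimately show "additive_on (T D) (\<lambda>s. tev2 D br \<xi> z (teps L D s) + brk L z (tev D \<xi> s) + lmul A lam f z (tmap L D P s))"
    by (intro additive_on_intros tev_additive[OF S \<xi>lin])
  show "tev D \<xi> (br (unit_tens L D z) (tens L d l)) = tev2 D br \<xi> z (teps L D (tens L d l)) + brk L z (tev D \<xi> (tens L d l))
      + lmul A lam f z (tmap L D P (tens L d l))" if d: "d \<in> acar D" for d l
  proof -
    have "br (unit_tens L D z) (tens L d l) = act L D d (br (unit_tens L D z) (unit_tens L D l))"
      using tbracket_act(2)[OF br d, of "unit_tens L D z" "unit_tens L D l"] d by (simp add: act_unit[OF D])
    moreover have "lmul A lam f z (tens L (P d) l) = tev A (f (P d)) (lam (unit_tens L A z) (unit_tens L A l))"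
      unfolding lmul_def by (rule tensor_lift_pure[OF S' balanced_mul(2) aug_homD(1)[OF P d]])
    ultimately show ?thesis
      using d c2 by (simp add: tev_act_twisted lift_eps lift tmap_unit[OF D P] teps_pure[OF D] tev_pure[OF S \<xi>lin]
          tmap_pure[OF S aug_homD(2)[OF P]] brk_scl tev2_def[symmetric])
  qed
qed

text \<open>The lift \<open>br\<close> and the algebra \<open>D\<close> enter the value of a twisted derivation on the obstruction only through a coboundary; the other
  term depends on \<open>lam\<close> and the twist alone.  Therefore obstructions over different algebras can be compared as soon as
  they carry derivations with the same twist.  Existence and uniqueness of extensions follow from this comparison, and
  so does the vanishing of the obstruction at classes realised by a deformation.\<close>

lemma tev_obstruction:
  "tev D \<xi> (obstruction_cochain L D br x y z) = d2 (tev2 D br \<xi>) x y z + defect A lam f x y z"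
proof -
  note S = sub_alg[OF D]
  note [simp] = tbracket_in[OF br] unit_in[OF D]
  show ?thesis
    unfolding obstruction_cochain_def Let_def
    by (simp add: additive_on_T(2,3)[OF tev_additive[OF S \<xi>lin]] T_diff tev_bracket_right tev_bracket_left
        lift_eps lift tmap_unit[OF D P] tev2_def[symmetric] d2_def defect_def)
qed

end

end

end

section \<open>Extending deformations along surjections with small kernel\<close>

context hom_leibniz
begin

lemma T_scale_additive: "additive_on (T A) (\<lambda>t. pw (scl L) c t)"
  by (rule additive_on_intros(11)[OF additive_on_intros(4)])

lemma tens_scalar: "tens L (pw (*) c a) l = pw (scl L) c (tens L a l)"
  by (simp add: tens_scale tens_scale')

lemma tens_sum_tev:
  assumes "sub A" "lfun A \<xi>" "\<And>i. i < r \<Longrightarrow> n i \<in> acar A"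
  shows "tev A \<xi> (\<Sum>i<r. tens L (n i) (l i)) = (\<Sum>i<r. scl L (\<xi> (n i)) (l i))"
proof -
  have "tev A \<xi> (\<Sum>i<r. tens L (n i) (l i)) = (\<Sum>i<r. tev A \<xi> (tens L (n i) (l i)))"
    by (rule additive_on_T(5)[OF tev_additive[OF assms(1,2)]]) (simp add: T_pure assms(3))
  also have "\<dots> = (\<Sum>i<r. scl L (\<xi> (n i)) (l i))"
    by (rule sum.cong) (simp_all add: tev_pure[OF assms(1,2)] assms(3))
  finally show ?thesis .
qed

context
  fixes D :: "('k, 'j) aug_alg" and A :: "('k, 'i) aug_alg" and P
  assumes D: "aug_algebra D" and A: "aug_algebra A" and P: "aug_hom D A P" and surj: "P ` acar D = acar A"
    and small: "small_kernel D P"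
begin

lemma kernel_mul: "d \<in> acar D \<Longrightarrow> n \<in> acar D \<Longrightarrow> P n = 0 \<Longrightarrow> amul D d n = pw (*) (aeps D d) n"
  "d \<in> acar D \<Longrightarrow> n \<in> acar D \<Longrightarrow> P n = 0 \<Longrightarrow> amul D n d = pw (*) (aeps D d) n"
  using small aug_algebraD(5)[OF D] by (auto simp: small_kernel_def)

lemma kernel_eps: "n \<in> acar D \<Longrightarrow> P n = 0 \<Longrightarrow> aeps D n = 0"
  using aug_homD(5)[OF P] aeps_zero[OF A] by metis

lemma kernel_tmap: "n \<in> acar D \<Longrightarrow> P n = 0 \<Longrightarrow> tmap L D P (tens L n l) = 0"
  by (simp add: tmap_pure[OF sub_alg[OF D] aug_homD(2)[OF P]] tens_zero)

lemma act_on_kernel: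
  assumes "d \<in> acar D" "t \<in> T D" "tmap L D P t = 0"
  shows "act L D d t = pw (scl L) (aeps D d) t"
  by (rule T_kernel_ext[OF D A P surj act_additive[OF D assms(1)] T_scale_additive _ assms(2,3)])
    (use assms(1) in \<open>simp add: act_pure[OF D] kernel_mul tens_scalar\<close>)

lemma act_by_kernel:
  assumes "n \<in> acar D" "P n = 0" "t \<in> T D"
  shows "act L D n t = tens L n (teps L D t)"
  by (rule T_ext[OF act_additive[OF D assms(1)] _ _ assms(3)])
    (use assms in \<open>auto intro!: additive_on_intros teps_additive[OF D] simp: act_pure[OF D] kernel_mul teps_pure[OF D] tens_scale\<close>)

lemma teps_kernel: "t \<in> T D \<Longrightarrow> tmap L D P t = 0 \<Longrightarrow> teps L D t = 0"
  using teps_tmap[OF D A P, of t] additive_on_T(1)[OF teps_additive[OF A]] by simp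

lemma bracket_kernel:
  assumes br: "tbracket D br" and eps: "\<And>x y. teps L D (br (unit_tens L D x) (unit_tens L D y)) = brk L x y"
    and n: "n \<in> acar D" "P n = 0" and s: "s \<in> T D"
  shows "br s (tens L n l) = tens L n (brk L (teps L D s) l)"
    and "br (tens L n l) s = tens L n (brk L l (teps L D s))"
proof -
  have n': "tens L n l = act L D n (unit_tens L D l)" using n by (simp add: act_unit[OF D])
  have "br s (tens L n l) = act L D n (br s (unit_tens L D l))" "br (tens L n l) s = act L D n (br (unit_tens L D l) s)"
    unfolding n' using n s by (simp_all only: tbracket_act[OF br] unit_in[OF D])
  then show "br s (tens L n l) = tens L n (brk L (teps L D s) l)" "br (tens L n l) s = tens L n (brk L l (teps L D s))"
    using n s by (simp_all add: unit_in[OF D] act_by_kernel tbracket_in[OF br]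
        teps_bracket[OF D br eps] teps_unit[OF D])
qed

context
  fixes lam br
  assumes lam: "deformation L A lam" and br: "tbracket D br"
    and lift: "\<And>s t. s \<in> T D \<Longrightarrow> t \<in> T D \<Longrightarrow> tmap L D P (br s t) = lam (tmap L D P s) (tmap L D P t)"
begin

lemma lift_teps: "teps L D (br (unit_tens L D x) (unit_tens L D y)) = brk L x y"
  by (rule lift_eps[OF D A P deformationD(2,4)[OF lam] br lift])

lemma obstruction_in_kernel: "tmap L D P (obstruction_cochain L D br x y z) = 0"
  by (simp add: obstruction_tmap[OF D A P br lift] deformationD(3)[OF lam])

lemma obstruction_trilinear:
  "obstruction_cochain L D br (x + x') y z = obstruction_cochain L D br x y z + obstruction_cochain L D br x' y z"
  "obstruction_cochain L D br x (y + y') z = obstruction_cochain L D br x y z + obstruction_cochain L D br x y' z"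
  "obstruction_cochain L D br x y (z + z') = obstruction_cochain L D br x y z + obstruction_cochain L D br x y z'"
  "obstruction_cochain L D br (scl L c x) y z = pw (scl L) c (obstruction_cochain L D br x y z)"
  "obstruction_cochain L D br x (scl L c y) z = pw (scl L) c (obstruction_cochain L D br x y z)"
  "obstruction_cochain L D br x y (scl L c z) = pw (scl L) c (obstruction_cochain L D br x y z)"
proof -
  have c: "pw (*) c (aone D) \<in> acar D" for c
    using aug_algebraD(1,2)[OF D] by (rule K.subspace_scale)
  note u = unit_in[OF D]
  have s: "unit_tens L D (scl L c x) = act L D (pw (*) c (aone D)) (unit_tens L D x)" for c x
    by (simp add: unit_scale scale_act[OF D u])
  show "obstruction_cochain L D br (x + x') y z = obstruction_cochain L D br x y z + obstruction_cochain L D br x' y z"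
    "obstruction_cochain L D br x (y + y') z = obstruction_cochain L D br x y z + obstruction_cochain L D br x y' z"
    "obstruction_cochain L D br x y (z + z') = obstruction_cochain L D br x y z + obstruction_cochain L D br x y z'"
    unfolding jac_unit[OF D br, symmetric] tens_add
    by (simp_all add: additive_on_T(2)[OF jac_additive(1)[OF D br]] additive_on_T(2)[OF jac_additive(2)[OF D br]]
        additive_on_T(2)[OF jac_additive(3)[OF D br]] u)
  show "obstruction_cochain L D br (scl L c x) y z = pw (scl L) c (obstruction_cochain L D br x y z)"
    "obstruction_cochain L D br x (scl L c y) z = pw (scl L) c (obstruction_cochain L D br x y z)"
    "obstruction_cochain L D br x y (scl L c z) = pw (scl L) c (obstruction_cochain L D br x y z)"
    unfolding jac_unit[OF D br, symmetric] s
    by (simp_all add: jac_act[OF D br] c u scale_act[OF D jac_in[OF D br]])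
qed

text \<open>Since the obstruction lies over the kernel, it is not affected by the maximal ideal.\<close>

lemma jac_teps:
  assumes stu: "s \<in> T D" "t \<in> T D" "u \<in> T D"
  shows "jac D br s t u = obstruction_cochain L D br (teps L D s) (teps L D t) (teps L D u)"
proof -
  note u = unit_in[OF D]
  note add = additive_on_comp[OF _ teps_additive[OF D], where S' = UNIV, simplified]
  have o: "additive_on UNIV (\<lambda>x. obstruction_cochain L D br x y z)" "additive_on UNIV (\<lambda>x. obstruction_cochain L D br y x z)"
      "additive_on UNIV (obstruction_cochain L D br y z)" for y z
    by (simp_all add: additive_on_def obstruction_trilinear)
  have scal: "act L D a (obstruction_cochain L D br x y z) = pw (scl L) (aeps D a) (obstruction_cochain L D br x y z)"
    if "a \<in> acar D" for a x y z
    by (rule act_on_kernel[OF that obstruction_in[OF D A P br] obstruction_in_kernel])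
  have step1: "jac D br (unit_tens L D x) (unit_tens L D y) u = obstruction_cochain L D br x y (teps L D u)"
    if "u \<in> T D" for x y u
  proof (rule T_ext[OF jac_additive(3)[OF D br u u] add[OF o(3)] _ that])
    fix a l assume a: "a \<in> acar D"
    show "jac D br (unit_tens L D x) (unit_tens L D y) (tens L a l) = obstruction_cochain L D br x y (teps L D (tens L a l))"
      using jac_act(3)[OF D br a u u u, of x y l] a
      by (simp add: act_unit[OF D] jac_unit[OF D br] scal teps_pure[OF D] obstruction_trilinear)
  qed
  have scal2: "act L D a (jac D br (unit_tens L D x) (unit_tens L D y) u) = pw (scl L) (aeps D a) (jac D br (unit_tens L D x) (unit_tens L D y) u)"
    if "a \<in> acar D" "u \<in> T D" for a x y u
    using that by (simp add: step1 scal)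
  have step2: "jac D br (unit_tens L D x) t u = obstruction_cochain L D br x (teps L D t) (teps L D u)"
    if "t \<in> T D" "u \<in> T D" for x t u
  proof (rule T_ext[OF jac_additive(2)[OF D br unit_in[OF D] that(2)] add[OF o(2)] _ that(1)])
    fix a l assume a: "a \<in> acar D"
    show "jac D br (unit_tens L D x) (tens L a l) u = obstruction_cochain L D br x (teps L D (tens L a l)) (teps L D u)"
      using jac_act(2)[OF D br a unit_in[OF D] unit_in[OF D] that(2), of x l] a that
      by (simp add: act_unit[OF D] step1 scal teps_pure[OF D] obstruction_trilinear)
  qed
  show ?thesis
  proof (rule T_ext[OF jac_additive(1)[OF D br stu(2,3)] add[OF o(1)] _ stu(1)])
    fix a l assume a: "a \<in> acar D"
    show "jac D br (tens L a l) t u = obstruction_cochain L D br (teps L D (tens L a l)) (teps L D t) (teps L D u)"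
      using jac_act(1)[OF D br a unit_in[OF D] stu(2,3), of l] a stu
      by (simp add: act_unit[OF D] step2 scal teps_pure[OF D] obstruction_trilinear)
  qed
qed

lemma tev_bracket_kernel:
  assumes \<xi>: "lfun D \<xi>" and s: "s \<in> T D" and t: "t \<in> T D" "tmap L D P t = 0"
  shows "tev D \<xi> (br s t) = brk L (teps L D s) (tev D \<xi> t)" "tev D \<xi> (br t s) = brk L (tev D \<xi> t) (teps L D s)"
proof -
  note S = sub_alg[OF D]
  show "tev D \<xi> (br s t) = brk L (teps L D s) (tev D \<xi> t)"
    by (rule T_kernel_ext[OF D A P surj _ _ _ t, where F = "\<lambda>t. tev D \<xi> (br s t)"])
      (use s in \<open>auto intro!: additive_on_comp[OF tev_additive[OF S \<xi>] tbracket_additive(2)[OF br]] tbracket_in[OF br]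
        additive_on_intros tev_additive[OF S \<xi>] simp: bracket_kernel[OF br lift_teps] tev_pure[OF S \<xi>] brk_scl\<close>)
  show "tev D \<xi> (br t s) = brk L (tev D \<xi> t) (teps L D s)"
    by (rule T_kernel_ext[OF D A P surj _ _ _ t, where F = "\<lambda>t. tev D \<xi> (br t s)"])
      (use s in \<open>auto intro!: additive_on_comp[OF tev_additive[OF S \<xi>] tbracket_additive(1)[OF br]] tbracket_in[OF br]
        additive_on_intros tev_additive[OF S \<xi>] simp: bracket_kernel[OF br lift_teps] tev_pure[OF S \<xi>] brk_scl\<close>)
qed

lemma tev_scalar:
  assumes \<xi>: "lfun D \<xi>" and t: "t \<in> T D"
  shows "tev D \<xi> (pw (scl L) c t) = scl L c (tev D \<xi> t)"
  by (rule T_ext[OF _ _ _ t, where F = "\<lambda>t. tev D \<xi> (pw (scl L) c t)"])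
    (auto intro!: additive_on_comp[OF tev_additive[OF sub_alg[OF D] \<xi>] T_scale_additive] T_scale
      additive_on_intros tev_additive[OF sub_alg[OF D] \<xi>] simp: tens_scale' tev_pure[OF sub_alg[OF D] \<xi>] mult.commute)

lemma obstruction_cocycle:
  assumes \<xi>: "lfun D \<xi>"
  shows "list3 (\<lambda>x y z. tev D \<xi> (obstruction_cochain L D br x y z)) \<in> cocycles L 3"
proof (rule cocycles3_list)
  note S = sub_alg[OF D] and oin = obstruction_in[OF D A P br]
  note ta = additive_on_T[OF tev_additive[OF S \<xi>]]
  fix x x' y y' z z' w c
  show "tev D \<xi> (obstruction_cochain L D br (x + x') y z) =
         tev D \<xi> (obstruction_cochain L D br x y z) + tev D \<xi> (obstruction_cochain L D br x' y z) \<and>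
       tev D \<xi> (obstruction_cochain L D br (scl L c x) y z) = scl L c (tev D \<xi> (obstruction_cochain L D br x y z))"
    "tev D \<xi> (obstruction_cochain L D br x (y + y') z) =
         tev D \<xi> (obstruction_cochain L D br x y z) + tev D \<xi> (obstruction_cochain L D br x y' z) \<and>
       tev D \<xi> (obstruction_cochain L D br x (scl L c y) z) = scl L c (tev D \<xi> (obstruction_cochain L D br x y z))"
    "tev D \<xi> (obstruction_cochain L D br x y (z + z')) =
         tev D \<xi> (obstruction_cochain L D br x y z) + tev D \<xi> (obstruction_cochain L D br x y z') \<and>
       tev D \<xi> (obstruction_cochain L D br x y (scl L c z)) = scl L c (tev D \<xi> (obstruction_cochain L D br x y z))"
    by (simp_all add: obstruction_trilinear ta(2) oin tev_scalar[OF \<xi>])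
  show "twist L (tev D \<xi> (obstruction_cochain L D br x y z)) =
      tev D \<xi> (obstruction_cochain L D br (twist L x) (twist L y) (twist L z))"
    by (simp add: tev_ttwist[OF S \<xi> oin, symmetric] obstruction_ttwist[OF D br])
  note u = unit_in[OF D]
  have zero: "tev D \<xi> 0 = 0" by (rule ta(1))
  show "brk L (twist L (twist L x)) (tev D \<xi> (obstruction_cochain L D br y z w))
    + brk L (tev D \<xi> (obstruction_cochain L D br x z w)) (twist L (twist L y))
    - brk L (tev D \<xi> (obstruction_cochain L D br x y w)) (twist L (twist L z))
    + brk L (tev D \<xi> (obstruction_cochain L D br x y z)) (twist L (twist L w))
    - tev D \<xi> (obstruction_cochain L D br (brk L x y) (twist L z) (twist L w))
    + tev D \<xi> (obstruction_cochain L D br (brk L x z) (twist L y) (twist L w))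
    + tev D \<xi> (obstruction_cochain L D br (twist L x) (brk L y z) (twist L w))
    - tev D \<xi> (obstruction_cochain L D br (brk L x w) (twist L y) (twist L z))
    - tev D \<xi> (obstruction_cochain L D br (twist L x) (brk L y w) (twist L z))
    - tev D \<xi> (obstruction_cochain L D br (twist L x) (twist L y) (brk L z w)) = 0"
    using arg_cong[OF jac_cocycle[OF D br u u u u, of x y z w], of "tev D \<xi>"]
    by (simp add: zero jac_teps u ttwist_unit[OF D] teps_unit[OF D] lift_teps tbracket_in[OF br] oin
        ta(2,3) T_add T_diff tev_bracket_kernel[OF \<xi>] obstruction_in_kernel)
qed

end

text \<open>The coordinates on the kernel are chosen as restrictions of twisted derivations, so that obstructions can be compared coordinatewise.\<close>

lemma frame_of_kernel:
  assumes fin: "finite_dim (pw (*)) {d \<in> acar D. P d = 0}"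
  obtains r :: nat and n \<xi> f where "\<And>i. i < r \<Longrightarrow> n i \<in> acar D" "\<And>i. i < r \<Longrightarrow> P (n i) = 0"
    "\<And>i. i < r \<Longrightarrow> f i \<in> harr_cocycles A" "\<And>i. i < r \<Longrightarrow> twisted_derivation D P (f i) (\<xi> i)"
    "\<And>i j. i < r \<Longrightarrow> j < r \<Longrightarrow> \<xi> i (n j) = (if i = j then 1 else 0)"
    "\<And>x. x \<in> acar D \<Longrightarrow> P x = 0 \<Longrightarrow> x = (\<Sum>i<r. pw (*) (\<xi> i x) (n i))"
proof -
  obtain r :: nat and n \<zeta> where fr: "\<And>i. i < r \<Longrightarrow> n i \<in> {d \<in> acar D. P d = 0}"
    "\<And>i. i < r \<Longrightarrow> Vector_Spaces.linear (pw (*)) (*) (\<zeta> i)"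
    "\<And>i j. i < r \<Longrightarrow> j < r \<Longrightarrow> \<zeta> i (n j) = (if i = j then 1 else 0)"
    "\<And>x. x \<in> {d \<in> acar D. P d = 0} \<Longrightarrow> x = (\<Sum>i<r. pw (*) (\<zeta> i x) (n i))"
  proof (rule K.frame_exists[OF fin], goal_cases)
    case 1
    from 1(2-) show ?case by (rule 1(1))
  qed
  have "\<exists>f \<xi>. f \<in> harr_cocycles A \<and> twisted_derivation D P f \<xi> \<and> (\<forall>n\<in>acar D. P n = 0 \<longrightarrow> \<xi> n = \<zeta> i n)" if "i < r" for i
  proof -
    have lf: "lfun D (\<zeta> i)" by (rule linear_imp_linear_on[OF fr(2)[OF that]])
    have "\<zeta> i (amul D d n) = aeps D d * \<zeta> i n" if "d \<in> acar D" "n \<in> acar D" "P n = 0" for d n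
      using that linear_onD(2)[OF lf] by (simp add: kernel_mul)
    then obtain f where f: "f \<in> harr_cocycles A" "\<And>f'. f' - f \<in> harr_coboundaries A \<Longrightarrow>
      \<exists>\<xi>'. twisted_derivation D P f' \<xi>' \<and> (\<forall>n\<in>acar D. P n = 0 \<longrightarrow> \<xi>' n = \<zeta> i n)"
      using extend_to_twisted_derivation[OF D A P surj lf] by metis
    have "f - f \<in> harr_coboundaries A"
      unfolding harr_coboundaries_def by (auto intro!: exI[of _ "\<lambda>_. 0"] simp: linear_on_def fun_eq_iff pointwise)
    then show ?thesis using f by blast
  qed
  then obtain f \<xi> where *: "\<And>i. i < r \<Longrightarrow> f i \<in> harr_cocycles A \<and> twisted_derivation D P (f i) (\<xi> i) \<and>
      (\<forall>n\<in>acar D. P n = 0 \<longrightarrow> \<xi> i n = \<zeta> i n)" by metis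
  show thesis
  proof (rule that[of r n f \<xi>])
    show "\<xi> i (n j) = (if i = j then 1 else 0)" if "i < r" "j < r" for i j
      using *[OF that(1)] fr(1)[OF that(2)] fr(3)[OF that] by simp
    show "x = (\<Sum>i<r. pw (*) (\<xi> i x) (n i))" if "x \<in> acar D" "P x = 0" for x
    proof -
      have "x = (\<Sum>i<r. pw (*) (\<zeta> i x) (n i))" using fr(4) that by blast
      also have "\<dots> = (\<Sum>i<r. pw (*) (\<xi> i x) (n i))" using * that by (intro sum.cong) auto
      finally show ?thesis .
    qed
  qed (use fr * in auto)
qed

text \<open>Subtract from the lifted bracket, over a basis of the kernel, the cochains whose coboundaries are the coordinates of the obstruction.
  The bracket changes over the kernel only, hence the defects in the coordinates of the obstruction remain the same, and the coordinates change by
  exactly these coboundaries.\<close>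

lemma deformation_extends:
  assumes fin: "finite_dim (pw (*)) {d \<in> acar D. P d = 0}"
    and lam: "deformation L A lam" and br: "tbracket D br"
    and lift: "\<And>s t. s \<in> T D \<Longrightarrow> t \<in> T D \<Longrightarrow> tmap L D P (br s t) = lam (tmap L D P s) (tmap L D P t)"
    and exact: "\<And>\<xi>. lfun D \<xi> \<Longrightarrow> \<exists>\<beta>. cochain2 \<beta> \<and> (\<forall>x y z. tev D \<xi> (obstruction_cochain L D br x y z) = d2 \<beta> x y z)"
  obtains \<mu> where "is_pushout L D A P \<mu> lam"
proof -
  note S = sub_alg[OF D]
  obtain r :: nat and n \<xi> f where n: "\<And>i. i < r \<Longrightarrow> n i \<in> acar D" "\<And>i. i < r \<Longrightarrow> P (n i) = 0"
    and f: "\<And>i. i < r \<Longrightarrow> f i \<in> harr_cocycles A" and \<xi>: "\<And>i. i < r \<Longrightarrow> twisted_derivation D P (f i) (\<xi> i)"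
    and delta: "\<And>i j. i < r \<Longrightarrow> j < r \<Longrightarrow> \<xi> i (n j) = (if i = j then 1 else 0)"
    and basis: "\<And>x. x \<in> acar D \<Longrightarrow> P x = 0 \<Longrightarrow> x = (\<Sum>i<r. pw (*) (\<xi> i x) (n i))"
  proof (rule frame_of_kernel[OF fin], goal_cases)
    case 1
    from 1(2-) show ?case by (rule 1(1))
  qed
  have \<xi>l: "lfun D (\<xi> i)" if "i < r" for i using \<xi>[OF that] by (simp add: twisted_derivation_def)
  obtain \<beta> where \<beta>: "\<And>i. i < r \<Longrightarrow> cochain2 (\<beta> i)"
    "\<And>i x y z. i < r \<Longrightarrow> tev D (\<xi> i) (obstruction_cochain L D br x y z) = d2 (\<beta> i) x y z"
    using exact[OF \<xi>l] by metis
  define \<psi> where "\<psi> x y = br (unit_tens L D x) (unit_tens L D y) - (\<Sum>i<r. tens L (n i) (\<beta> i x y))" for x y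
  have sumT: "(\<Sum>i<r. tens L (n i) (\<beta> i x y)) \<in> T D" for x y
    by (rule T_sum) (simp add: T_pure n)
  have brT: "br (unit_tens L D x) (unit_tens L D y) \<in> T D" for x y
    by (simp add: tbracket_in[OF br] unit_in[OF D])
  have "\<exists>\<mu>. tbracket D \<mu> \<and> (\<forall>x y. \<mu> (unit_tens L D x) (unit_tens L D y) = \<psi> x y)"
  proof (rule tbracket_extend[OF D])
    have b: "bilinear_cochain (pw (scl L)) (\<lambda>x y. \<Sum>i<r. tens L (n i) (\<beta> i x y))"
      using \<beta>(1) unfolding cochain2_def bilinear_cochain_def
      by (auto simp: tens_add tens_scale'[symmetric] sum.distrib intro!: sum.cong)
        (auto simp: pw_def fun_eq_iff sum_apply LV.scale_sum_right)
    show "bilinear_cochain (pw (scl L)) \<psi>"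
      using b tbracket_cochain[OF D br] unfolding bilinear_cochain_def \<psi>_def
      by (simp add: algebra_simps) (simp add: pw_def fun_eq_iff pointwise LV.scale_right_diff_distrib)
    show "\<psi> x y \<in> T D" for x y unfolding \<psi>_def by (rule T_diff[OF brT sumT])
    show "ttwist L D (\<psi> x y) = \<psi> (twist L x) (twist L y)" for x y
    proof -
      have "ttwist L D (\<Sum>i<r. tens L (n i) (\<beta> i x y)) = (\<Sum>i<r. ttwist L D (tens L (n i) (\<beta> i x y)))"
        by (rule additive_on_T(5)[OF ttwist_additive[OF S]]) (simp add: T_pure n)
      also have "\<dots> = (\<Sum>i<r. tens L (n i) (\<beta> i (twist L x) (twist L y)))"
        using \<beta>(1) by (intro sum.cong) (auto simp: ttwist_pure[OF S] n cochain2_def)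
      finally show ?thesis
        unfolding \<psi>_def by (simp add: additive_on_T(3)[OF ttwist_additive[OF S]] brT sumT
            tbracket_ttwist[OF br] unit_in[OF D] ttwist_unit[OF D])
    qed
  qed blast
  then obtain \<mu> where \<mu>: "tbracket D \<mu>" "\<And>x y. \<mu> (unit_tens L D x) (unit_tens L D y) = \<psi> x y"
    by blast
  have "tmap L D P (\<Sum>i<r. tens L (n i) (\<beta> i x y)) = (\<Sum>i<r. tmap L D P (tens L (n i) (\<beta> i x y)))" for x y
    by (rule additive_on_T(5)[OF tmap_hom_additive[OF D A P]]) (simp add: T_pure n)
  then have sum0: "tmap L D P (\<Sum>i<r. tens L (n i) (\<beta> i x y)) = 0" for x y
    by (simp add: kernel_tmap n)
  have \<mu>P: "lam (unit_tens L A x) (unit_tens L A y) = tmap L D P (\<mu> (unit_tens L D x) (unit_tens L D y))" for x y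
    unfolding \<mu>(2) \<psi>_def
    by (simp add: additive_on_T(3)[OF tmap_hom_additive[OF D A P]] brT sumT sum0 lift unit_in[OF D] tmap_unit[OF D P])
  note \<mu>lift = tbracket_tmap[OF D A P \<mu>(1) deformationD(2)[OF lam] \<mu>P]
  have "obstruction_cochain L D \<mu> x y z = 0" for x y z
  proof -
    have zero: "tev D (\<xi> i) (obstruction_cochain L D \<mu> x y z) = 0" if i: "i < r" for i
    proof -
      note fi = f[OF i]
      have f1: "\<And>a. a \<in> acar A \<Longrightarrow> lfun A (f i a)" "\<And>a b. f i a b = f i b a"
        using fi by (auto simp: harr_cocycles_def)
      have t2: "tev2 D \<mu> (\<xi> i) = (\<lambda>x y. tev2 D br (\<xi> i) x y - \<beta> i x y)"
      proof (intro ext)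
        fix x y
        have "(\<Sum>j<r. scl L (\<xi> i (n j)) (\<beta> j x y)) = (\<Sum>j<r. if j = i then \<beta> i x y else 0)"
          using i by (intro sum.cong) (auto simp: delta)
        then show "tev2 D \<mu> (\<xi> i) x y = tev2 D br (\<xi> i) x y - \<beta> i x y"
          unfolding tev2_def \<mu>(2) \<psi>_def using i
          by (simp add: additive_on_T(3)[OF tev_additive[OF S \<xi>l[OF i]]] brT sumT tens_sum_tev[OF S \<xi>l[OF i]] n)
      qed
      have "tev D (\<xi> i) (obstruction_cochain L D \<mu> x y z) = d2 (tev2 D \<mu> (\<xi> i)) x y z + defect A lam (f i) x y z"
        by (rule tev_obstruction[OF D A P deformationD(2,4)[OF lam] \<mu>(1) \<mu>lift f1 \<xi>[OF i]])
      also have "\<dots> = (d2 (tev2 D br (\<xi> i)) x y z + defect A lam (f i) x y z) - d2 (\<beta> i) x y z"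
        unfolding t2 d2_diff by simp
      also have "\<dots> = tev D (\<xi> i) (obstruction_cochain L D br x y z) - d2 (\<beta> i) x y z"
        by (simp add: tev_obstruction[OF D A P deformationD(2,4)[OF lam] br lift f1 \<xi>[OF i]])
      finally show ?thesis by (simp add: \<beta>(2)[OF i])
    qed
    have "obstruction_cochain L D \<mu> x y z = (\<Sum>i<r. tens L (n i) (tev D (\<xi> i) (obstruction_cochain L D \<mu> x y z)))"
      by (rule kernel_decomposition[OF D A P surj n(1) \<xi>l basis obstruction_in[OF D A P \<mu>(1)]
            obstruction_in_kernel[OF lam \<mu>(1) \<mu>lift]])
    also have "\<dots> = 0" by (simp add: zero tens_zero)
    finally show ?thesis .
  qed
  then have "deformation L D \<mu>"
    by (intro deformationI[OF D \<mu>(1)] lift_teps[OF lam \<mu>(1) \<mu>lift]) auto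
  then have "is_pushout L D A P \<mu> lam"
    using P lam \<mu>P by (simp add: is_pushout_def)
  then show thesis by (rule that)
qed

text \<open>Two extensions of \<open>lam\<close> differ by \<open>2\<close>-cochains over the kernel, one for each coordinate, and these are cocycles because both
  obstructions vanish and have the same defect.  If every class of \<open>2\<close>-cocycles is the image of \<open>lam\<close> under a derivation
  \<open>\<theta>\<close> of \<open>A\<close>, the automorphism \<open>d + \<Sum> \<theta>\<^sub>i(P d) n\<^sub>i\<close> of the extension makes the differences coboundaries of \<open>1\<close>-cochains \<open>\<gamma>\<^sub>i\<close>, and
  the equivalence \<open>t + \<Sum> n\<^sub>i \<otimes> \<gamma>\<^sub>i((\<epsilon> \<otimes> id) t)\<close> removes them.\<close>

lemma extension_unique:
  assumes fin: "finite_dim (pw (*)) {d \<in> acar D. P d = 0}"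
    and mu: "is_pushout L D A P \<mu> lam" and mu': "is_pushout L D A P \<mu>' lam"
    and deriv: "\<And>\<phi>. \<phi> \<in> cocycles L 2 \<Longrightarrow> \<exists>\<theta> \<gamma>. twisted_derivation A (\<lambda>a. a) (\<lambda>_ _. 0) \<theta> \<and> cochain1 \<gamma> \<and>
      (\<forall>x y. tev A \<theta> (lam (unit_tens L A x) (unit_tens L A y)) = \<phi> [x, y] + d1 \<gamma> x y)"
  obtains u \<nu> where "aug_iso D D u" "\<And>n. n \<in> acar D \<Longrightarrow> P n = 0 \<Longrightarrow> u n = n" "\<And>d. d \<in> acar D \<Longrightarrow> P (u d) = P d"
    "is_pushout L D D u \<mu> \<nu>" "equivalent_deformations L D \<nu> \<mu>'"
proof -
  interpret KF: vector_space_pair "pw ((*) :: 'k \<Rightarrow> 'k \<Rightarrow> 'k)" "(*)"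
    by (rule vector_space_pair_times[OF vector_space_pw_times])
  note S = sub_alg[OF D] and S' = sub_alg[OF A]
  have defs: "deformation L D \<mu>" "deformation L D \<mu>'" "deformation L A lam"
    using mu mu' by (simp_all add: is_pushout_def)
  note br = deformationD(2)[OF defs(1)] and br' = deformationD(2)[OF defs(2)]
  note lift = is_pushout_tmap[OF mu] and lift' = is_pushout_tmap[OF mu']
  obtain r :: nat and n \<xi> f where n: "\<And>i. i < r \<Longrightarrow> n i \<in> acar D" "\<And>i. i < r \<Longrightarrow> P (n i) = 0"
    and f: "\<And>i. i < r \<Longrightarrow> f i \<in> harr_cocycles A" and \<xi>: "\<And>i. i < r \<Longrightarrow> twisted_derivation D P (f i) (\<xi> i)"
    and delta: "\<And>i j. i < r \<Longrightarrow> j < r \<Longrightarrow> \<xi> i (n j) = (if i = j then 1 else 0)"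
    and basis: "\<And>x. x \<in> acar D \<Longrightarrow> P x = 0 \<Longrightarrow> x = (\<Sum>i<r. pw (*) (\<xi> i x) (n i))"
  proof (rule frame_of_kernel[OF fin], goal_cases)
    case 1
    from 1(2-) show ?case by (rule 1(1))
  qed
  have \<xi>l: "lfun D (\<xi> i)" if "i < r" for i using \<xi>[OF that] by (simp add: twisted_derivation_def)
  define \<chi> where "\<chi> i x y = tev2 D \<mu>' (\<xi> i) x y - tev2 D \<mu> (\<xi> i) x y" for i x y
  have \<chi>: "list2 (\<chi> i) \<in> cocycles L 2" if i: "i < r" for i
  proof (rule cocycles2_list)
    have f1: "\<And>a. a \<in> acar A \<Longrightarrow> lfun A (f i a)" "\<And>a b. f i a b = f i b a"
      using f[OF i] by (auto simp: harr_cocycles_def)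
    show "cochain2 (\<chi> i)" unfolding \<chi>_def
      by (intro cochain2_combination cochain2_tev2[OF D A P deformationD(2,4)[OF defs(3)] br lift \<xi>l[OF i]]
          cochain2_tev2[OF D A P deformationD(2,4)[OF defs(3)] br' lift' \<xi>l[OF i]])
    fix x y z
    have z: "tev D (\<xi> i) 0 = 0" by (rule additive_on_T(1)[OF tev_additive[OF S \<xi>l[OF i]]])
    have "d2 (tev2 D \<mu> (\<xi> i)) x y z + defect A lam (f i) x y z = 0"
      using tev_obstruction[OF D A P deformationD(2,4)[OF defs(3)] br lift f1 \<xi>[OF i], of x y z]
      unfolding deformationD(3)[OF defs(1)] z by (rule sym)
    moreover have "d2 (tev2 D \<mu>' (\<xi> i)) x y z + defect A lam (f i) x y z = 0"
      using tev_obstruction[OF D A P deformationD(2,4)[OF defs(3)] br' lift' f1 \<xi>[OF i], of x y z]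
      unfolding deformationD(3)[OF defs(2)] z by (rule sym)
    ultimately show "d2 (\<chi> i) x y z = 0"
      unfolding \<chi>_def d2_diff by (metis add_right_cancel eq_iff_diff_eq_0)
  qed
  obtain \<theta> \<gamma> where \<theta>: "\<And>i. i < r \<Longrightarrow> twisted_derivation A (\<lambda>a. a) (\<lambda>_ _. 0) (\<theta> i)"
    and \<gamma>: "\<And>i. i < r \<Longrightarrow> cochain1 (\<gamma> i)"
    and \<theta>\<gamma>: "\<And>i x y. i < r \<Longrightarrow> tev A (\<theta> i) (lam (unit_tens L A x) (unit_tens L A y)) = \<chi> i x y + d1 (\<gamma> i) x y"
  proof -
    have "\<exists>\<theta> \<gamma>. twisted_derivation A (\<lambda>a. a) (\<lambda>_ _. 0) \<theta> \<and> cochain1 \<gamma> \<and>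
      (\<forall>x y. tev A \<theta> (lam (unit_tens L A x) (unit_tens L A y)) = \<chi> i x y + d1 \<gamma> x y)" if "i < r" for i
      using deriv[OF \<chi>[OF that]] by simp
    then show thesis using that by metis
  qed
  have \<theta>l: "lfun A (\<theta> i)" and \<theta>mul: "a \<in> acar A \<Longrightarrow> b \<in> acar A \<Longrightarrow> \<theta> i (amul A a b) = aeps A a * \<theta> i b + aeps A b * \<theta> i a"
    if "i < r" for i a b using \<theta>[OF that] by (auto simp: twisted_derivation_def)
  have \<theta>0: "\<theta> i 0 = 0" if "i < r" for i by (rule KF.linear_on_zero[OF \<theta>l[OF that] S'])
  have \<theta>1: "\<theta> i (aone A) = 0" if "i < r" for i
    using \<theta>mul[OF that aug_algebraD(2)[OF A] aug_algebraD(2)[OF A]]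
    by (simp only: aug_algebraD(7)[OF A aug_algebraD(2)[OF A]] aug_algebraD(11)[OF A] mult_1 add_cancel_right_right)
  have \<gamma>lin: "\<gamma> i (x + y) = \<gamma> i x + \<gamma> i y" "\<gamma> i (scl L c x) = scl L c (\<gamma> i x)" "twist L (\<gamma> i x) = \<gamma> i (twist L x)"
    if "i < r" for i x y c using \<gamma>[OF that] by (auto simp: cochain1_def linear_scl_iff)
  \<comment> \<open>\<open>h\<close> is a derivation with values in the kernel, whose square is zero; therefore \<open>id + h\<close> is multiplicative\<close>
  define h where "h d = (\<Sum>i<r. pw (*) (\<theta> i (P d)) (n i))" for d
  define u where "u d = d + h d" for d
  note PA = aug_homD(1)[OF P]
  have hD: "h d \<in> acar D" for d
    unfolding h_def using n by (intro K.subspace_sum[OF S] K.subspace_scale[OF S]) auto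
  have kerS: "module.subspace (pw (*)) {d \<in> acar D. P d = 0}" by (rule subspace_kernel_on[OF D P])
  have hP: "P (h d) = 0" for d
  proof -
    have "h d \<in> {d \<in> acar D. P d = 0}" unfolding h_def
      using n by (intro K.subspace_sum[OF kerS] K.subspace_scale[OF kerS]) auto
    then show ?thesis by simp
  qed
  have hlin: "h (d + e) = h d + h e" "h (pw (*) c d) = pw (*) c (h d)" if "d \<in> acar D" "e \<in> acar D" for d e c
    unfolding h_def using that PA linear_onD[OF \<theta>l] linear_onD[OF aug_homD(2)[OF P]]
    by (simp_all add: K.scale_left_distrib sum.distrib K.scale_sum_right)
  have hmul: "h (amul D d e) = pw (*) (aeps D d) (h e) + pw (*) (aeps D e) (h d)" if "d \<in> acar D" "e \<in> acar D" for d e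
    unfolding h_def using that PA aug_homD(3,5)[OF P]
    by (simp add: \<theta>mul K.scale_left_distrib sum.distrib K.scale_sum_right)
  have hker: "h d = 0" if "P d = 0" for d unfolding h_def using that \<theta>0 by simp
  have uD: "u d \<in> acar D" and Pu: "P (u d) = P d" if "d \<in> acar D" for d
    using that hD hP linear_onD(1)[OF aug_homD(2)[OF P]] by (simp_all add: u_def K.subspace_add[OF S])
  have uhom: "aug_hom D D u"
    unfolding aug_hom_def
  proof (intro conjI ballI)
    show ulin: "lin D u" by (rule linear_onI) (simp_all add: u_def hlin K.scale_right_distrib algebra_simps)
    show "u (aone D) = aone D" unfolding u_def h_def using aug_homD(4)[OF P] \<theta>1 by simp
    fix d e assume de: "d \<in> acar D" "e \<in> acar D"
    have "amul D (u d) (u e) = amul D d e + amul D d (h e) + (amul D (h d) e + amul D (h d) (h e))"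
      unfolding u_def using de hD K.subspace_add[OF S] by (simp add: aug_algebra_mul_add(1,2)[OF D])
    also have "\<dots> = amul D d e + pw (*) (aeps D d) (h e) + (pw (*) (aeps D e) (h d) + 0)"
      using de hD hP kernel_mul kernel_eps[OF hD hP] by simp
    finally show "u (amul D d e) = amul D (u d) (u e)" using hmul[OF de] by (simp add: u_def algebra_simps)
  next
    show "aeps D (u x) = aeps D x" if "x \<in> acar D" for x
      unfolding u_def using that hD linear_onD(1)[OF aug_algebraD(9)[OF D]] kernel_eps[OF hD hP] by simp
  qed (rule uD)
  have uiso: "aug_iso D D u"
    unfolding aug_iso_def
  proof (intro conjI uhom)
    show "bij_betw u (acar D) (acar D)"
    proof (rule bij_betw_byWitness[where f' = "\<lambda>d. d - h d"])
      have hh: "h (d + h d) = h d" "h (d - h d) = h d" if "d \<in> acar D" for d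
      proof -
        have "P (d + h d) = P d" "P (d - h d) = P d"
          using that hD hP linear_onD(1)[OF aug_homD(2)[OF P]] aug_hom_diff[OF D P] by simp_all
        then show "h (d + h d) = h d" "h (d - h d) = h d" by (simp_all only: h_def)
      qed
      show "\<forall>a\<in>acar D. u a - h (u a) = a" "\<forall>a\<in>acar D. u (a - h a) = a"
        by (simp_all add: u_def hh)
      show "u ` acar D \<subseteq> acar D" using uD by auto
      show "(\<lambda>d. d - h d) ` acar D \<subseteq> acar D" using hD K.subspace_diff[OF S] by auto
    qed
  qed
  obtain \<nu> where \<nu>: "is_pushout L D D u \<mu> \<nu>"
    by (rule pushout_deformation[OF D D uhom defs(1)])
  have \<nu>def: "deformation L D \<nu>" using \<nu> by (simp add: is_pushout_def)
  note br\<nu> = deformationD(2)[OF \<nu>def]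
  have sumT: "(\<Sum>i<r. tens L (n i) (l i)) \<in> T D" for l
    by (rule T_sum) (simp add: T_pure n)
  have tmapu: "tmap L D u t = t + (\<Sum>i<r. tens L (n i) (tev A (\<theta> i) (tmap L D P t)))" if "t \<in> T D" for t
  proof (rule T_ext[OF tmap_hom_additive[OF D D uhom] _ _ that])
    show "additive_on (T D) (\<lambda>t. t + (\<Sum>i<r. tens L (n i) (tev A (\<theta> i) (tmap L D P t))))"
      by (intro additive_on_intros additive_on_comp[OF tev_additive[OF S' \<theta>l] tmap_hom_additive[OF D A P] tmap_hom_in[OF D A P]]) auto
    show "tmap L D u (tens L a l) = tens L a l + (\<Sum>i<r. tens L (n i) (tev A (\<theta> i) (tmap L D P (tens L a l))))"
      if a: "a \<in> acar D" for a l
    proof -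
      have "tens L (h a) l = (\<Sum>i<r. tens L (n i) (scl L (\<theta> i (P a)) l))"
        unfolding h_def by (simp add: tens_sum tens_scale)
      then show ?thesis
        using a PA by (simp add: tmap_pure[OF S aug_homD(2)[OF uhom]] tmap_pure[OF S aug_homD(2)[OF P]]
            u_def tens_add tev_pure[OF S' \<theta>l])
    qed
  qed
  \<comment> \<open>after the automorphism, the difference is a coboundary\<close>
  have \<mu>diff: "\<mu>' (unit_tens L D x) (unit_tens L D y) - \<mu> (unit_tens L D x) (unit_tens L D y) = (\<Sum>i<r. tens L (n i) (\<chi> i x y))" for x y
  proof -
    let ?t = "\<mu>' (unit_tens L D x) (unit_tens L D y) - \<mu> (unit_tens L D x) (unit_tens L D y)"
    have in': "\<mu>' (unit_tens L D x) (unit_tens L D y) \<in> T D" "\<mu> (unit_tens L D x) (unit_tens L D y) \<in> T D"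
      by (simp_all add: tbracket_in[OF br] tbracket_in[OF br'] unit_in[OF D])
    have "tmap L D P ?t = 0"
      by (simp add: additive_on_T(3)[OF tmap_hom_additive[OF D A P] in'] lift lift' unit_in[OF D])
    then have "?t = (\<Sum>i<r. tens L (n i) (tev D (\<xi> i) ?t))"
      by (intro kernel_decomposition[OF D A P surj n(1) \<xi>l basis T_diff[OF in']])
    also have "\<dots> = (\<Sum>i<r. tens L (n i) (\<chi> i x y))"
      by (intro sum.cong refl) (simp add: \<chi>_def tev2_def additive_on_T(3)[OF tev_additive[OF S \<xi>l] in'])
    finally show ?thesis .
  qed
  have \<nu>unit: "\<nu> (unit_tens L D x) (unit_tens L D y) = \<mu>' (unit_tens L D x) (unit_tens L D y) + (\<Sum>i<r. tens L (n i) (d1 (\<gamma> i) x y))" for x y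
  proof -
    have "\<nu> (unit_tens L D x) (unit_tens L D y) = tmap L D u (\<mu> (unit_tens L D x) (unit_tens L D y))"
      using \<nu> by (simp add: is_pushout_def)
    also have "\<dots> = \<mu> (unit_tens L D x) (unit_tens L D y) + (\<Sum>i<r. tens L (n i) (\<chi> i x y + d1 (\<gamma> i) x y))"
      by (simp add: tmapu tbracket_in[OF br] unit_in[OF D] lift tmap_unit[OF D P] \<theta>\<gamma>)
    finally show ?thesis using \<mu>diff[of x y] by (simp add: tens_add sum.distrib algebra_simps)
  qed
  \<comment> \<open>the algebra acts on the kernel through the augmentation, hence the correction \<open>g ((\<epsilon> \<otimes> id) t)\<close> is linear over it\<close>
  define g where "g l = (\<Sum>i<r. tens L (n i) (\<gamma> i l))" for l
  define \<rho> where "\<rho> t = t + g (teps L D t)" for t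
  have gT: "g l \<in> T D" for l unfolding g_def by (rule sumT)
  have gadd: "g (l + m) = g l + g m" for l m unfolding g_def using \<gamma>lin by (simp add: tens_add sum.distrib)
  have gscl: "g (scl L c l) = pw (scl L) c (g l)" for c l
  proof -
    interpret V: vector_space "pw (scl L)" by (rule vector_space_pw_scl)
    show ?thesis unfolding g_def V.scale_sum_right by (rule sum.cong) (simp_all add: \<gamma>lin tens_scale')
  qed
  have g0: "g 0 = 0" by (rule additive_zero) (rule gadd)
  have gP: "tmap L D P (g l) = 0" for l
  proof -
    have "tmap L D P (g l) = (\<Sum>i<r. tmap L D P (tens L (n i) (\<gamma> i l)))"
      unfolding g_def by (rule additive_on_T(5)[OF tmap_hom_additive[OF D A P]]) (simp add: T_pure n)
    then show ?thesis by (simp add: kernel_tmap n)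
  qed
  have geps: "teps L D (g l) = 0" for l by (rule teps_kernel[OF gT gP])
  have \<rho>T: "\<rho> t \<in> T D" if "t \<in> T D" for t unfolding \<rho>_def by (rule T_add[OF that gT])
  have \<rho>add: "\<rho> (s + t) = \<rho> s + \<rho> t" if "s \<in> T D" "t \<in> T D" for s t
    unfolding \<rho>_def using that by (simp add: additive_on_T(2)[OF teps_additive[OF D]] gadd algebra_simps)
  have \<rho>additive: "additive_on (T D) \<rho>" using \<rho>add by (simp add: additive_on_def)
  have \<rho>act: "\<rho> (act L D a t) = act L D a (\<rho> t)" if "a \<in> acar D" "t \<in> T D" for a t
    unfolding \<rho>_def using that
    by (simp add: teps_act[OF D] gscl additive_on_T(2)[OF act_additive[OF D]] gT act_on_kernel[OF _ gT gP])
  have \<rho>eps: "teps L D (\<rho> t) = teps L D t" if "t \<in> T D" for t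
    unfolding \<rho>_def using that by (simp add: additive_on_T(2)[OF teps_additive[OF D]] gT geps)
  have \<rho>tw: "\<rho> (ttwist L D t) = ttwist L D (\<rho> t)" if "t \<in> T D" for t
  proof -
    have "ttwist L D (g l) = g (twist L l)" for l
    proof -
      have "ttwist L D (g l) = (\<Sum>i<r. ttwist L D (tens L (n i) (\<gamma> i l)))"
        unfolding g_def by (rule additive_on_T(5)[OF ttwist_additive[OF S]]) (simp add: T_pure n)
      also have "\<dots> = g (twist L l)" unfolding g_def
        by (rule sum.cong) (simp_all add: ttwist_pure[OF S] n \<gamma>lin)
      finally show ?thesis .
    qed
    then show ?thesis unfolding \<rho>_def using that
      by (simp add: additive_on_T(2)[OF ttwist_additive[OF S]] gT teps_ttwist[OF D])
  qed
  have bij: "bij_betw \<rho> (T D) (T D)"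
  proof (rule bij_betw_byWitness[where f' = "\<lambda>t. t - g (teps L D t)"])
    show "\<forall>t\<in>T D. \<rho> t - g (teps L D (\<rho> t)) = t" by (simp add: \<rho>eps) (simp add: \<rho>_def)
    show "\<forall>t\<in>T D. \<rho> (t - g (teps L D t)) = t"
      by (simp add: \<rho>_def additive_on_T(3)[OF teps_additive[OF D]] gT geps)
    show "\<rho> ` T D \<subseteq> T D" using \<rho>T by auto
    show "(\<lambda>t. t - g (teps L D t)) ` T D \<subseteq> T D" using T_diff gT by auto
  qed
  have eps': "\<And>x y. teps L D (\<mu>' (unit_tens L D x) (unit_tens L D y)) = brk L x y"
    by (rule deformationD(4)[OF defs(2)])
  have kb: "\<mu>' s (g l) = (\<Sum>i<r. tens L (n i) (brk L (teps L D s) (\<gamma> i l)))"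
    "\<mu>' (g l) s = (\<Sum>i<r. tens L (n i) (brk L (\<gamma> i l) (teps L D s)))" if s: "s \<in> T D" for s l
  proof -
    have "\<mu>' s (g l) = (\<Sum>i<r. \<mu>' s (tens L (n i) (\<gamma> i l)))"
      unfolding g_def by (rule additive_on_T(5)[OF tbracket_additive(2)[OF br' s]]) (simp add: T_pure n)
    then show "\<mu>' s (g l) = (\<Sum>i<r. tens L (n i) (brk L (teps L D s) (\<gamma> i l)))"
      using s by (simp add: bracket_kernel[OF br' eps'] n)
    have "\<mu>' (g l) s = (\<Sum>i<r. \<mu>' (tens L (n i) (\<gamma> i l)) s)"
      unfolding g_def by (rule additive_on_T(5)[OF tbracket_additive(1)[OF br' s]]) (simp add: T_pure n)
    then show "\<mu>' (g l) s = (\<Sum>i<r. tens L (n i) (brk L (\<gamma> i l) (teps L D s)))"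
      using s by (simp add: bracket_kernel[OF br' eps'] n)
  qed
  have unit: "\<rho> (\<nu> (unit_tens L D x) (unit_tens L D y)) = \<mu>' (\<rho> (unit_tens L D x)) (\<rho> (unit_tens L D y))" for x y
  proof -
    note U = unit_in[OF D]
    have "\<rho> (\<nu> (unit_tens L D x) (unit_tens L D y)) = \<nu> (unit_tens L D x) (unit_tens L D y) + g (brk L x y)"
      unfolding \<rho>_def by (simp add: deformationD(4)[OF \<nu>def])
    also have "\<dots> = \<mu>' (unit_tens L D x) (unit_tens L D y)
        + (\<Sum>i<r. tens L (n i) (brk L x (\<gamma> i y)) + tens L (n i) (brk L (\<gamma> i x) y))"
      unfolding \<nu>unit g_def d1_def by (simp add: tens_add tens_diff sum.distrib sum_subtractf)
    finally have 1: "\<rho> (\<nu> (unit_tens L D x) (unit_tens L D y)) = \<mu>' (unit_tens L D x) (unit_tens L D y)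
        + (\<Sum>i<r. tens L (n i) (brk L x (\<gamma> i y)) + tens L (n i) (brk L (\<gamma> i x) y))" .
    have "\<mu>' (\<rho> (unit_tens L D x)) (\<rho> (unit_tens L D y)) =
        \<mu>' (unit_tens L D x + g x) (unit_tens L D y) + \<mu>' (unit_tens L D x + g x) (g y)"
      unfolding \<rho>_def teps_unit[OF D] by (rule additive_on_T(2)[OF tbracket_additive(2)[OF br' T_add[OF U gT]] U gT])
    also have "\<mu>' (unit_tens L D x + g x) (unit_tens L D y) = \<mu>' (unit_tens L D x) (unit_tens L D y) + \<mu>' (g x) (unit_tens L D y)"
      by (rule additive_on_T(2)[OF tbracket_additive(1)[OF br' U] U gT])
    also have "\<mu>' (g x) (unit_tens L D y) = (\<Sum>i<r. tens L (n i) (brk L (\<gamma> i x) y))"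
      by (simp add: kb U teps_unit[OF D])
    also have "\<mu>' (unit_tens L D x + g x) (g y) = (\<Sum>i<r. tens L (n i) (brk L x (\<gamma> i y)))"
      by (simp add: kb T_add[OF U gT] additive_on_T(2)[OF teps_additive[OF D] U gT] teps_unit[OF D] geps)
    finally show ?thesis unfolding 1 by (simp add: sum.distrib algebra_simps)
  qed
  have hom: "\<rho> (\<nu> s t) = \<mu>' (\<rho> s) (\<rho> t)" if st: "s \<in> T D" "t \<in> T D" for s t
  proof -
    have pure: "\<rho> (\<nu> (tens L a x) (tens L b y)) = \<mu>' (\<rho> (tens L a x)) (\<rho> (tens L b y))"
      if ab: "a \<in> acar D" "b \<in> acar D" for a b x y
    proof -
      have U: "\<rho> (unit_tens L D x) \<in> T D" for x by (rule \<rho>T[OF unit_in[OF D]])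
      have "\<rho> (\<nu> (act L D a (unit_tens L D x)) (act L D b (unit_tens L D y))) =
          \<mu>' (\<rho> (act L D a (unit_tens L D x))) (\<rho> (act L D b (unit_tens L D y)))"
        using ab U by (simp add: tbracket_act[OF br\<nu>] tbracket_act[OF br'] \<rho>act act_in[OF D] unit_in[OF D] tbracket_in[OF br\<nu>] unit)
      then show ?thesis using ab by (simp add: act_unit[OF D])
    qed
    have *: "\<rho> (\<nu> (tens L a x) t) = \<mu>' (\<rho> (tens L a x)) (\<rho> t)" if a: "a \<in> acar D" for a x
      by (rule T_ext[OF _ _ _ st(2), where F = "\<lambda>t. \<rho> (\<nu> (tens L a x) t)"])
        (use a in \<open>simp_all add: pure additive_on_comp[OF \<rho>additive tbracket_additive(2)[OF br\<nu>]] tbracket_in[OF br\<nu>] T_pure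
          additive_on_comp[OF tbracket_additive(2)[OF br'] \<rho>additive] \<rho>T\<close>)
    show ?thesis
      by (rule T_ext[OF _ _ _ st(1), where F = "\<lambda>s. \<rho> (\<nu> s t)"])
        (use st in \<open>simp_all add: * additive_on_comp[OF \<rho>additive tbracket_additive(1)[OF br\<nu>]] tbracket_in[OF br\<nu>] T_pure
          additive_on_comp[OF tbracket_additive(1)[OF br'] \<rho>additive] \<rho>T\<close>)
  qed
  have "equivalent_deformations L D \<nu> \<mu>'"
    unfolding equivalent_deformations_def Let_def
    using bij \<rho>add \<rho>act hom \<rho>tw \<rho>eps by (intro exI[of _ \<rho>]) simp
  then show thesis
    using that uiso Pu \<nu> hker by (simp add: u_def)
qed

end

end

section \<open>Harrison cohomology and extensions of algebras\<close>

lemma harr_cocyclesD: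
  assumes "f \<in> harr_cocycles A"
  shows "a \<notin> acar A \<or> b \<notin> acar A \<Longrightarrow> f a b = 0" "f a b = f b a"
    "a \<in> acar A \<Longrightarrow> linear_on (pw (*)) (*) (acar A) (f a)"
    "a \<in> acar A \<Longrightarrow> b \<in> acar A \<Longrightarrow> c \<in> acar A \<Longrightarrow>
      aeps A a * f b c + f a (amul A b c) = f (amul A a b) c + aeps A c * f a b"
proof -
  show "a \<notin> acar A \<or> b \<notin> acar A \<Longrightarrow> f a b = 0" "f a b = f b a"
    "a \<in> acar A \<Longrightarrow> linear_on (pw (*)) (*) (acar A) (f a)"
    using assms unfolding harr_cocycles_def by blast+
  assume "a \<in> acar A" "b \<in> acar A" "c \<in> acar A"
  then have "aeps A a * f b c - f (amul A a b) c + f a (amul A b c) - aeps A c * f a b = 0"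
    using assms unfolding harr_cocycles_def by blast
  then show "aeps A a * f b c + f a (amul A b c) = f (amul A a b) c + aeps A c * f a b"
    by (simp add: algebra_simps)
qed

lemma subspace_harr_cocycles: "module.subspace (pw (pw (*))) (harr_cocycles (A :: ('k::field, 'i) aug_alg))"
proof -
  interpret V: vector_space "pw (pw ((*) :: 'k \<Rightarrow> 'k \<Rightarrow> 'k))"
    by (rule vector_space_pw[OF vector_space_pw_times])
  show ?thesis
  proof (rule V.subspaceI)
    show "0 \<in> harr_cocycles A" by (simp add: harr_cocycles_def pointwise linear_on_def)
  next
    fix f g assume fg: "f \<in> harr_cocycles A" "g \<in> harr_cocycles A"
    note F = harr_cocyclesD[OF fg(1)] and G = harr_cocyclesD[OF fg(2)]
    show "f + g \<in> harr_cocycles A"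
      unfolding harr_cocycles_def
    proof (intro CollectI conjI allI impI ballI)
      show "(f + g) a b = 0" if "a \<notin> acar A \<or> b \<notin> acar A" for a b using F(1)[OF that] G(1)[OF that] by (simp add: pointwise)
      show "(f + g) a b = (f + g) b a" for a b using F(2)[of a b] G(2)[of a b] by (simp add: pointwise)
      show "linear_on (pw (*)) (*) (acar A) ((f + g) a)" if "a \<in> acar A" for a
        using linear_onD[OF F(3)[OF that]] linear_onD[OF G(3)[OF that]] by (intro linear_onI) (simp_all add: pointwise algebra_simps)
      fix a b c assume abc: "a \<in> acar A" "b \<in> acar A" "c \<in> acar A"
      have "aeps A a * (f + g) b c + (f + g) a (amul A b c) = (f + g) (amul A a b) c + aeps A c * (f + g) a b"
        using arg_cong2[OF F(4)[OF abc] G(4)[OF abc], of "(+)"] by (simp add: pointwise algebra_simps)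
      then show "aeps A a * (f + g) b c - (f + g) (amul A a b) c + (f + g) a (amul A b c) - aeps A c * (f + g) a b = 0"
        by (simp add: algebra_simps)
    qed
  next
    fix k f assume "f \<in> harr_cocycles A"
    note F = harr_cocyclesD[OF this]
    show "pw (pw (*)) k f \<in> harr_cocycles A"
      unfolding harr_cocycles_def
    proof (intro CollectI conjI allI impI ballI)
      show "pw (pw (*)) k f a b = 0" if "a \<notin> acar A \<or> b \<notin> acar A" for a b using F(1)[OF that] by (simp add: pw_def)
      show "pw (pw (*)) k f a b = pw (pw (*)) k f b a" for a b using F(2)[of a b] by (simp add: pw_def)
      show "linear_on (pw (*)) (*) (acar A) (pw (pw (*)) k f a)" if "a \<in> acar A" for a
        using linear_onD[OF F(3)[OF that]] by (intro linear_onI) (simp_all add: pw_def[of _ k] algebra_simps)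
      fix a b c assume abc: "a \<in> acar A" "b \<in> acar A" "c \<in> acar A"
      have "k * (aeps A a * f b c + f a (amul A b c)) = k * (f (amul A a b) c + aeps A c * f a b)"
        using F(4)[OF abc] by simp
      then show "aeps A a * pw (pw (*)) k f b c - pw (pw (*)) k f (amul A a b) c + pw (pw (*)) k f a (amul A b c)
          - aeps A c * pw (pw (*)) k f a b = 0"
        by (simp add: pw_def algebra_simps)
    qed
  qed
qed

lemma harr_coboundariesI:
  assumes "linear_on (pw (*)) (*) (acar A) g"
    "f = (\<lambda>a b. if a \<in> acar A \<and> b \<in> acar A then aeps A a * g b - g (amul A a b) + aeps A b * g a else 0)"
  shows "f \<in> harr_coboundaries A"
  using assms unfolding harr_coboundaries_def by (intro CollectI exI[of _ g] conjI)

lemma subspace_harr_coboundaries: "module.subspace (pw (pw (*))) (harr_coboundaries (A :: ('k::field, 'i) aug_alg))"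
proof -
  interpret V: vector_space "pw (pw ((*) :: 'k \<Rightarrow> 'k \<Rightarrow> 'k))"
    by (rule vector_space_pw[OF vector_space_pw_times])
  let ?d = "\<lambda>g a b. if a \<in> acar A \<and> b \<in> acar A then aeps A a * g b - g (amul A a b) + aeps A b * g a else 0"
  show ?thesis
  proof (rule V.subspaceI)
    have "linear_on (pw (*)) (*) (acar A) (\<lambda>_. 0)" "0 = ?d (\<lambda>_. 0)"
      by (auto simp: linear_on_def fun_eq_iff pointwise)
    then show "0 \<in> harr_coboundaries A" by (rule harr_coboundariesI)
  next
    fix f f' assume "f \<in> harr_coboundaries A" "f' \<in> harr_coboundaries A"
    then obtain g g' where g: "linear_on (pw (*)) (*) (acar A) g" "f = ?d g"
      "linear_on (pw (*)) (*) (acar A) g'" "f' = ?d g'" by (auto simp: harr_coboundaries_def)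
    then have "linear_on (pw (*)) (*) (acar A) (\<lambda>a. g a + g' a)" by (simp add: linear_on_def algebra_simps)
    moreover have "f + f' = ?d (\<lambda>a. g a + g' a)" using g by (auto simp: fun_eq_iff pointwise algebra_simps)
    ultimately show "f + f' \<in> harr_coboundaries A" by (rule harr_coboundariesI)
  next
    fix c f assume "f \<in> harr_coboundaries A"
    then obtain g where g: "linear_on (pw (*)) (*) (acar A) g" "f = ?d g" by (auto simp: harr_coboundaries_def)
    then have "linear_on (pw (*)) (*) (acar A) (\<lambda>a. c * g a)" by (simp add: linear_on_def algebra_simps)
    moreover have "pw (pw (*)) c f = ?d (\<lambda>a. c * g a)" using g by (auto simp: fun_eq_iff pw_def algebra_simps)
    ultimately show "pw (pw (*)) c f \<in> harr_coboundaries A" by (rule harr_coboundariesI)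
  qed
qed

lemma harr_coboundaries_subset:
  assumes A: "aug_algebra (A :: ('k::field, 'i) aug_alg)"
  shows "harr_coboundaries A \<subseteq> harr_cocycles A"
proof
  note S = aug_algebraD(1)[OF A]
  fix f assume "f \<in> harr_coboundaries A"
  then obtain g where g: "linear_on (pw (*)) (*) (acar A) g" and
    f: "f = (\<lambda>a b. if a \<in> acar A \<and> b \<in> acar A then aeps A a * g b - g (amul A a b) + aeps A b * g a else 0)"
    by (auto simp: harr_coboundaries_def)
  note lin = linear_onD[OF g] linear_onD[OF aug_algebraD(9)[OF A]] aug_algebra_mul_add(1)[OF A]
    aug_algebra_mul_add(3)[OF A _ _ aug_algebraD(2)[OF A]] aug_algebraD(3)[OF A]
  show "f \<in> harr_cocycles A"
    unfolding harr_cocycles_def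
  proof (intro CollectI conjI allI impI ballI)
    show "f a b = 0" if "a \<notin> acar A \<or> b \<notin> acar A" for a b using that by (auto simp: f)
    show "f a b = f b a" for a b using aug_algebraD(5)[OF A, of a b] by (simp add: f)
    show "linear_on (pw (*)) (*) (acar A) (f a)" if "a \<in> acar A" for a
      using that by (intro linear_onI) (simp_all add: f lin K.subspace_add[OF S] K.subspace_scale[OF S] algebra_simps)
    fix a b c assume abc: "a \<in> acar A" "b \<in> acar A" "c \<in> acar A"
    show "aeps A a * f b c - f (amul A a b) c + f a (amul A b c) - aeps A c * f a b = 0"
      using abc by (simp add: f lin aug_algebraD(6,10)[OF A] algebra_simps)
  qed
qed

lemma finite_dim_harr_cocycles:
  assumes A: "aug_algebra (A :: ('k::field, 'i) aug_alg)" and fin: "finite_dim (pw (*)) (acar A)"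
  shows "finite_dim (pw (pw (*))) (harr_cocycles A)"
proof -
  interpret KF: vector_space_pair "pw ((*) :: 'k \<Rightarrow> 'k \<Rightarrow> 'k)" "(*)"
    by (rule vector_space_pair_times[OF vector_space_pw_times])
  interpret V: vector_space "pw (pw ((*) :: 'k \<Rightarrow> 'k \<Rightarrow> 'k))"
    by (rule vector_space_pw[OF vector_space_pw_times])
  note S = aug_algebraD(1)[OF A]
  obtain r a \<xi> where "frame_mod (pw (*)) (acar A) {0} r a \<xi>"
    using K.frame_mod_exists[OF K.subspace_single_0 K.finite_dim_imp_finite_dim_quot[OF fin]] by metis
  then have a: "\<And>i. i < r \<Longrightarrow> a i \<in> acar A" and ex: "\<And>x. x \<in> acar A \<Longrightarrow> x = (\<Sum>i<r. pw (*) (\<xi> i x) (a i))"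
    by (auto simp: frame_mod_def)
  define E where "E = (\<lambda>(i, j) x y. if x \<in> acar A \<and> y \<in> acar A then \<xi> i x * \<xi> j y else 0)"
  have "f \<in> V.span (E ` ({..<r} \<times> {..<r}))" if f: "f \<in> harr_cocycles A" for f
  proof -
    note D = harr_cocyclesD[OF f]
    have "f = (\<Sum>p\<in>{..<r} \<times> {..<r}. pw (pw (*)) (f (a (fst p)) (a (snd p))) (E p))"
    proof (intro ext)
      fix x y
      show "f x y = (\<Sum>p\<in>{..<r} \<times> {..<r}. pw (pw (*)) (f (a (fst p)) (a (snd p))) (E p)) x y"
      proof (cases "x \<in> acar A \<and> y \<in> acar A")
        case False
        then show ?thesis using D(1) by (auto simp: sum_apply pw_def E_def split_def intro!: sum.neutral[symmetric])
      next
        case True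
        have ey: "f b y = (\<Sum>j<r. \<xi> j y * f b (a j))" if "b \<in> acar A" for b
        proof -
          have "f b y = f b (\<Sum>j<r. pw (*) (\<xi> j y) (a j))" by (subst ex[of y]) (use True in auto)
          also have "\<dots> = (\<Sum>j<r. f b (pw (*) (\<xi> j y) (a j)))"
            by (rule KF.linear_on_sum[OF D(3)[OF that] S]) (use a K.subspace_scale[OF S] in auto)
          also have "\<dots> = (\<Sum>j<r. \<xi> j y * f b (a j))"
            by (rule sum.cong) (use a linear_onD(2)[OF D(3)[OF that]] in auto)
          finally show ?thesis .
        qed
        have "f x y = f y x" by (rule D(2))
        also have "\<dots> = f y (\<Sum>i<r. pw (*) (\<xi> i x) (a i))" by (subst ex[of x]) (use True in auto)
        also have "\<dots> = (\<Sum>i<r. f y (pw (*) (\<xi> i x) (a i)))"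
          by (rule KF.linear_on_sum[OF D(3) S]) (use True a K.subspace_scale[OF S] in auto)
        also have "\<dots> = (\<Sum>i<r. \<xi> i x * f (a i) y)"
          by (rule sum.cong) (use True a linear_onD(2)[OF D(3)[of y]] D(2) in auto)
        also have "\<dots> = (\<Sum>i<r. \<Sum>j<r. f (a i) (a j) * (\<xi> i x * \<xi> j y))"
        proof (rule sum.cong[OF refl])
          fix i assume "i \<in> {..<r}"
          then have "a i \<in> acar A" using a by simp
          then have "\<xi> i x * f (a i) y = \<xi> i x * (\<Sum>j<r. \<xi> j y * f (a i) (a j))" by (simp only: ey)
          also have "\<dots> = (\<Sum>j<r. f (a i) (a j) * (\<xi> i x * \<xi> j y))"
            unfolding sum_distrib_left by (rule sum.cong) (simp_all only: mult_ac)
          finally show "\<xi> i x * f (a i) y = (\<Sum>j<r. f (a i) (a j) * (\<xi> i x * \<xi> j y))" .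
        qed
        also have "\<dots> = (\<Sum>p\<in>{..<r} \<times> {..<r}. f (a (fst p)) (a (snd p)) * (\<xi> (fst p) x * \<xi> (snd p) y))"
          by (simp add: sum.cartesian_product split_def)
        also have "\<dots> = (\<Sum>p\<in>{..<r} \<times> {..<r}. pw (pw (*)) (f (a (fst p)) (a (snd p))) (E p)) x y"
          using True by (simp add: sum_apply pw_def E_def split_def)
        finally show ?thesis .
      qed
    qed
    also have "\<dots> \<in> V.span (E ` ({..<r} \<times> {..<r}))"
      by (intro V.span_sum V.span_scale V.span_base imageI)
    finally show ?thesis .
  qed
  then show ?thesis using V.finite_dim_subspace[OF subspace_harr_cocycles, of A "E ` ({..<r} \<times> {..<r})"] by blast
qed

lemma case_sum_comp_pw: "(x + y) \<circ> Inl = (x \<circ> Inl) + (y \<circ> Inl)" "(x + y) \<circ> Inr = (x \<circ> Inr) + (y \<circ> Inr)"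
  "pw s c x \<circ> Inl = pw s c (x \<circ> Inl)" "pw s c x \<circ> Inr = pw s c (x \<circ> Inr)"
  "0 \<circ> Inl = 0" "0 \<circ> Inr = 0"
  by (auto simp: fun_eq_iff pointwise pw_def)

lemma case_sum_eq_iff: "x = case_sum a m \<longleftrightarrow> x \<circ> Inl = a \<and> x \<circ> Inr = m"
  by (auto simp: fun_eq_iff split: sum.splits)

lemma case_sum_comps [simp]: "case_sum a m \<circ> Inl = a" "case_sum a m \<circ> Inr = m"
  by (auto simp: fun_eq_iff)

lemma case_sum_pw: "case_sum a m + case_sum b n = case_sum (a + b) (m + n)"
  "pw s c (case_sum a m) = case_sum (pw s c a) (pw s c m)"
  by (auto simp: case_sum_eq_iff case_sum_comp_pw)

lemma ext_alg_sel:
  "x \<in> acar (ext_alg A M f) \<longleftrightarrow> x \<circ> Inl \<in> acar A \<and> x \<circ> Inr \<in> M"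
  "amul (ext_alg A M f) x y = case_sum (amul A (x \<circ> Inl) (y \<circ> Inl))
        (pw (*) (aeps A (x \<circ> Inl)) (y \<circ> Inr) + pw (*) (aeps A (y \<circ> Inl)) (x \<circ> Inr) + f (x \<circ> Inl) (y \<circ> Inl))"
  "aone (ext_alg A M f) = case_sum (aone A) (- f (aone A) (aone A))"
  "aeps (ext_alg A M f) x = aeps A (x \<circ> Inl)"
  by (auto simp: ext_alg_def case_sum_eq_iff)

text \<open>The associativity of the extension is the cocycle condition.\<close>

lemma ext_alg:
  fixes A :: "('k::field, 'i) aug_alg" and M :: "('m \<Rightarrow> 'k) set"
  assumes A: "aug_algebra A" and M: "module.subspace (pw (*)) M"
    and fM: "\<And>a b. a \<in> acar A \<Longrightarrow> b \<in> acar A \<Longrightarrow> f a b \<in> M"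
    and sym: "\<And>a b. a \<in> acar A \<Longrightarrow> b \<in> acar A \<Longrightarrow> f a b = f b a"
    and lin: "\<And>a. a \<in> acar A \<Longrightarrow> linear_on (pw (*)) (pw (*)) (acar A) (f a)"
    and coc: "\<And>a b c. a \<in> acar A \<Longrightarrow> b \<in> acar A \<Longrightarrow> c \<in> acar A \<Longrightarrow>
      pw (*) (aeps A a) (f b c) + f a (amul A b c) = f (amul A a b) c + pw (*) (aeps A c) (f a b)"
  shows "aug_algebra (ext_alg A M f)" "aug_hom (ext_alg A M f) A (\<lambda>x. x \<circ> Inl)"
    "(\<lambda>x. x \<circ> Inl) ` acar (ext_alg A M f) = acar A" "small_kernel (ext_alg A M f) (\<lambda>x. x \<circ> Inl)"
proof -
  note S = aug_algebraD(1)[OF A] and one = aug_algebraD(2)[OF A]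
  note Mcl = module.subspace_add[OF _ M] module.subspace_scale[OF _ M] module.subspace_neg[OF _ M] module.subspace_0[OF _ M]
  have mod: "module (pw ((*) :: 'k \<Rightarrow> 'k \<Rightarrow> 'k) :: 'k \<Rightarrow> ('m \<Rightarrow> 'k) \<Rightarrow> 'm \<Rightarrow> 'k)"
    using vector_space_pw_times by (simp add: module_iff_vector_space)
  note eps = linear_onD[OF aug_algebraD(9)[OF A]]
  note mul = aug_algebraD(3)[OF A] aug_algebra_mul_add(1)[OF A] aug_algebra_mul_add(3)[OF A _ _ one]
  note f0 = KK.linear_on_zero[OF lin S]
  have f1: "f (aone A) c = pw (*) (aeps A c) (f (aone A) (aone A))" if "c \<in> acar A" for c
    using coc[OF one one that] aug_algebraD(7,11)[OF A] that one by (simp add: pw_def)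
  have pwsimps: "pw (*) (c + d) m = pw (*) c m + pw (*) d m" "pw (*) (c * d) m = pw (*) c (pw (*) d m)"
     "pw (*) c (m + n) = pw (*) c m + pw (*) c n" "pw (*) c (- m) = - pw (*) c m" "pw (*) 1 m = m" "pw (*) 0 m = 0" "pw (*) c 0 = 0"
    for c d :: 'k and m n :: "'x \<Rightarrow> 'k"
    by (auto simp: pw_def fun_eq_iff pointwise algebra_simps)
  show alg: "aug_algebra (ext_alg A M f)"
    unfolding aug_algebra_def
  proof (intro conjI ballI)
    show "module.subspace (pw (*)) (acar (ext_alg A M f))"
      by (rule K.subspaceI)
        (use S M mod in \<open>auto simp: ext_alg_sel case_sum_comp_pw K.subspace_0 K.subspace_add K.subspace_scale Mcl\<close>)
    show "aone (ext_alg A M f) \<in> acar (ext_alg A M f)" using one fM[OF one one] mod by (simp add: ext_alg_sel Mcl)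
    fix x assume x: "x \<in> acar (ext_alg A M f)"
    show "linear_on (pw (*)) (pw (*)) (acar (ext_alg A M f)) (amul (ext_alg A M f) x)"
    proof (rule linear_onI)
      have a: "x \<circ> Inl \<in> acar A" using x by (simp add: ext_alg_sel)
      fix u v c assume u: "u \<in> acar (ext_alg A M f)"
      then have ua: "u \<circ> Inl \<in> acar A" by (simp add: ext_alg_sel)
      show "amul (ext_alg A M f) x (pw (*) c u) = pw (*) c (amul (ext_alg A M f) x u)"
        unfolding ext_alg_sel case_sum_comp_pw case_sum_pw mul(3)[OF a ua] eps(2)[OF ua] linear_onD(2)[OF lin[OF a] ua]
        by (simp add: pwsimps(3)) (simp add: pw_def mult_ac)
      assume "v \<in> acar (ext_alg A M f)"
      then have va: "v \<circ> Inl \<in> acar A" by (simp add: ext_alg_sel)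
      show "amul (ext_alg A M f) x (u + v) = amul (ext_alg A M f) x u + amul (ext_alg A M f) x v"
        unfolding ext_alg_sel case_sum_comp_pw case_sum_pw mul(2)[OF a ua va] eps(1)[OF ua va] linear_onD(1)[OF lin[OF a] ua va]
        by (simp add: pwsimps(1,3) add_ac)
    qed
    show "amul (ext_alg A M f) (aone (ext_alg A M f)) x = x"
      using x f1[of "x \<circ> Inl"] aug_algebraD(7,11)[OF A] case_sum_eq_iff[of x "x \<circ> Inl" "x \<circ> Inr"]
      by (simp add: ext_alg_sel pwsimps)
    fix y assume y: "y \<in> acar (ext_alg A M f)"
    show "amul (ext_alg A M f) x y \<in> acar (ext_alg A M f)"
      using x y mod fM by (simp add: ext_alg_sel mul Mcl)
    show "amul (ext_alg A M f) x y = amul (ext_alg A M f) y x"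
      using x y sym[of "x \<circ> Inl" "y \<circ> Inl"] aug_algebraD(5)[OF A, of "x \<circ> Inl" "y \<circ> Inl"]
      by (simp add: ext_alg_sel add.commute)
    show "aeps (ext_alg A M f) (amul (ext_alg A M f) x y) = aeps (ext_alg A M f) x * aeps (ext_alg A M f) y"
      using x y aug_algebraD(10)[OF A] by (simp add: ext_alg_sel)
    fix z assume z: "z \<in> acar (ext_alg A M f)"
    let ?a = "x \<circ> Inl" and ?b = "y \<circ> Inl" and ?c = "z \<circ> Inl"
    have abc: "?a \<in> acar A" "?b \<in> acar A" "?c \<in> acar A" using x y z by (auto simp: ext_alg_sel)
    show "amul (ext_alg A M f) (amul (ext_alg A M f) x y) z = amul (ext_alg A M f) x (amul (ext_alg A M f) y z)"
    proof -
      have key: "pw (*) (\<alpha> * \<beta>) z' + pw (*) \<gamma> (pw (*) \<alpha> y' + pw (*) \<beta> x' + m1) + m2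
          = pw (*) \<alpha> (pw (*) \<beta> z' + pw (*) \<gamma> y' + m3) + pw (*) (\<beta> * \<gamma>) x' + m4"
        if "pw (*) \<alpha> m3 + m4 = m2 + pw (*) \<gamma> m1" for \<alpha> \<beta> \<gamma> :: 'k and x' y' z' m1 m2 m3 m4 :: "'m \<Rightarrow> 'k"
      proof
        fix j
        have "\<alpha> * m3 j + m4 j = m2 j + \<gamma> * m1 j" using fun_cong[OF that, of j] by (simp add: pw_def pointwise)
        then show "(pw (*) (\<alpha> * \<beta>) z' + pw (*) \<gamma> (pw (*) \<alpha> y' + pw (*) \<beta> x' + m1) + m2) j
          = (pw (*) \<alpha> (pw (*) \<beta> z' + pw (*) \<gamma> y' + m3) + pw (*) (\<beta> * \<gamma>) x' + m4) j"
          by (simp add: pw_def pointwise algebra_simps)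
      qed
      show ?thesis
        unfolding ext_alg_sel case_sum_comps aug_algebraD(10)[OF A abc(1,2)] aug_algebraD(10)[OF A abc(2,3)]
          aug_algebraD(6)[OF A abc] key[OF coc[OF abc]] by (rule refl)
    qed
  next
    show "linear_on (pw (*)) (*) (acar (ext_alg A M f)) (aeps (ext_alg A M f))"
      by (intro linear_onI) (auto simp: ext_alg_sel case_sum_comp_pw eps)
    show "aeps (ext_alg A M f) (aone (ext_alg A M f)) = 1" using aug_algebraD(11)[OF A] by (simp add: ext_alg_sel)
  qed
  show "aug_hom (ext_alg A M f) A (\<lambda>x. x \<circ> Inl)"
    unfolding aug_hom_def by (auto simp: ext_alg_sel linear_on_def case_sum_comp_pw)
  show "(\<lambda>x. x \<circ> Inl) ` acar (ext_alg A M f) = acar A"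
  proof
    show "acar A \<subseteq> (\<lambda>x. x \<circ> Inl) ` acar (ext_alg A M f)"
    proof
      fix a assume "a \<in> acar A"
      then show "a \<in> (\<lambda>x. x \<circ> Inl) ` acar (ext_alg A M f)"
        using mod by (intro image_eqI[of _ _ "case_sum a 0"]) (simp_all add: ext_alg_sel Mcl)
    qed
  qed (auto simp: ext_alg_sel)
  show "small_kernel (ext_alg A M f) (\<lambda>x. x \<circ> Inl)"
    unfolding small_kernel_def
  proof (intro ballI impI)
    fix d n assume dn: "d \<in> acar (ext_alg A M f)" "n \<in> acar (ext_alg A M f)" "n \<circ> Inl = 0"
    have "amul A (d \<circ> Inl) 0 = 0"
      using dn by (intro KK.linear_on_zero[OF aug_algebraD(4)[OF A] S]) (simp add: ext_alg_sel)
    then have "amul (ext_alg A M f) d n = case_sum 0 (pw (*) (aeps A (d \<circ> Inl)) (n \<circ> Inr))"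
      using dn f0[of "d \<circ> Inl"] aeps_zero[OF A] by (simp add: ext_alg_sel pwsimps)
    also have "\<dots> = pw (*) (aeps (ext_alg A M f) d) n"
      using dn(3) by (subst eq_commute) (simp add: case_sum_eq_iff case_sum_comp_pw ext_alg_sel pwsimps)
    finally show "amul (ext_alg A M f) d n = pw (*) (aeps (ext_alg A M f) d) n" .
  qed
qed

lemma finite_dim_ext_alg:
  assumes "finite_dim (pw (*)) (acar (A :: ('k::field, 'i) aug_alg))" "finite_dim (pw (*)) M"
    and "0 \<in> acar A" "0 \<in> M"
  shows "finite_dim (pw (*)) (acar (ext_alg A M f))"
proof -
  have mh: "module_hom (pw ((*) :: 'k \<Rightarrow> 'k \<Rightarrow> 'k)) (pw (*)) (\<lambda>a. case_sum a 0)"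
      "module_hom (pw ((*) :: 'k \<Rightarrow> 'k \<Rightarrow> 'k)) (pw (*)) (case_sum 0)"
    unfolding module_hom_iff_linear Vector_Spaces.linear_iff
    by (auto simp: vector_space_pw_times case_sum_eq_iff case_sum_comp_pw case_sum_pw)
  obtain F G where F: "finite F" "F \<subseteq> acar A" "acar A \<subseteq> module.span (pw (*)) F"
    and G: "finite G" "G \<subseteq> M" "M \<subseteq> module.span (pw (*)) G"
    using assms by (auto simp: finite_dim_def)
  let ?H = "(\<lambda>a. case_sum a 0) ` F \<union> case_sum 0 ` G"
  have "acar (ext_alg A M f) \<subseteq> module.span (pw (*)) ?H"
  proof
    fix x assume x: "x \<in> acar (ext_alg A M f)"
    have "case_sum (x \<circ> Inl) 0 \<in> module.span (pw (*)) ((\<lambda>a. case_sum a 0) ` F)"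
      unfolding module_hom.span_image[OF mh(1)] using x F by (auto simp: ext_alg_sel)
    moreover have "case_sum 0 (x \<circ> Inr) \<in> module.span (pw (*)) (case_sum 0 ` G)"
      unfolding module_hom.span_image[OF mh(2)] using x G by (auto simp: ext_alg_sel)
    ultimately have "case_sum (x \<circ> Inl) 0 + case_sum 0 (x \<circ> Inr) \<in> module.span (pw (*)) ?H"
      by (intro K.span_add) (rule subsetD[OF K.span_mono, rotated], assumption, blast)+
    moreover have "case_sum (x \<circ> Inl) 0 + case_sum 0 (x \<circ> Inr) = x"
      by (subst eq_commute) (simp add: case_sum_pw case_sum_eq_iff)
    ultimately show "x \<in> module.span (pw (*)) ?H" by simp
  qed
  then show ?thesis
    unfolding finite_dim_def using F G assms(3,4) by (intro exI[of _ ?H]) (auto simp: ext_alg_sel)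
qed

section \<open>Powers of the augmentation ideal, and local algebras\<close>

lemma alg_idealD: "alg_ideal A J \<Longrightarrow> module.subspace (pw (*)) J" "alg_ideal A J \<Longrightarrow> J \<subseteq> acar A"
  "alg_ideal A J \<Longrightarrow> a \<in> acar A \<Longrightarrow> x \<in> J \<Longrightarrow> amul A a x \<in> J"
  by (auto simp: alg_ideal_def)

lemma alg_ideal_aug_ideal:
  assumes A: "aug_algebra (A :: ('k::field, 'i) aug_alg)" shows "alg_ideal A (aug_ideal A)"
proof -
  note S = aug_algebraD(1)[OF A]
  show ?thesis
    unfolding alg_ideal_def aug_ideal_def
    using K.subspace_0[OF S] K.subspace_add[OF S] K.subspace_scale[OF S] aeps_zero[OF A]
      linear_onD[OF aug_algebraD(9)[OF A]] aug_algebraD(3,10)[OF A]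
    by (auto intro!: K.subspaceI)
qed

lemma local_if_units:
  assumes A: "aug_algebra (A :: ('k::field, 'i) aug_alg)"
    and units: "\<And>x. x \<in> acar A \<Longrightarrow> aeps A x \<noteq> 0 \<Longrightarrow> \<exists>y\<in>acar A. amul A y x = aone A"
  shows "local_algebra A"
proof -
  have proper: "J \<subseteq> aug_ideal A \<or> J = acar A" if J: "alg_ideal A J" for J
  proof (rule ccontr)
    assume *: "\<not> (J \<subseteq> aug_ideal A \<or> J = acar A)"
    then obtain x where x: "x \<in> J" "x \<in> acar A" "aeps A x \<noteq> 0" using alg_idealD(2)[OF J] by (auto simp: aug_ideal_def)
    obtain y where y: "y \<in> acar A" "amul A y x = aone A" using units[OF x(2,3)] by blast
    then have "aone A \<in> J" using alg_idealD(3)[OF J y(1) x(1)] by simp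
    then have "a \<in> J" if "a \<in> acar A" for a
      using alg_idealD(3)[OF J that, of "aone A"] aug_algebraD(8)[OF A that] by simp
    then show False using * alg_idealD(2)[OF J] by blast
  qed
  have "aone A \<in> acar A - aug_ideal A" using aug_algebraD(2,11)[OF A] by (simp add: aug_ideal_def)
  then have m: "alg_ideal A (aug_ideal A)" "aug_ideal A \<noteq> acar A"
    using alg_ideal_aug_ideal[OF A] by auto
  have "maximal_ideal A J \<longleftrightarrow> J = aug_ideal A" for J
    unfolding maximal_ideal_def using proper m by (metis subset_antisym)
  then show ?thesis using A by (simp add: local_algebra_def)
qed

lemma max_pow_ideal:
  assumes A: "aug_algebra (A :: ('k::field, 'i) aug_alg)"
  shows "alg_ideal A (max_pow A n)"
proof -
  note S = aug_algebraD(1)[OF A]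
  show ?thesis
  proof (induction n)
    case 0
    then show ?case using S aug_algebraD(3)[OF A] by (simp add: alg_ideal_def)
  next
    case (Suc n)
    let ?G = "{amul A x y |x y. x \<in> aug_ideal A \<and> y \<in> max_pow A n}"
    have G: "?G \<subseteq> acar A" using alg_idealD(2)[OF Suc] aug_algebraD(3)[OF A] by (auto simp: aug_ideal_def)
    have sub: "K.span ?G \<subseteq> acar A" by (rule K.span_minimal[OF G S])
    have "amul A a x \<in> K.span ?G" if a: "a \<in> acar A" and x: "x \<in> K.span ?G" for a x
    proof -
      have "x \<in> acar A \<and> amul A a x \<in> K.span ?G"
        using x
      proof (induction rule: K.span_induct_alt)
        case base
        have "amul A a 0 = 0" by (rule KK.linear_on_zero[OF aug_algebraD(4)[OF A a] S])
        then have "0 \<in> acar A \<and> amul A a 0 \<in> K.span ?G" using K.span_zero K.subspace_0[OF S] by simp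
        then show ?case .
      next
        case (step c z w)
        then obtain u v where uv: "u \<in> aug_ideal A" "v \<in> max_pow A n" "z = amul A u v" by blast
        have in': "u \<in> acar A" "v \<in> acar A" "z \<in> acar A"
          using uv alg_idealD(2)[OF Suc] G step(1) by (auto simp: aug_ideal_def)
        have "amul A a z = amul A u (amul A a v)"
          using aug_algebraD(5)[OF A, of u a] aug_algebraD(6)[OF A] in' a uv(3) by metis
        moreover have "amul A a v \<in> max_pow A n" using alg_idealD(3)[OF Suc a uv(2)] .
        ultimately have az: "amul A a z \<in> K.span ?G" using uv(1) by (intro K.span_base) auto
        have cz: "pw (*) c z \<in> acar A" using in' K.subspace_scale[OF S] by blast
        have "amul A a (pw (*) c z + w) = pw (*) c (amul A a z) + amul A a w"
          using a cz in' step.IH by (simp add: aug_algebra_mul_add(1)[OF A] aug_algebra_mul_add(3)[OF A _ _ a])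
        then have "pw (*) c z + w \<in> acar A \<and> amul A a (pw (*) c z + w) \<in> K.span ?G"
          using step.IH az cz by (simp add: K.span_add K.span_scale K.subspace_add[OF S])
        then show ?case .
      qed
      then show ?thesis by simp
    qed
    then show ?case using sub by (simp add: alg_ideal_def)
  qed
qed

lemma max_pow_mul: "x \<in> aug_ideal A \<Longrightarrow> y \<in> max_pow A n \<Longrightarrow> amul A x y \<in> max_pow A (Suc n)"
  for A :: "('k::field, 'i) aug_alg"
  by (auto intro: K.span_base)

lemma max_pow_Suc_subset:
  assumes "\<And>x y. x \<in> aug_ideal A \<Longrightarrow> y \<in> max_pow A n \<Longrightarrow> amul A x y \<in> J" "module.subspace (pw (*)) J"
  shows "max_pow (A :: ('k::field, 'i) aug_alg) (Suc n) \<subseteq> J"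
  unfolding max_pow.simps by (rule K.span_minimal) (use assms in auto)

lemma max_pow_1: "aug_algebra (A :: ('k::field, 'i) aug_alg) \<Longrightarrow> max_pow A (Suc 0) = aug_ideal A"
proof
  assume A: "aug_algebra A"
  show "max_pow A (Suc 0) \<subseteq> aug_ideal A"
  proof (rule max_pow_Suc_subset)
    fix x y assume "x \<in> aug_ideal A" "y \<in> max_pow A 0"
    then show "amul A x y \<in> aug_ideal A"
      using aug_algebraD(3,10)[OF A, of x y] by (simp add: aug_ideal_def)
  qed (rule alg_idealD(1)[OF alg_ideal_aug_ideal[OF A]])
  show "aug_ideal A \<subseteq> max_pow A (Suc 0)"
  proof
    fix x assume x: "x \<in> aug_ideal A"
    then have "amul A x (aone A) \<in> max_pow A (Suc 0)" using aug_algebraD(2)[OF A] by (intro max_pow_mul) auto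
    then show "x \<in> max_pow A (Suc 0)" using x aug_algebraD(8)[OF A] by (simp add: aug_ideal_def)
  qed
qed

lemma max_pow_decreasing: "aug_algebra (A :: ('k::field, 'i) aug_alg) \<Longrightarrow> max_pow A (Suc n) \<subseteq> max_pow A n"
  using alg_idealD[OF max_pow_ideal[of A n]] by (intro max_pow_Suc_subset) (auto simp: aug_ideal_def)

lemma max_pow_antimono: "aug_algebra (A :: ('k::field, 'i) aug_alg) \<Longrightarrow> m \<le> n \<Longrightarrow> max_pow A n \<subseteq> max_pow A m"
  by (rule lift_Suc_antimono_le[of "max_pow A"]) (rule max_pow_decreasing)

lemma max_pow_hom:
  assumes A: "aug_algebra (A :: ('k::field, 'i) aug_alg)" and B: "aug_algebra B" and \<phi>: "aug_hom A B \<phi>"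
  shows "x \<in> max_pow A n \<Longrightarrow> \<phi> x \<in> max_pow B n"
proof (induction n arbitrary: x)
  case 0
  then show ?case using aug_homD(1)[OF \<phi>] by simp
next
  case (Suc n)
  note SB = alg_idealD(1)[OF max_pow_ideal[OF B, of "Suc n"]]
  note S = aug_algebraD(1)[OF A]
  have "max_pow A (Suc n) \<subseteq> {x \<in> acar A. \<phi> x \<in> max_pow B (Suc n)}"
  proof (rule max_pow_Suc_subset)
    show "module.subspace (pw (*)) {x \<in> acar A. \<phi> x \<in> max_pow B (Suc n)}"
      by (rule K.subspaceI)
        (use S aug_hom_zero[OF A \<phi>] linear_onD[OF aug_homD(2)[OF \<phi>]] in
         \<open>auto simp del: max_pow.simps simp: K.subspace_0 K.subspace_add K.subspace_scale module.subspace_0[OF _ SB] module.subspace_add[OF _ SB]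
           module.subspace_scale[OF _ SB] module_iff_vector_space vector_space_pw_times\<close>)
    fix u v assume uv: "u \<in> aug_ideal A" "v \<in> max_pow A n"
    then have in': "u \<in> acar A" "v \<in> acar A" using alg_idealD(2)[OF max_pow_ideal[OF A]] by (auto simp: aug_ideal_def)
    have "\<phi> u \<in> aug_ideal B" using uv(1) aug_homD(1,5)[OF \<phi>] by (simp add: aug_ideal_def)
    then show "amul A u v \<in> {x \<in> acar A. \<phi> x \<in> max_pow B (Suc n)}"
      using max_pow_mul[OF _ Suc.IH[OF uv(2)]] aug_homD(3)[OF \<phi> in'] aug_algebraD(3)[OF A in'] by (simp del: max_pow.simps)
  qed
  then show ?case using Suc.prems by blast
qed

lemma max_pow_surj:
  assumes A: "aug_algebra (A :: ('k::field, 'i) aug_alg)" and B: "aug_algebra B" and \<phi>: "aug_hom A B \<phi>"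
    and surj: "\<phi> ` acar A = acar B"
  shows "y \<in> max_pow B n \<Longrightarrow> \<exists>x\<in>max_pow A n. \<phi> x = y"
proof (induction n arbitrary: y)
  case 0
  then have "y \<in> \<phi> ` acar A" using surj by simp
  then show ?case by auto
next
  case (Suc n)
  note I = max_pow_ideal[OF A, of "Suc n"]
  have "max_pow B (Suc n) \<subseteq> \<phi> ` max_pow A (Suc n)"
  proof (rule max_pow_Suc_subset)
    show "module.subspace (pw (*)) (\<phi> ` max_pow A (Suc n))"
      by (rule KK.subspace_linear_image[OF linear_on_subset[OF aug_homD(2)[OF \<phi>] alg_idealD(2)[OF I]] alg_idealD(1)[OF I]])
    fix u v assume uv: "u \<in> aug_ideal B" "v \<in> max_pow B n"
    obtain v' where v': "v' \<in> max_pow A n" "\<phi> v' = v" using Suc.IH[OF uv(2)] by blast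
    have "u \<in> \<phi> ` acar A" using uv(1) surj by (simp add: aug_ideal_def)
    then obtain u' where u': "u' \<in> acar A" "\<phi> u' = u" by blast
    then have "u' \<in> aug_ideal A" using uv(1) aug_homD(5)[OF \<phi>] by (auto simp: aug_ideal_def)
    then have "amul A u' v' \<in> max_pow A (Suc n)" "\<phi> (amul A u' v') = amul B u v"
      using max_pow_mul[OF _ v'(1)] aug_homD(3)[OF \<phi> u'(1)] v' u' alg_idealD(2)[OF max_pow_ideal[OF A]] by (auto simp del: max_pow.simps)
    then show "amul B u v \<in> \<phi> ` max_pow A (Suc n)" by (metis image_eqI)
  qed
  then show ?case using Suc.prems by blast
qed

text \<open>If \<open>x\<close> has augmentation \<open>1\<close>, then \<open>y = x y + (1 - x) y\<close> shows inductively that every power of the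
  augmentation ideal, starting with a vanishing one, lies in the ideal generated by \<open>x\<close>.\<close>

lemma nilpotent_units:
  assumes A: "aug_algebra (A :: ('k::field, 'i) aug_alg)" and nil: "max_pow A n \<subseteq> {0}"
    and x: "x \<in> acar A" "aeps A x \<noteq> 0"
  shows "\<exists>y\<in>acar A. amul A y x = aone A"
proof -
  interpret KF: vector_space_pair "pw ((*) :: 'k \<Rightarrow> 'k \<Rightarrow> 'k)" "(*)"
    by (rule vector_space_pair_times[OF vector_space_pw_times])
  note S = aug_algebraD(1)[OF A] and one = aug_algebraD(2)[OF A]
  have ex: "linear_on (pw (*)) (pw (*)) (acar A) (\<lambda>y. amul A y x)"
    using x(1) by (intro linear_onI) (simp_all add: aug_algebra_mul_add(2)[OF A] aug_algebra_mul_add(4)[OF A _ _ one])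
  let ?J = "(\<lambda>y. amul A y x) ` acar A"
  have J: "module.subspace (pw (*)) ?J" by (rule KK.subspace_linear_image[OF ex S])
  define e where "e = pw (*) (inverse (aeps A x)) (aone A)"
  have e: "e \<in> acar A" "amul A e x \<in> acar A" "aeps A (amul A e x) = 1"
  proof -
    show e: "e \<in> acar A" unfolding e_def by (rule K.subspace_scale[OF S one])
    show "amul A e x \<in> acar A" by (rule aug_algebraD(3)[OF A e x(1)])
    show "aeps A (amul A e x) = 1"
      using x e by (simp add: aug_algebraD(10)[OF A]) (simp add: e_def linear_onD(2)[OF aug_algebraD(9)[OF A] one] aug_algebraD(11)[OF A])
  qed
  let ?z = "aone A - amul A e x"
  have z: "?z \<in> aug_ideal A"
    using e one KF.linear_on_diff[OF aug_algebraD(9)[OF A] S one e(2)] aug_algebraD(11)[OF A]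
    by (simp add: aug_ideal_def K.subspace_diff[OF S])
  have "max_pow A (n - k) \<subseteq> ?J" for k
  proof (induction k)
    case 0
    then show ?case using nil K.subspace_0[OF J] by auto
  next
    case (Suc k)
    show ?case
    proof (cases "k < n")
      case True
      then have n: "n - k = Suc (n - Suc k)" by simp
      show ?thesis
      proof
        fix y assume y: "y \<in> max_pow A (n - Suc k)"
        have yA: "y \<in> acar A" using y alg_idealD(2)[OF max_pow_ideal[OF A]] by blast
        have "amul A ?z y \<in> ?J" using max_pow_mul[OF z y] Suc n by auto
        moreover have "amul A (amul A e x) y \<in> ?J"
        proof (rule image_eqI)
          show "amul A (amul A e x) y = amul A (amul A e y) x"
            using aug_algebraD(6)[OF A e(1) x(1) yA] aug_algebraD(6)[OF A e(1) yA x(1)] aug_algebraD(5)[OF A x(1) yA] by simp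
          show "amul A e y \<in> acar A" by (rule aug_algebraD(3)[OF A e(1) yA])
        qed
        ultimately have "amul A (amul A e x) y + amul A ?z y \<in> ?J" by (intro K.subspace_add[OF J])
        also have "amul A (amul A e x) y + amul A ?z y = amul A (amul A e x + ?z) y"
          using yA e z by (intro aug_algebra_mul_add(2)[OF A, symmetric]) (auto simp: aug_ideal_def)
        also have "\<dots> = y" using aug_algebraD(7)[OF A yA] by simp
        finally show "y \<in> ?J" .
      qed
    qed (use Suc in simp)
  qed
  from this[of n] have "aone A \<in> ?J" using one by auto
  then obtain y where "y \<in> acar A" "aone A = amul A y x" by blast
  then show ?thesis by metis
qed

lemma local_if_nilpotent:
  "aug_algebra (A :: ('k::field, 'i) aug_alg) \<Longrightarrow> max_pow A n \<subseteq> {0} \<Longrightarrow> local_algebra A"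
  using local_if_units nilpotent_units by blast

lemma max_pow_small_kernel:
  assumes D: "aug_algebra (D :: ('k::field, 'i) aug_alg)" and A: "aug_algebra A" and P: "aug_hom D A P"
    and small: "small_kernel D P" and nil: "max_pow A n \<subseteq> {0}"
  shows "max_pow D (Suc n) \<subseteq> {0}"
proof (rule max_pow_Suc_subset)
  show "module.subspace (pw (*)) {0 :: 'i \<Rightarrow> 'k}" by (rule K.subspace_single_0)
  fix x y assume xy: "x \<in> aug_ideal D" "y \<in> max_pow D n"
  have "y \<in> acar D" "P y = 0" using xy(2) alg_idealD(2)[OF max_pow_ideal[OF D]] max_pow_hom[OF D A P] nil by blast+
  then show "amul D x y \<in> {0}" using xy(1) small by (simp add: small_kernel_def aug_ideal_def)
qed

section \<open>The universal extension and its obstruction\<close>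

lemma vector_space_pw2_times: "vector_space (pw (pw ((*) :: 'k::field \<Rightarrow> 'k \<Rightarrow> 'k)))"
  by (rule vector_space_pw[OF vector_space_pw_times])

lemma finite_dim_quot_harr:
  assumes "aug_algebra A" "finite_dim (pw (*)) (acar A)"
  shows "finite_dim_quot (pw (pw (*))) (harr_cocycles A) (harr_coboundaries A)"
proof -
  interpret V: vector_space "pw (pw ((*) :: 'a \<Rightarrow> 'a \<Rightarrow> 'a))" by (rule vector_space_pw2_times)
  show ?thesis by (rule V.finite_dim_imp_finite_dim_quot[OF finite_dim_harr_cocycles[OF assms]])
qed

lemma harr_section_exists:
  fixes A :: "('k::field, 'i) aug_alg"
  assumes A: "aug_algebra A" and fin: "finite_dim (pw (*)) (acar A)"
  obtains \<sigma> where "harr_section A \<sigma>"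
proof -
  interpret V: vector_space "pw (pw ((*) :: 'k \<Rightarrow> 'k \<Rightarrow> 'k))" by (rule vector_space_pw2_times)
  let ?Z = "harr_cocycles A" and ?B = "harr_coboundaries A"
  note Z = subspace_harr_cocycles[of A] and B = subspace_harr_coboundaries[of A]
  obtain n z \<xi> where f: "frame_mod (pw (pw (*))) ?Z ?B n z \<xi>"
    using V.frame_mod_exists[OF B finite_dim_quot_harr[OF A fin]] by metis
  note fd = V.frame_dual[OF Z B f]
  define \<sigma> where "\<sigma> X = (\<Sum>i<n. pw (pw (*)) (quot_functional ?Z ?B (\<xi> i) X) (z i))" for X
  have "linear_on_quot (pw (pw (*))) (pw (pw (*))) ?Z ?B \<sigma>"
    unfolding linear_on_quot_def \<sigma>_def
    by (simp add: V.dual_quotD[OF fd(1)] V.scale_left_distrib sum.distrib V.scale_sum_right)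
  moreover have "\<sigma> c \<in> c" if c: "c \<in> Harr A" for c
  proof -
    obtain x where x: "x \<in> ?Z" "c = coset ?B x" using c by (auto simp: Harr_def quot_def)
    have "\<sigma> c = (\<Sum>i<n. pw (pw (*)) (\<xi> i x) (z i))" unfolding \<sigma>_def x(2) using fd(2) x(1) by simp
    moreover have "x - (\<Sum>i<n. pw (pw (*)) (\<xi> i x) (z i)) \<in> ?B" using f x(1) by (simp add: frame_mod_def)
    ultimately have "\<sigma> c - x \<in> ?B" using V.subspace_neg[OF B] by (metis minus_diff_eq)
    then show ?thesis by (simp add: V.mem_coset_iff x(2))
  qed
  ultimately have "harr_section A \<sigma>" by (simp add: harr_section_def)
  then show thesis by (rule that)
qed

lemma pw_apply: "pw s c f x = s c (f x)"
  by (simp add: pw_def)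

locale universal_extension =
  fixes A :: "('k::field, 'i) aug_alg" and \<sigma>
  assumes A: "aug_algebra A" and fin: "finite_dim (pw (*)) (acar A)" and \<sigma>: "harr_section A \<sigma>"
begin

sublocale V: vector_space "pw (pw ((*) :: 'k \<Rightarrow> 'k \<Rightarrow> 'k)) :: 'k \<Rightarrow> (('i \<Rightarrow> 'k) \<Rightarrow> ('i \<Rightarrow> 'k) \<Rightarrow> 'k) \<Rightarrow> _"
  by (rule vector_space_pw2_times)

abbreviation "U \<equiv> harr_univ_ext A \<sigma>"
abbreviation "Z \<equiv> harr_cocycles A"
abbreviation "B \<equiv> harr_coboundaries A"

lemmas subZ = subspace_harr_cocycles[of A] and subB = subspace_harr_coboundaries[of A]

lemma coset_in_Harr: "z \<in> Z \<Longrightarrow> coset B z \<in> Harr A"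
  by (simp add: Harr_def quot_def)

lemma HarrE: assumes "c \<in> Harr A" obtains z where "z \<in> Z" "c = coset B z"
  using assms by (auto simp: Harr_def quot_def)

lemma \<sigma>_coset: "z \<in> Z \<Longrightarrow> \<sigma> (coset B z) - z \<in> B"
  using \<sigma> coset_in_Harr[of z] by (simp add: harr_section_def V.mem_coset_iff[symmetric])

lemma \<sigma>_in: assumes "c \<in> Harr A" shows "\<sigma> c \<in> Z"
proof -
  obtain z where z: "z \<in> Z" "c = coset B z" using assms by (rule HarrE)
  have "\<sigma> c - z \<in> Z" using \<sigma>_coset[OF z(1)] harr_coboundaries_subset[OF A] z(2) by blast
  then show ?thesis using V.subspace_add[OF subZ _ z(1)] by fastforce
qed

lemma \<sigma>_lin: "x \<in> Z \<Longrightarrow> y \<in> Z \<Longrightarrow> \<sigma> (coset B (x + y)) = \<sigma> (coset B x) + \<sigma> (coset B y)"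
  "x \<in> Z \<Longrightarrow> \<sigma> (coset B (pw (pw (*)) k x)) = pw (pw (*)) k (\<sigma> (coset B x))"
  using \<sigma> by (auto simp: harr_section_def linear_on_quot_def)

lemma subspace_Harr_dual: "module.subspace (pw (*)) (Harr_dual A)"
  unfolding Harr_dual_def by (rule V.subspace_dual_quot)

lemma finite_dim_Harr_dual: "finite_dim (pw (*)) (Harr_dual A)"
  unfolding Harr_dual_def by (rule V.finite_dim_dual_quot[OF subZ subB finite_dim_quot_harr[OF A fin]])

lemma U_alg: "aug_algebra U" "aug_hom U A (\<lambda>x. x \<circ> Inl)" "(\<lambda>x. x \<circ> Inl) ` acar U = acar A"
    "small_kernel U (\<lambda>x. x \<circ> Inl)"
proof -
  have 1: "harr_univ_cocycle A \<sigma> a b \<in> Harr_dual A" for a b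
    unfolding Harr_dual_def dual_quot_def linear_on_quot_def harr_univ_cocycle_def
    using coset_in_Harr V.subspace_add[OF subZ] V.subspace_scale[OF subZ]
    by (auto simp: \<sigma>_lin pointwise) (auto simp: pw_def Harr_def)
  have 2: "harr_univ_cocycle A \<sigma> a b = harr_univ_cocycle A \<sigma> b a" for a b
    unfolding harr_univ_cocycle_def using harr_cocyclesD(2)[OF \<sigma>_in] by (intro ext) simp
  have 3: "linear_on (pw (*)) (pw (*)) (acar A) (harr_univ_cocycle A \<sigma> a)" if "a \<in> acar A" for a
  proof (rule linear_onI)
    fix x y k assume x: "x \<in> acar A"
    show "harr_univ_cocycle A \<sigma> a (pw (*) k x) = pw (*) k (harr_univ_cocycle A \<sigma> a x)"
    proof
      fix c
      show "harr_univ_cocycle A \<sigma> a (pw (*) k x) c = pw (*) k (harr_univ_cocycle A \<sigma> a x) c"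
        using linear_onD(2)[OF harr_cocyclesD(3)[OF \<sigma>_in[of c] that] x, of k]
        by (simp add: harr_univ_cocycle_def pw_apply)
    qed
    assume y: "y \<in> acar A"
    show "harr_univ_cocycle A \<sigma> a (x + y) = harr_univ_cocycle A \<sigma> a x + harr_univ_cocycle A \<sigma> a y"
    proof
      fix c
      show "harr_univ_cocycle A \<sigma> a (x + y) c = (harr_univ_cocycle A \<sigma> a x + harr_univ_cocycle A \<sigma> a y) c"
        using linear_onD(1)[OF harr_cocyclesD(3)[OF \<sigma>_in[of c] that] x y]
        by (simp add: harr_univ_cocycle_def pointwise)
    qed
  qed
  have 4: "pw (*) (aeps A a) (harr_univ_cocycle A \<sigma> b c) + harr_univ_cocycle A \<sigma> a (amul A b c) =
      harr_univ_cocycle A \<sigma> (amul A a b) c + pw (*) (aeps A c) (harr_univ_cocycle A \<sigma> a b)"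
    if abc: "a \<in> acar A" "b \<in> acar A" "c \<in> acar A" for a b c
  proof
    fix x
    show "(pw (*) (aeps A a) (harr_univ_cocycle A \<sigma> b c) + harr_univ_cocycle A \<sigma> a (amul A b c)) x =
      (harr_univ_cocycle A \<sigma> (amul A a b) c + pw (*) (aeps A c) (harr_univ_cocycle A \<sigma> a b)) x"
      using harr_cocyclesD(4)[OF \<sigma>_in[of x] abc] by (cases "x \<in> Harr A") (simp_all add: harr_univ_cocycle_def pointwise pw_apply)
  qed
  note * = ext_alg[OF A subspace_Harr_dual 1 2 3 4]
  show "aug_algebra U" by (rule *(1))
  show "aug_hom U A (\<lambda>x. x \<circ> Inl)" by (rule *(2))
  show "(\<lambda>x. x \<circ> Inl) ` acar U = acar A" by (rule *(3))
  show "small_kernel U (\<lambda>x. x \<circ> Inl)" by (rule *(4))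
qed

lemma finite_dim_U: "finite_dim (pw (*)) (acar U)"
  using fin finite_dim_Harr_dual K.subspace_0[OF aug_algebraD(1)[OF A]] K.subspace_0[OF subspace_Harr_dual]
  by (rule finite_dim_ext_alg)

lemma in_U_iff: "x \<in> acar U \<longleftrightarrow> x \<circ> Inl \<in> acar A \<and> x \<circ> Inr \<in> Harr_dual A"
  by (rule ext_alg_sel(1))

lemma kernel_U: "g \<in> Harr_dual A \<Longrightarrow> case_sum 0 g \<in> acar U"
  using K.subspace_0[OF aug_algebraD(1)[OF A]] by (simp add: in_U_iff)

text \<open>The universal extension carries, for all Harrison classes simultaneously, a derivation twisted by the class.\<close>

lemma evaluation_twisted: "c \<in> Harr A \<Longrightarrow> twisted_derivation U (\<lambda>x. x \<circ> Inl) (\<sigma> c) (\<lambda>x. x (Inr c))"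
  unfolding twisted_derivation_def
  by (auto simp: linear_on_def pointwise ext_alg_sel harr_univ_cocycle_def) (auto simp: pw_def)

end

text \<open>The map \<open>w\<close> of the inductive step together with the lift of the bracket from which it is computed.\<close>

locale obstruction_setting = hom_leibniz L + universal_extension A \<sigma>
  for L :: "('k::field, 'l::ab_group_add) hom_leib" and A :: "('k, 'i) aug_alg" and \<sigma> +
  fixes lam br w
  assumes lam: "deformation L A lam"
    and brU: "is_bracket_lift L A U (\<lambda>x. x \<circ> Inl) lam br"
    and w: "\<And>c. c \<in> Harr A \<Longrightarrow> w c = coset (coboundaries L 3)
        (\<lambda>xs. if length xs = 3 then obstruction_cochain L U br (xs ! 0) (xs ! 1) (xs ! 2) (Inr c) else 0)"
begin

lemma br: "tbracket U br" and br_lift: "s \<in> T U \<Longrightarrow> t \<in> T U \<Longrightarrow>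
    tmap L U (\<lambda>x. x \<circ> Inl) (br s t) = lam (tmap L U (\<lambda>x. x \<circ> Inl) s) (tmap L U (\<lambda>x. x \<circ> Inl) t)"
  using brU by (auto simp: is_bracket_lift_iff)

definition ob where "ob c = list3 (\<lambda>x y z. tev U (\<lambda>u. u (Inr c)) (obstruction_cochain L U br x y z))"

lemma lfun_coordinate: "lfun U (\<lambda>u. u j)"
  by (auto simp: linear_on_def pw_def pointwise)

lemma ob_in_T: "obstruction_cochain L U br x y z \<in> T U"
  by (rule obstruction_in[OF U_alg(1) A U_alg(2) br])

lemma w_ob: "c \<in> Harr A \<Longrightarrow> w c = coset (coboundaries L 3) (ob c)"
  unfolding w ob_def by (intro arg_cong[of _ _ "coset (coboundaries L 3)"] ext)
    (simp add: tev_coordinate[OF sub_alg[OF U_alg(1)] ob_in_T])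

lemma ob_cocycle: "ob c \<in> cocycles L 3"
  unfolding ob_def
  by (rule obstruction_cocycle[OF U_alg(1) A U_alg(2) U_alg(3) U_alg(4) lam br br_lift lfun_coordinate])

lemma w_zero_iff: "c \<in> Harr A \<Longrightarrow> w c = coboundaries L 3 \<longleftrightarrow> ob c \<in> coboundaries L 3"
  unfolding w_ob by (rule vector_space.coset_eq_self_iff[OF vector_space_pw_scl subspace_coboundaries])

lemma ob_exact_iff: "ob c \<in> coboundaries L 3 \<longleftrightarrow>
    (\<exists>\<beta>. cochain2 \<beta> \<and> (\<forall>x y z. tev U (\<lambda>u. u (Inr c)) (obstruction_cochain L U br x y z) = d2 \<beta> x y z))"
proof
  assume "ob c \<in> coboundaries L 3"
  then obtain \<beta> where "cochain2 \<beta>" "\<And>x y z. ob c [x, y, z] = d2 \<beta> x y z" by (rule coboundaries3D) blast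
  then show "\<exists>\<beta>. cochain2 \<beta> \<and> (\<forall>x y z. tev U (\<lambda>u. u (Inr c)) (obstruction_cochain L U br x y z) = d2 \<beta> x y z)"
    by (auto simp: ob_def)
next
  assume "\<exists>\<beta>. cochain2 \<beta> \<and> (\<forall>x y z. tev U (\<lambda>u. u (Inr c)) (obstruction_cochain L U br x y z) = d2 \<beta> x y z)"
  then obtain \<beta> where \<beta>: "cochain2 \<beta>" "\<And>x y z. tev U (\<lambda>u. u (Inr c)) (obstruction_cochain L U br x y z) = d2 \<beta> x y z" by blast
  then have "ob c = list3 (d2 \<beta>)" by (intro ext) (simp add: ob_def)
  then show "ob c \<in> coboundaries L 3" using coboundaries3_list[OF \<beta>(1)] by simp
qed

text \<open>The obstruction of \<open>\<mu>\<close> vanishes, hence the defect of \<open>\<sigma> c\<close> is a coboundary.  The same defect computes the obstruction at \<open>c\<close>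
  on the universal extension.\<close>

lemma w_vanishes:
  assumes E: "aug_algebra E" and P: "aug_hom E A P" and mu: "is_pushout L E A P \<mu> lam"
    and c: "c \<in> Harr A" and \<xi>: "twisted_derivation E P (\<sigma> c) \<xi>"
  shows "w c = coboundaries L 3"
proof -
  have f: "\<And>a. a \<in> acar A \<Longrightarrow> lfun A (\<sigma> c a)" "\<And>a b. \<sigma> c a b = \<sigma> c b a"
    using harr_cocyclesD(2,3)[OF \<sigma>_in[OF c]] by auto
  have md: "deformation L E \<mu>" using mu by (simp add: is_pushout_def)
  note ld = deformationD(2,4)[OF lam]
  have \<xi>l: "lfun E \<xi>" using \<xi> by (simp add: twisted_derivation_def)
  let ?\<psi> = "tev2 U br (\<lambda>u. u (Inr c))" and ?\<chi> = "tev2 E \<mu> \<xi>"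
  have "cochain2 (\<lambda>x y. ?\<psi> x y - ?\<chi> x y)"
    by (intro cochain2_combination cochain2_tev2[OF U_alg(1) A U_alg(2) ld br br_lift lfun_coordinate]
        cochain2_tev2[OF E A P ld deformationD(2)[OF md] is_pushout_tmap[OF mu] \<xi>l])
  moreover have "tev U (\<lambda>u. u (Inr c)) (obstruction_cochain L U br x y z) = d2 (\<lambda>x y. ?\<psi> x y - ?\<chi> x y) x y z" for x y z
  proof -
    have "tev E \<xi> (obstruction_cochain L E \<mu> x y z) = d2 ?\<chi> x y z + defect A lam (\<sigma> c) x y z"
      by (rule tev_obstruction[OF E A P ld deformationD(2)[OF md] is_pushout_tmap[OF mu] f \<xi>])
    then have "d2 ?\<chi> x y z + defect A lam (\<sigma> c) x y z = 0"
      unfolding deformationD(3)[OF md] additive_on_T(1)[OF tev_additive[OF sub_alg[OF E] \<xi>l]] by (rule sym)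
    then have "defect A lam (\<sigma> c) x y z = - d2 ?\<chi> x y z" by (simp add: eq_neg_iff_add_eq_0 add.commute)
    moreover have "tev U (\<lambda>u. u (Inr c)) (obstruction_cochain L U br x y z) = d2 ?\<psi> x y z + defect A lam (\<sigma> c) x y z"
      by (rule tev_obstruction[OF U_alg(1) A U_alg(2) ld br br_lift f evaluation_twisted[OF c]])
    ultimately show ?thesis unfolding d2_diff by simp
  qed
  ultimately show ?thesis unfolding w_zero_iff[OF c] ob_exact_iff by blast
qed

lemma ob_linear:
  assumes "x \<in> Z"
  shows "y \<in> Z \<Longrightarrow> ob (coset B (x + y)) = ob (coset B x) + ob (coset B y)"
    and "ob (coset B (pw (pw (*)) k x)) = pw (scl L) k (ob (coset B x))"
proof -
  note S = sub_alg[OF U_alg(1)]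
  have d: "u \<circ> Inr \<in> Harr_dual A" if "u \<in> acar U" for u using that by (simp add: in_U_iff)
  have d2': "u (Inr (coset B (pw (pw (*)) k x))) = k * u (Inr (coset B x))" if u: "u \<in> acar U" for u
    using V.dual_quotD(2)[OF d[OF u, unfolded Harr_dual_def] assms, of k] by simp
  show "ob (coset B (x + y)) = ob (coset B x) + ob (coset B y)" if y: "y \<in> Z"
  proof
    fix xs
    have d1: "u (Inr (coset B (x + y))) = u (Inr (coset B x)) + u (Inr (coset B y))" if u: "u \<in> acar U" for u
      using V.dual_quotD(1)[OF d[OF u, unfolded Harr_dual_def] assms y] by simp
    have "tev U (\<lambda>u. u (Inr (coset B (x + y)))) t = tev U (\<lambda>u. u (Inr (coset B x))) t + tev U (\<lambda>u. u (Inr (coset B y))) t"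
      if "t \<in> T U" for t
    proof -
      have "tev U (\<lambda>u. u (Inr (coset B (x + y)))) t = tev U (\<lambda>u. u (Inr (coset B x)) + u (Inr (coset B y))) t"
        by (rule tev_cong[OF S lfun_coordinate _ that])
          (rule d1, assumption)
      then show ?thesis using tev_add[OF S lfun_coordinate lfun_coordinate that] by simp
    qed
    then show "ob (coset B (x + y)) xs = (ob (coset B x) + ob (coset B y)) xs" by (simp add: ob_def pointwise ob_in_T)
  qed
  show "ob (coset B (pw (pw (*)) k x)) = pw (scl L) k (ob (coset B x))"
  proof
    fix xs
    have "tev U (\<lambda>u. u (Inr (coset B (pw (pw (*)) k x)))) t = scl L k (tev U (\<lambda>u. u (Inr (coset B x))) t)"
      if "t \<in> T U" for t
    proof -
      have "tev U (\<lambda>u. u (Inr (coset B (pw (pw (*)) k x)))) t = tev U (\<lambda>u. k * u (Inr (coset B x))) t"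
        by (rule tev_cong[OF S lfun_coordinate _ that])
          (rule d2', assumption)
      then show ?thesis using tev_scale[OF S lfun_coordinate that] by simp
    qed
    then show "ob (coset B (pw (pw (*)) k x)) xs = pw (scl L) k (ob (coset B x)) xs" by (simp add: ob_def pw_def ob_in_T)
  qed
qed

lemma obstruction_dual_in:
  assumes g: "g \<in> HL_dual L 3" shows "obstruction_dual A w g \<in> Harr_dual A"
proof -
  interpret W: vector_space "pw (scl L)" by (rule vector_space_pw_scl)
  note g' = g[unfolded HL_dual_def]
  show ?thesis
    unfolding Harr_dual_def dual_quot_def linear_on_quot_def obstruction_dual_def
    using coset_in_Harr V.subspace_add[OF subZ] V.subspace_scale[OF subZ]
    by (auto simp: w_ob ob_linear W.dual_quotD[OF g'] ob_cocycle) (auto simp: Harr_def)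
qed

lemma ker_obstruction_iff: "c \<in> ker_obstruction L A w \<longleftrightarrow> c \<in> Harr A \<and> w c = coboundaries L 3"
  by (auto simp: ker_obstruction_def ker_cocycles_def quot_def Harr_def)

lemma subspace_ker_cocycles: "module.subspace (pw (pw (*))) (ker_cocycles L A w)"
  and coboundaries_ker_cocycles: "B \<subseteq> ker_cocycles L A w"
proof -
  interpret W: vector_space "pw (scl L)" by (rule vector_space_pw_scl)
  note S = subspace_coboundaries[of 3]
  have 0: "ob (coset B 0) = 0"
    using ob_linear(1)[OF V.subspace_0[OF subZ] V.subspace_0[OF subZ]] by simp
  have k: "z \<in> ker_cocycles L A w \<longleftrightarrow> z \<in> Z \<and> ob (coset B z) \<in> coboundaries L 3" for z
    using coset_in_Harr w_zero_iff by (auto simp: ker_cocycles_def)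
  show "module.subspace (pw (pw (*))) (ker_cocycles L A w)"
    by (rule V.subspaceI)
      (use V.subspace_0[OF subZ] V.subspace_add[OF subZ] V.subspace_scale[OF subZ] W.subspace_0[OF S] W.subspace_add[OF S] W.subspace_scale[OF S] in
       \<open>auto simp: k 0 ob_linear\<close>)
  show "B \<subseteq> ker_cocycles L A w"
  proof
    fix b assume b: "b \<in> B"
    then have "coset B b = coset B 0" using V.coset_eq_iff[OF subB, of b 0] by simp
    then show "b \<in> ker_cocycles L A w" using b harr_coboundaries_subset[OF A] W.subspace_0[OF S] by (auto simp: k 0)
  qed
qed

definition restrict :: "((('i \<Rightarrow> 'k) \<Rightarrow> ('i \<Rightarrow> 'k) \<Rightarrow> 'k) set \<Rightarrow> 'k) \<Rightarrow> (('i \<Rightarrow> 'k) \<Rightarrow> ('i \<Rightarrow> 'k) \<Rightarrow> 'k) set \<Rightarrow> 'k" where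
  "restrict g = (\<lambda>c. if c \<in> ker_obstruction L A w then g c else 0)"

text \<open>Restriction to \<open>ker w\<close> is surjective because a functional on a subspace extends to the whole space.\<close>

lemma ker_obstruction_dual_eq: "ker_obstruction_dual L A w = restrict ` Harr_dual A"
proof
  interpret VF: vector_space_pair "pw (pw ((*) :: 'k \<Rightarrow> 'k \<Rightarrow> 'k)) :: 'k \<Rightarrow> (('i \<Rightarrow> 'k) \<Rightarrow> ('i \<Rightarrow> 'k) \<Rightarrow> 'k) \<Rightarrow> _" "(*)"
    by (rule vector_space_pair_times[OF vector_space_pw2_times])
  let ?K = "ker_cocycles L A w"
  have KZ: "?K \<subseteq> Z" by (auto simp: ker_cocycles_def)
  note subK = subspace_ker_cocycles
  show "restrict ` Harr_dual A \<subseteq> ker_obstruction_dual L A w"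
  proof clarify
    fix g assume g: "g \<in> Harr_dual A"
    have c: "coset B z \<in> ker_obstruction L A w" if "z \<in> ?K" for z using that by (auto simp: ker_obstruction_def quot_def)
    show "restrict g \<in> ker_obstruction_dual L A w"
      unfolding ker_obstruction_dual_def dual_quot_def linear_on_quot_def restrict_def
      using c KZ V.subspace_add[OF subK] V.subspace_scale[OF subK] V.dual_quotD[OF g[unfolded Harr_dual_def]]
      by (auto simp: subset_iff ker_obstruction_def)
  qed
  show "ker_obstruction_dual L A w \<subseteq> restrict ` Harr_dual A"
  proof
    fix m assume "m \<in> ker_obstruction_dual L A w"
    then have m: "m \<in> dual_quot (pw (pw (*))) ?K B" by (simp add: ker_obstruction_dual_def)
    obtain F where F: "Vector_Spaces.linear (pw (pw (*))) (*) F" "\<And>z. z \<in> ?K \<Longrightarrow> F z = m (coset B z)"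
      using VF.linear_on_extend[OF subK V.dual_quot_linear_on[OF m]] by blast
    have F0: "F b = 0" if "b \<in> B" for b
      using F(2) coboundaries_ker_cocycles that V.dual_quot_zero[OF m subK subB] by auto
    note q = V.quot_functional[OF subZ subB linear_imp_linear_on[OF F(1)] F0]
    have "m = restrict (quot_functional Z B F)"
    proof
      fix c
      show "m c = restrict (quot_functional Z B F) c"
      proof (cases "c \<in> ker_obstruction L A w")
        case True
        then obtain z where "z \<in> ?K" "c = coset B z" by (auto simp: ker_obstruction_def quot_def)
        then show ?thesis using True q(1)[of z] F(2) KZ by (auto simp: restrict_def)
      next
        case False
        then show ?thesis using V.dual_quotD(3)[OF m] by (simp add: restrict_def ker_obstruction_def)
      qed
    qed
    moreover have "quot_functional Z B F \<in> Harr_dual A" using q(2) by (simp add: Harr_dual_def)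
    ultimately show "m \<in> restrict ` Harr_dual A" by blast
  qed
qed

end

section \<open>The inductive step\<close>

lemma pw_zero_right: "pw (*) (k :: 'k::field) (0 :: 'i \<Rightarrow> 'k) = 0"
  by (simp add: pw_def fun_eq_iff pointwise)

lemma (in vector_space_pair) finite_dim_image:
  assumes V: "vs1.subspace V" and f: "linear_on s1 s2 V f" and fin: "finite_dim s1 V"
  shows "finite_dim s2 (f ` V)"
proof -
  obtain F where F: "Vector_Spaces.linear s1 s2 F" "\<And>x. x \<in> V \<Longrightarrow> F x = f x"
    using linear_on_extend[OF V f] by blast
  obtain G where G: "finite G" "G \<subseteq> V" "V \<subseteq> vs1.span G" using fin by (auto simp: finite_dim_def)
  have "f ` V = F ` V" using F(2) by auto
  moreover have "F ` V \<subseteq> vs2.span (F ` G)" using linear_span_image[OF F(1), of G] G(3) by auto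
  ultimately show ?thesis unfolding finite_dim_def using G by (intro exI[of _ "F ` G"]) auto
qed

text \<open>The coordinates with respect to a basis of \<open>B/J\<close> embed this quotient into a space of sequences; the multiplication is transported.\<close>

lemma quotient_realisation:
  fixes B :: "('k::field, 'j) aug_alg"
  assumes B: "aug_algebra B" and fin: "finite_dim (pw (*)) (acar B)"
    and J: "alg_ideal B J" "J \<subseteq> aug_ideal B"
  obtains C :: "('k, nat) aug_alg" and \<rho> where "aug_algebra C" "aug_hom B C \<rho>" "\<rho> ` acar B = acar C"
    "{x \<in> acar B. \<rho> x = 0} = J"
proof -
  interpret KF: vector_space_pair "pw ((*) :: 'k \<Rightarrow> 'k \<Rightarrow> 'k)" "(*)"
    by (rule vector_space_pair_times[OF vector_space_pw_times])
  note S = aug_algebraD(1)[OF B] and SJ = alg_idealD(1)[OF J(1)] and JB = alg_idealD(2)[OF J(1)]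
  note one = aug_algebraD(2)[OF B]
  obtain r z \<xi> where f: "frame_mod (pw (*)) (acar B) J r z \<xi>"
    using K.frame_mod_exists[OF SJ K.finite_dim_imp_finite_dim_quot[OF fin]] by metis
  have \<xi>: "Vector_Spaces.linear (pw (*)) (*) (\<xi> i)" "\<And>b. b \<in> J \<Longrightarrow> \<xi> i b = 0" if "i < r" for i
    using f that by (auto simp: frame_mod_def)
  define \<rho> :: "('j \<Rightarrow> 'k) \<Rightarrow> nat \<Rightarrow> 'k" where "\<rho> x = (\<lambda>i. if i < r then \<xi> i x else 0)" for x
  have \<rho>add: "\<rho> (x + y) = \<rho> x + \<rho> y" and \<rho>scl: "\<rho> (pw (*) c x) = pw (*) c (\<rho> x)" for x y c
    using \<xi>(1) by (auto simp: \<rho>_def fun_eq_iff pointwise pw_apply Vector_Spaces.linear_iff)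
  have \<rho>lin: "linear_on (pw (*)) (pw (*)) V \<rho>" for V by (rule linear_onI) (simp_all add: \<rho>add \<rho>scl)
  have \<rho>diff: "\<rho> (x - y) = \<rho> x - \<rho> y" for x y using \<rho>add[of "x - y" y] by simp
  have ker: "\<rho> x = 0 \<longleftrightarrow> x \<in> J" if x: "x \<in> acar B" for x
  proof
    assume "\<rho> x = 0"
    then have "\<rho> x i = 0" for i by (simp add: pointwise)
    then have "\<xi> i x = 0" if "i < r" for i using that by (metis \<rho>_def)
    then have "(\<Sum>i<r. pw (*) (\<xi> i x) (z i)) = 0" by simp
    moreover have "x - (\<Sum>i<r. pw (*) (\<xi> i x) (z i)) \<in> J" using f x by (simp add: frame_mod_def)
    ultimately show "x \<in> J" by simp
  next
    assume "x \<in> J"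
    then show "\<rho> x = 0" using \<xi>(2) by (auto simp: \<rho>_def fun_eq_iff pointwise)
  qed
  define s where "s u = (SOME x. x \<in> acar B \<and> \<rho> x = u)" for u
  have s: "s (\<rho> x) \<in> acar B" "\<rho> (s (\<rho> x)) = \<rho> x" if "x \<in> acar B" for x
    unfolding s_def by (rule someI2[of _ x]; use that in simp)+
  have sJ: "s (\<rho> x) - x \<in> J" if "x \<in> acar B" for x
    using ker[of "s (\<rho> x) - x"] s[OF that] that by (simp add: \<rho>diff K.subspace_diff[OF S])
  define C where "C = \<lparr>acar = \<rho> ` acar B, amul = (\<lambda>u v. \<rho> (amul B (s u) (s v))), aone = \<rho> (aone B),
    aeps = (\<lambda>u. aeps B (s u))\<rparr>"
  note mulB = aug_algebraD(3)[OF B]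
  have mul: "amul C (\<rho> x) (\<rho> y) = \<rho> (amul B x y)" if xy: "x \<in> acar B" "y \<in> acar B" for x y
  proof -
    let ?x = "s (\<rho> x)" and ?y = "s (\<rho> y)"
    note sx = s[OF xy(1)] and sy = s[OF xy(2)]
    define dx dy where "dx = ?x - x" and "dy = ?y - y"
    have dJ: "dx \<in> J" "dy \<in> J" using sJ xy by (simp_all add: dx_def dy_def)
    then have dB: "dx \<in> acar B" "dy \<in> acar B" using JB by auto
    have xd: "?x = x + dx" and yd: "?y = y + dy" by (simp_all add: dx_def dy_def)
    have "amul B ?x ?y = amul B x ?y + amul B dx ?y"
      unfolding xd by (rule aug_algebra_mul_add(2)[OF B sy(1) xy(1) dB(1)])
    moreover have "amul B x ?y = amul B x y + amul B x dy"
      unfolding yd by (rule aug_algebra_mul_add(1)[OF B xy dB(2)])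
    moreover have "amul B dx ?y = amul B ?y dx" by (rule aug_algebraD(5)[OF B dB(1) sy(1)])
    ultimately have "amul B ?x ?y = amul B x y + (amul B x dy + amul B ?y dx)" by (simp add: add.assoc)
    moreover have "\<rho> (amul B x dy + amul B ?y dx) = 0"
    proof -
      have "amul B x dy + amul B ?y dx \<in> J"
        by (intro K.subspace_add[OF SJ] alg_idealD(3)[OF J(1)] dJ xy sy)
      then show ?thesis using ker JB by blast
    qed
    ultimately have "\<rho> (amul B ?x ?y) = \<rho> (amul B x y)" by (simp only: \<rho>add add_0_right)
    then show ?thesis by (simp add: C_def)
  qed
  have eps: "aeps C (\<rho> x) = aeps B x" if x: "x \<in> acar B" for x
  proof -
    have "aeps B (s (\<rho> x) - x) = 0" using sJ[OF x] J(2) by (auto simp: aug_ideal_def)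
    then show ?thesis using KF.linear_on_diff[OF aug_algebraD(9)[OF B] S s(1)[OF x] x] by (simp add: C_def)
  qed
  have car: "acar C = \<rho> ` acar B" and oneC: "aone C = \<rho> (aone B)" by (simp_all add: C_def)
  note plus = K.subspace_add[OF S] and scal = K.subspace_scale[OF S]
  have C: "aug_algebra C"
    unfolding aug_algebra_def car
  proof (intro conjI ballI)
    show "module.subspace (pw (*)) (\<rho> ` acar B)" by (rule KK.subspace_linear_image[OF \<rho>lin S])
    show "aone C \<in> \<rho> ` acar B" using one by (simp add: oneC)
    fix u assume "u \<in> \<rho> ` acar B"
    then obtain x where x: "x \<in> acar B" "u = \<rho> x" by blast
    show "amul C (aone C) u = u" using x one aug_algebraD(7)[OF B] by (simp add: oneC mul)
    show "linear_on (pw (*)) (pw (*)) (\<rho> ` acar B) (amul C u)"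
    proof (rule linear_onI)
      fix v w c assume "v \<in> \<rho> ` acar B"
      then obtain y where y: "y \<in> acar B" "v = \<rho> y" by blast
      show "amul C u (pw (*) c v) = pw (*) c (amul C u v)"
        using x y scal aug_algebra_mul_add(3)[OF B x(1) y(1) y(1)] by (simp add: mul \<rho>scl[symmetric])
      assume "w \<in> \<rho> ` acar B"
      then obtain y' where y': "y' \<in> acar B" "w = \<rho> y'" by blast
      show "amul C u (v + w) = amul C u v + amul C u w"
        using x y y' plus aug_algebra_mul_add(1)[OF B] mulB by (simp add: mul \<rho>add[symmetric])
    qed
    fix v assume "v \<in> \<rho> ` acar B"
    then obtain y where y: "y \<in> acar B" "v = \<rho> y" by blast
    show "amul C u v \<in> \<rho> ` acar B" using x y mulB by (simp add: mul)
    show "amul C u v = amul C v u" using x y aug_algebraD(5)[OF B x(1) y(1)] by (simp add: mul)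
    show "aeps C (amul C u v) = aeps C u * aeps C v" using x y mulB aug_algebraD(10)[OF B] by (simp add: mul eps)
    fix w assume "w \<in> \<rho> ` acar B"
    then obtain y' where y': "y' \<in> acar B" "w = \<rho> y'" by blast
    show "amul C (amul C u v) w = amul C u (amul C v w)"
      using x y y' mulB aug_algebraD(6)[OF B] by (simp add: mul)
  next
    show "linear_on (pw (*)) (*) (\<rho> ` acar B) (aeps C)"
    proof (rule linear_onI)
      fix v w c assume "v \<in> \<rho> ` acar B"
      then obtain y where y: "y \<in> acar B" "v = \<rho> y" by blast
      show "aeps C (pw (*) c v) = c * aeps C v"
        using y scal linear_onD(2)[OF aug_algebraD(9)[OF B]] by (simp add: eps \<rho>scl[symmetric])
      assume "w \<in> \<rho> ` acar B"
      then obtain y' where y': "y' \<in> acar B" "w = \<rho> y'" by blast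
      show "aeps C (v + w) = aeps C v + aeps C w"
        using y y' plus linear_onD(1)[OF aug_algebraD(9)[OF B]] by (simp add: eps \<rho>add[symmetric])
    qed
    show "aeps C (aone C) = 1" using one aug_algebraD(11)[OF B] by (simp add: oneC eps)
  qed
  have "aug_hom B C \<rho>"
    unfolding aug_hom_def using \<rho>lin by (simp add: car mul eps oneC)
  moreover have "{x \<in> acar B. \<rho> x = 0} = J" using ker JB by auto
  ultimately show thesis using that[OF C] car by simp
qed

context hom_leibniz
begin

lemma tmap_cong:
  assumes "sub A" "lin A g" "\<And>a. a \<in> acar A \<Longrightarrow> g a = h a" "t \<in> T A"
  shows "tmap L A g t = tmap L A h t"
proof -
  have 1: "lin A h"
    using linear_on_cong[of "acar A" g h "pw (*)" "pw (*)"] assms(1-3) vector_space_pw_times by simp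
  show ?thesis
    by (rule T_ext[OF _ _ _ assms(4), where F = "tmap L A g"]) (use assms 1 in \<open>auto intro!: tmap_additive simp: tmap_pure\<close>)
qed

lemma bracket_lift_exists:
  assumes D: "aug_algebra D" and A: "aug_algebra A" and P: "aug_hom D A P" and surj: "P ` acar D = acar A"
    and lam: "tbracket A lam"
  obtains br where "is_bracket_lift L A D P lam br"
proof -
  note S = sub_alg[OF A] and SD = sub_alg[OF D]
  obtain s where s: "Vector_Spaces.linear (pw (*)) (pw (*)) s" "\<And>a. a \<in> acar A \<Longrightarrow> s a \<in> acar D"
    "\<And>a. a \<in> acar A \<Longrightarrow> P (s a) = a"
    using aug_hom_section[OF D P surj] by metis
  have sl: "lin A s" by (rule linear_imp_linear_on[OF s(1)])
  define \<psi> where "\<psi> x y = tmap L A s (lam (unit_tens L A x) (unit_tens L A y))" for x y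
  have lamT: "lam (unit_tens L A x) (unit_tens L A y) \<in> T A" for x y
    by (simp add: tbracket_in[OF lam] unit_in[OF A])
  have sc: "tmap L A s (pw (scl L) c t) = pw (scl L) c (tmap L A s t)" if "t \<in> T A" for c t
    by (rule T_ext[OF _ _ _ that, where F = "\<lambda>t. tmap L A s (pw (scl L) c t)"])
      (auto intro!: additive_on_comp[OF tmap_additive[OF S sl] additive_on_intros(11)[OF additive_on_intros(4)]] T_scale
        additive_on_intros tmap_additive[OF S sl] simp: tens_scale' tmap_pure[OF S sl])
  have "\<exists>br. tbracket D br \<and> (\<forall>x y. br (unit_tens L D x) (unit_tens L D y) = \<psi> x y)"
  proof (rule tbracket_extend[OF D, of \<psi>])
    show "bilinear_cochain (pw (scl L)) \<psi>"
      using tbracket_cochain[OF A lam] unfolding bilinear_cochain_def \<psi>_def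
      by (simp add: sc lamT additive_on_T(2)[OF tmap_additive[OF S sl]])
    show "\<psi> x y \<in> T D" for x y unfolding \<psi>_def by (rule tmap_in[OF S sl s(2) lamT])
    show "ttwist L D (\<psi> x y) = \<psi> (twist L x) (twist L y)" for x y
    proof -
      have "ttwist L D (\<psi> x y) = tmap L A s (ttwist L A (lam (unit_tens L A x) (unit_tens L A y)))"
        unfolding \<psi>_def by (rule tmap_ttwist[OF S SD sl s(2) lamT, symmetric])
      then show ?thesis
        unfolding \<psi>_def by (simp add: tbracket_ttwist[OF lam] unit_in[OF A] ttwist_unit[OF A])
    qed
  qed blast
  then obtain br where br: "tbracket D br" "\<And>x y. br (unit_tens L D x) (unit_tens L D y) = \<psi> x y" by blast
  have "lam (unit_tens L A x) (unit_tens L A y) = tmap L D P (br (unit_tens L D x) (unit_tens L D y))" for x y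
  proof -
    have "tmap L D P (\<psi> x y) = tmap L A (\<lambda>a. P (s a)) (lam (unit_tens L A x) (unit_tens L A y))"
      unfolding \<psi>_def by (rule tmap_tmap[OF S SD sl s(2) aug_homD(2)[OF P] lamT])
    also have "\<dots> = lam (unit_tens L A x) (unit_tens L A y)" by (rule tmap_id[OF S s(3) lamT])
    finally show ?thesis by (simp add: br(2))
  qed
  then have "is_bracket_lift L A D P lam br"
    unfolding is_bracket_lift_iff using br(1) tbracket_tmap[OF D A P br(1) lam] by blast
  then show thesis by (rule that)
qed

end

lemma (in universal_extension) lfun_Harr_dual_reflexive:
  assumes "linear_on (pw (*)) (*) (Harr_dual A) \<Phi>"
  shows "\<exists>c\<in>Harr A. \<forall>g\<in>Harr_dual A. \<Phi> g = g c"
proof -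
  obtain x where "x \<in> Z" "\<And>g. g \<in> dual_quot (pw (pw (*))) Z B \<Longrightarrow> \<Phi> g = g (coset B x)"
    using V.quot_reflexive[OF subZ subB finite_dim_quot_harr[OF A fin] assms[unfolded Harr_dual_def]] by metis
  then show ?thesis using coset_in_Harr by (auto simp: Harr_dual_def)
qed

text \<open>The algebra \<open>C\<close> is the quotient of the universal extension by the image of \<open>w'\<close>.\<close>

locale quotient_setting = obstruction_setting L A \<sigma> lam br w
  for L :: "('k::field, 'l::ab_group_add) hom_leib" and A :: "('k, 'i) aug_alg" and \<sigma> lam br w +
  fixes C :: "('k, 'j) aug_alg" and \<rho> and p
  assumes C: "aug_algebra C" and \<rho>: "aug_hom U C \<rho>" and \<rho>_surj: "\<rho> ` acar U = acar C"
    and \<rho>_ker: "{x \<in> acar U. \<rho> x = 0} = case_sum 0 ` obstruction_dual A w ` HL_dual L 3"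
    and p: "\<And>x. x \<in> acar U \<Longrightarrow> p (\<rho> x) = x \<circ> Inl"
begin

lemma CE: assumes "y \<in> acar C" obtains x where "x \<in> acar U" "y = \<rho> x"
  using assms \<rho>_surj by blast

lemma p_hom: "aug_hom C A p"
  unfolding aug_hom_def
proof (intro conjI ballI)
  note SU = aug_algebraD(1)[OF U_alg(1)]
  show "p (aone C) = aone A"
    using p[OF aug_algebraD(2)[OF U_alg(1)]] aug_homD(4)[OF \<rho>] by (simp add: ext_alg_sel)
  show "linear_on (pw (*)) (pw (*)) (acar C) p"
  proof (rule linear_onI)
    fix y y' c assume "y \<in> acar C"
    then obtain x where x: "x \<in> acar U" "y = \<rho> x" by (rule CE)
    show "p (pw (*) c y) = pw (*) c (p y)"
      using x p[OF K.subspace_scale[OF SU x(1)], of c] p linear_onD(2)[OF aug_homD(2)[OF \<rho>] x(1)] by (simp add: case_sum_comp_pw)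
    assume "y' \<in> acar C"
    then obtain x' where x': "x' \<in> acar U" "y' = \<rho> x'" by (rule CE)
    show "p (y + y') = p y + p y'"
      using x x' p[OF K.subspace_add[OF SU x(1) x'(1)]] p linear_onD(1)[OF aug_homD(2)[OF \<rho>] x(1) x'(1)] by (simp add: case_sum_comp_pw)
  qed
  fix y assume "y \<in> acar C"
  then obtain x where x: "x \<in> acar U" "y = \<rho> x" by (rule CE)
  show "p y \<in> acar A" using x p by (simp add: in_U_iff)
  show "aeps A (p y) = aeps C y" using x p aug_homD(5)[OF \<rho>] by (simp add: ext_alg_sel)
  fix y' assume "y' \<in> acar C"
  then obtain x' where x': "x' \<in> acar U" "y' = \<rho> x'" by (rule CE)
  have "p (amul C y y') = p (\<rho> (amul U x x'))" using x x' aug_homD(3)[OF \<rho>] by simp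
  also have "\<dots> = amul A (x \<circ> Inl) (x' \<circ> Inl)"
    unfolding p[OF aug_algebraD(3)[OF U_alg(1) x(1) x'(1)]] by (simp add: ext_alg_sel(2))
  finally show "p (amul C y y') = amul A (p y) (p y')" using x x' p by simp
qed

lemma p_surj: "p ` acar C = acar A"
  unfolding U_alg(3)[symmetric] \<rho>_surj[symmetric] using p by (force simp: image_iff)

lemma p_kernel:
  assumes "y \<in> acar C" "p y = 0"
  obtains g where "g \<in> Harr_dual A" "y = \<rho> (case_sum 0 g)"
proof -
  obtain x where x: "x \<in> acar U" "y = \<rho> x" using assms(1) by (rule CE)
  then have "x \<circ> Inl = 0" using assms(2) p by simp
  then have "x = case_sum 0 (x \<circ> Inr)" by (simp add: case_sum_eq_iff)
  then show thesis using that[of "x \<circ> Inr"] x by (metis in_U_iff)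
qed

lemma p_small: "small_kernel C p"
  unfolding small_kernel_def
proof (intro ballI impI)
  fix d n assume dn: "d \<in> acar C" "n \<in> acar C" "p n = 0"
  obtain x where x: "x \<in> acar U" "d = \<rho> x" using dn(1) by (rule CE)
  obtain g where g: "g \<in> Harr_dual A" "n = \<rho> (case_sum 0 g)" using dn(2,3) by (rule p_kernel)
  note gU = kernel_U[OF g(1)]
  have "amul U x (case_sum 0 g) = pw (*) (aeps U x) (case_sum 0 g)"
    using U_alg(4) x gU unfolding small_kernel_def by simp
  then show "amul C d n = pw (*) (aeps C d) n"
    unfolding x(2) g(2) aug_homD(3)[OF \<rho> x(1) gU, symmetric] aug_homD(5)[OF \<rho> x(1)]
    using linear_onD(2)[OF aug_homD(2)[OF \<rho>] gU] by simp
qed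

lemma finite_dim_C: "finite_dim (pw (*)) (acar C)"
  using KK.finite_dim_image[OF aug_algebraD(1)[OF U_alg(1)] aug_homD(2)[OF \<rho>] finite_dim_U] by (simp add: \<rho>_surj)

lemma finite_dim_p_kernel: "finite_dim (pw (*)) {y \<in> acar C. p y = 0}"
  by (rule K.finite_dim_mono[OF subspace_kernel_on[OF C p_hom] _ finite_dim_C]) auto

lemma \<rho>_kernel_lin: "g \<in> Harr_dual A \<Longrightarrow> h \<in> Harr_dual A \<Longrightarrow> \<rho> (case_sum 0 (g + h)) = \<rho> (case_sum 0 g) + \<rho> (case_sum 0 h)"
  "g \<in> Harr_dual A \<Longrightarrow> \<rho> (case_sum 0 (pw (*) k g)) = pw (*) k (\<rho> (case_sum 0 g))"
proof -
  assume g: "g \<in> Harr_dual A"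
  have "case_sum (0 :: 'i \<Rightarrow> 'k) (pw (*) k g) = pw (*) k (case_sum 0 g)" by (simp add: case_sum_pw pw_zero_right)
  then show "\<rho> (case_sum 0 (pw (*) k g)) = pw (*) k (\<rho> (case_sum 0 g))"
    using linear_onD(2)[OF aug_homD(2)[OF \<rho>] kernel_U[OF g], of k] by (simp only:)
  assume h: "h \<in> Harr_dual A"
  have "case_sum (0 :: 'i \<Rightarrow> 'k) (g + h) = case_sum 0 g + case_sum 0 h" by (simp add: case_sum_pw)
  then show "\<rho> (case_sum 0 (g + h)) = \<rho> (case_sum 0 g) + \<rho> (case_sum 0 h)"
    using linear_onD(1)[OF aug_homD(2)[OF \<rho>] kernel_U[OF g] kernel_U[OF h]] by (simp only:)
qed

text \<open>By reflexivity, a functional on the kernel of the universal extension is evaluation at a class \<open>c\<close>.  If it comes from \<open>C\<close>, it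
  annihilates the image of \<open>w'\<close>, that is, all functionals on \<open>H\<^sup>3(L,L)\<close> vanish at \<open>w c\<close>.\<close>

lemma functional_on_kernel:
  assumes \<xi>: "linear_on (pw (*)) (*) (acar C) \<xi>"
  shows "\<exists>c\<in>Harr A. w c = coboundaries L 3 \<and> (\<forall>g\<in>Harr_dual A. \<xi> (\<rho> (case_sum 0 g)) = g c)"
proof -
  interpret W: vector_space "pw (scl L)" by (rule vector_space_pw_scl)
  interpret KF: vector_space_pair "pw ((*) :: 'k \<Rightarrow> 'k \<Rightarrow> 'k)" "(*)"
    by (rule vector_space_pair_times[OF vector_space_pw_times])
  have "linear_on (pw (*)) (*) (Harr_dual A) (\<lambda>g. \<xi> (\<rho> (case_sum 0 g)))"
    using aug_homD(1)[OF \<rho> kernel_U] by (intro linear_onI) (simp_all add: \<rho>_kernel_lin linear_onD[OF \<xi>])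
  from lfun_Harr_dual_reflexive[OF this]
  obtain c where c: "c \<in> Harr A" "\<And>g. g \<in> Harr_dual A \<Longrightarrow> \<xi> (\<rho> (case_sum 0 g)) = g c" by blast
  have "h (coset (coboundaries L 3) (ob c)) = 0" if h: "h \<in> dual_quot (pw (scl L)) (cocycles L 3) (coboundaries L 3)" for h
  proof -
    have hd: "h \<in> HL_dual L 3" using h by (simp add: HL_dual_def)
    have "case_sum 0 (obstruction_dual A w h) \<in> {x \<in> acar U. \<rho> x = 0}" unfolding \<rho>_ker by (intro imageI hd)
    then have "\<rho> (case_sum 0 (obstruction_dual A w h)) = 0" by simp
    then have "obstruction_dual A w h c = 0"
      using c(2)[OF obstruction_dual_in[OF hd]] KF.linear_on_zero[OF \<xi> aug_algebraD(1)[OF C]] by simp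
    then show ?thesis using c(1) by (simp add: obstruction_dual_def w_ob)
  qed
  then have "ob c \<in> coboundaries L 3"
    by (rule W.dual_quot_separates[OF subspace_cocycles subspace_coboundaries ob_cocycle])
  then have "w c = coboundaries L 3" using w_zero_iff[OF c(1)] by simp
  then show ?thesis using c by (intro bexI[of _ c]) auto
qed

text \<open>Nothing more than the image of \<open>w'\<close> has been divided out: a nonzero element of the kernel in \<open>C\<close> is detected by a functional, which is
  evaluation at a class of \<open>ker w\<close>.\<close>

lemma kernel_zero_iff:
  assumes G: "G \<in> Harr_dual A"
  shows "\<rho> (case_sum 0 G) = 0 \<longleftrightarrow> (\<forall>c\<in>ker_obstruction L A w. G c = 0)"
proof
  interpret W: vector_space "pw (scl L)" by (rule vector_space_pw_scl)
  assume "\<rho> (case_sum 0 G) = 0"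
  then have "case_sum 0 G \<in> {x \<in> acar U. \<rho> x = 0}" using kernel_U[OF G] by simp
  then have "case_sum (0 :: 'i \<Rightarrow> 'k) G \<in> case_sum 0 ` obstruction_dual A w ` HL_dual L 3" unfolding \<rho>_ker .
  then obtain h where h: "h \<in> HL_dual L 3" "case_sum (0 :: 'i \<Rightarrow> 'k) G = case_sum 0 (obstruction_dual A w h)" by blast
  then have "G = obstruction_dual A w h" by (metis case_sum_comps(2))
  moreover have "h (coboundaries L 3) = 0"
    using W.dual_quot_zero[OF h(1)[unfolded HL_dual_def] subspace_cocycles subspace_coboundaries, of 0]
      W.subspace_0[OF subspace_cocycles] W.subspace_0[OF subspace_coboundaries] by (simp add: W.coset_zero)
  ultimately show "\<forall>c\<in>ker_obstruction L A w. G c = 0" by (simp add: ker_obstruction_iff obstruction_dual_def)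
next
  assume 0: "\<forall>c\<in>ker_obstruction L A w. G c = 0"
  show "\<rho> (case_sum 0 G) = 0"
  proof (rule ccontr)
    assume "\<rho> (case_sum 0 G) \<noteq> 0"
    then have "\<rho> (case_sum 0 G) \<notin> {0}" by simp
    then obtain \<xi> where \<xi>: "Vector_Spaces.linear (pw (*)) (*) \<xi>" "\<xi> (\<rho> (case_sum 0 G)) = 1"
      using K.separating_functional[OF K.subspace_single_0] by metis
    obtain c where "c \<in> Harr A" "w c = coboundaries L 3" "\<And>g. g \<in> Harr_dual A \<Longrightarrow> \<xi> (\<rho> (case_sum 0 g)) = g c"
      using functional_on_kernel[OF linear_imp_linear_on[OF \<xi>(1)]] by blast
    then show False using 0 G \<xi>(2) by (simp add: ker_obstruction_iff)
  qed
qed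

text \<open>Evaluation at \<open>c\<close> annihilates the functionals of the form \<open>g \<circ> w\<close>.\<close>

lemma evaluation_descends:
  assumes c: "c \<in> Harr A" "w c = coboundaries L 3"
  obtains \<zeta> where "twisted_derivation C p (\<sigma> c) \<zeta>"
proof -
  note SU = aug_algebraD(1)[OF U_alg(1)]
  have wd: "x (Inr c) = x' (Inr c)" if x: "x \<in> acar U" "x' \<in> acar U" "\<rho> x = \<rho> x'" for x x'
  proof -
    have d: "x - x' \<in> acar U" "\<rho> (x - x') = 0" using x by (auto simp: K.subspace_diff[OF SU] aug_hom_diff[OF U_alg(1) \<rho>])
    then have "x - x' \<in> case_sum 0 ` obstruction_dual A w ` HL_dual L 3" using \<rho>_ker by blast
    then obtain G where G: "x - x' = case_sum 0 G" by blast
    then have "G \<in> Harr_dual A" using d(1) by (simp add: in_U_iff)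
    then have "G c = 0" using kernel_zero_iff d(2) G c by (simp add: ker_obstruction_iff)
    then show ?thesis using fun_cong[OF G, of "Inr c"] by (simp add: pointwise)
  qed
  define \<zeta> where "\<zeta> y = (SOME x. x \<in> acar U \<and> \<rho> x = y) (Inr c)" for y
  have \<zeta>: "\<zeta> (\<rho> x) = x (Inr c)" if "x \<in> acar U" for x
    unfolding \<zeta>_def by (rule someI2[of _ x]) (use that wd in auto)
  note ev = evaluation_twisted[OF c(1), unfolded twisted_derivation_def]
  have "twisted_derivation C p (\<sigma> c) \<zeta>"
    unfolding twisted_derivation_def
  proof (intro conjI ballI)
    show "linear_on (pw (*)) (*) (acar C) \<zeta>"
    proof (rule linear_onI)
      fix y y' k assume "y \<in> acar C"
      then obtain x where x: "x \<in> acar U" "y = \<rho> x" by (rule CE)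
      show "\<zeta> (pw (*) k y) = k * \<zeta> y"
        using x \<zeta>[OF K.subspace_scale[OF SU x(1)], of k] \<zeta> linear_onD(2)[OF aug_homD(2)[OF \<rho>] x(1)] by (simp add: pw_apply)
      assume "y' \<in> acar C"
      then obtain x' where x': "x' \<in> acar U" "y' = \<rho> x'" by (rule CE)
      show "\<zeta> (y + y') = \<zeta> y + \<zeta> y'"
        using x x' \<zeta>[OF K.subspace_add[OF SU x(1) x'(1)]] \<zeta> linear_onD(1)[OF aug_homD(2)[OF \<rho>] x(1) x'(1)] by (simp add: pointwise)
    qed
    fix y y' assume "y \<in> acar C" "y' \<in> acar C"
    then obtain x x' where x: "x \<in> acar U" "y = \<rho> x" and x': "x' \<in> acar U" "y' = \<rho> x'" by (metis CE)
    have "\<zeta> (amul C y y') = (amul U x x') (Inr c)"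
      using \<zeta>[OF aug_algebraD(3)[OF U_alg(1) x(1) x'(1)]] aug_homD(3)[OF \<rho> x(1) x'(1)] x x' by simp
    also have "\<dots> = aeps U x * x' (Inr c) + aeps U x' * x (Inr c) + \<sigma> c (x \<circ> Inl) (x' \<circ> Inl)"
      using ev x(1) x'(1) by blast
    finally show "\<zeta> (amul C y y') = aeps C y * \<zeta> y' + aeps C y' * \<zeta> y + \<sigma> c (p y) (p y')"
      using x x' \<zeta> p aug_homD(5)[OF \<rho>] by simp
  qed
  then show thesis by (rule that)
qed

text \<open>The universal extension adds no new generators: a functional vanishing on the square of the augmentation
  ideal is, up to the augmentation, a derivation, and a derivation trivialises the class at which it evaluates.\<close>

lemma kernel_in_square: "y \<in> acar C \<Longrightarrow> p y = 0 \<Longrightarrow> y \<in> max_pow C 2"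
proof (rule ccontr)
  assume y: "y \<in> acar C" "p y = 0" and "y \<notin> max_pow C 2"
  then obtain \<xi>1 where \<xi>1: "Vector_Spaces.linear (pw (*)) (*) \<xi>1" "\<And>x. x \<in> max_pow C 2 \<Longrightarrow> \<xi>1 x = 0" "\<xi>1 y = 1"
    using K.separating_functional[OF alg_idealD(1)[OF max_pow_ideal[OF C]]] by metis
  note SC = aug_algebraD(1)[OF C] and one = aug_algebraD(2)[OF C]
  note l1 = linear_onD[OF linear_imp_linear_on[OF \<xi>1(1), of UNIV], simplified]
  note epsl = linear_onD[OF aug_algebraD(9)[OF C]]
  \<comment> \<open>a functional which annihilates \<open>1\<close> and the square of the augmentation ideal is a derivation\<close>
  define \<xi> where "\<xi> d = \<xi>1 d - \<xi>1 (aone C) * aeps C d" for d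
  have \<xi>l: "linear_on (pw (*)) (*) (acar C) \<xi>" by (rule linear_onI) (simp_all add: \<xi>_def l1 epsl algebra_simps)
  note ll = linear_onD[OF \<xi>l]
  have \<xi>one: "\<xi> (aone C) = 0" using aug_algebraD(11)[OF C] by (simp add: \<xi>_def)
  have sq: "\<xi> (amul C d e) = 0" if "d \<in> aug_ideal C" "e \<in> aug_ideal C" for d e
  proof -
    have "amul C d e \<in> max_pow C 2" using max_pow_mul[OF that(1), of e "Suc 0"] that(2) max_pow_1[OF C] by (simp add: numeral_2_eq_2)
    moreover have "aeps C (amul C d e) = 0" using that aug_algebraD(10)[OF C] by (simp add: aug_ideal_def)
    ultimately show ?thesis using \<xi>1(2) by (simp add: \<xi>_def)
  qed
  have der: "\<xi> (amul C d e) = aeps C d * \<xi> e + aeps C e * \<xi> d" if de: "d \<in> acar C" "e \<in> acar C" for d e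
  proof -
    define d0 where "d0 = d + pw (*) (- aeps C d) (aone C)"
    define e0 where "e0 = e + pw (*) (- aeps C e) (aone C)"
    have s: "pw (*) k (aone C) \<in> acar C" for k by (rule K.subspace_scale[OF SC one])
    have d0: "d0 \<in> aug_ideal C" and e0: "e0 \<in> aug_ideal C"
      using de s one aug_algebraD(11)[OF C] by (simp_all add: d0_def e0_def aug_ideal_def K.subspace_add[OF SC] epsl del: K.scale_minus_left)
    then have in': "d0 \<in> acar C" "e0 \<in> acar C" by (simp_all add: aug_ideal_def)
    have "d = d0 + pw (*) (aeps C d) (aone C)" "e = e0 + pw (*) (aeps C e) (aone C)"
      by (simp_all add: d0_def e0_def)
    then have "amul C d e = amul C d0 e + amul C (pw (*) (aeps C d) (aone C)) e"
      using aug_algebra_mul_add(2)[OF C de(2) in'(1) s[of "aeps C d"]] by simp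
    also have "amul C (pw (*) (aeps C d) (aone C)) e = pw (*) (aeps C d) e"
      using aug_algebra_mul_add(4)[OF C de(2) one one] aug_algebraD(7)[OF C de(2)] by simp
    also have "amul C d0 e = amul C d0 e0 + pw (*) (aeps C e) d0"
      using aug_algebra_mul_add(1)[OF C in'(1) in'(2) s[of "aeps C e"]] aug_algebra_mul_add(3)[OF C in'(1) one one] aug_algebraD(8)[OF C in'(1)]
        \<open>e = e0 + _\<close> by simp
    finally have "\<xi> (amul C d e) = \<xi> (amul C d0 e0) + aeps C e * \<xi> d0 + aeps C d * \<xi> e"
      using in' de aug_algebraD(3)[OF C] K.subspace_add[OF SC] K.subspace_scale[OF SC] by (simp add: ll)
    moreover have "\<xi> d0 = \<xi> d" unfolding d0_def using de s one \<xi>one by (simp add: ll del: K.scale_minus_left)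
    ultimately show ?thesis using sq[OF d0 e0] by simp
  qed
  obtain c where c: "c \<in> Harr A" "\<And>g. g \<in> Harr_dual A \<Longrightarrow> \<xi> (\<rho> (case_sum 0 g)) = g c"
    using functional_on_kernel[OF \<xi>l] by blast
  note ev = evaluation_twisted[OF c(1), unfolded twisted_derivation_def]
  note SU = aug_algebraD(1)[OF U_alg(1)] and \<rho>l = linear_onD[OF aug_homD(2)[OF \<rho>]]
  \<comment> \<open>\<open>\<xi> \<circ> \<rho>\<close> agrees with evaluation at \<open>c\<close> on the kernel; the difference descends to \<open>A\<close>, where its coboundary is \<open>\<sigma> c\<close>\<close>
  define h where "h x = \<xi> (\<rho> x) - x (Inr c)" for x
  have hl: "h (x + x') = h x + h x'" "h (pw (*) k x) = k * h x" if "x \<in> acar U" "x' \<in> acar U" for x x' k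
    using that aug_homD(1)[OF \<rho>] by (simp_all add: h_def \<rho>l ll pointwise pw_apply algebra_simps)
  have hmul: "h (amul U x x') = aeps U x * h x' + aeps U x' * h x - \<sigma> c (x \<circ> Inl) (x' \<circ> Inl)"
    if x: "x \<in> acar U" "x' \<in> acar U" for x x'
  proof -
    have "(amul U x x') (Inr c) = aeps U x * x' (Inr c) + aeps U x' * x (Inr c) + \<sigma> c (x \<circ> Inl) (x' \<circ> Inl)"
      using ev x by blast
    moreover have "\<xi> (\<rho> (amul U x x')) = aeps U x * \<xi> (\<rho> x') + aeps U x' * \<xi> (\<rho> x)"
      using der[OF aug_homD(1)[OF \<rho> x(1)] aug_homD(1)[OF \<rho> x(2)]] aug_homD(3)[OF \<rho> x] aug_homD(5)[OF \<rho>] x by simp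
    ultimately show ?thesis by (simp add: h_def algebra_simps)
  qed
  have zH: "0 \<in> Harr_dual A" by (rule K.subspace_0[OF subspace_Harr_dual])
  have aU: "case_sum a 0 \<in> acar U" if "a \<in> acar A" for a using that zH by (simp add: in_U_iff)
  have h0: "h x = h (case_sum (x \<circ> Inl) 0)" if x: "x \<in> acar U" for x
  proof -
    have g: "x \<circ> Inr \<in> Harr_dual A" "x \<circ> Inl \<in> acar A" using x by (auto simp: in_U_iff)
    have "x = case_sum (x \<circ> Inl) 0 + case_sum 0 (x \<circ> Inr)" by (simp add: case_sum_pw case_sum_eq_iff)
    then have "h x = h (case_sum (x \<circ> Inl) 0) + h (case_sum 0 (x \<circ> Inr))" using hl(1)[OF aU[OF g(2)] kernel_U[OF g(1)]] by simp
    moreover have "h (case_sum 0 (x \<circ> Inr)) = 0" using c(2)[OF g(1)] by (simp add: h_def)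
    ultimately show ?thesis by simp
  qed
  define g where "g a = h (case_sum a 0)" for a
  have gl: "linear_on (pw (*)) (*) (acar A) g"
  proof (rule linear_onI)
    fix a b k assume a: "a \<in> acar A"
    have "case_sum (pw (*) k a) 0 = pw (*) k (case_sum a (0 :: (('i \<Rightarrow> 'k) \<Rightarrow> ('i \<Rightarrow> 'k) \<Rightarrow> 'k) set \<Rightarrow> 'k))" by (simp add: case_sum_pw)
    then show "g (pw (*) k a) = k * g a" using hl(2)[OF aU[OF a] aU[OF a], of k] by (simp add: g_def)
    assume b: "b \<in> acar A"
    have "case_sum (a + b) 0 = case_sum a (0 :: (('i \<Rightarrow> 'k) \<Rightarrow> ('i \<Rightarrow> 'k) \<Rightarrow> 'k) set \<Rightarrow> 'k) + case_sum b 0" by (simp add: case_sum_pw)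
    then show "g (a + b) = g a + g b" using hl(1)[OF aU[OF a] aU[OF b]] by (simp add: g_def)
  qed
  have "\<sigma> c = (\<lambda>a b. if a \<in> acar A \<and> b \<in> acar A then aeps A a * g b - g (amul A a b) + aeps A b * g a else 0)"
  proof (intro ext)
    fix a b
    show "\<sigma> c a b = (if a \<in> acar A \<and> b \<in> acar A then aeps A a * g b - g (amul A a b) + aeps A b * g a else 0)"
    proof (cases "a \<in> acar A \<and> b \<in> acar A")
      case True
      then have ab: "case_sum a 0 \<in> acar U" "case_sum b 0 \<in> acar U" using aU by auto
      have "h (amul U (case_sum a 0) (case_sum b 0)) = g (amul A a b)"
        unfolding h0[OF aug_algebraD(3)[OF U_alg(1) ab]] by (simp add: g_def ext_alg_sel(2))
      then show ?thesis using hmul[OF ab] True by (simp add: g_def ext_alg_sel(4) algebra_simps)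
    next
      case False
      then show ?thesis using harr_cocyclesD(1)[OF \<sigma>_in[OF c(1)]] by auto
    qed
  qed
  then have \<sigma>B: "\<sigma> c \<in> B" by (rule harr_coboundariesI[OF gl])
  obtain z where z: "z \<in> Z" "c = coset B z" using c(1) by (rule HarrE)
  have "z \<in> B" using V.subspace_diff[OF subB \<sigma>B \<sigma>_coset[OF z(1)]] z(2) by simp
  obtain g' where g': "g' \<in> Harr_dual A" "y = \<rho> (case_sum 0 g')" using y by (rule p_kernel)
  have "\<xi> y = g' (coset B z)" using c(2)[OF g'(1)] g'(2) z(2) by simp
  also have "\<dots> = 0" using V.dual_quot_zero[OF g'(1)[unfolded Harr_dual_def] subZ subB z(1) \<open>z \<in> B\<close>] .
  finally have "\<xi> y = 0" .
  moreover have "aeps C y = 0" using aug_homD(5)[OF p_hom y(1)] y(2) aeps_zero[OF A] by simp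
  ultimately show False using \<xi>1(3) by (simp add: \<xi>_def)
qed

text \<open>Every functional on \<open>C\<close> takes the obstruction of the induced bracket to the obstruction at a class of \<open>ker w\<close>, which is
  a coboundary.\<close>

lemma deformation_exists: obtains \<mu> where "is_pushout L C A p \<mu> lam"
proof -
  note SU = sub_alg[OF U_alg(1)] and SC = sub_alg[OF C]
  obtain br' where br': "tbracket C br'"
    "\<And>x y. br' (unit_tens L C x) (unit_tens L C y) = tmap L U \<rho> (br (unit_tens L U x) (unit_tens L U y))"
    using tbracket_pushout[OF U_alg(1) C \<rho> br] by metis
  note u = unit_in[OF U_alg(1)]
  have brT: "br (unit_tens L U x) (unit_tens L U y) \<in> T U" for x y by (rule tbracket_in[OF br u u])
  have "lam (unit_tens L A x) (unit_tens L A y) = tmap L C p (br' (unit_tens L C x) (unit_tens L C y))" for x y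
  proof -
    have "tmap L C p (tmap L U \<rho> (br (unit_tens L U x) (unit_tens L U y))) = tmap L U (\<lambda>u. p (\<rho> u)) (br (unit_tens L U x) (unit_tens L U y))"
      by (rule tmap_tmap[OF SU SC aug_homD(2,1)[OF \<rho>] aug_homD(2)[OF p_hom] brT])
    also have "\<dots> = tmap L U (\<lambda>u. u \<circ> Inl) (br (unit_tens L U x) (unit_tens L U y))"
      by (rule tmap_cong[OF SU _ _ brT, symmetric]) (use aug_homD(2)[OF U_alg(2)] p in auto)
    also have "\<dots> = lam (unit_tens L A x) (unit_tens L A y)"
      by (simp add: br_lift u tmap_unit[OF U_alg(1,2)])
    finally show ?thesis by (simp add: br'(2))
  qed
  note lift' = tbracket_tmap[OF C A p_hom br'(1) deformationD(2)[OF lam] this]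
  show thesis
  proof (rule deformation_extends[OF C A p_hom p_surj p_small finite_dim_p_kernel lam br'(1) lift'])
    fix \<xi> assume \<xi>: "linear_on (pw (*)) (*) (acar C) \<xi>"
    obtain c where c: "c \<in> Harr A" "w c = coboundaries L 3" "\<And>g. g \<in> Harr_dual A \<Longrightarrow> \<xi> (\<rho> (case_sum 0 g)) = g c"
      using functional_on_kernel[OF \<xi>] by blast
    obtain \<beta> where \<beta>: "cochain2 \<beta>" "\<And>x y z. tev U (\<lambda>u. u (Inr c)) (obstruction_cochain L U br x y z) = d2 \<beta> x y z"
    proof -
      have "ob c \<in> coboundaries L 3" using w_zero_iff[OF c(1)] c(2) by simp
      then show thesis using that unfolding ob_exact_iff by blast
    qed
    have \<xi>\<rho>: "lfun U (\<lambda>u. \<xi> (\<rho> u))"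
      by (rule linear_on_comp[OF aug_homD(2)[OF \<rho>] \<xi>]) (use aug_homD(1)[OF \<rho>] in auto)
    have "tev C \<xi> (obstruction_cochain L C br' x y z) = d2 \<beta> x y z" for x y z
    proof -
      have obs: "tmap L U \<rho> (obstruction_cochain L U br x y z) = obstruction_cochain L C br' x y z"
        by (rule obstruction_tmap[OF U_alg(1) C \<rho> br tbracket_tmap[OF U_alg(1) C \<rho> br br']])
      have "tev C \<xi> (obstruction_cochain L C br' x y z) = tev C \<xi> (tmap L U \<rho> (obstruction_cochain L U br x y z))"
        unfolding obs by (rule refl)
      also have "\<dots> = tev U (\<lambda>u. \<xi> (\<rho> u)) (obstruction_cochain L U br x y z)"
        by (rule tev_tmap[OF SU SC aug_homD(2,1)[OF \<rho>] \<xi> ob_in_T])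
      also have "\<dots> = tev U (\<lambda>u. u (Inr c)) (obstruction_cochain L U br x y z)"
      proof (rule T_kernel_ext[OF U_alg(1) A U_alg(2,3), where F = "tev U (\<lambda>u. \<xi> (\<rho> u))" and G = "tev U (\<lambda>u. u (Inr c))"])
        show "additive_on (T U) (tev U (\<lambda>u. \<xi> (\<rho> u)))" "additive_on (T U) (tev U (\<lambda>u. u (Inr c)))"
          by (rule tev_additive[OF SU \<xi>\<rho>], rule tev_additive[OF SU lfun_coordinate])
        show "obstruction_cochain L U br x y z \<in> T U" by (rule ob_in_T)
        show "tmap L U (\<lambda>x. x \<circ> Inl) (obstruction_cochain L U br x y z) = 0"
          by (rule obstruction_in_kernel[OF U_alg(1) A U_alg(2) U_alg(3) U_alg(4) lam br br_lift])
      next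
        fix n l assume n: "n \<in> acar U" "n \<circ> Inl = 0"
        have "n = case_sum 0 (n \<circ> Inr)" using n(2) by (simp add: case_sum_eq_iff)
        then have "\<xi> (\<rho> n) = n (Inr c)" using c(3)[of "n \<circ> Inr"] n(1) by (simp add: in_U_iff)
        then show "tev U (\<lambda>u. \<xi> (\<rho> u)) (tens L n l) = tev U (\<lambda>u. u (Inr c)) (tens L n l)"
          using n(1) by (simp add: tev_pure[OF SU \<xi>\<rho>] tev_pure[OF SU lfun_coordinate])
      qed
      finally show ?thesis by (simp add: \<beta>(2))
    qed
    then show "\<exists>\<beta>. cochain2 \<beta> \<and> (\<forall>x y z. tev C \<xi> (obstruction_cochain L C br' x y z) = d2 \<beta> x y z)" using \<beta>(1) by blast
  qed (assumption | rule that)+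
qed

lemma extension_property:
  assumes i: "\<And>g. g \<in> Harr_dual A \<Longrightarrow> i (restrict g) = \<rho> (case_sum 0 g)" and loc: "local_algebra A"
  shows "algebra_extension A (ker_obstruction_dual L A w) C i p"
proof -
  note SH = subspace_Harr_dual
  let ?M = "ker_obstruction_dual L A w"
  have M: "?M = restrict ` Harr_dual A" by (rule ker_obstruction_dual_eq)
  have rl: "restrict (g + h) = restrict g + restrict h" "restrict (pw (*) k g) = pw (*) k (restrict g)" for g h k
    by (auto simp: restrict_def fun_eq_iff pointwise pw_apply)
  have rlin: "linear_on (pw (*)) (pw (*)) (Harr_dual A) restrict" by (rule linear_onI) (simp_all add: rl)
  have iC: "i m \<in> acar C" "p (i m) = 0" if "m \<in> ?M" for m
  proof -
    obtain g where g: "g \<in> Harr_dual A" "m = restrict g" using \<open>m \<in> ?M\<close> M by auto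
    show "i m \<in> acar C" "p (i m) = 0" using g i aug_homD(1)[OF \<rho> kernel_U] p[OF kernel_U] by simp_all
  qed
  show ?thesis
    unfolding algebra_extension_def
  proof (intro conjI loc C p_hom p_surj)
    show "module.subspace (pw (*)) ?M" unfolding M by (rule KK.subspace_linear_image[OF rlin SH])
    show "finite_dim (pw (*)) ?M" unfolding M by (rule KK.finite_dim_image[OF SH rlin finite_dim_Harr_dual])
    show "linear_on (pw (*)) (pw (*)) ?M i"
    proof (rule linear_onI)
      fix m m' k assume "m \<in> ?M"
      then obtain g where g: "g \<in> Harr_dual A" "m = restrict g" using M by auto
      show "i (pw (*) k m) = pw (*) k (i m)"
        using g i[OF K.subspace_scale[OF SH g(1)], of k] i[OF g(1)] \<rho>_kernel_lin(2)[OF g(1)] by (simp add: rl)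
      assume "m' \<in> ?M"
      then obtain g' where g': "g' \<in> Harr_dual A" "m' = restrict g'" using M by auto
      show "i (m + m') = i m + i m'"
        using g g' i[OF K.subspace_add[OF SH g(1) g'(1)]] i[OF g(1)] i[OF g'(1)] \<rho>_kernel_lin(1)[OF g(1) g'(1)] by (simp add: rl)
    qed
    show "inj_on i ?M"
    proof (rule inj_onI)
      fix m m' assume m: "m \<in> ?M" "m' \<in> ?M" "i m = i m'"
      then obtain g g' where g: "g \<in> Harr_dual A" "m = restrict g" "g' \<in> Harr_dual A" "m' = restrict g'" using M by auto
      have d: "g - g' \<in> Harr_dual A" using g K.subspace_diff[OF SH] by blast
      have "\<rho> (case_sum 0 (g - g')) + \<rho> (case_sum 0 g') = \<rho> (case_sum 0 g)"
        using \<rho>_kernel_lin(1)[OF d g(3)] by simp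
      then have "\<rho> (case_sum 0 (g - g')) = 0" using m(3) g i by simp
      then have "\<forall>c\<in>ker_obstruction L A w. (g - g') c = 0" using kernel_zero_iff[OF d] by blast
      then show "m = m'" using g by (auto simp: restrict_def fun_eq_iff pointwise)
    qed
    show "i ` ?M = {b \<in> acar C. p b = 0}"
    proof
      show "i ` ?M \<subseteq> {b \<in> acar C. p b = 0}" using iC by auto
      show "{b \<in> acar C. p b = 0} \<subseteq> i ` ?M"
      proof clarify
        fix b assume "b \<in> acar C" "p b = 0"
        then obtain g where "g \<in> Harr_dual A" "b = \<rho> (case_sum 0 g)" by (rule p_kernel)
        then show "b \<in> i ` ?M" using i M by (metis image_eqI)
      qed
    qed
    show "\<forall>m\<in>?M. \<forall>b\<in>acar C. amul C (i m) b = i (pw (*) (aeps A (p b)) m)"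
    proof (intro ballI)
      fix m b assume mb: "m \<in> ?M" "b \<in> acar C"
      obtain g where g: "g \<in> Harr_dual A" "m = restrict g" using mb M by auto
      have "amul C (i m) b = pw (*) (aeps C b) (i m)"
        using kernel_mul(2)[OF C A p_hom p_surj p_small mb(2)] iC[OF mb(1)] by blast
      also have "\<dots> = i (pw (*) (aeps C b) m)"
        using g i[OF K.subspace_scale[OF SH g(1)], of "aeps C b"] i[OF g(1)] \<rho>_kernel_lin(2)[OF g(1)] by (simp add: rl)
      finally show "amul C (i m) b = i (pw (*) (aeps A (p b)) m)" using aug_homD(5)[OF p_hom mb(2)] by simp
    qed
    show "\<forall>m\<in>?M. \<forall>m'\<in>?M. amul C (i m) (i m') = 0"
    proof (intro ballI)
      fix m m' assume m: "m \<in> ?M" "m' \<in> ?M"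
      have "amul C (i m) (i m') = pw (*) (aeps C (i m)) (i m')"
        using kernel_mul(1)[OF C A p_hom p_surj p_small] iC[OF m(1)] iC[OF m(2)] by blast
      also have "aeps C (i m) = 0" using kernel_eps[OF C A p_hom p_surj p_small] iC[OF m(1)] by blast
      finally show "amul C (i m) (i m') = 0" by (simp add: pw_def fun_eq_iff pointwise)
    qed
  qed
qed

end

section \<open>Single steps of the construction\<close>

context hom_leibniz
begin

lemma inductive_stepE:
  fixes A :: "('k, 'i) aug_alg"
  assumes step: "inductive_step L A lam w C i p"
    and A: "aug_algebra A" "finite_dim (pw (*)) (acar A)" and lam: "deformation L A lam"
  obtains \<sigma> br \<rho> where "quotient_setting L A \<sigma> lam br w C \<rho> p"
    "\<And>g. g \<in> Harr_dual A \<Longrightarrow> i (\<lambda>c. if c \<in> ker_obstruction L A w then g c else 0) = \<rho> (case_sum 0 g)"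
proof -
  obtain \<sigma> \<rho> where *: "aug_algebra C" "harr_section A \<sigma>" "is_obstruction_map L A lam \<sigma> w"
      "aug_hom (harr_univ_ext A \<sigma>) C \<rho>" "\<rho> ` acar (harr_univ_ext A \<sigma>) = acar C"
      "{x \<in> acar (harr_univ_ext A \<sigma>). \<rho> x = 0} = case_sum 0 ` obstruction_dual A w ` HL_dual L 3"
      "\<forall>g\<in>Harr_dual A. i (\<lambda>c. if c \<in> ker_obstruction L A w then g c else 0) = \<rho> (case_sum 0 g)"
      "\<forall>x\<in>acar (harr_univ_ext A \<sigma>). p (\<rho> x) = x \<circ> Inl"
    using step unfolding inductive_step_def by blast
  obtain br where br: "is_bracket_lift L A (harr_univ_ext A \<sigma>) (\<lambda>x. x \<circ> Inl) lam br"
    "\<forall>c\<in>Harr A. w c = coset (coboundaries L 3)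
        (\<lambda>xs. if length xs = 3
              then obstruction_cochain L (harr_univ_ext A \<sigma>) br (xs ! 0) (xs ! 1) (xs ! 2) (Inr c) else 0)"
    using *(3) unfolding is_obstruction_map_def by blast
  have "quotient_setting L A \<sigma> lam br w C \<rho> p"
  proof unfold_locales
    show "w c = coset (coboundaries L 3) (\<lambda>xs. if length xs = 3
              then obstruction_cochain L (harr_univ_ext A \<sigma>) br (xs ! 0) (xs ! 1) (xs ! 2) (Inr c) else 0)"
      if "c \<in> Harr A" for c using br(2) that by blast
    show "p (\<rho> x) = x \<circ> Inl" if "x \<in> acar (harr_univ_ext A \<sigma>)" for x using *(8) that by blast
  qed (fact A lam br(1) *)+
  then show thesis using that *(7) by blast
qed

lemma inductive_step_exists:
  fixes A :: "('k, nat) aug_alg"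
  assumes A: "aug_algebra A" "finite_dim (pw (*)) (acar A)" and lam: "deformation L A lam"
  shows "\<exists>w C i p. inductive_step L A lam w C i p"
proof -
  interpret W: vector_space "pw (scl L)" by (rule vector_space_pw_scl)
  obtain \<sigma> where \<sigma>: "harr_section A \<sigma>" using harr_section_exists[OF A] by blast
  interpret universal_extension A \<sigma> by unfold_locales (fact A \<sigma>)+
  obtain br where br: "is_bracket_lift L A U (\<lambda>x. x \<circ> Inl) lam br"
    using bracket_lift_exists[OF U_alg(1) A(1) U_alg(2,3) deformationD(2)[OF lam]] by blast
  define w where "w c = coset (coboundaries L 3)
        (\<lambda>xs. if length xs = 3 then obstruction_cochain L U br (xs ! 0) (xs ! 1) (xs ! 2) (Inr c) else 0)" for c
  interpret O: obstruction_setting L A \<sigma> lam br w by unfold_locales (fact lam br | rule w_def)+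
  let ?H = "HL_dual L 3"
  let ?J = "case_sum (0 :: nat \<Rightarrow> 'k) ` obstruction_dual A w ` ?H"
  have J: "alg_ideal U ?J" "?J \<subseteq> aug_ideal U"
  proof -
    have ol: "linear_on (pw (*)) (pw (*)) ?H (obstruction_dual A w)"
      by (intro linear_onI) (auto simp: obstruction_dual_def fun_eq_iff pointwise pw_apply)
    have SH: "module.subspace (pw (*)) ?H" unfolding HL_dual_def by (rule W.subspace_dual_quot)
    note SO = KK.subspace_linear_image[OF ol SH]
    have cl: "linear_on (pw (*)) (pw (*)) (obstruction_dual A w ` ?H) (case_sum (0 :: nat \<Rightarrow> 'k))"
      by (intro linear_onI) (simp_all add: case_sum_pw pw_zero_right)
    have SJ: "module.subspace (pw (*)) ?J" by (rule KK.subspace_linear_image[OF cl SO])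
    have JU: "?J \<subseteq> acar U" using O.obstruction_dual_in kernel_U by blast
    have "amul U a x \<in> ?J" if "a \<in> acar U" "x \<in> ?J" for a x
    proof -
      have "x \<circ> Inl = 0" using that(2) by auto
      then have "amul U a x = pw (*) (aeps U a) x"
        using U_alg(4) that JU unfolding small_kernel_def by blast
      then show ?thesis using K.subspace_scale[OF SJ that(2)] by simp
    qed
    then show "alg_ideal U ?J" using SJ JU by (simp add: alg_ideal_def)
    show "?J \<subseteq> aug_ideal U"
      using JU aeps_zero[OF A(1)] by (auto simp: aug_ideal_def ext_alg_sel(4))
  qed
  obtain C :: "('k, nat) aug_alg" and \<rho> where C: "aug_algebra C" "aug_hom U C \<rho>" "\<rho> ` acar U = acar C"
    "{x \<in> acar U. \<rho> x = 0} = ?J"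
    by (rule quotient_realisation[OF U_alg(1) finite_dim_U J]) blast
  define s where "s y = (SOME x. x \<in> acar U \<and> \<rho> x = y)" for y
  define p where "p y = s y \<circ> Inl" for y
  have p: "p (\<rho> x) = x \<circ> Inl" if x: "x \<in> acar U" for x
  proof -
    have s: "s (\<rho> x) \<in> acar U" "\<rho> (s (\<rho> x)) = \<rho> x"
      unfolding s_def by (rule someI2[of _ x]; use x in simp)+
    then have "s (\<rho> x) - x \<in> {x \<in> acar U. \<rho> x = 0}"
      using x by (simp add: K.subspace_diff[OF aug_algebraD(1)[OF U_alg(1)]] aug_hom_diff[OF U_alg(1) C(2)])
    then have "s (\<rho> x) - x \<in> ?J" unfolding C(4) .
    then obtain G where G: "s (\<rho> x) - x = case_sum 0 G" by blast
    have "(s (\<rho> x) \<circ> Inl) - (x \<circ> Inl) = (s (\<rho> x) - x) \<circ> Inl" by (simp add: fun_eq_iff pointwise)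
    then show ?thesis using G by (simp add: p_def)
  qed
  interpret Q: quotient_setting L A \<sigma> lam br w C \<rho> p
    by unfold_locales (fact C p)+
  define i where "i m = \<rho> (case_sum 0 (SOME g. g \<in> Harr_dual A \<and> O.restrict g = m))" for m
  have i: "i (O.restrict g) = \<rho> (case_sum 0 g)" if g: "g \<in> Harr_dual A" for g
  proof -
    define g' where "g' = (SOME g'. g' \<in> Harr_dual A \<and> O.restrict g' = O.restrict g)"
    have g': "g' \<in> Harr_dual A" "O.restrict g' = O.restrict g"
      unfolding g'_def by (rule someI2[of _ g]; use g in simp)+
    have d: "g' - g \<in> Harr_dual A" using g g' K.subspace_diff[OF subspace_Harr_dual] by blast
    have "(g' - g) c = 0" if "c \<in> ker_obstruction L A w" for c
      using fun_cong[OF g'(2), of c] that by (simp add: O.restrict_def pointwise)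
    then have "\<rho> (case_sum 0 (g' - g)) = 0" using Q.kernel_zero_iff[OF d] by blast
    moreover have "\<rho> (case_sum 0 (g' - g)) + \<rho> (case_sum 0 g) = \<rho> (case_sum 0 g')"
      using Q.\<rho>_kernel_lin(1)[OF d g] by simp
    ultimately show ?thesis by (simp add: i_def g'_def)
  qed
  have "is_obstruction_map L A lam \<sigma> w"
    unfolding is_obstruction_map_def using br w_def by blast
  then have "inductive_step L A lam w C i p"
    unfolding inductive_step_def using C \<sigma> p i
    by (intro conjI exI[of _ \<sigma>] exI[of _ \<rho>]) (auto simp: O.restrict_def)
  then show ?thesis by blast
qed

section \<open>Stages of the construction\<close>

lemma base_field: "aug_algebra (base_field :: ('k, unit) aug_alg)" "finite_dim (pw (*)) (acar (base_field :: ('k, unit) aug_alg))"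
  "max_pow (base_field :: ('k, unit) aug_alg) (Suc 0) \<subseteq> {0}"
proof -
  show A: "aug_algebra (base_field :: ('k, unit) aug_alg)"
    unfolding aug_algebra_def base_field_def by (auto simp: linear_on_def fun_eq_iff pointwise pw_apply algebra_simps)
  have "x \<in> K.span {\<lambda>_ :: unit. 1}" for x
  proof -
    have "x = pw (*) (x ()) (\<lambda>_. 1)" by (auto simp: pw_def fun_eq_iff)
    moreover have "pw (*) (x ()) (\<lambda>_. 1) \<in> K.span {\<lambda>_ :: unit. 1}" by (intro K.span_scale K.span_base) auto
    ultimately show ?thesis by simp
  qed
  then show "finite_dim (pw (*)) (acar (base_field :: ('k, unit) aug_alg))"
    unfolding finite_dim_def by (intro exI[of _ "{\<lambda>_. 1}"]) (auto simp: base_field_def)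
  show "max_pow (base_field :: ('k, unit) aug_alg) (Suc 0) \<subseteq> {0}"
    unfolding max_pow_1[OF A] by (auto simp: aug_ideal_def base_field_def fun_eq_iff pointwise)
qed

abbreviation "IB \<equiv> inf_base L"

lemma inf_base: "aug_algebra IB" "aug_hom IB base_field (\<lambda>x. x \<circ> Inl)" "(\<lambda>x. x \<circ> Inl) ` acar IB = acar base_field"
    "small_kernel IB (\<lambda>x. x \<circ> Inl)" "max_pow IB 2 \<subseteq> {0}"
proof -
  interpret W: vector_space "pw (scl L)" by (rule vector_space_pw_scl)
  have M: "module.subspace (pw (*)) (HL_dual L 2)" unfolding HL_dual_def by (rule W.subspace_dual_quot)
  have z: "(\<lambda>_. 0 :: 'x \<Rightarrow> 'k) = (\<lambda>_. 0)" "(0 :: 'x \<Rightarrow> 'k) = 0" by auto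
  note * = ext_alg[OF base_field(1) M, of "\<lambda>_ _. 0", folded inf_base_def]
  have 0: "0 \<in> HL_dual L 2" by (rule K.subspace_0[OF M])
  show 1: "aug_algebra IB" by (rule *(1)) (simp_all add: 0 linear_on_def pw_zero_right)
  show 2: "aug_hom IB base_field (\<lambda>x. x \<circ> Inl)" by (rule *(2)) (simp_all add: 0 linear_on_def pw_zero_right)
  show "(\<lambda>x. x \<circ> Inl) ` acar IB = acar base_field" by (rule *(3)) (simp_all add: 0 linear_on_def pw_zero_right)
  show 4: "small_kernel IB (\<lambda>x. x \<circ> Inl)" by (rule *(4)) (simp_all add: 0 linear_on_def pw_zero_right)
  show "max_pow IB 2 \<subseteq> {0}"
    using max_pow_small_kernel[OF 1 base_field(1) 2 4 base_field(3)] by (simp only: numeral_2_eq_2)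
qed

lemma inf_base_derivation: "twisted_derivation IB (\<lambda>x. x \<circ> Inl) (\<lambda>_ _. 0) (\<lambda>x. x (Inr c))"
  unfolding twisted_derivation_def inf_base_def
  by (auto simp: linear_on_def pointwise ext_alg_sel pw_apply)

lemma is_pushout_comp:
  assumes "is_pushout L A B \<phi> lam lam'" "is_pushout L B C \<psi> lam' lam''"
  shows "is_pushout L A C (\<lambda>x. \<psi> (\<phi> x)) lam lam''"
proof -
  have 1: "aug_hom A B \<phi>" "deformation L A lam" "deformation L B lam'"
    "\<And>x y. lam' (unit_tens L B x) (unit_tens L B y) = tmap L A \<phi> (lam (unit_tens L A x) (unit_tens L A y))"
    using assms(1) by (simp_all add: is_pushout_def)
  have 2: "aug_hom B C \<psi>" "deformation L C lam''"
    "\<And>x y. lam'' (unit_tens L C x) (unit_tens L C y) = tmap L B \<psi> (lam' (unit_tens L B x) (unit_tens L B y))"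
    using assms(2) by (simp_all add: is_pushout_def)
  note A = deformationD(1)[OF 1(2)] and B = deformationD(1)[OF 1(3)]
  have "tmap L B \<psi> (tmap L A \<phi> t) = tmap L A (\<lambda>x. \<psi> (\<phi> x)) t" if "t \<in> T A" for t
    by (rule tmap_tmap[OF sub_alg[OF A] sub_alg[OF B] aug_homD(2,1)[OF 1(1)] aug_homD(2)[OF 2(1)] that])
  then show ?thesis
    using 1 2 aug_hom_comp[OF 1(1) 2(1)] tbracket_in[OF deformationD(2)[OF 1(2)] unit_in[OF A] unit_in[OF A]]
    by (simp add: is_pushout_def)
qed

lemma is_pushout_inverse:
  assumes iso: "aug_iso A B \<psi>" and po: "is_pushout L A B \<psi> lam lam'"
  shows "is_pushout L B A (the_inv_into (acar A) \<psi>) lam' lam"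
proof -
  have hom: "aug_hom A B \<psi>" and inj: "inj_on \<psi> (acar A)" and im: "\<psi> ` acar A = acar B"
    using iso by (auto simp: aug_iso_def bij_betw_def)
  have d: "deformation L A lam" "deformation L B lam'"
    "\<And>x y. lam' (unit_tens L B x) (unit_tens L B y) = tmap L A \<psi> (lam (unit_tens L A x) (unit_tens L A y))"
    using po by (simp_all add: is_pushout_def)
  note A = deformationD(1)[OF d(1)] and B = deformationD(1)[OF d(2)]
  let ?i = "the_inv_into (acar A) \<psi>"
  have i: "?i (\<psi> x) = x" if "x \<in> acar A" for x by (rule the_inv_into_f_f[OF inj that])
  have E: "\<exists>x\<in>acar A. y = \<psi> x" if "y \<in> acar B" for y using that im by blast
  have ihom: "aug_hom B A ?i"
    unfolding aug_hom_def
  proof (intro conjI ballI)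
    show "?i (aone B) = aone A" using i[OF aug_algebraD(2)[OF A]] aug_homD(4)[OF hom] by simp
    show "linear_on (pw (*)) (pw (*)) (acar B) ?i"
    proof (rule linear_onI)
      fix y y' c assume "y \<in> acar B"
      then obtain x where x: "x \<in> acar A" "y = \<psi> x" using E by blast
      show "?i (pw (*) c y) = pw (*) c (?i y)"
        using x i[OF K.subspace_scale[OF aug_algebraD(1)[OF A] x(1)], of c] linear_onD(2)[OF aug_homD(2)[OF hom] x(1)] i by simp
      assume "y' \<in> acar B"
      then obtain x' where x': "x' \<in> acar A" "y' = \<psi> x'" using E by blast
      show "?i (y + y') = ?i y + ?i y'"
        using x x' i[OF K.subspace_add[OF aug_algebraD(1)[OF A] x(1) x'(1)]] linear_onD(1)[OF aug_homD(2)[OF hom] x(1) x'(1)] i by simp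
    qed
    fix y assume "y \<in> acar B"
    then obtain x where x: "x \<in> acar A" "y = \<psi> x" using E by blast
    show "?i y \<in> acar A" using x i by simp
    show "aeps A (?i y) = aeps B y" using x i aug_homD(5)[OF hom] by simp
    fix y' assume "y' \<in> acar B"
    then obtain x' where x': "x' \<in> acar A" "y' = \<psi> x'" using E by blast
    show "?i (amul B y y') = amul A (?i y) (?i y')"
      using x x' i[OF aug_algebraD(3)[OF A x(1) x'(1)]] aug_homD(3)[OF hom x(1) x'(1)] i by simp
  qed
  have "lam (unit_tens L A x) (unit_tens L A y) = tmap L B ?i (lam' (unit_tens L B x) (unit_tens L B y))" for x y
  proof -
    have t: "lam (unit_tens L A x) (unit_tens L A y) \<in> T A" by (rule tbracket_in[OF deformationD(2)[OF d(1)] unit_in[OF A] unit_in[OF A]])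
    have "tmap L B ?i (tmap L A \<psi> (lam (unit_tens L A x) (unit_tens L A y))) = tmap L A (\<lambda>a. ?i (\<psi> a)) (lam (unit_tens L A x) (unit_tens L A y))"
      by (rule tmap_tmap[OF sub_alg[OF A] sub_alg[OF B] aug_homD(2,1)[OF hom] aug_homD(2)[OF ihom] t])
    also have "\<dots> = lam (unit_tens L A x) (unit_tens L A y)" by (rule tmap_id[OF sub_alg[OF A] i t])
    finally show ?thesis by (simp add: d(3))
  qed
  then show ?thesis using ihom d by (simp add: is_pushout_def)
qed

text \<open>The coordinates of \<open>K \<oplus> H\<^sup>2(L,L)'\<close> at classes are derivations, and the coordinate of the universal infinitesimal deformation at
  the class of \<open>\<phi>\<close> is a cocycle of this class.\<close>

lemma differential_surjective:
  assumes univ: "universal_infinitesimal L lam0" and q: "is_pushout L A IB q lam lam0"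
    and \<phi>: "\<phi> \<in> cocycles L 2"
  shows "\<exists>\<theta> \<gamma>. twisted_derivation A (\<lambda>a. a) (\<lambda>_ _. 0) \<theta> \<and> cochain1 \<gamma> \<and>
      (\<forall>x y. tev A \<theta> (lam (unit_tens L A x) (unit_tens L A y)) = \<phi> [x, y] + d1 \<gamma> x y)"
proof -
  interpret W: vector_space "pw (scl L)" by (rule vector_space_pw_scl)
  let ?B = "coboundaries L 2" and ?Z = "cocycles L 2"
  note SZ = subspace_cocycles[of 2] and SB = subspace_coboundaries[of 2]
  obtain n \<mu> g where b: "basis_quot (pw (scl L)) ?Z ?B n \<mu>"
    and g: "\<And>i. i < n \<Longrightarrow> g i \<in> HL_dual L 2" "\<And>i j. i < n \<Longrightarrow> j < n \<Longrightarrow> g i (coset ?B (\<mu> j)) = (if i = j then 1 else 0)"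
    and lam0: "\<And>l1 l2. lam0 (unit_tens L IB l1) (unit_tens L IB l2) =
           unit_tens L IB (brk L l1 l2) + (\<Sum>i<n. tens L (case_sum 0 (g i)) (\<mu> i [l1, l2]))"
    using univ unfolding universal_infinitesimal_def by blast
  have qd: "aug_hom A IB q" "deformation L A lam" "deformation L IB lam0"
    "\<And>x y. lam0 (unit_tens L IB x) (unit_tens L IB y) = tmap L A q (lam (unit_tens L A x) (unit_tens L A y))"
    using q by (simp_all add: is_pushout_def)
  note A = deformationD(1)[OF qd(2)]
  obtain c where c: "\<phi> - (\<Sum>i<n. pw (scl L) (c i) (\<mu> i)) \<in> ?B" using b \<phi> unfolding basis_quot_def by blast
  have \<mu>: "\<mu> i \<in> ?Z" if "i < n" for i using b that by (simp add: basis_quot_def)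
  define X where "X = coset ?B \<phi>"
  have gX: "g i X = c i" if i: "i < n" for i
  proof -
    interpret WF: vector_space_pair "pw (scl L)" "(*)" by (rule vector_space_pair_times[OF vector_space_pw_scl])
    note gi = g(1)[OF i, unfolded HL_dual_def]
    have "X = coset ?B (\<Sum>j<n. pw (scl L) (c j) (\<mu> j))" unfolding X_def using W.coset_eq_iff[OF SB] c by blast
    then have "g i X = (\<Sum>j<n. g i (coset ?B (pw (scl L) (c j) (\<mu> j))))"
      using WF.linear_on_sum[OF W.dual_quot_linear_on[OF gi] SZ, of "{..<n}" "\<lambda>j. pw (scl L) (c j) (\<mu> j)"] \<mu> W.subspace_scale[OF SZ] by simp
    also have "\<dots> = (\<Sum>j<n. if j = i then c i else 0)"
      by (rule sum.cong) (use \<mu> g(2)[OF i] in \<open>auto simp: W.dual_quotD(2)[OF gi]\<close>)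
    finally show ?thesis using i by simp
  qed
  obtain \<gamma> where \<gamma>: "cochain1 \<gamma>" "\<And>x y. (\<phi> - (\<Sum>i<n. pw (scl L) (c i) (\<mu> i))) [x, y] = d1 \<gamma> x y"
    using coboundaries2D[OF c] by metis
  define \<theta> where "\<theta> a = (q a) (Inr X)" for a
  note der = inf_base_derivation[of X, unfolded twisted_derivation_def]
  have td: "twisted_derivation A (\<lambda>a. a) (\<lambda>_ _. 0) \<theta>"
    unfolding twisted_derivation_def \<theta>_def
  proof (intro conjI ballI)
    show "linear_on (pw (*)) (*) (acar A) (\<lambda>a. q a (Inr X))"
      by (rule linear_on_comp[OF aug_homD(2)[OF qd(1)] conjunct1[OF der]]) (use aug_homD(1)[OF qd(1)] in auto)
    show "q (amul A d e) (Inr X) = aeps A d * q e (Inr X) + aeps A e * q d (Inr X) + 0" if "d \<in> acar A" "e \<in> acar A" for d e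
      using conjunct2[OF der] aug_homD(1,3,5)[OF qd(1)] that by simp
  qed
  have val: "tev A \<theta> (lam (unit_tens L A x) (unit_tens L A y)) = \<phi> [x, y] + d1 (\<lambda>x. - \<gamma> x) x y" for x y
  proof -
    have t: "lam (unit_tens L A x) (unit_tens L A y) \<in> T A" by (rule tbracket_in[OF deformationD(2)[OF qd(2)] unit_in[OF A] unit_in[OF A]])
    have "tev A \<theta> (lam (unit_tens L A x) (unit_tens L A y)) = tev IB (\<lambda>u. u (Inr X)) (tmap L A q (lam (unit_tens L A x) (unit_tens L A y)))"
      unfolding \<theta>_def by (rule tev_tmap[OF sub_alg[OF A] sub_alg[OF inf_base(1)] aug_homD(2,1)[OF qd(1)] conjunct1[OF der] t, symmetric])
    also have "\<dots> = lam0 (unit_tens L IB x) (unit_tens L IB y) (Inr X)"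
      unfolding qd(4)[symmetric]
      by (rule tev_coordinate[OF sub_alg[OF inf_base(1)] tbracket_in[OF deformationD(2)[OF qd(3)] unit_in[OF inf_base(1)] unit_in[OF inf_base(1)]]])
    also have "\<dots> = (\<Sum>i<n. scl L (c i) (\<mu> i [x, y]))"
      unfolding lam0 by (simp add: pointwise sum_apply tens_def inf_base_def ext_alg_sel(3) gX)
    also have "\<dots> = \<phi> [x, y] - d1 \<gamma> x y"
      unfolding \<gamma>(2)[symmetric] by (simp add: pointwise sum_apply pw_apply)
    also have "\<dots> = \<phi> [x, y] + d1 (\<lambda>x. - \<gamma> x) x y" by (simp add: d1_def brk_neg)
    finally show ?thesis .
  qed
  have "cochain1 (\<lambda>x. - \<gamma> x)" using \<gamma>(1) by (auto simp: cochain1_def linear_scl_iff twist_neg)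
  then show ?thesis using td val by blast
qed

lemma constructedD:
  assumes "constructed L k C \<eta> w i p"
  shows "j \<le> k \<Longrightarrow> fd_local_algebra (C j)" "j \<le> k \<Longrightarrow> deformation L (C j) (\<eta> j)"
    "bij_betw (aeps (C 0)) (acar (C 0)) UNIV"
    "\<exists>lam \<psi>. universal_infinitesimal L lam \<and> aug_iso IB (C 1) \<psi> \<and> is_pushout L IB (C 1) \<psi> lam (\<eta> 1)"
    "j < k \<Longrightarrow> is_pushout L (C (Suc j)) (C j) (p j) (\<eta> (Suc j)) (\<eta> j)"
    "1 \<le> j \<Longrightarrow> j < k \<Longrightarrow> inductive_step L (C j) (\<eta> j) (w j) (C (Suc j)) (i j) (p j)"
  using assms unfolding constructed_def by blast+

lemma fd_localD: "fd_local_algebra A \<Longrightarrow> aug_algebra A" "fd_local_algebra A \<Longrightarrow> finite_dim (pw (*)) (acar A)"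
  "fd_local_algebra A \<Longrightarrow> local_algebra A"
  by (auto simp: fd_local_algebra_def local_algebra_def)

lemma constructed_universal:
  assumes con: "constructed L k C \<eta> w i p" and j: "1 \<le> j" "j \<le> k"
  shows "\<exists>lam q. universal_infinitesimal L lam \<and> is_pushout L (C j) IB q (\<eta> j) lam"
  using j
proof (induction j)
  case (Suc j)
  show ?case
  proof (cases "j = 0")
    case True
    then show ?thesis using constructedD(4)[OF con] is_pushout_inverse by fastforce
  next
    case False
    then obtain lam q where "universal_infinitesimal L lam" "is_pushout L (C j) IB q (\<eta> j) lam" using Suc by auto
    moreover have "is_pushout L (C (Suc j)) (C j) (p j) (\<eta> (Suc j)) (\<eta> j)"
      using constructedD(5)[OF con, of j] Suc.prems by simp
    ultimately show ?thesis using is_pushout_comp by blast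
  qed
qed simp

lemma constructed_nilpotent:
  assumes con: "constructed L k C \<eta> w i p" and k: "1 \<le> k" and j: "j \<le> k"
  shows "max_pow (C j) (Suc j) \<subseteq> {0}"
  using j
proof (induction j)
  case 0
  have A: "aug_algebra (C 0)" using constructedD(1)[OF con, of 0] by (simp add: fd_localD)
  have "x = 0" if "x \<in> aug_ideal (C 0)" for x
    using that constructedD(3)[OF con] aeps_zero[OF A] K.subspace_0[OF aug_algebraD(1)[OF A]]
    by (auto simp: aug_ideal_def bij_betw_def inj_on_def)
  then show ?case unfolding max_pow_1[OF A] by blast
next
  case (Suc j)
  show ?case
  proof (cases "j = 0")
    case True
    obtain \<psi> where \<psi>: "aug_iso IB (C 1) \<psi>" using constructedD(4)[OF con] by blast
    have A: "aug_algebra (C 1)" using constructedD(1)[OF con, of 1] k by (simp add: fd_localD)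
    have h: "aug_hom IB (C 1) \<psi>" "\<psi> ` acar IB = acar (C 1)" using \<psi> by (auto simp: aug_iso_def bij_betw_def)
    have "y = 0" if y: "y \<in> max_pow (C 1) 2" for y
    proof -
      obtain x where "x \<in> max_pow IB 2" "\<psi> x = y" using max_pow_surj[OF inf_base(1) A h y] by blast
      then show ?thesis using inf_base(5) aug_hom_zero[OF inf_base(1) h(1)] by auto
    qed
    then have "max_pow (C 1) 2 \<subseteq> {0}" by blast
    then show ?thesis using True by (simp only: numeral_2_eq_2 One_nat_def)
  next
    case False
    then have j: "1 \<le> j" "j < k" using Suc.prems by auto
    have A: "aug_algebra (C j)" "finite_dim (pw (*)) (acar (C j))" using constructedD(1)[OF con, of j] j by (auto simp: fd_localD)
    obtain \<sigma> br \<rho> where "quotient_setting L (C j) \<sigma> (\<eta> j) br (w j) (C (Suc j)) \<rho> (p j)"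
    proof -
      have "deformation L (C j) (\<eta> j)"
        using constructedD(2)[OF con, of j] j by simp
      show thesis
      proof (rule inductive_stepE[OF constructedD(6)[OF con j] A \<open>deformation L (C j) (\<eta> j)\<close>], goal_cases)
        case 1
        show ?case by (rule that[OF 1(1)])
      qed
    qed
    then interpret quotient_setting L "C j" \<sigma> "\<eta> j" br "w j" "C (Suc j)" \<rho> "p j" .
    show ?thesis
      by (rule max_pow_small_kernel[OF C A(1) p_hom p_small]) (use Suc j in auto)
  qed
qed

text \<open>The hypothesis of the uniqueness lemma, that derivations of \<open>C\<^sub>k\<close> realise all classes of \<open>2\<close>-cocycles, holds because the derivations
  of \<open>C\<^sub>1\<close> do and can be pulled back along \<open>C\<^sub>k \<rightarrow> C\<^sub>1\<close>.\<close>

theorem single_step: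
  assumes con: "constructed L k C \<eta> w i p" and k: "1 \<le> k"
    and step: "inductive_step L (C k) (\<eta> k) wk C' i' p'"
  shows "fd_local_algebra C'" "max_pow C' (Suc (Suc k)) \<subseteq> {0}"
    "algebra_extension (C k) (ker_obstruction_dual L (C k) wk) C' i' p'"
    "\<exists>\<mu>. is_pushout L C' (C k) p' \<mu> (\<eta> k)"
    "is_pushout L C' (C k) p' \<mu> (\<eta> k) \<Longrightarrow> is_pushout L C' (C k) p' \<mu>' (\<eta> k) \<Longrightarrow>
       \<exists>u \<nu>. extension_automorphism (ker_obstruction_dual L (C k) wk) C' i' p' u \<and>
          is_pushout L C' C' u \<mu> \<nu> \<and> equivalent_deformations L C' \<nu> \<mu>'"
proof -
  have loc: "local_algebra (C k)" and Ck: "aug_algebra (C k)" "finite_dim (pw (*)) (acar (C k))"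
    using constructedD(1)[OF con, of k] by (auto simp: fd_localD)
  obtain \<sigma> br \<rho> where q: "quotient_setting L (C k) \<sigma> (\<eta> k) br wk C' \<rho> p'"
    and i': "\<And>g. g \<in> Harr_dual (C k) \<Longrightarrow> i' (\<lambda>c. if c \<in> ker_obstruction L (C k) wk then g c else 0) = \<rho> (case_sum 0 g)"
    using inductive_stepE[OF step Ck constructedD(2)[OF con]] by auto
  interpret Q: quotient_setting L "C k" \<sigma> "\<eta> k" br wk C' \<rho> p' by (rule q)
  show nil: "max_pow C' (Suc (Suc k)) \<subseteq> {0}"
    by (rule max_pow_small_kernel[OF Q.C Ck(1) Q.p_hom Q.p_small constructed_nilpotent[OF con k order_refl]])
  show "fd_local_algebra C'"
    using local_if_nilpotent[OF Q.C nil] Q.finite_dim_C by (simp add: fd_local_algebra_def)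
  show ext: "algebra_extension (C k) (ker_obstruction_dual L (C k) wk) C' i' p'"
    by (rule Q.extension_property[OF _ loc]) (simp add: Q.restrict_def i')
  show "\<exists>\<mu>. is_pushout L C' (C k) p' \<mu> (\<eta> k)" using Q.deformation_exists by blast
  show "\<exists>u \<nu>. extension_automorphism (ker_obstruction_dual L (C k) wk) C' i' p' u \<and>
          is_pushout L C' C' u \<mu> \<nu> \<and> equivalent_deformations L C' \<nu> \<mu>'"
    if \<mu>: "is_pushout L C' (C k) p' \<mu> (\<eta> k)" "is_pushout L C' (C k) p' \<mu>' (\<eta> k)"
  proof -
    obtain lam0 q0 where u: "universal_infinitesimal L lam0" "is_pushout L (C k) IB q0 (\<eta> k) lam0"
      using constructed_universal[OF con k order_refl] by blast
    have im: "i' ` ker_obstruction_dual L (C k) wk = {b \<in> acar C'. p' b = 0}"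
      using ext by (simp add: algebra_extension_def)
    have "\<exists>u \<nu>. aug_iso C' C' u \<and> (\<forall>n\<in>acar C'. p' n = 0 \<longrightarrow> u n = n) \<and> (\<forall>d\<in>acar C'. p' (u d) = p' d) \<and>
      is_pushout L C' C' u \<mu> \<nu> \<and> equivalent_deformations L C' \<nu> \<mu>'"
      by (rule extension_unique[OF Q.C Ck(1) Q.p_hom Q.p_surj Q.p_small Q.finite_dim_p_kernel \<mu> differential_surjective[OF u]]) blast+
    then obtain u \<nu> where *: "aug_iso C' C' u" "\<forall>n\<in>acar C'. p' n = 0 \<longrightarrow> u n = n" "\<forall>d\<in>acar C'. p' (u d) = p' d"
      "is_pushout L C' C' u \<mu> \<nu>" "equivalent_deformations L C' \<nu> \<mu>'" by blast
    have "u (i' m) = i' m" if "m \<in> ker_obstruction_dual L (C k) wk" for m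
    proof -
      have "i' m \<in> {b \<in> acar C'. p' b = 0}" unfolding im[symmetric] using that by (rule imageI)
      then show ?thesis using *(2) by blast
    qed
    then have "extension_automorphism (ker_obstruction_dual L (C k) wk) C' i' p' u"
      using *(1,3) by (simp add: extension_automorphism_def)
    then show ?thesis using *(4,5) by blast
  qed
qed

end

section \<open>Existence of the construction\<close>

context hom_leibniz
begin

lemma trivial_deformation:
  assumes A: "aug_algebra A"
  obtains lam where "deformation L A lam" "\<And>x y. lam (unit_tens L A x) (unit_tens L A y) = unit_tens L A (brk L x y)"
proof -
  have "\<exists>lam. tbracket A lam \<and> (\<forall>x y. lam (unit_tens L A x) (unit_tens L A y) = unit_tens L A (brk L x y))"
  proof (rule tbracket_extend[OF A, of "\<lambda>x y. unit_tens L A (brk L x y)"])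
    show "bilinear_cochain (pw (scl L)) (\<lambda>x y. unit_tens L A (brk L x y))"
      by (simp add: bilinear_cochain_def brk_add brk_scl tens_add tens_scale')
  qed (auto simp: unit_in[OF A] ttwist_unit[OF A] twist_brk)
  then obtain lam where lam: "tbracket A lam" "\<And>x y. lam (unit_tens L A x) (unit_tens L A y) = unit_tens L A (brk L x y)"
    by blast
  have "obstruction_cochain L A lam x y z = 0" for x y z
    unfolding obstruction_cochain_def Let_def lam(2) brk_leibniz by (simp add: tens_diff)
  then have "deformation L A lam" by (intro deformationI[OF A lam(1)]) (simp_all add: lam(2) teps_unit[OF A])
  then show thesis using that lam(2) by blast
qed

text \<open>The coordinate of the obstruction at a class is the coboundary of a combination of the cocycles \<open>\<mu>\<^sub>i\<close>, up to the defect of the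
  zero twist.  This defect vanishes, as the comparison with the constant deformation shows.\<close>

lemma universal_infinitesimal_exists:
  assumes H: "finite_dim_quot (pw (scl L)) (cocycles L 2) (coboundaries L 2)"
  shows "\<exists>lam. universal_infinitesimal L lam"
proof -
  interpret W: vector_space "pw (scl L)" by (rule vector_space_pw_scl)
  let ?B = "coboundaries L 2" and ?Z = "cocycles L 2"
  note SZ = subspace_cocycles[of 2] and SB = subspace_coboundaries[of 2]
  note I = inf_base(1) and BF = base_field(1)
  note SI = sub_alg[OF I]
  obtain n \<mu> \<xi> where f: "frame_mod (pw (scl L)) ?Z ?B n \<mu> \<xi>" using W.frame_mod_exists[OF SB H] by metis
  define g where "g i = quot_functional ?Z ?B (\<xi> i)" for i
  have \<mu>: "\<mu> i \<in> ?Z" if "i < n" for i using f that by (simp add: frame_mod_def)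
  have g: "g i \<in> HL_dual L 2" if "i < n" for i using W.frame_dual(1)[OF SZ SB f that] by (simp add: g_def HL_dual_def)
  have gd: "g i (coset ?B (\<mu> j)) = (if i = j then 1 else 0)" if "i < n" "j < n" for i j
    using W.frame_dual(2)[OF SZ SB f that(1) \<mu>[OF that(2)]] f that by (simp add: g_def frame_mod_def)
  have basis: "basis_quot (pw (scl L)) ?Z ?B n \<mu>"
    unfolding basis_quot_def
  proof (intro conjI allI impI ballI)
    show "\<mu> i \<in> ?Z" if "i < n" for i by (rule \<mu>[OF that])
    show "\<exists>c. z - (\<Sum>i<n. pw (scl L) (c i) (\<mu> i)) \<in> ?B" if "z \<in> ?Z" for z
      using f that unfolding frame_mod_def by (intro exI[of _ "\<lambda>i. \<xi> i z"]) blast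
    fix c i assume *: "(\<Sum>i<n. pw (scl L) (c i) (\<mu> i)) \<in> ?B" and i: "i < n"
    interpret WF: vector_space_pair "pw (scl L)" "(*)" by (rule vector_space_pair_times[OF vector_space_pw_scl])
    have \<xi>l: "Vector_Spaces.linear (pw (scl L)) (*) (\<xi> i)" using f i by (simp add: frame_mod_def)
    have "0 = \<xi> i (\<Sum>j<n. pw (scl L) (c j) (\<mu> j))" using f i * by (simp add: frame_mod_def)
    also have "\<dots> = (\<Sum>j<n. c j * \<xi> i (\<mu> j))" by (simp add: WF.linear_sum[OF \<xi>l] WF.linear_scale[OF \<xi>l])
    also have "\<dots> = (\<Sum>j<n. if j = i then c i else 0)" using f i by (intro sum.cong) (auto simp: frame_mod_def)
    finally show "c i = 0" using i by simp
  qed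
  have gI: "case_sum 0 (g i) \<in> acar IB" if "i < n" for i
    using g[OF that] by (simp add: inf_base_def ext_alg_sel(1) base_field_def)
  define \<psi> where "\<psi> l1 l2 = unit_tens L IB (brk L l1 l2) + (\<Sum>i<n. tens L (case_sum 0 (g i)) (\<mu> i [l1, l2]))" for l1 l2
  have c2: "cochain2 (\<lambda>x y. \<mu> i [x, y])" if "i < n" for i by (rule cocycles2D(1)[OF \<mu>[OF that]])
  note c2' = c2[unfolded cochain2_def bilinear_cochain_def]
  have sumT: "(\<Sum>i<n. tens L (case_sum 0 (g i)) (l i)) \<in> T IB" for l by (rule T_sum) (simp add: T_pure gI)
  have "\<exists>lam. tbracket IB lam \<and> (\<forall>x y. lam (unit_tens L IB x) (unit_tens L IB y) = \<psi> x y)"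
  proof (rule tbracket_extend[OF I, of \<psi>])
    show "bilinear_cochain (pw (scl L)) \<psi>"
      unfolding bilinear_cochain_def \<psi>_def using c2'
      by (simp add: brk_add brk_scl tens_add sum.distrib W.scale_right_distrib W.scale_sum_right tens_scale' algebra_simps)
    show "\<psi> x y \<in> T IB" for x y unfolding \<psi>_def by (rule T_add[OF unit_in[OF I] sumT])
    show "ttwist L IB (\<psi> x y) = \<psi> (twist L x) (twist L y)" for x y
    proof -
      have "ttwist L IB (\<Sum>i<n. tens L (case_sum 0 (g i)) (\<mu> i [x, y])) = (\<Sum>i<n. ttwist L IB (tens L (case_sum 0 (g i)) (\<mu> i [x, y])))"
        by (rule additive_on_T(5)[OF ttwist_additive[OF SI]]) (simp add: T_pure gI)
      also have "\<dots> = (\<Sum>i<n. tens L (case_sum 0 (g i)) (\<mu> i [twist L x, twist L y]))"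
        by (rule sum.cong) (simp_all add: ttwist_pure[OF SI] gI c2')
      finally show ?thesis
        unfolding \<psi>_def by (simp add: additive_on_T(2)[OF ttwist_additive[OF SI]] unit_in[OF I] sumT ttwist_unit[OF I] twist_brk)
    qed
  qed blast
  then obtain lam where lam: "tbracket IB lam" "\<And>x y. lam (unit_tens L IB x) (unit_tens L IB y) = \<psi> x y" by blast
  obtain lam0 where lam0: "deformation L base_field lam0"
    "\<And>x y. lam0 (unit_tens L base_field x) (unit_tens L base_field y) = unit_tens L base_field (brk L x y)"
    using trivial_deformation[OF BF] by metis
  obtain triv where triv: "deformation L IB triv"
    "\<And>x y. triv (unit_tens L IB x) (unit_tens L IB y) = unit_tens L IB (brk L x y)"
    using trivial_deformation[OF I] by metis
  note P = inf_base(2)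
  note add = additive_on_T[OF tmap_hom_additive[OF I BF P]]
  have "tmap L IB (\<lambda>x. x \<circ> Inl) (\<Sum>i<n. tens L (case_sum 0 (g i)) (l i)) = 0" for l
  proof -
    have "tmap L IB (\<lambda>x. x \<circ> Inl) (\<Sum>i<n. tens L (case_sum 0 (g i)) (l i))
        = (\<Sum>i<n. tmap L IB (\<lambda>x. x \<circ> Inl) (tens L (case_sum 0 (g i)) (l i)))"
      by (rule add(5)) (simp add: T_pure gI)
    then show ?thesis by (simp add: tmap_pure[OF SI aug_homD(2)[OF P]] gI tens_zero)
  qed
  then have lamP: "lam0 (unit_tens L base_field x) (unit_tens L base_field y) = tmap L IB (\<lambda>x. x \<circ> Inl) (lam (unit_tens L IB x) (unit_tens L IB y))" for x y
    unfolding lam(2) \<psi>_def lam0(2) by (simp add: add(2) unit_in[OF I] sumT tmap_unit[OF I P])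
  have trivP: "lam0 (unit_tens L base_field x) (unit_tens L base_field y) = tmap L IB (\<lambda>x. x \<circ> Inl) (triv (unit_tens L IB x) (unit_tens L IB y))" for x y
    unfolding triv(2) lam0(2) by (simp add: tmap_unit[OF I P])
  note lift = tbracket_tmap[OF I BF P lam(1) deformationD(2)[OF lam0(1)] lamP]
  note lift' = tbracket_tmap[OF I BF P deformationD(2)[OF triv(1)] deformationD(2)[OF lam0(1)] trivP]
  have f0: "\<And>a. a \<in> acar base_field \<Longrightarrow> lfun base_field ((\<lambda>_ _. 0) a)" by (simp add: linear_on_def)
  have coord: "lfun IB (\<lambda>u. u j)" for j by (auto simp: linear_on_def pw_def pointwise)
  have one: "aone IB (Inr X) = 0" for X by (simp add: inf_base_def ext_alg_sel(3) pointwise)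
  \<comment> \<open>the defect of the zero twist, computed with the constant deformation, which has no obstruction\<close>
  have defect0: "defect base_field lam0 (\<lambda>_ _. 0) x y z = 0" for x y z
  proof -
    have t0: "tev2 IB triv (\<lambda>u. u (Inr undefined)) = (\<lambda>_ _. 0)"
      unfolding tev2_def triv(2) by (intro ext) (simp add: tev_pure[OF SI coord aug_algebraD(2)[OF I]] one)
    have "tev IB (\<lambda>u. u (Inr undefined)) (obstruction_cochain L IB triv x y z) =
        d2 (tev2 IB triv (\<lambda>u. u (Inr undefined))) x y z + defect base_field lam0 (\<lambda>_ _. 0) x y z"
      by (rule tev_obstruction[OF I BF P deformationD(2,4)[OF lam0(1)] deformationD(2)[OF triv(1)] lift' f0 refl inf_base_derivation])
    then show ?thesis
      unfolding t0 deformationD(3)[OF triv(1)] additive_on_T(1)[OF tev_additive[OF SI coord]]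
      by (simp add: d2_def brk_zero)
  qed
  have obin: "obstruction_cochain L IB lam x y z \<in> T IB" for x y z by (rule obstruction_in[OF I BF P lam(1)])
  have "obstruction_cochain L IB lam x y z = 0" for x y z
  proof
    fix j
    have "tev IB (\<lambda>u. u j) (obstruction_cochain L IB lam x y z) = 0"
    proof (cases j)
      case (Inl u)
      have bl: "lfun base_field (\<lambda>a. a u)" by (auto simp: linear_on_def pw_def pointwise)
      have "tev IB (\<lambda>a. (a \<circ> Inl) u) (obstruction_cochain L IB lam x y z) = tev base_field (\<lambda>a. a u) (tmap L IB (\<lambda>x. x \<circ> Inl) (obstruction_cochain L IB lam x y z))"
        by (rule tev_tmap[OF SI sub_alg[OF BF] aug_homD(2,1)[OF P] bl obin, symmetric])
      also have "\<dots> = 0"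
      proof -
        have k: "tmap L IB (\<lambda>x. x \<circ> Inl) (obstruction_cochain L IB lam x y z) = 0"
          by (rule obstruction_in_kernel[OF I BF P inf_base(3,4) lam0(1) lam(1) lift])
        show ?thesis unfolding k by (rule additive_on_T(1)[OF tev_additive[OF sub_alg[OF BF] bl]])
      qed
      finally show ?thesis using Inl by simp
    next
      case (Inr X)
      let ?\<beta> = "\<Sum>i<n. pw (scl L) (g i X) (\<mu> i)"
      have \<beta>Z: "?\<beta> \<in> ?Z" using \<mu> by (intro W.subspace_sum[OF SZ] W.subspace_scale[OF SZ]) auto
      have t2: "tev2 IB lam (\<lambda>u. u (Inr X)) = (\<lambda>x y. ?\<beta> [x, y])"
      proof (intro ext)
        fix x y
        have "tev2 IB lam (\<lambda>u. u (Inr X)) x y = \<psi> x y (Inr X)"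
          unfolding tev2_def lam(2) \<psi>_def by (rule tev_coordinate[OF SI T_add[OF unit_in[OF I] sumT]])
        then show "tev2 IB lam (\<lambda>u. u (Inr X)) x y = ?\<beta> [x, y]"
          by (simp add: \<psi>_def pointwise sum_apply tens_def one pw_apply)
      qed
      have "tev IB (\<lambda>u. u (Inr X)) (obstruction_cochain L IB lam x y z) =
          d2 (tev2 IB lam (\<lambda>u. u (Inr X))) x y z + defect base_field lam0 (\<lambda>_ _. 0) x y z"
        by (rule tev_obstruction[OF I BF P deformationD(2,4)[OF lam0(1)] lam(1) lift f0 refl inf_base_derivation])
      then show ?thesis unfolding t2 defect0 cocycles2D(2)[OF \<beta>Z] using Inr by simp
    qed
    then show "obstruction_cochain L IB lam x y z j = 0 j" by (simp add: tev_coordinate[OF SI obin] pointwise)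
  qed
  then have "deformation L IB lam"
    by (intro deformationI[OF I lam(1)] lift_teps[OF I BF P inf_base(3,4) lam0(1) lam(1) lift]) auto
  then have "universal_infinitesimal L lam"
    unfolding universal_infinitesimal_def using basis g gd lam(2)[unfolded \<psi>_def] by blast
  then show ?thesis by blast
qed

lemma augmentation_hom:
  fixes A :: "('k, 'i) aug_alg" and B :: "('k, 'j) aug_alg"
  assumes A: "aug_algebra A" and B: "aug_algebra B"
  shows "aug_hom A B (\<lambda>x. pw (*) (aeps A x) (aone B))"
proof -
  have scaled: "pw (*) c (aone B) \<in> acar B" for c using K.subspace_scale[OF aug_algebraD(1)[OF B] aug_algebraD(2)[OF B]] .
  note one = aug_algebraD(2)[OF B]
  show ?thesis
    unfolding aug_hom_def
  proof (intro conjI ballI)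
    show "pw (*) (aeps A x) (aone B) \<in> acar B" for x by (rule scaled)
    show "linear_on (pw (*)) (pw (*)) (acar A) (\<lambda>x. pw (*) (aeps A x) (aone B))"
      using linear_onD[OF aug_algebraD(9)[OF A]] by (intro linear_onI) (simp_all add: K.scale_left_distrib)
    show "pw (*) (aeps A (aone A)) (aone B) = aone B" by (simp add: aug_algebraD(11)[OF A])
    show "aeps B (pw (*) (aeps A x) (aone B)) = aeps A x" for x
      using linear_onD(2)[OF aug_algebraD(9)[OF B] one] aug_algebraD(11)[OF B] by simp
    fix x y assume xy: "x \<in> acar A" "y \<in> acar A"
    show "pw (*) (aeps A (amul A x y)) (aone B) = amul B (pw (*) (aeps A x) (aone B)) (pw (*) (aeps A y) (aone B))"
      using xy one aug_algebraD(10)[OF A xy] aug_algebra_mul_add(3)[OF B scaled one one]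
        aug_algebra_mul_add(4)[OF B one one one] aug_algebraD(7)[OF B one] by (simp add: mult.commute)
  qed
qed

lemma constructed_initial:
  assumes H: "finite_dim_quot (pw (scl L)) (cocycles L 2) (coboundaries L 2)"
  shows "\<exists>C \<eta> w i p. constructed L 1 C \<eta> w i p"
proof -
  interpret W: vector_space "pw (scl L)" by (rule vector_space_pw_scl)
  have zero_ideal: "alg_ideal A {0}" "{0} \<subseteq> aug_ideal A" if A: "aug_algebra A" for A :: "('k, 'x) aug_alg"
  proof -
    note S = aug_algebraD(1)[OF A]
    show "alg_ideal A {0}"
      using K.subspace_0[OF S] KK.linear_on_zero[OF aug_algebraD(4)[OF A] S] by (simp add: alg_ideal_def)
    show "{0} \<subseteq> aug_ideal A" using K.subspace_0[OF S] aeps_zero[OF A] by (simp add: aug_ideal_def)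
  qed
  note I = inf_base(1) and BF = base_field(1)
  obtain lam where lam: "universal_infinitesimal L lam" using universal_infinitesimal_exists[OF H] by blast
  then have dlam: "deformation L IB lam" by (simp add: universal_infinitesimal_def)
  have fI: "finite_dim (pw (*)) (acar IB)"
    unfolding inf_base_def
  proof (rule finite_dim_ext_alg[OF base_field(2)])
    show "finite_dim (pw (*)) (HL_dual L 2)"
      unfolding HL_dual_def by (rule W.finite_dim_dual_quot[OF subspace_cocycles subspace_coboundaries H])
    show "0 \<in> HL_dual L 2" unfolding HL_dual_def by (rule K.subspace_0[OF W.subspace_dual_quot])
    show "0 \<in> acar base_field" by (simp add: base_field_def)
  qed
  obtain C0 :: "('k, nat) aug_alg" and \<rho>0 where C0: "aug_algebra C0" "aug_hom base_field C0 \<rho>0" "\<rho>0 ` acar base_field = acar C0"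
    "{x \<in> acar base_field. \<rho>0 x = 0} = {0}"
    by (rule quotient_realisation[OF BF base_field(2) zero_ideal[OF BF]]) blast
  obtain C1 :: "('k, nat) aug_alg" and \<psi> where C1: "aug_algebra C1" "aug_hom IB C1 \<psi>" "\<psi> ` acar IB = acar C1"
    "{x \<in> acar IB. \<psi> x = 0} = {0}"
    by (rule quotient_realisation[OF I fI zero_ideal[OF I]]) blast
  have iso: "aug_iso IB C1 \<psi>"
  proof -
    have "inj_on \<psi> (acar IB)"
    proof (rule inj_onI)
      fix x y assume xy: "x \<in> acar IB" "y \<in> acar IB" "\<psi> x = \<psi> y"
      then have "x - y \<in> {x \<in> acar IB. \<psi> x = 0}"
        by (simp add: K.subspace_diff[OF aug_algebraD(1)[OF I]] aug_hom_diff[OF I C1(2)])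
      then show "x = y" unfolding C1(4) by simp
    qed
    then show ?thesis using C1 by (simp add: aug_iso_def bij_betw_def)
  qed
  obtain \<eta>1 where \<eta>1: "is_pushout L IB C1 \<psi> lam \<eta>1" using pushout_deformation[OF I C1(1,2) dlam] by blast
  then have d1: "deformation L C1 \<eta>1" by (simp add: is_pushout_def)
  define p0 where "p0 x = pw (*) (aeps C1 x) (aone C0)" for x
  have p0: "aug_hom C1 C0 p0" unfolding p0_def by (rule augmentation_hom[OF C1(1) C0(1)])
  obtain \<eta>0 where \<eta>0: "is_pushout L C1 C0 p0 \<eta>1 \<eta>0" using pushout_deformation[OF C1(1) C0(1) p0 d1] by blast
  then have d0: "deformation L C0 \<eta>0" by (simp add: is_pushout_def)
  have nil0: "max_pow C0 (Suc 0) \<subseteq> {0}"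
    using max_pow_surj[OF BF C0(1-3), of _ "Suc 0"] base_field(3) aug_hom_zero[OF BF C0(2)] by blast
  have nil1: "max_pow C1 2 \<subseteq> {0}"
    using max_pow_surj[OF I C1(1-3), of _ 2] inf_base(5) aug_hom_zero[OF I C1(2)] by blast
  have fd0: "finite_dim (pw (*)) (acar C0)"
    using KK.finite_dim_image[OF aug_algebraD(1)[OF BF] aug_homD(2)[OF C0(2)] base_field(2)] by (simp only: C0(3))
  have fd1: "finite_dim (pw (*)) (acar C1)"
    using KK.finite_dim_image[OF aug_algebraD(1)[OF I] aug_homD(2)[OF C1(2)] fI] by (simp only: C1(3))
  have loc: "fd_local_algebra C0" "fd_local_algebra C1"
    using local_if_nilpotent[OF C0(1) nil0] local_if_nilpotent[OF C1(1) nil1] fd0 fd1 by (simp_all add: fd_local_algebra_def)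
  have bij: "bij_betw (aeps C0) (acar C0) UNIV"
  proof -
    have "inj_on (aeps C0) (acar C0)"
    proof (rule inj_onI)
      fix u v assume uv: "u \<in> acar C0" "v \<in> acar C0" "aeps C0 u = aeps C0 v"
      obtain b where b: "b \<in> acar base_field" "u = \<rho>0 b" using uv(1) unfolding C0(3)[symmetric] by (rule imageE) blast
      obtain c where c: "c \<in> acar base_field" "v = \<rho>0 c" using uv(2) unfolding C0(3)[symmetric] by (rule imageE) blast
      have "b () = c ()"
        using uv(3) aug_homD(5)[OF C0(2) b(1)] aug_homD(5)[OF C0(2) c(1)] b c by (simp add: base_field_def)
      then have "b = c" by (intro ext) simp
      then show "u = v" using b c by simp
    qed
    moreover have "c \<in> aeps C0 ` acar C0" for c
      using aug_homD(1,5)[OF C0(2), of "\<lambda>_. c"] by (intro image_eqI[of _ _ "\<rho>0 (\<lambda>_. c)"]) (simp_all add: base_field_def)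
    ultimately show ?thesis by (auto simp: bij_betw_def)
  qed
  have "constructed L 1 (\<lambda>j. if j = 0 then C0 else C1) (\<lambda>j. if j = 0 then \<eta>0 else \<eta>1) undefined undefined (\<lambda>_. p0)"
    unfolding constructed_def using loc d0 d1 bij lam iso \<eta>1 \<eta>0 by auto
  then show ?thesis by blast
qed

lemma constructed_cong:
  assumes "constructed L k C \<eta> w i p"
    and "\<And>j. j \<le> k \<Longrightarrow> C' j = C j \<and> \<eta>' j = \<eta> j" "\<And>j. j < k \<Longrightarrow> w' j = w j \<and> i' j = i j \<and> p' j = p j" and "1 \<le> k"
  shows "constructed L k C' \<eta>' w' i' p'"
  using assms unfolding constructed_def by simp

lemma constructed_mono: "constructed L k C \<eta> w i p \<Longrightarrow> j \<le> k \<Longrightarrow> constructed L j C \<eta> w i p"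
  unfolding constructed_def by (simp add: less_le_trans)

lemma constructed_extend:
  assumes con: "constructed L k C \<eta> w i p" and k: "1 \<le> k"
  shows "\<exists>C' \<eta>' w' i' p'. constructed L (Suc k) C' \<eta>' w' i' p' \<and> (\<forall>j\<le>k. C' j = C j \<and> \<eta>' j = \<eta> j) \<and>
    (\<forall>j<k. w' j = w j \<and> i' j = i j \<and> p' j = p j)"
proof -
  have Ck: "aug_algebra (C k)" "finite_dim (pw (*)) (acar (C k))" "deformation L (C k) (\<eta> k)"
    using constructedD(1,2)[OF con, of k] by (auto simp: fd_localD)
  obtain wk C' i' p' where step: "inductive_step L (C k) (\<eta> k) wk C' i' p'" using inductive_step_exists[OF Ck] by blast
  obtain \<mu> where \<mu>: "is_pushout L C' (C k) p' \<mu> (\<eta> k)" using single_step(4)[OF con k step] by blast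
  have fd: "fd_local_algebra C'" by (rule single_step(1)[OF con k step])
  have d\<mu>: "deformation L C' \<mu>" using \<mu> by (simp add: is_pushout_def)
  have "constructed L (Suc k) (C(Suc k := C')) (\<eta>(Suc k := \<mu>)) (w(k := wk)) (i(k := i')) (p(k := p'))"
    unfolding constructed_def
  proof (intro conjI allI impI)
    show "fd_local_algebra ((C(Suc k := C')) j)" "deformation L ((C(Suc k := C')) j) ((\<eta>(Suc k := \<mu>)) j)" if "j \<le> Suc k" for j
      using that fd d\<mu> constructedD(1,2)[OF con, of j] by (auto simp: le_Suc_eq)
    show "bij_betw (aeps ((C(Suc k := C')) 0)) (acar ((C(Suc k := C')) 0)) UNIV" using constructedD(3)[OF con] by simp
    show "\<exists>lam \<psi>. universal_infinitesimal L lam \<and> aug_iso IB ((C(Suc k := C')) 1) \<psi> \<and>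
       is_pushout L IB ((C(Suc k := C')) 1) \<psi> lam ((\<eta>(Suc k := \<mu>)) 1)"
      using constructedD(4)[OF con] k by simp
    show "is_pushout L ((C(Suc k := C')) (Suc j)) ((C(Suc k := C')) j) ((p(k := p')) j) ((\<eta>(Suc k := \<mu>)) (Suc j)) ((\<eta>(Suc k := \<mu>)) j)"
      if "j < Suc k" for j
      using that \<mu> constructedD(5)[OF con, of j] by (cases "j = k") auto
    show "inductive_step L ((C(Suc k := C')) j) ((\<eta>(Suc k := \<mu>)) j) ((w(k := wk)) j) ((C(Suc k := C')) (Suc j)) ((i(k := i')) j) ((p(k := p')) j)"
      if "1 \<le> j \<and> j < Suc k" for j
      using that step constructedD(6)[OF con, of j] by (cases "j = k") auto
  qed
  moreover have "(\<forall>j\<le>k. (C(Suc k := C')) j = C j \<and> (\<eta>(Suc k := \<mu>)) j = \<eta> j)"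
    "(\<forall>j<k. (w(k := wk)) j = w j \<and> (i(k := i')) j = i j \<and> (p(k := p')) j = p j)" by auto
  ultimately show ?thesis by blast
qed

text \<open>Dependent choice, and the diagonal of the chosen finite stages.\<close>

lemma constructed_continue:
  assumes con: "constructed L k C \<eta> w i p" and k: "1 \<le> k"
  shows "\<exists>C' \<eta>' w' i' p'. (\<forall>n\<ge>1. constructed L n C' \<eta>' w' i' p') \<and>
           (\<forall>j\<le>k. C' j = C j \<and> \<eta>' j = \<eta> j) \<and> (\<forall>j<k. w' j = w j \<and> i' j = i j \<and> p' j = p j)"
proof -
  \<comment> \<open>the stage chosen at time \<open>n\<close> is final for all indices up to \<open>k + n\<close>\<close>
  define agree where "agree n s s' \<longleftrightarrow> (case s of (C, \<eta>, w, i, p) \<Rightarrow> case s' of (C', \<eta>', w', i', p') \<Rightarrow>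
    (\<forall>j\<le>n. C' j = C j \<and> \<eta>' j = \<eta> j) \<and> (\<forall>j<n. w' j = w j \<and> i' j = i j \<and> p' j = p j))"
    for n and s s' :: "(nat \<Rightarrow> ('k, nat) aug_alg) \<times>
    (nat \<Rightarrow> (nat \<Rightarrow> 'l) \<Rightarrow> (nat \<Rightarrow> 'l) \<Rightarrow> nat \<Rightarrow> 'l) \<times>
    (nat \<Rightarrow> ((nat \<Rightarrow> 'k) \<Rightarrow> (nat \<Rightarrow> 'k) \<Rightarrow> 'k) set \<Rightarrow> ('l list \<Rightarrow> 'l) set) \<times>
    (nat \<Rightarrow> (((nat \<Rightarrow> 'k) \<Rightarrow> (nat \<Rightarrow> 'k) \<Rightarrow> 'k) set \<Rightarrow> 'k) \<Rightarrow> nat \<Rightarrow> 'k) \<times>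
    (nat \<Rightarrow> (nat \<Rightarrow> 'k) \<Rightarrow> nat \<Rightarrow> 'k)"
  define cst where "cst n s \<longleftrightarrow> (case s of (C, \<eta>, w, i, p) \<Rightarrow> constructed L n C \<eta> w i p)" for n s
  have "\<exists>X. \<forall>n. (cst (k + n) (X n) \<and> (n = 0 \<longrightarrow> X n = (C, \<eta>, w, i, p))) \<and> agree (k + n) (X n) (X (Suc n))"
  proof (rule dependent_nat_choice)
    show "\<exists>s. cst (k + 0) s \<and> (0 = (0::nat) \<longrightarrow> s = (C, \<eta>, w, i, p))" using con by (simp add: cst_def)
    fix s n assume s: "cst (k + n) s \<and> (n = 0 \<longrightarrow> s = (C, \<eta>, w, i, p))"
    obtain D \<theta> v h q where sd: "s = (D, \<theta>, v, h, q)" by (cases s)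
    have "constructed L (k + n) D \<theta> v h q" using s by (simp add: cst_def sd)
    then have "\<exists>D' \<theta>' v' h' q'. constructed L (Suc (k + n)) D' \<theta>' v' h' q' \<and> (\<forall>j\<le>k + n. D' j = D j \<and> \<theta>' j = \<theta> j) \<and>
      (\<forall>j<k + n. v' j = v j \<and> h' j = h j \<and> q' j = q j)" by (rule constructed_extend) (use k in simp)
    then obtain D' \<theta>' v' h' q' where e: "constructed L (Suc (k + n)) D' \<theta>' v' h' q'" "\<forall>j\<le>k + n. D' j = D j \<and> \<theta>' j = \<theta> j"
      "\<forall>j<k + n. v' j = v j \<and> h' j = h j \<and> q' j = q j"
      by (elim exE conjE) (rule that)
    then show "\<exists>y. (cst (k + Suc n) y \<and> (Suc n = 0 \<longrightarrow> y = (C, \<eta>, w, i, p))) \<and> agree (k + n) s y"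
      by (intro exI[of _ "(D', \<theta>', v', h', q')"]) (simp add: cst_def agree_def sd)
  qed
  then obtain X where X: "\<And>n. cst (k + n) (X n)" "X 0 = (C, \<eta>, w, i, p)" "\<And>n. agree (k + n) (X n) (X (Suc n))" by blast
  have agree_trans: "agree n s s' \<Longrightarrow> agree m s' s'' \<Longrightarrow> n \<le> m \<Longrightarrow> agree n s s''" for n m s s' s''
    by (auto simp: agree_def split: prod.splits)
  have agree_refl: "agree n s s" for n s by (auto simp: agree_def split: prod.splits)
  have ag: "agree (k + n) (X n) (X m)" if "n \<le> m" for n m
    using that
  proof (induction m rule: dec_induct)
    case base
    show ?case by (rule agree_refl)
  next
    case (step m)
    then show ?case using agree_trans[OF step.IH X(3)] by simp
  qed
  define C' where "C' j = fst (X j) j" for j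
  define \<eta>' where "\<eta>' j = fst (snd (X j)) j" for j
  define w' where "w' j = fst (snd (snd (X (Suc j)))) j" for j
  define i' where "i' j = fst (snd (snd (snd (X (Suc j))))) j" for j
  define p' where "p' j = snd (snd (snd (snd (X (Suc j))))) j" for j
  have eq1: "C' j = fst (X n) j" "\<eta>' j = fst (snd (X n)) j" if "j \<le> k + n" for j n
  proof -
    show "C' j = fst (X n) j"
      using ag[of j n] ag[of n j] that k by (cases "j \<le> n") (auto simp: C'_def agree_def split: prod.splits)
    show "\<eta>' j = fst (snd (X n)) j"
      using ag[of j n] ag[of n j] that k by (cases "j \<le> n") (auto simp: \<eta>'_def agree_def split: prod.splits)
  qed
  have eq2: "w' j = fst (snd (snd (X n))) j" "i' j = fst (snd (snd (snd (X n)))) j" "p' j = snd (snd (snd (snd (X n)))) j"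
    if "j < k + n" for j n
  proof -
    have "agree (k + Suc j) (X (Suc j)) (X n) \<or> agree (k + n) (X n) (X (Suc j))"
      using ag[of "Suc j" n] ag[of n "Suc j"] by (meson nat_le_linear)
    then show "w' j = fst (snd (snd (X n))) j" "i' j = fst (snd (snd (snd (X n)))) j" "p' j = snd (snd (snd (snd (X n)))) j"
      using that by (auto simp: w'_def i'_def p'_def agree_def split: prod.splits)
  qed
  have "constructed L n C' \<eta>' w' i' p'" if n: "1 \<le> n" for n
  proof -
    obtain D \<theta> v h q where sd: "X n = (D, \<theta>, v, h, q)" by (cases "X n")
    have "constructed L (k + n) D \<theta> v h q" using X(1)[of n] by (simp add: cst_def sd)
    then have *: "constructed L n D \<theta> v h q" by (rule constructed_mono) simp
    show ?thesis
    proof (rule constructed_cong[OF * _ _ n])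
      show "C' j = D j \<and> \<eta>' j = \<theta> j" if "j \<le> n" for j using eq1[of j n] that by (simp add: sd)
      show "w' j = v j \<and> i' j = h j \<and> p' j = q j" if "j < n" for j using eq2[of j n] that by (simp add: sd)
    qed
  qed
  moreover have "\<forall>j\<le>k. C' j = C j \<and> \<eta>' j = \<eta> j" "\<forall>j<k. w' j = w j \<and> i' j = i j \<and> p' j = p j"
    using eq1[of _ 0] eq2[of _ 0] X(2) by auto
  ultimately show ?thesis by (intro exI[of _ C'] exI[of _ \<eta>'] exI[of _ w'] exI[of _ i'] exI[of _ p']) auto
qed

end

section \<open>Projective limits of towers of augmented algebras\<close>

lemma component_simps: "component n (x + y) = component n x + component n y" "component n (x - y) = component n x - component n y"
    "component n 0 = 0" "component n (pw s c x) = pw s c (component n x)"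
  by (auto simp: component_def fun_eq_iff pointwise pw_apply)

lemma component_sum: "component n (sum f I) = (\<Sum>i\<in>I. component n (f i))" for f :: "'a \<Rightarrow> nat \<times> 'i \<Rightarrow> 'k::ab_group_add"
  by (induction I rule: infinite_finite_induct) (auto simp: component_simps)

lemma component_ext: "(\<And>n. component n x = component n y) \<Longrightarrow> x = y"
  by (auto simp: component_def fun_eq_iff)

definition from_components :: "(nat \<Rightarrow> 'i \<Rightarrow> 'k) \<Rightarrow> nat \<times> 'i \<Rightarrow> 'k" where
  "from_components f = (\<lambda>(n, j). f n j)"

lemma component_from_components: "component n (from_components f) = f n"
  by (simp add: component_def from_components_def)

locale tower =
  fixes C :: "nat \<Rightarrow> ('k::field, 'i) aug_alg" and p :: "nat \<Rightarrow> ('i \<Rightarrow> 'k) \<Rightarrow> 'i \<Rightarrow> 'k"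
  assumes alg: "\<And>n. aug_algebra (C n)" and hom: "\<And>n. aug_hom (C (Suc n)) (C n) (p n)"
    and surj: "\<And>n. p n ` acar (C (Suc n)) = acar (C n)"
begin

abbreviation "A \<equiv> lim_alg C p"

lemma sub: "K.subspace (acar (C n))" by (rule aug_algebraD(1)[OF alg])

lemma in_A_iff: "x \<in> acar A \<longleftrightarrow> (\<forall>n. component n x \<in> acar (C n) \<and> p n (component (Suc n) x) = component n x)"
  by (simp add: lim_alg_def)

lemma component_in: "x \<in> acar A \<Longrightarrow> component n x \<in> acar (C n)"
  and component_p: "x \<in> acar A \<Longrightarrow> p n (component (Suc n) x) = component n x"
  by (simp_all add: in_A_iff)

lemma component_mul: "component n (amul A x y) = amul (C n) (component n x) (component n y)"
  and component_one: "component n (aone A) = aone (C n)"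
  by (simp_all add: lim_alg_def component_def)

lemma eps_component: "x \<in> acar A \<Longrightarrow> aeps (C n) (component n x) = aeps A x"
proof (induction n)
  case 0
  then show ?case by (simp add: lim_alg_def)
next
  case (Suc n)
  then show ?case using aug_homD(5)[OF hom component_in[OF Suc.prems, of "Suc n"]] component_p[OF Suc.prems, of n] by simp
qed

lemma from_components_in:
  "(\<And>n. f n \<in> acar (C n)) \<Longrightarrow> (\<And>n. p n (f (Suc n)) = f n) \<Longrightarrow> from_components f \<in> acar A"
  by (simp add: in_A_iff component_from_components)

lemma aug_algebra_limit: "aug_algebra A"
proof -
  note hl = linear_onD[OF aug_homD(2)[OF hom]]
  have S: "K.subspace (acar A)"
    using K.subspace_0[OF sub] K.subspace_add[OF sub] K.subspace_scale[OF sub] aug_hom_zero[OF alg hom] hl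
    by (intro K.subspaceI) (simp_all add: in_A_iff component_simps)
  have mul: "amul A x y \<in> acar A" if "x \<in> acar A" "y \<in> acar A" for x y
    using that aug_algebraD(3)[OF alg] aug_homD(3)[OF hom] by (simp add: in_A_iff component_mul)
  have one: "aone A \<in> acar A"
    using aug_algebraD(2)[OF alg] aug_homD(4)[OF hom] by (simp add: in_A_iff component_one)
  note o = aug_algebraD(2)[OF alg]
  have lin: "linear_on (pw (*)) (pw (*)) (acar A) (amul A x)" if x: "x \<in> acar A" for x
  proof (rule linear_onI)
    fix c y assume y: "y \<in> acar A"
    show "amul A x (pw (*) c y) = pw (*) c (amul A x y)"
      using aug_algebra_mul_add(3)[OF alg component_in[OF x] component_in[OF y] component_in[OF y]]
      by (intro component_ext) (simp add: component_mul component_simps)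
    fix z assume z: "z \<in> acar A"
    show "amul A x (y + z) = amul A x y + amul A x z"
      using aug_algebra_mul_add(1)[OF alg component_in[OF x] component_in[OF y] component_in[OF z]]
      by (intro component_ext) (simp add: component_mul component_simps)
  qed
  have comm: "amul A x y = amul A y x" if "x \<in> acar A" "y \<in> acar A" for x y
    by (rule component_ext) (simp add: component_mul aug_algebraD(5)[OF alg component_in[OF that(1)] component_in[OF that(2)]])
  have assoc: "amul A (amul A x y) z = amul A x (amul A y z)" if "x \<in> acar A" "y \<in> acar A" "z \<in> acar A" for x y z
    by (rule component_ext) (simp add: component_mul aug_algebraD(6)[OF alg component_in[OF that(1)] component_in[OF that(2)] component_in[OF that(3)]])
  have unit: "amul A (aone A) x = x" if "x \<in> acar A" for x
    by (rule component_ext) (simp add: component_mul component_one aug_algebraD(7)[OF alg component_in[OF that]])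
  have e: "aeps A x = aeps (C 0) (component 0 x)" for x by (simp add: lim_alg_def)
  have el: "linear_on (pw (*)) (*) (acar A) (aeps A)"
    using linear_onD[OF aug_algebraD(9)[OF alg[of 0]]] component_in by (intro linear_onI) (simp_all add: e component_simps)
  have em: "aeps A (amul A x y) = aeps A x * aeps A y" if "x \<in> acar A" "y \<in> acar A" for x y
    using that aug_algebraD(10)[OF alg[of 0]] component_in by (simp add: e component_mul)
  have e1: "aeps A (aone A) = 1" using aug_algebraD(11)[OF alg[of 0]] by (simp add: e component_one)
  show ?thesis unfolding aug_algebra_def by (intro conjI ballI S one mul lin comm assoc unit el em e1)
qed

lemma component_hom: "aug_hom A (C n) (component n)"
  unfolding aug_hom_def
  by (auto simp: component_in component_mul component_one eps_component component_simps intro!: linear_onI)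

lemma component_surj: "component n ` acar A = acar (C n)"
proof
  show "component n ` acar A \<subseteq> acar (C n)" using component_in by blast
  show "acar (C n) \<subseteq> component n ` acar A"
  proof
    fix a assume a: "a \<in> acar (C n)"
    have "\<exists>g. g n = a \<and> (\<forall>m\<le>n. g m \<in> acar (C m)) \<and> (\<forall>m<n. p m (g (Suc m)) = g m)"
      using a
    proof (induction n arbitrary: a)
      case 0
      then show ?case by (intro exI[of _ "\<lambda>_. a"]) simp
    next
      case (Suc n)
      obtain g where g: "g n = p n a" "\<forall>m\<le>n. g m \<in> acar (C m)" "\<forall>m<n. p m (g (Suc m)) = g m"
        using Suc.IH[OF aug_homD(1)[OF hom Suc.prems]] by blast
      then show ?case using Suc.prems by (intro exI[of _ "g(Suc n := a)"]) (auto simp: less_Suc_eq le_Suc_eq)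
    qed
    then obtain g where g: "g n = a" "\<forall>m\<le>n. g m \<in> acar (C m)" "\<forall>m<n. p m (g (Suc m)) = g m" by blast
    have "\<exists>f. \<forall>m. (f m \<in> acar (C m) \<and> (m \<le> n \<longrightarrow> f m = g m)) \<and> p m (f (Suc m)) = f m"
    proof (rule dependent_nat_choice)
      show "\<exists>x. x \<in> acar (C 0) \<and> (0 \<le> n \<longrightarrow> x = g 0)" using g(2) by auto
      fix x m assume x: "x \<in> acar (C m) \<and> (m \<le> n \<longrightarrow> x = g m)"
      show "\<exists>y. (y \<in> acar (C (Suc m)) \<and> (Suc m \<le> n \<longrightarrow> y = g (Suc m))) \<and> p m y = x"
      proof (cases "Suc m \<le> n")
        case True
        then show ?thesis using x g by (intro exI[of _ "g (Suc m)"]) auto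
      next
        case False
        have "x \<in> p m ` acar (C (Suc m))" using x surj by simp
        then show ?thesis using False by blast
      qed
    qed
    then obtain f where f: "\<And>m. f m \<in> acar (C m)" "\<And>m. m \<le> n \<Longrightarrow> f m = g m" "\<And>m. p m (f (Suc m)) = f m" by blast
    have "from_components f \<in> acar A" by (rule from_components_in[OF f(1,3)])
    moreover have "component n (from_components f) = a" by (simp add: component_from_components f(2) g(1))
    ultimately show "a \<in> component n ` acar A" by (metis image_eqI)
  qed
qed

end

definition combinations :: "('k::field, 'i) aug_alg \<Rightarrow> nat \<Rightarrow> (nat \<Rightarrow> 'i \<Rightarrow> 'k) \<Rightarrow> ('i \<Rightarrow> 'k) set \<Rightarrow> ('i \<Rightarrow> 'k) set" where
  "combinations B N x S = {\<Sum>i<N. amul B (x i) (v i) |v. \<forall>i<N. v i \<in> S}"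

lemma combinationsI: "z = (\<Sum>i<N. amul B (x i) (v i)) \<Longrightarrow> (\<And>i. i < N \<Longrightarrow> v i \<in> S) \<Longrightarrow> z \<in> combinations B N x S"
  by (auto simp: combinations_def)

lemma combinationsE:
  assumes "z \<in> combinations B N x S"
  obtains v where "z = (\<Sum>i<N. amul B (x i) (v i))" "\<And>i. i < N \<Longrightarrow> v i \<in> S"
  using assms by (auto simp: combinations_def)

lemma subspace_combinations:
  fixes B :: "('k::field, 'i) aug_alg"
  assumes B: "aug_algebra B" and x: "\<And>i. i < N \<Longrightarrow> x i \<in> acar B"
    and S: "module.subspace (pw (*)) S" "S \<subseteq> acar B"
  shows "module.subspace (pw (*)) (combinations B N x S)"
proof -
  have l: "linear_on (pw (*)) (pw (*)) (acar B) (amul B (x i))" if "i < N" for i by (rule aug_algebraD(4)[OF B x[OF that]])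
  show ?thesis
  proof (rule K.subspaceI)
    show "0 \<in> combinations B N x S"
      by (rule combinationsI[where v = "\<lambda>_. 0"])
        (simp_all add: KK.linear_on_zero[OF l aug_algebraD(1)[OF B]] K.subspace_0[OF S(1)])
    fix a b assume a: "a \<in> combinations B N x S"
    obtain v where v: "a = (\<Sum>i<N. amul B (x i) (v i))" "\<And>i. i < N \<Longrightarrow> v i \<in> S" using a by (rule combinationsE) blast
    have vB: "v i \<in> acar B" if "i < N" for i using v(2)[OF that] S(2) by blast
    show "pw (*) c a \<in> combinations B N x S" for c
      by (rule combinationsI[where v = "\<lambda>i. pw (*) c (v i)"])
        (simp_all add: v vB K.scale_sum_right linear_onD(2)[OF l] K.subspace_scale[OF S(1)])
    assume b: "b \<in> combinations B N x S"
    obtain u where u: "b = (\<Sum>i<N. amul B (x i) (u i))" "\<And>i. i < N \<Longrightarrow> u i \<in> S" using b by (rule combinationsE) blast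
    have uB: "u i \<in> acar B" if "i < N" for i using u(2)[OF that] S(2) by blast
    show "a + b \<in> combinations B N x S"
      by (rule combinationsI[where v = "\<lambda>i. v i + u i"])
        (simp_all add: v u vB uB sum.distrib linear_onD(1)[OF l] K.subspace_add[OF S(1)])
  qed
qed

lemma combinations_subset:
  assumes B: "aug_algebra B" and x: "\<And>i. i < N \<Longrightarrow> x i \<in> acar B" and S: "S \<subseteq> acar B"
  shows "combinations B N x S \<subseteq> acar (B :: ('k::field, 'i) aug_alg)"
proof
  fix z assume "z \<in> combinations B N x S"
  then obtain v where v: "z = (\<Sum>i<N. amul B (x i) (v i))" "\<And>i. i < N \<Longrightarrow> v i \<in> S" by (rule combinationsE) blast
  show "z \<in> acar B" unfolding v(1)
    by (rule K.subspace_sum[OF aug_algebraD(1)[OF B]]) (use v(2) S x in \<open>auto intro!: aug_algebraD(3)[OF B]\<close>)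
qed

lemma combinations_mul:
  assumes B: "aug_algebra (B :: ('k::field, 'i) aug_alg)" and x: "\<And>i. i < N \<Longrightarrow> x i \<in> acar B"
    and z: "z \<in> combinations B N x (acar B)" and v: "v \<in> S" and S: "alg_ideal B S"
  shows "amul B z v \<in> combinations B N x S"
proof -
  obtain d where d: "z = (\<Sum>i<N. amul B (x i) (d i))" "\<And>i. i < N \<Longrightarrow> d i \<in> acar B" using z by (rule combinationsE) blast
  have vB: "v \<in> acar B" using v alg_idealD(2)[OF S] by blast
  have xd: "amul B (x i) (d i) \<in> acar B" if "i < N" for i using x d that by (simp add: aug_algebraD(3)[OF B])
  have zB: "z \<in> acar B" by (rule subsetD[OF combinations_subset[OF B x order_refl] z])
  have "amul B z v = amul B v z" by (rule aug_algebraD(5)[OF B zB vB])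
  also have "\<dots> = (\<Sum>i<N. amul B v (amul B (x i) (d i)))"
    unfolding d(1) by (rule KK.linear_on_sum[OF aug_algebraD(4)[OF B vB] aug_algebraD(1)[OF B]]) (simp add: xd)
  also have "\<dots> = (\<Sum>i<N. amul B (x i) (amul B (d i) v))"
    by (rule sum.cong) (use aug_algebraD(5)[OF B vB xd] aug_algebraD(6)[OF B x d(2) vB] in auto)
  finally show ?thesis by (rule combinationsI) (use alg_idealD(3)[OF S d(2) v] in simp)
qed

text \<open>A tower \<open>C\<^sub>0 \<leftarrow> C\<^sub>1 \<leftarrow> \<dots>\<close> in which the kernel of \<open>C\<^bsub>n+1\<^esub> \<rightarrow> C\<^sub>n\<close> is the power of exponent \<open>n + 1\<close> of the augmentation ideal.\<close>

locale adic_tower = tower C p for C :: "nat \<Rightarrow> ('k::field, 'i) aug_alg" and p +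
  assumes nil: "\<And>n. max_pow (C n) (Suc n) \<subseteq> {0}"
    and kernel: "\<And>n y. y \<in> acar (C (Suc n)) \<Longrightarrow> p n y = 0 \<Longrightarrow> y \<in> max_pow (C (Suc n)) (Suc n)"
    and fin: "finite_dim (pw (*)) (acar (C 1))"
begin

lemma local_limit: "local_algebra A"
proof (rule local_if_units[OF aug_algebra_limit])
  fix x assume x: "x \<in> acar A" "aeps A x \<noteq> 0"
  have "\<exists>y\<in>acar (C n). amul (C n) y (component n x) = aone (C n)" for n
    by (rule nilpotent_units[OF alg nil component_in[OF x(1)]]) (simp add: eps_component x)
  then obtain y where y: "\<And>n. y n \<in> acar (C n)" "\<And>n. amul (C n) (y n) (component n x) = aone (C n)" by metis
  have unique: "u = y n" if u: "u \<in> acar (C n)" "amul (C n) u (component n x) = aone (C n)" for u n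
  proof -
    note xn = component_in[OF x(1), of n]
    have "u = amul (C n) u (amul (C n) (component n x) (y n))"
      using y(2)[of n] aug_algebraD(5)[OF alg xn y(1)] aug_algebraD(8)[OF alg u(1)] by simp
    also have "\<dots> = y n" using aug_algebraD(6)[OF alg u(1) xn y(1)] u(2) aug_algebraD(7)[OF alg y(1)] by simp
    finally show ?thesis .
  qed
  have "p n (y (Suc n)) = y n" for n
  proof (rule unique)
    show "p n (y (Suc n)) \<in> acar (C n)" by (rule aug_homD(1)[OF hom y(1)])
    show "amul (C n) (p n (y (Suc n))) (component n x) = aone (C n)"
      using aug_homD(3)[OF hom y(1) component_in[OF x(1)], of n] y(2)[of "Suc n"] aug_homD(4)[OF hom, of n] component_p[OF x(1), of n]
      by simp
  qed
  then have "from_components y \<in> acar A" using y(1) by (intro from_components_in)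
  moreover have "amul A (from_components y) x = aone A"
    by (rule component_ext) (simp add: component_mul component_one component_from_components y(2))
  ultimately show "\<exists>y\<in>acar A. amul A y x = aone A" by blast
qed

lemma p_lift:
  assumes "\<And>i. i < (N::nat) \<Longrightarrow> v i \<in> max_pow (C k) r"
  obtains v' where "\<And>i. i < N \<Longrightarrow> v' i \<in> max_pow (C (Suc k)) r" "\<And>i. i < N \<Longrightarrow> p k (v' i) = v i"
proof -
  have "\<forall>i\<in>{..<N}. \<exists>z. z \<in> max_pow (C (Suc k)) r \<and> p k z = v i"
    using max_pow_surj[OF alg alg hom surj assms] by blast
  then obtain v' where "\<forall>i\<in>{..<N}. v' i \<in> max_pow (C (Suc k)) r \<and> p k (v' i) = v i" by (rule bchoice[THEN exE])
  then show thesis by (intro that[of v']) simp_all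
qed

lemma p_combination:
  assumes x: "\<And>i. i < (N::nat) \<Longrightarrow> x i \<in> acar A" and v: "\<And>i. i < N \<Longrightarrow> v i \<in> acar (C (Suc k))"
  shows "p k (\<Sum>i<N. amul (C (Suc k)) (component (Suc k) (x i)) (v i)) = (\<Sum>i<N. amul (C k) (component k (x i)) (p k (v i)))"
proof -
  have "p k (\<Sum>i<N. amul (C (Suc k)) (component (Suc k) (x i)) (v i)) = (\<Sum>i<N. p k (amul (C (Suc k)) (component (Suc k) (x i)) (v i)))"
    by (rule KK.linear_on_sum[OF aug_homD(2)[OF hom] sub]) (use x v in \<open>auto intro!: aug_algebraD(3)[OF alg] component_in\<close>)
  also have "\<dots> = (\<Sum>i<N. amul (C k) (component k (x i)) (p k (v i)))"
    by (rule sum.cong) (use x v in \<open>auto simp: aug_homD(3)[OF hom component_in] component_p\<close>)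
  finally show ?thesis .
qed

text \<open>Elements of the limit which lift a basis of the augmentation ideal of \<open>C\<^sub>1\<close> generate the augmentation ideal of every
  \<open>C\<^sub>k\<close>, because for \<open>k \<ge> 1\<close> the kernel of \<open>C\<^bsub>k+1\<^esub> \<rightarrow> C\<^sub>k\<close> lies in the square of the augmentation ideal and is annihilated by this ideal.\<close>

lemma generators:
  obtains N :: nat and x where "\<And>i. i < N \<Longrightarrow> x i \<in> aug_ideal A"
    "\<And>k. aug_ideal (C k) \<subseteq> combinations (C k) N (\<lambda>i. component k (x i)) (acar (C k))"
proof -
  have I1: "K.subspace (aug_ideal (C 1))" by (rule alg_idealD(1)[OF alg_ideal_aug_ideal[OF alg]])
  have "finite_dim (pw (*)) (aug_ideal (C 1))" by (rule K.finite_dim_mono[OF I1 _ fin]) (auto simp: aug_ideal_def)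
  then obtain N :: nat and b \<xi> where b: "\<And>i. i < N \<Longrightarrow> b i \<in> aug_ideal (C 1)"
    and rep: "\<And>u. u \<in> aug_ideal (C 1) \<Longrightarrow> u = (\<Sum>i<N. pw (*) (\<xi> i u) (b i))"
  proof (rule K.frame_exists, goal_cases)
    case (1 n z \<xi>)
    show ?case by (rule that[OF 1(2,5)])
  qed
  have "\<forall>i\<in>{..<N}. \<exists>y. y \<in> acar A \<and> component 1 y = b i"
  proof
    fix i assume "i \<in> {..<N}"
    then have "b i \<in> component 1 ` acar A" using b unfolding component_surj by (auto simp: aug_ideal_def)
    then show "\<exists>y. y \<in> acar A \<and> component 1 y = b i"
    proof (rule imageE)
      fix y assume y: "b i = component 1 y" "y \<in> acar A"
      show ?thesis by (rule exI[of _ y]) (rule conjI[OF y(2) y(1)[symmetric]])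
    qed
  qed
  then obtain x where x': "\<forall>i\<in>{..<N}. x i \<in> acar A \<and> component 1 (x i) = b i" by (rule bchoice[THEN exE])
  then have x: "x i \<in> acar A" "component 1 (x i) = b i" if "i < N" for i using that by auto
  have xI: "x i \<in> aug_ideal A" if "i < N" for i
    using x[OF that] b[OF that] eps_component[of "x i" 1] by (simp add: aug_ideal_def)
  have gen: "aug_ideal (C k) \<subseteq> combinations (C k) N (\<lambda>i. component k (x i)) (acar (C k))" for k
  proof (induction k)
    case 0
    have "aug_ideal (C 0) \<subseteq> {0}" using nil[of 0] max_pow_1[OF alg[of 0]] by simp
    moreover have "0 \<in> combinations (C 0) N (\<lambda>i. component 0 (x i)) (acar (C 0))"
      by (rule K.subspace_0, rule subspace_combinations[OF alg _ sub]) (use x(1) component_in in auto)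
    ultimately show ?case by blast
  next
    case (Suc k)
    let ?J = "combinations (C (Suc k)) N (\<lambda>i. component (Suc k) (x i)) (acar (C (Suc k)))"
    have xc: "component j (x i) \<in> acar (C j)" if "i < N" for i j by (rule component_in[OF x(1)[OF that]])
    have J: "K.subspace ?J" by (rule subspace_combinations[OF alg xc sub order_refl])
    have JC: "?J \<subseteq> acar (C (Suc k))" by (rule combinations_subset[OF alg xc order_refl])
    show ?case
    proof (cases "k = 0")
      case True
      show ?thesis
      proof
        fix u assume u: "u \<in> aug_ideal (C (Suc k))"
        note one = aug_algebraD(2)[OF alg[of 1]]
        have "u = (\<Sum>i<N. amul (C 1) (b i) (pw (*) (\<xi> i u) (aone (C 1))))"
        proof -
          have "amul (C 1) (b i) (pw (*) (\<xi> i u) (aone (C 1))) = pw (*) (\<xi> i u) (b i)" if "i < N" for i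
          proof -
            have bi: "b i \<in> acar (C 1)" using b[OF that] by (simp add: aug_ideal_def)
            show ?thesis by (simp only: aug_algebra_mul_add(3)[OF alg bi one one] aug_algebraD(8)[OF alg bi])
          qed
          then show ?thesis using rep[of u] u True by simp
        qed
        then show "u \<in> ?J" unfolding True
          by (intro combinationsI) (use x K.subspace_scale[OF sub one] in auto)
      qed
    next
      case False
      \<comment> \<open>modulo the kernel every element of the augmentation ideal is a combination\<close>
      have approx: "\<exists>z\<in>?J. p k (u - z) = 0 \<and> u - z \<in> acar (C (Suc k))" if u: "u \<in> aug_ideal (C (Suc k))" for u
      proof -
        have uC: "u \<in> acar (C (Suc k))" using u by (simp add: aug_ideal_def)
        have "p k u \<in> aug_ideal (C k)" using u aug_homD(1,5)[OF hom, of u k] by (simp add: aug_ideal_def)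
        then have "p k u \<in> combinations (C k) N (\<lambda>i. component k (x i)) (acar (C k))" using Suc by blast
        then obtain d where d: "p k u = (\<Sum>i<N. amul (C k) (component k (x i)) (d i))" "\<And>i. i < N \<Longrightarrow> d i \<in> acar (C k)"
          by (rule combinationsE) blast
        obtain d' where d': "\<And>i. i < N \<Longrightarrow> d' i \<in> acar (C (Suc k))" "\<And>i. i < N \<Longrightarrow> p k (d' i) = d i"
        proof (rule p_lift[of N d k 0], goal_cases)
          case (1 i)
          then show ?case using d(2) by simp
        next
          case (2 v')
          show ?case by (rule that[of v']) (use 2 in auto)
        qed
        let ?z = "\<Sum>i<N. amul (C (Suc k)) (component (Suc k) (x i)) (d' i)"
        have zJ: "?z \<in> ?J" by (rule combinationsI[OF refl d'(1)])
        have zC: "?z \<in> acar (C (Suc k))" by (rule subsetD[OF JC zJ])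
        have "p k ?z = (\<Sum>i<N. amul (C k) (component k (x i)) (p k (d' i)))" by (rule p_combination[OF x(1) d'(1)])
        also have "\<dots> = p k u" unfolding d(1) by (rule sum.cong) (simp_all add: d'(2))
        finally have "p k ?z = p k u" .
        then have "p k (u - ?z) = 0" by (simp add: aug_hom_diff[OF alg hom uC zC])
        then show ?thesis using zJ K.subspace_diff[OF sub uC zC] by blast
      qed
      have "max_pow (C (Suc k)) (Suc k) \<subseteq> ?J"
      proof (rule max_pow_Suc_subset[OF _ J])
        fix a v assume a: "a \<in> aug_ideal (C (Suc k))" and v: "v \<in> max_pow (C (Suc k)) k"
        obtain z where z: "z \<in> ?J" "p k (a - z) = 0" "a - z \<in> acar (C (Suc k))" using approx[OF a] by blast
        have vI: "v \<in> aug_ideal (C (Suc k))"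
          using v False max_pow_antimono[OF alg, of "Suc 0" k "Suc k"] unfolding max_pow_1[OF alg] by auto
        then have vC: "v \<in> acar (C (Suc k))" by (simp add: aug_ideal_def)
        have zC: "z \<in> acar (C (Suc k))" by (rule subsetD[OF JC z(1)])
        have "amul (C (Suc k)) v (a - z) \<in> max_pow (C (Suc k)) (Suc (Suc k))"
          by (rule max_pow_mul[OF vI kernel[OF z(3,2)]])
        then have "amul (C (Suc k)) (a - z) v = 0" using nil[of "Suc k"] aug_algebraD(5)[OF alg vC z(3)] by auto
        then have "amul (C (Suc k)) a v = amul (C (Suc k)) z v"
          using aug_algebra_mul_add(2)[OF alg vC z(3) zC] by simp
        moreover have "amul (C (Suc k)) z v \<in> ?J"
          by (rule combinations_mul[OF alg xc z(1) vC]) (use sub aug_algebraD(3)[OF alg] in \<open>simp_all add: alg_ideal_def\<close>)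
        ultimately show "amul (C (Suc k)) a v \<in> ?J" by simp
      qed
      note ker = subsetD[OF this kernel]
      show ?thesis
      proof
        fix u assume "u \<in> aug_ideal (C (Suc k))"
        then obtain z where z: "z \<in> ?J" "p k (u - z) = 0" "u - z \<in> acar (C (Suc k))" using approx by blast
        have "z + (u - z) \<in> ?J" by (rule K.subspace_add[OF J z(1) ker[OF z(3,2)]])
        then show "u \<in> ?J" by simp
      qed
    qed
  qed
  show thesis by (rule that[OF xI gen])
qed

lemma kernel_0: "y \<in> max_pow (C k) n \<Longrightarrow> k < n \<Longrightarrow> y = 0"
  using nil[of k] max_pow_antimono[OF alg, of "Suc k" n k] by (auto simp: Suc_le_eq)

text \<open>An element of the limit with vanishing component in \<open>C\<^bsub>n+1\<^esub>\<close> is a combination of the generators with coefficients vanishing in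
  \<open>C\<^sub>n\<close>.  The coefficients are constructed by successive approximation: solutions \<open>d\<^sub>k\<close> in \<open>C\<^sub>k\<close> are corrected by elements of
  \<open>m\<^sup>k\<close>, which vanish in \<open>C\<^bsub>k-1\<^esub>\<close>; therefore the images of \<open>d\<^bsub>k+1\<^esub>\<close> in \<open>C\<^sub>k\<close> are compatible.\<close>

lemma kernel_combination:
  assumes x: "\<And>i. i < (N::nat) \<Longrightarrow> x i \<in> aug_ideal A"
    and gen: "\<And>k. aug_ideal (C k) \<subseteq> combinations (C k) N (\<lambda>i. component k (x i)) (acar (C k))"
    and a: "a \<in> acar A" "component (Suc n) a = 0"
  shows "\<exists>y. (\<forall>i<N. y i \<in> acar A \<and> component n (y i) = 0) \<and> a = (\<Sum>i<N. amul A (x i) (y i))"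
proof -
  have xA: "x i \<in> acar A" if "i < N" for i using x[OF that] by (simp add: aug_ideal_def)
  have xc: "component k (x i) \<in> acar (C k)" if "i < N" for i k by (rule component_in[OF xA[OF that]])
  have pz: "p k 0 = 0" for k by (rule aug_hom_zero[OF alg hom])
  have mz: "amul (C k) u 0 = 0" if "u \<in> acar (C k)" for k u
    using linear_onD(1)[OF aug_algebraD(4)[OF alg that], of 0 0] K.subspace_0[OF sub] by simp
  have am: "component k a = 0" if "k \<le> Suc n" for k
    using that by (induction rule: inc_induct) (use a component_p[OF a(1)] pz in \<open>auto simp: a(2), metis\<close>)
  have pow: "max_pow (C k) (Suc r) \<subseteq> combinations (C k) N (\<lambda>i. component k (x i)) (max_pow (C k) r)" for k r
  proof (rule max_pow_Suc_subset)
    note I = max_pow_ideal[OF alg[of k], of r]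
    show "K.subspace (combinations (C k) N (\<lambda>i. component k (x i)) (max_pow (C k) r))"
      by (rule subspace_combinations[OF alg xc alg_idealD(1,2)[OF I]])
    fix u v assume "u \<in> aug_ideal (C k)" "v \<in> max_pow (C k) r"
    then show "amul (C k) u v \<in> combinations (C k) N (\<lambda>i. component k (x i)) (max_pow (C k) r)"
      using gen[of k] by (intro combinations_mul[OF alg xc _ _ I]) auto
  qed
  \<comment> \<open>for \<open>k \<le> n\<close> the only solution is zero; the approximation starts after that\<close>
  define sol where "sol k d \<longleftrightarrow> (\<forall>i<N. d i \<in> max_pow (C k) (Suc n)) \<and>
    component k a = (\<Sum>i<N. amul (C k) (component k (x i)) (d i))" for k d
  have in': "d i \<in> acar (C k)" if "sol k d" "i < N" for k d i
    using that alg_idealD(2)[OF max_pow_ideal[OF alg]] unfolding sol_def by blast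
  have "\<exists>D. \<forall>k. sol k (D k) \<and> (\<forall>j i. k = Suc j \<and> i < N \<longrightarrow> p j (p k (D (Suc k) i)) = p j (D k i))"
  proof (rule dependent_nat_choice)
    have z: "sol k (\<lambda>_. 0)" if "k \<le> Suc n" for k
      using am[OF that] K.subspace_0[OF alg_idealD(1)[OF max_pow_ideal[OF alg]]] by (simp add: sol_def mz xc del: max_pow.simps)
    show "\<exists>d. sol 0 d" using z[of 0] by blast
    fix d k assume d: "sol k d"
    show "\<exists>e. sol (Suc k) e \<and> (\<forall>j i. k = Suc j \<and> i < N \<longrightarrow> p j (p k (e i)) = p j (d i))"
    proof (cases "k \<le> n")
      case True
      have "d i = 0" if "i < N" for i using d that True kernel_0[of "d i" k "Suc n"] by (simp add: sol_def)
      then show ?thesis using z[of "Suc k"] True by (intro exI[of _ "\<lambda>_. 0"]) (simp add: pz)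
    next
      case False
      obtain e where e: "\<And>i. i < N \<Longrightarrow> e i \<in> max_pow (C (Suc k)) (Suc n)" "\<And>i. i < N \<Longrightarrow> p k (e i) = d i"
        by (rule p_lift[of N d k "Suc n"]) (use d in \<open>auto simp: sol_def simp del: max_pow.simps\<close>)
      have eC: "e i \<in> acar (C (Suc k))" if "i < N" for i
        using e(1)[OF that] alg_idealD(2)[OF max_pow_ideal[OF alg]] by blast
      let ?z = "\<Sum>i<N. amul (C (Suc k)) (component (Suc k) (x i)) (e i)"
      let ?r = "component (Suc k) a - ?z"
      have zC: "?z \<in> acar (C (Suc k))" by (rule K.subspace_sum[OF sub]) (use xc eC in \<open>auto intro!: aug_algebraD(3)[OF alg]\<close>)
      note aC = component_in[OF a(1), of "Suc k"]
      have "p k ?z = (\<Sum>i<N. amul (C k) (component k (x i)) (p k (e i)))" by (rule p_combination[OF xA eC])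
      also have "\<dots> = (\<Sum>i<N. amul (C k) (component k (x i)) (d i))" by (rule sum.cong) (simp_all add: e(2))
      finally have "p k ?z = component k a" using d by (simp add: sol_def del: max_pow.simps)
      then have "p k ?r = 0" by (simp add: aug_hom_diff[OF alg hom aC zC] component_p[OF a(1)])
      then have "?r \<in> max_pow (C (Suc k)) (Suc k)" by (rule kernel[OF K.subspace_diff[OF sub aC zC]])
      then have "?r \<in> combinations (C (Suc k)) N (\<lambda>i. component (Suc k) (x i)) (max_pow (C (Suc k)) k)" using pow by blast
      then obtain v where v: "?r = (\<Sum>i<N. amul (C (Suc k)) (component (Suc k) (x i)) (v i))"
        "\<And>i. i < N \<Longrightarrow> v i \<in> max_pow (C (Suc k)) k" by (rule combinationsE) blast
      have vC: "v i \<in> acar (C (Suc k))" if "i < N" for i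
        using v(2)[OF that] alg_idealD(2)[OF max_pow_ideal[OF alg]] by blast
      have "max_pow (C (Suc k)) k \<subseteq> max_pow (C (Suc k)) (Suc n)" by (rule max_pow_antimono[OF alg]) (use False in simp)
      then have ev: "e i + v i \<in> max_pow (C (Suc k)) (Suc n)" if "i < N" for i
        using K.subspace_add[OF alg_idealD(1)[OF max_pow_ideal[OF alg]] e(1)[OF that]] v(2)[OF that] by blast
      have "component (Suc k) a = ?z + ?r" by simp
      also have "\<dots> = (\<Sum>i<N. amul (C (Suc k)) (component (Suc k) (x i)) (e i + v i))"
        unfolding v(1) sum.distrib[symmetric]
        by (rule sum.cong) (simp_all add: aug_algebra_mul_add(1)[OF alg xc eC vC])
      finally have s: "sol (Suc k) (\<lambda>i. e i + v i)" unfolding sol_def using ev by blast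
      have "p j (p k (e i + v i)) = p j (d i)" if j: "k = Suc j" "i < N" for i j
      proof -
        have pv: "p k (v i) \<in> max_pow (C k) k" by (rule max_pow_hom[OF alg alg hom v(2)[OF j(2)]])
        then have "p j (p k (v i)) \<in> max_pow (C j) k" unfolding j(1) by (rule max_pow_hom[OF alg alg hom])
        then have "p j (p k (v i)) = 0" by (rule kernel_0) (use j in simp)
        moreover have "p j (p k (e i + v i)) = p j (p k (e i)) + p j (p k (v i))"
          using linear_onD(1)[OF aug_homD(2)[OF hom] eC[OF j(2)] vC[OF j(2)]]
            linear_onD(1)[OF aug_homD(2)[OF hom[of j]], of "p k (e i)" "p k (v i)"] aug_homD(1)[OF hom eC[OF j(2)]] aug_homD(1)[OF hom vC[OF j(2)]] j(1) by simp
        ultimately show ?thesis using e(2)[OF j(2)] by simp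
      qed
      then show ?thesis using s by (intro exI[of _ "\<lambda>i. e i + v i"]) blast
    qed
  qed
  then obtain D where D: "\<And>k. sol k (D k)" "\<And>j i. i < N \<Longrightarrow> p j (p (Suc j) (D (Suc (Suc j)) i)) = p j (D (Suc j) i)" by blast
  \<comment> \<open>the solutions themselves need not be compatible, but their images one level below are\<close>
  define y where "y i = from_components (\<lambda>k. p k (D (Suc k) i))" for i
  have y: "y i \<in> acar A" if "i < N" for i
    unfolding y_def by (rule from_components_in) (use that aug_homD(1)[OF hom in'[OF D(1)]] D(2) in auto)
  have yn: "component n (y i) = 0" if i: "i < N" for i
  proof -
    have "D (Suc n) i \<in> max_pow (C (Suc n)) (Suc n)" using D(1)[of "Suc n"] i by (simp add: sol_def)
    then have "p n (D (Suc n) i) \<in> max_pow (C n) (Suc n)" by (rule max_pow_hom[OF alg alg hom])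
    then show ?thesis using nil[of n] by (auto simp: y_def component_from_components)
  qed
  have "a = (\<Sum>i<N. amul A (x i) (y i))"
  proof (rule component_ext)
    fix k
    have "component k a = p k (component (Suc k) a)" by (simp add: component_p[OF a(1)])
    also have "\<dots> = p k (\<Sum>i<N. amul (C (Suc k)) (component (Suc k) (x i)) (D (Suc k) i))" using D(1)[of "Suc k"] by (simp add: sol_def)
    also have "\<dots> = (\<Sum>i<N. amul (C k) (component k (x i)) (p k (D (Suc k) i)))" by (rule p_combination[OF xA in'[OF D(1)]])
    also have "\<dots> = component k (\<Sum>i<N. amul A (x i) (y i))"
      by (simp add: component_sum component_mul y_def component_from_components)
    finally show "component k a = component k (\<Sum>i<N. amul A (x i) (y i))" .
  qed
  then show ?thesis using y yn by blast
qed

text \<open>The inclusion from right to left is the substance: it says that the projective limit topology is the adic one, so that the algebras \<open>C\<^sub>n\<close> are the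
  quotients by which formal deformations are defined.\<close>

lemma max_pow_limit: "max_pow A (Suc n) = {a \<in> acar A. component n a = 0}"
proof
  note AA = aug_algebra_limit
  show "max_pow A (Suc n) \<subseteq> {a \<in> acar A. component n a = 0}"
  proof
    fix a assume a: "a \<in> max_pow A (Suc n)"
    have "component n a \<in> max_pow (C n) (Suc n)" by (rule max_pow_hom[OF AA alg component_hom a])
    then show "a \<in> {a \<in> acar A. component n a = 0}" using a nil[of n] alg_idealD(2)[OF max_pow_ideal[OF AA]] by blast
  qed
  show "{a \<in> acar A. component n a = 0} \<subseteq> max_pow A (Suc n)"
  proof (induction n)
    case 0
    have "aeps (C 0) 0 = 0" by (rule aeps_zero[OF alg])
    then show ?case unfolding max_pow_1[OF AA] by (auto simp: aug_ideal_def lim_alg_def)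
  next
    case (Suc n)
    obtain N :: nat and x where x: "\<And>i. i < N \<Longrightarrow> x i \<in> aug_ideal A"
      "\<And>k. aug_ideal (C k) \<subseteq> combinations (C k) N (\<lambda>i. component k (x i)) (acar (C k))" by (rule generators) blast
    show ?case
    proof
      fix a assume "a \<in> {a \<in> acar A. component (Suc n) a = 0}"
      then have "\<exists>y. (\<forall>i<N. y i \<in> acar A \<and> component n (y i) = 0) \<and> a = (\<Sum>i<N. amul A (x i) (y i))"
        by (intro kernel_combination[OF x]) auto
      then obtain y where y: "\<forall>i<N. y i \<in> acar A \<and> component n (y i) = 0" "a = (\<Sum>i<N. amul A (x i) (y i))" by blast
      have "y i \<in> max_pow A (Suc n)" if "i < N" for i using y(1) Suc that by blast
      then show "a \<in> max_pow A (Suc (Suc n))" unfolding y(2)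
        by (intro K.subspace_sum[OF alg_idealD(1)[OF max_pow_ideal[OF AA]]] max_pow_mul) (auto simp: x simp del: max_pow.simps)
    qed
  qed
qed

lemma complete_limit: "complete_local_algebra A"
  unfolding complete_local_algebra_def
proof (intro conjI allI impI)
  note SA = aug_algebraD(1)[OF aug_algebra_limit]
  show "local_algebra A" by (rule local_limit)
  fix x assume x: "\<forall>n. x n \<in> acar A \<and> x (Suc n) - x n \<in> max_pow A n"
  have eq: "component n (x (Suc (Suc n))) = component n (x (Suc n))" for n
  proof -
    have "x (Suc (Suc n)) - x (Suc n) \<in> max_pow A (Suc n)" using x by blast
    then show ?thesis unfolding max_pow_limit by (simp add: component_simps)
  qed
  define a where "a = from_components (\<lambda>n. component n (x (Suc n)))"
  have a: "a \<in> acar A"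
    unfolding a_def by (rule from_components_in) (use x component_in component_p eq in auto)
  have ac: "component n a = component n (x (Suc n))" for n by (simp add: a_def component_from_components)
  have iff: "b - x n \<in> max_pow A n \<longleftrightarrow> (\<forall>m. n = Suc m \<longrightarrow> component m b = component m (x (Suc m)))" if b: "b \<in> acar A" for b n
  proof (cases n)
    case 0
    then show ?thesis using K.subspace_diff[OF SA b] x by simp
  next
    case (Suc m)
    then show ?thesis using K.subspace_diff[OF SA b] x by (simp add: max_pow_limit component_simps del: max_pow.simps)
  qed
  show "\<exists>!a. a \<in> acar A \<and> (\<forall>n. a - x n \<in> max_pow A n)"
  proof (rule ex1I[of _ a])
    show "a \<in> acar A \<and> (\<forall>n. a - x n \<in> max_pow A n)" using a iff[OF a] ac by blast
    fix b assume "b \<in> acar A \<and> (\<forall>n. b - x n \<in> max_pow A n)"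
    then have "component m b = component m (x (Suc m))" for m using iff by blast
    then show "b = a" by (intro component_ext) (simp add: ac)
  qed
qed

lemma quotient_system_limit: "quotient_system A C component p"
  unfolding quotient_system_def using alg component_hom component_surj max_pow_limit component_p by auto

end

section \<open>The limit of the construction\<close>

locale construction = hom_leibniz L for L :: "('k::field, 'l::ab_group_add) hom_leib" +
  fixes C \<eta> w i p
  assumes con: "\<And>k. 1 \<le> k \<Longrightarrow> constructed L k C \<eta> w i p"
begin

lemma C_alg: "aug_algebra (C n)" and C_fin: "finite_dim (pw (*)) (acar (C n))"
  using constructedD(1)[OF con[of "Suc n"], of n] by (simp_all add: fd_localD)

lemma \<eta>_deformation: "deformation L (C n) (\<eta> n)"
  using constructedD(2)[OF con[of "Suc n"], of n] by simp

lemma \<eta>_pushout: "is_pushout L (C (Suc n)) (C n) (p n) (\<eta> (Suc n)) (\<eta> n)"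
  using constructedD(5)[OF con[of "Suc n"], of n] by simp

lemma p_hom: "aug_hom (C (Suc n)) (C n) (p n)"
  using \<eta>_pushout by (simp add: is_pushout_def)

lemma stage: assumes "1 \<le> n"
  obtains \<sigma> br \<rho> where "quotient_setting L (C n) \<sigma> (\<eta> n) br (w n) (C (Suc n)) \<rho> (p n)"
proof -
  have step: "inductive_step L (C n) (\<eta> n) (w n) (C (Suc n)) (i n) (p n)"
    using constructedD(6)[OF con[of "Suc n"], of n] assms by simp
  show thesis
  proof (rule inductive_stepE[OF step C_alg C_fin \<eta>_deformation], goal_cases)
    case 1
    show ?case by (rule that[OF 1(1)])
  qed
qed

lemma p_surj: "p n ` acar (C (Suc n)) = acar (C n)"
proof (cases "n = 0")
  case False
  then obtain \<sigma> br \<rho> where "quotient_setting L (C n) \<sigma> (\<eta> n) br (w n) (C (Suc n)) \<rho> (p n)"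
    by (rule stage[OF Suc_leI[OF neq0_conv[THEN iffD1], folded One_nat_def]])
  then interpret quotient_setting L "C n" \<sigma> "\<eta> n" br "w n" "C (Suc n)" \<rho> "p n" .
  show ?thesis by (rule p_surj)
next
  case True
  note one = aug_algebraD(2)[OF C_alg]
  note inj = bij_betw_imp_inj_on[OF constructedD(3)[OF con[OF order_refl]]]
  have "a \<in> p 0 ` acar (C 1)" if a: "a \<in> acar (C 0)" for a
  proof -
    let ?b = "pw (*) (aeps (C 0) a) (aone (C 1))"
    have b: "?b \<in> acar (C (Suc 0))" using K.subspace_scale[OF aug_algebraD(1)[OF C_alg] one] by simp
    have "aeps (C 0) (p 0 ?b) = aeps (C 0) a"
      using aug_homD(5)[OF p_hom b] linear_onD(2)[OF aug_algebraD(9)[OF C_alg] one[of 1]] aug_algebraD(11)[OF C_alg, of 1] by simp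
    then have "a = p 0 ?b" using inj_onD[OF inj _ a aug_homD(1)[OF p_hom b]] by simp
    then show ?thesis using b by (intro image_eqI[of a _ ?b]) simp_all
  qed
  then show ?thesis using aug_homD(1)[OF p_hom] True by auto
qed

lemma C_nil: "max_pow (C n) (Suc n) \<subseteq> {0}"
  by (rule constructed_nilpotent[OF con[of "Suc n"]]) simp_all

text \<open>A functional \<open>\<xi>\<close> on \<open>C\<^bsub>m+2\<^esub>\<close> which annihilates the power of exponent \<open>m + 2\<close> of the augmentation ideal agrees, on the kernel of
  \<open>C\<^bsub>m+2\<^esub> \<rightarrow> C\<^sub>m\<close>, with a derivation twisted by a Harrison class of \<open>C\<^sub>m\<close>.  The class is in \<open>ker w\<close>
  because \<open>\<eta>\<^sub>m\<close> extends to \<open>C\<^bsub>m+2\<^esub>\<close>, hence \<open>C\<^bsub>m+1\<^esub>\<close> already carries a derivation with this twist.  The difference of the two is an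
  ordinary derivation and vanishes on squares of the augmentation ideal, thus on the kernel of \<open>C\<^bsub>m+2\<^esub> \<rightarrow> C\<^bsub>m+1\<^esub>\<close>; there \<open>\<xi>\<close> agrees with a
  functional pulled back from \<open>C\<^bsub>m+1\<^esub>\<close> and is therefore zero.\<close>

lemma kernel_step:
  assumes m: "1 \<le> m" and IH: "\<And>y. y \<in> acar (C (Suc m)) \<Longrightarrow> p m y = 0 \<Longrightarrow> y \<in> max_pow (C (Suc m)) (Suc m)"
    and y: "y \<in> acar (C (Suc (Suc m)))" "p (Suc m) y = 0"
  shows "y \<in> max_pow (C (Suc (Suc m))) (Suc (Suc m))"
proof (rule ccontr)
  let ?E = "C (Suc (Suc m))" and ?D = "C (Suc m)" and ?A = "C m" and ?q = "p (Suc m)"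
  let ?P = "\<lambda>x. p m (?q x)"
  obtain \<sigma> br \<rho> where "quotient_setting L ?A \<sigma> (\<eta> m) br (w m) ?D \<rho> (p m)" by (rule stage[OF m])
  then interpret S: quotient_setting L ?A \<sigma> "\<eta> m" br "w m" ?D \<rho> "p m" .
  obtain \<sigma>' br' \<rho>' where "quotient_setting L ?D \<sigma>' (\<eta> (Suc m)) br' (w (Suc m)) ?E \<rho>' ?q" by (rule stage[of "Suc m"]) simp
  then interpret S': quotient_setting L ?D \<sigma>' "\<eta> (Suc m)" br' "w (Suc m)" ?E \<rho>' ?q .
  note E = C_alg[of "Suc (Suc m)"] and D = C_alg[of "Suc m"] and q = p_hom[of "Suc m"]
  note SE = aug_algebraD(1)[OF E] and one = aug_algebraD(2)[OF E]
  note I = max_pow_ideal[OF E]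
  assume "y \<notin> max_pow ?E (Suc (Suc m))"
  then obtain \<xi> where \<xi>: "Vector_Spaces.linear (pw (*)) (*) \<xi>" "\<And>x. x \<in> max_pow ?E (Suc (Suc m)) \<Longrightarrow> \<xi> x = 0" "\<xi> y = 1"
    using K.separating_functional[OF alg_idealD(1)[OF I]] by metis
  note \<xi>l = linear_imp_linear_on[OF \<xi>(1), of "acar ?E"]
  have \<xi>N: "\<xi> (amul ?E d x) = aeps ?E d * \<xi> x" if d: "d \<in> acar ?E" and x: "x \<in> acar ?E" "?P x = 0" for d x
  proof -
    \<comment> \<open>modulo the kernel of \<open>?q\<close>, the element \<open>x\<close> lies in the power of exponent \<open>m + 1\<close>\<close>
    have "?q x \<in> max_pow ?D (Suc m)" by (rule IH[OF aug_homD(1)[OF q x(1)] x(2)])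
    then obtain z where z: "z \<in> max_pow ?E (Suc m)" "?q z = ?q x" using max_pow_surj[OF E D q p_surj] by blast
    have zE: "z \<in> acar ?E" using z(1) alg_idealD(2)[OF I] by blast
    have xz: "x - z \<in> acar ?E" by (rule K.subspace_diff[OF SE x(1) zE])
    have "?q (x - z) = 0" by (simp add: aug_hom_diff[OF E q x(1) zE] z(2))
    then have small: "amul ?E d (x - z) = pw (*) (aeps ?E d) (x - z)" using S'.p_small d xz by (simp add: small_kernel_def)
    define d0 where "d0 = d + pw (*) (- aeps ?E d) (aone ?E)"
    have s: "pw (*) c (aone ?E) \<in> acar ?E" for c by (rule K.subspace_scale[OF SE one])
    note epsl = linear_onD[OF aug_algebraD(9)[OF E]]
    have d0: "d0 \<in> aug_ideal ?E"
      using d s one aug_algebraD(11)[OF E] by (simp add: d0_def aug_ideal_def K.subspace_add[OF SE] epsl del: K.scale_minus_left)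
    then have d0E: "d0 \<in> acar ?E" by (simp add: aug_ideal_def)
    have "d = d0 + pw (*) (aeps ?E d) (aone ?E)" by (simp add: d0_def)
    then have "amul ?E d z = amul ?E d0 z + pw (*) (aeps ?E d) z"
      using aug_algebra_mul_add(2)[OF E zE d0E s[of "aeps ?E d"]] aug_algebra_mul_add(4)[OF E zE one one] aug_algebraD(7)[OF E zE] by simp
    moreover have "\<xi> (amul ?E d0 z) = 0" by (rule \<xi>(2)[OF max_pow_mul[OF d0 z(1)]])
    moreover have "amul ?E d0 z \<in> acar ?E" "pw (*) (aeps ?E d) z \<in> acar ?E"
      by (rule aug_algebraD(3)[OF E d0E zE], rule K.subspace_scale[OF SE zE])
    ultimately have dz: "\<xi> (amul ?E d z) = aeps ?E d * \<xi> z" using linear_onD[OF \<xi>l] zE by simp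
    have "\<xi> (amul ?E d x) = \<xi> (amul ?E d z + amul ?E d (x - z))"
      using aug_algebra_mul_add(1)[OF E d zE xz] by simp
    also have "\<dots> = \<xi> (amul ?E d z) + \<xi> (amul ?E d (x - z))"
      by (rule linear_onD(1)[OF \<xi>l]) (use aug_algebraD(3)[OF E] d zE xz in auto)
    also have "\<dots> = aeps ?E d * (\<xi> z + \<xi> (x - z))" 
      by (simp only: dz small linear_onD(2)[OF \<xi>l xz] distrib_left)
    also have "\<xi> z + \<xi> (x - z) = \<xi> x" using linear_onD(1)[OF \<xi>l zE xz] by simp
    finally show ?thesis .
  qed
  have P: "aug_hom ?E ?A ?P" by (rule aug_hom_comp[OF q p_hom])
  have Psurj: "?P ` acar ?E = acar ?A" using p_surj[of m] p_surj[of "Suc m"] by (simp add: image_image[symmetric])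
  obtain f where f: "f \<in> harr_cocycles ?A" "\<And>f'. f' - f \<in> harr_coboundaries ?A \<Longrightarrow>
      \<exists>\<xi>'. twisted_derivation ?E ?P f' \<xi>' \<and> (\<forall>n\<in>acar ?E. ?P n = 0 \<longrightarrow> \<xi>' n = \<xi> n)"
    by (rule extend_to_twisted_derivation[OF E C_alg P Psurj \<xi>l \<xi>N]) blast+
  define c where "c = coset (harr_coboundaries ?A) f"
  have c: "c \<in> Harr ?A" unfolding c_def by (rule S.coset_in_Harr[OF f(1)])
  obtain \<xi>' where \<xi>': "twisted_derivation ?E ?P (\<sigma> c) \<xi>'" "\<And>n. n \<in> acar ?E \<Longrightarrow> ?P n = 0 \<Longrightarrow> \<xi>' n = \<xi> n"
    using f(2)[OF S.\<sigma>_coset[OF f(1), folded c_def]] by blast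
  have "w m c = coboundaries L 3"
    by (rule S.w_vanishes[OF E P is_pushout_comp[OF \<eta>_pushout \<eta>_pushout] c \<xi>'(1)])
  then obtain \<zeta> where \<zeta>: "twisted_derivation ?D (p m) (\<sigma> c) \<zeta>" by (rule S.evaluation_descends[OF c])
  \<comment> \<open>both have the twist \<open>\<sigma> c\<close>, hence the difference is a derivation\<close>
  define h where "h x = \<xi>' x - \<zeta> (?q x)" for x
  have \<xi>'l: "linear_on (pw (*)) (*) (acar ?E) \<xi>'" and \<zeta>l: "linear_on (pw (*)) (*) (acar ?D) \<zeta>"
    using \<xi>'(1) \<zeta> by (simp_all add: twisted_derivation_def)
  have hl: "linear_on (pw (*)) (*) (acar ?E) h"
    using linear_onD[OF \<xi>'l] linear_onD[OF \<zeta>l] linear_onD[OF aug_homD(2)[OF q]] aug_homD(1)[OF q]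
    by (intro linear_onI) (simp_all add: h_def algebra_simps)
  have hmul: "h (amul ?E d e) = aeps ?E d * h e + aeps ?E e * h d" if "d \<in> acar ?E" "e \<in> acar ?E" for d e
  proof -
    have "\<xi>' (amul ?E d e) = aeps ?E d * \<xi>' e + aeps ?E e * \<xi>' d + \<sigma> c (?P d) (?P e)"
      using \<xi>'(1) that unfolding twisted_derivation_def by blast
    moreover have "\<zeta> (amul ?D (?q d) (?q e)) = aeps ?D (?q d) * \<zeta> (?q e) + aeps ?D (?q e) * \<zeta> (?q d) + \<sigma> c (?P d) (?P e)"
      using \<zeta> aug_homD(1)[OF q] that unfolding twisted_derivation_def by blast
    ultimately show ?thesis using that by (simp add: h_def aug_homD(3,5)[OF q] algebra_simps)
  qed
  have "max_pow ?E (Suc (Suc 0)) \<subseteq> {x \<in> acar ?E. h x = 0}"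
  proof (rule max_pow_Suc_subset)
    interpret KF: vector_space_pair "pw ((*) :: 'k \<Rightarrow> 'k \<Rightarrow> 'k)" "(*)"
      by (rule vector_space_pair_times[OF vector_space_pw_times])
    show "K.subspace {x \<in> acar ?E. h x = 0}"
      using K.subspace_0[OF SE] K.subspace_add[OF SE] K.subspace_scale[OF SE] linear_onD[OF hl] KF.linear_on_zero[OF hl SE]
      by (intro K.subspaceI) simp_all
    fix a b assume ab: "a \<in> aug_ideal ?E" "b \<in> max_pow ?E (Suc 0)"
    then show "amul ?E a b \<in> {x \<in> acar ?E. h x = 0}"
      using hmul[of a b] aug_algebraD(3)[OF E, of a b] unfolding max_pow_1[OF E] by (simp add: aug_ideal_def)
  qed
  moreover have "y \<in> max_pow ?E (Suc (Suc 0))" using S'.kernel_in_square[OF y] by (simp only: numeral_2_eq_2)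
  ultimately have "h y = 0" by blast
  moreover have "\<zeta> 0 = 0" using linear_onD(2)[OF \<zeta>l, of 0 0] K.subspace_0[OF aug_algebraD(1)[OF D]] by simp
  moreover have "?P y = 0" using y(2) aug_hom_zero[OF D p_hom] by simp
  ultimately show False using \<xi>'(2)[OF y(1)] \<xi>(3) y(2) by (simp add: h_def)
qed

lemma p_kernel_power: "y \<in> acar (C (Suc n)) \<Longrightarrow> p n y = 0 \<Longrightarrow> y \<in> max_pow (C (Suc n)) (Suc n)"
proof (induction n arbitrary: y)
  case 0
  have "aeps (C 1) y = 0" using aug_homD(5)[OF p_hom 0(1)] 0(2) aeps_zero[OF C_alg[of 0]] by simp
  then show ?case unfolding max_pow_1[OF C_alg] using 0 by (simp add: aug_ideal_def)
next
  case (Suc n)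
  show ?case
  proof (cases "n = 0")
    case True
    obtain \<sigma> br \<rho> where "quotient_setting L (C 1) \<sigma> (\<eta> 1) br (w 1) (C (Suc 1)) \<rho> (p 1)" by (rule stage[OF order_refl])
    then interpret quotient_setting L "C 1" \<sigma> "\<eta> 1" br "w 1" "C (Suc 1)" \<rho> "p 1" .
    show ?thesis using kernel_in_square[of y] Suc.prems True by (simp add: numeral_2_eq_2 del: max_pow.simps)
  next
    case False
    then show ?thesis using kernel_step[of n y] Suc by simp
  qed
qed

sublocale adic_tower C p
  by unfold_locales (fact C_alg p_hom p_surj C_nil p_kernel_power C_fin)+

abbreviation "limit_bracket \<equiv> \<lambda>s t n. \<eta> n (s n) (t n)"

theorem formal_deformation_limit: "formal_deformation L A C component p limit_bracket"
proof -
  let ?T = "ctensor_space L C p"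
  note br = deformationD(2)[OF \<eta>_deformation]
  have TD: "t n \<in> T (C n)" "tmap L (C (Suc n)) (p n) (t (Suc n)) = t n" if "t \<in> ?T" for t n
    using that by (auto simp: ctensor_space_def)
  have TI: "t \<in> ?T" if "\<And>n. t n \<in> T (C n)" "\<And>n. tmap L (C (Suc n)) (p n) (t (Suc n)) = t n" for t
    using that by (auto simp: ctensor_space_def)
  note add = tbracket_additive[OF br]
  have "bilinear_on (acar A) (\<lambda>a t n. act L (C n) (component n a) (t n)) ?T limit_bracket"
    unfolding bilinear_on_def
  proof (intro conjI ballI)
    fix x y z assume "x \<in> ?T" "y \<in> ?T" "z \<in> ?T"
    note xyz = this[THEN TD(1)]
    show "limit_bracket (x + y) z = limit_bracket x z + limit_bracket y z"
      by (intro ext) (simp add: additive_on_T(2)[OF add(1)] xyz pointwise fun_eq_iff)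
    show "limit_bracket x (y + z) = limit_bracket x y + limit_bracket x z"
      by (intro ext) (simp add: additive_on_T(2)[OF add(2)] xyz pointwise fun_eq_iff)
  next
    fix a x y assume a: "a \<in> acar A" and "x \<in> ?T" "y \<in> ?T"
    note xy = this(2,3)[THEN TD(1)]
    show "limit_bracket (\<lambda>n. act L (C n) (component n a) (x n)) y = (\<lambda>n. act L (C n) (component n a) (limit_bracket x y n))"
      by (intro ext) (simp only: tbracket_act(1)[OF br component_in[OF a] xy])
    show "limit_bracket x (\<lambda>n. act L (C n) (component n a) (y n)) = (\<lambda>n. act L (C n) (component n a) (limit_bracket x y n))"
      by (intro ext) (simp only: tbracket_act(2)[OF br component_in[OF a] xy])
  qed
  moreover have "hom_leibniz_on ?T limit_bracket (\<lambda>t n. ttwist L (C n) (t n))"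
  proof -
    have h: "hom_leibniz_on (T (C n)) (\<eta> n) (ttwist L (C n))" for n using \<eta>_deformation by (simp add: deformation_def)
    note h = h[unfolded hom_leibniz_on_def]
    show ?thesis unfolding hom_leibniz_on_def
    proof (intro conjI ballI)
      fix x assume x: "x \<in> ?T"
      show "(\<lambda>n. ttwist L (C n) (x n)) \<in> ?T"
        by (rule TI) (use tmap_hom_ttwist[OF C_alg C_alg p_hom TD(1)[OF x]] TD[OF x] ttwist_in[OF sub_alg[OF C_alg]] in auto)
      fix y assume y: "y \<in> ?T"
      show "limit_bracket x y \<in> ?T"
        by (rule TI) (use is_pushout_tmap[OF \<eta>_pushout TD(1)[OF x] TD(1)[OF y]] TD[OF x] TD[OF y] tbracket_in[OF br] in auto)
      show "(\<lambda>n. ttwist L (C n) (limit_bracket x y n)) = limit_bracket (\<lambda>n. ttwist L (C n) (x n)) (\<lambda>n. ttwist L (C n) (y n))"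
        by (rule ext) (use h TD(1)[OF x] TD(1)[OF y] in blast)
      fix z assume z: "z \<in> ?T"
      show "limit_bracket (\<lambda>n. ttwist L (C n) (x n)) (limit_bracket y z) =
          limit_bracket (limit_bracket x y) (\<lambda>n. ttwist L (C n) (z n)) - limit_bracket (limit_bracket x z) (\<lambda>n. ttwist L (C n) (y n))"
      proof
        fix n
        have "\<eta> n (ttwist L (C n) (x n)) (\<eta> n (y n) (z n)) =
            \<eta> n (\<eta> n (x n) (y n)) (ttwist L (C n) (z n)) - \<eta> n (\<eta> n (x n) (z n)) (ttwist L (C n) (y n))"
          using h TD(1)[OF x] TD(1)[OF y] TD(1)[OF z] by blast
        then show "\<eta> n (ttwist L (C n) (x n)) (\<eta> n (y n) (z n)) =
            (limit_bracket (limit_bracket x y) (\<lambda>n. ttwist L (C n) (z n)) - limit_bracket (limit_bracket x z) (\<lambda>n. ttwist L (C n) (y n))) n"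
          by (simp add: pointwise)
      qed
    qed
  qed
  moreover have "teps L (C 0) (\<eta> 0 (s 0) (t 0)) = brk L (teps L (C 0) (s 0)) (teps L (C 0) (t 0))" if "s \<in> ?T" "t \<in> ?T" for s t
    by (rule teps_bracket[OF C_alg br deformationD(4)[OF \<eta>_deformation] TD(1)[OF that(1)] TD(1)[OF that(2)]])
  moreover have "teps L (C 0) (ttwist L (C 0) (t 0)) = twist L (teps L (C 0) (t 0))" if "t \<in> ?T" for t
    by (rule teps_ttwist[OF C_alg TD(1)[OF that]])
  ultimately show ?thesis
    unfolding formal_deformation_def Let_def
    using complete_limit quotient_system_limit \<eta>_deformation \<eta>_pushout by (intro conjI exI[of _ \<eta>]) auto
qed

theorem formal_pushout_limit: "is_formal_pushout L A C component limit_bracket (C k) (component k) (\<eta> k)"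
  unfolding is_formal_pushout_def
proof (intro conjI exI[of _ k] exI[of _ "\<lambda>x. x"] allI ballI refl)
  show "aug_hom (C k) (C k) (\<lambda>x. x)" by (simp add: aug_hom_def linear_on_def)
  show "\<eta> k (unit_tens L (C k) l1) (unit_tens L (C k) l2) = tmap L (C k) (\<lambda>x. x) (\<eta> k (unit_tens L (C k) l1) (unit_tens L (C k) l2))" for l1 l2
    by (rule tmap_id[OF sub_alg[OF C_alg] refl, symmetric])
      (rule tbracket_in[OF deformationD(2)[OF \<eta>_deformation] unit_in[OF C_alg] unit_in[OF C_alg]])
qed (fact component_hom \<eta>_deformation)+

end

theorem proposition5p1:
  fixes L :: "('k::{alg_closed_field, field_char_0}, 'l::ab_group_add) hom_leib"
  assumes L: "hom_leibniz_algebra L"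
    and H_fin: "finite_dim_quot (pw (scl L)) (cocycles L 2) (coboundaries L 2)"
  shows
    \<comment> \<open>one step: the extension, and existence and uniqueness of the extended deformation\<close>
    "(\<forall>k C \<eta> w i p w\<^sub>k C' i' p'.
        k \<ge> 1 \<and> constructed L k C \<eta> w i p \<and> inductive_step L (C k) (\<eta> k) w\<^sub>k C' i' p' \<longrightarrow>
        fd_local_algebra C' \<and>
        algebra_extension (C k) (ker_obstruction_dual L (C k) w\<^sub>k) C' i' p' \<and>
        (\<exists>\<mu>. is_pushout L C' (C k) p' \<mu> (\<eta> k)) \<and>
        (\<forall>\<mu> \<mu>'. is_pushout L C' (C k) p' \<mu> (\<eta> k) \<and> is_pushout L C' (C k) p' \<mu>' (\<eta> k) \<longrightarrow>
           (\<exists>u \<nu>. extension_automorphism (ker_obstruction_dual L (C k) w\<^sub>k) C' i' p' u \<and>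
              is_pushout L C' C' u \<mu> \<nu> \<and> equivalent_deformations L C' \<nu> \<mu>')))
     \<and>
     \<comment> \<open>the construction yields an infinite sequence, and any finite stage of it can be continued\<close>
     (\<exists>C \<eta> w i p. \<forall>k\<ge>1. constructed L k C \<eta> w i p) \<and>
     (\<forall>k C \<eta> w i p. k \<ge> 1 \<and> constructed L k C \<eta> w i p \<longrightarrow>
        (\<exists>C' \<eta>' w' i' p'. (\<forall>n\<ge>1. constructed L n C' \<eta>' w' i' p') \<and>
           (\<forall>j\<le>k. C' j = C j \<and> \<eta>' j = \<eta> j) \<and> (\<forall>j<k. w' j = w j \<and> i' j = i j \<and> p' j = p j)))
     \<and>
     \<comment> \<open>the projective limit of such a sequence is a formal deformation\<close>
     (\<forall>C \<eta> w i p. (\<forall>k\<ge>1. constructed L k C \<eta> w i p) \<longrightarrow>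
        (\<exists>(Q :: nat \<Rightarrow> ('k, nat) aug_alg) \<pi> q br.
           formal_deformation L (lim_alg C p) Q \<pi> q br \<and>
           (\<forall>k. is_formal_pushout L (lim_alg C p) Q \<pi> br (C k) (component k) (\<eta> k))))"
proof -
  interpret hom_leibniz L by unfold_locales (rule L)
  show ?thesis
  proof (intro conjI allI impI, goal_cases)
    case (1 k C \<eta> w i p wk C' i' p')
    then show ?case using single_step(1) by blast
  next
    case (2 k C \<eta> w i p wk C' i' p')
    then show ?case using single_step(3) by blast
  next
    case (3 k C \<eta> w i p wk C' i' p')
    then show ?case using single_step(4) by blast
  next
    case (4 k C \<eta> w i p wk C' i' p' \<mu> \<mu>')
    then show ?case using single_step(5)[of k C \<eta> w i p wk C' i' p' \<mu> \<mu>'] by blast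
  next
    case 5
    obtain C \<eta> w i p where c: "constructed L 1 C \<eta> w i p" using constructed_initial[OF H_fin] by blast
    show ?case using constructed_continue[OF c order_refl] by blast
  next
    case (6 k C \<eta> w i p)
    then show ?case using constructed_continue[of k C \<eta> w i p] by blast
  next
    case (7 C \<eta> w i p)
    interpret construction L C \<eta> w i p by unfold_locales (use 7 in blast)
    show ?case
      by (intro exI[of _ C] exI[of _ component] exI[of _ p] exI[of _ "\<lambda>s t n. \<eta> n (s n) (t n)"] conjI allI
        formal_deformation_limit formal_pushout_limit)
  qed
qed

end
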